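(* Let $0<\alpha<2\pi$ and $R>0$. Let $W_{\alpha}=\{(r,\phi): r>0,\ 0<\phi<\alpha\}\subset\mathbb{R}^2$ in polar coordinates, and let $u_{W_{\alpha}}((r,\phi);t)$ be the solution of the heat equation $\Delta u=\partial u/\partial t$ with a Dirichlet $0$ boundary condition on the positive $x_1$ axis, and initial data $\mathbf{1}_{W_{\alpha}}$. Then $$\int_0^{R} dr\,r\int_0^{\alpha}d\phi\, u_{W_{\alpha}}((r,\phi);t)=\frac12\alpha R^2-\frac{3}{\pi^{1/2}}Rt^{1/2}+a(\alpha)t+\frac{3Rt^{1/2}}{\pi^{1/2}}\int_1^{\infty}\frac{dv}{v^2}\int_0^1 d\zeta\,\frac{\zeta}{(1-\zeta^2)^{1/2}}e^{-R^2\zeta^2v^2/(4t)}+O(e^{-m_{\alpha}R^2/(4t)}),\quad t\downarrow 0,$$ where $m_{\alpha}>0$ is a constant which depends on $\alpha$ only, and $$a(\alpha)=-\frac34+\frac14\int_0^{\infty}d\theta\, \frac {4\big(\sinh((\pi-\frac{\alpha}{2})\theta)\big)^2 - \big(\sinh((\pi-\alpha)\theta)\big)^2}{\big(\sinh(\pi\theta/2)\big)^2 \cosh(\pi\theta)}.$$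
   Context: The Dirichlet condition is imposed only on the closed half-line $A=\{(x_1,0):x_1\ge 0\}$, and no boundary condition is imposed on the other edge $\phi=\alpha$ of the wedge. Explicitly, $u_{W_\alpha}(x;t)=\int_{W_\alpha}dy\,p_{\mathbb{R}^2-A}(x,y;t)$, where $p_{\mathbb{R}^2-A}(x,y;t)$ is the Dirichlet heat kernel of $\Delta u=\partial u/\partial t$ on $\mathbb{R}^2-A$ (i.e. on the wedge of opening angle $2\pi$). $\mathbf{1}_{W_\alpha}$ denotes the indicator function of $W_\alpha$. *)

theory Defs
  imports "HOL-Analysis.Analysis" "HOL-Library.Landau_Symbols"
begin

text \<open>Classical solutions of \<open>\<Delta>u = \<partial>u/\<partial>t\<close> on \<open>D \<times> (0,\<infinity>)\<close>, for an open set \<open>D\<close>.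
  Here \<open>ut\<close> is the time derivative, and \<open>ux b\<close>, \<open>uxx b\<close> are the first and second partial
  derivatives in the coordinate direction \<open>b\<close>.\<close>

definition heat_equation_on :: "'a::euclidean_space set \<Rightarrow> ('a \<Rightarrow> real \<Rightarrow> real) \<Rightarrow> bool" where
  "heat_equation_on D u \<longleftrightarrow>
     continuous_on (D \<times> {0<..}) (\<lambda>(x, t). u x t) \<and>
     (\<exists>ut ux uxx.
        continuous_on (D \<times> {0<..}) (\<lambda>(x, t). ut x t) \<and>
        (\<forall>b\<in>Basis. continuous_on (D \<times> {0<..}) (\<lambda>(x, t). ux b x t)) \<and>
        (\<forall>b\<in>Basis. continuous_on (D \<times> {0<..}) (\<lambda>(x, t). uxx b x t)) \<and>
        (\<forall>x\<in>D. \<forall>t>0.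
           ((\<lambda>s. u x s) has_real_derivative ut x t) (at t) \<and>
           (\<forall>b\<in>Basis.
              ((\<lambda>s. u (x + s *\<^sub>R b) t) has_real_derivative ux b x t) (at 0) \<and>
              ((\<lambda>s. ux b (x + s *\<^sub>R b) t) has_real_derivative uxx b x t) (at 0)) \<and>
           (\<Sum>b\<in>Basis. uxx b x t) = ut x t))"

text \<open>Initial datum \<open>\<delta>\<^sub>y\<close>: weak convergence against continuous functions
  with compact support in \<open>D\<close>.\<close>

definition initial_delta_on ::
  "'a::euclidean_space set \<Rightarrow> 'a \<Rightarrow> ('a \<Rightarrow> real \<Rightarrow> real) \<Rightarrow> bool" where
  "initial_delta_on D y u \<longleftrightarrow>
     (\<forall>f::'a \<Rightarrow> real.
        continuous_on UNIV f \<and> (\<exists>K. compact K \<and> K \<subseteq> D \<and> (\<forall>x. x \<notin> K \<longrightarrow> f x = 0)) \<longrightarrow>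
        ((\<lambda>t. LINT x:D|lborel. u x t * f x) \<longlongrightarrow> f y) (at_right 0))"

definition dirichlet_fundamental_solution ::
  "'a::euclidean_space set \<Rightarrow> 'a \<Rightarrow> ('a \<Rightarrow> real \<Rightarrow> real) \<Rightarrow> bool" where
  "dirichlet_fundamental_solution D y u \<longleftrightarrow>
     (\<forall>x\<in>D. \<forall>t>0. 0 \<le> u x t) \<and>
     heat_equation_on D u \<and>
     (\<forall>t>0. \<forall>z\<in>frontier D. ((\<lambda>x. u x t) \<longlongrightarrow> 0) (at z within D)) \<and>
     initial_delta_on D y u"

text \<open>The Dirichlet heat kernel is the smallest nonnegative fundamental solution. Minimality cannot
  be dropped: on the slit plane the function \<open>r\<^bsup>1/2\<^esup> sin(\<phi>/2) t\<^bsup>-3/2\<^esup> exp(-r\<^sup>2/(4t))\<close>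
  is a nonnegative solution of the heat equation which vanishes on the boundary for every \<open>t > 0\<close>
  and has initial value \<open>0\<close> in the interior, so that it could be added to any fundamental solution.
  The kernel is set to \<open>0\<close> off its natural domain in order to make it unique as a total function.
  The set \<open>D\<close> is meant to be open with regular boundary, since boundary values \<open>0\<close> are
  required at every boundary point.\<close>

definition is_dirichlet_heat_kernel ::
  "'a::euclidean_space set \<Rightarrow> ('a \<Rightarrow> 'a \<Rightarrow> real \<Rightarrow> real) \<Rightarrow> bool" where
  "is_dirichlet_heat_kernel D p \<longleftrightarrow>
     (\<forall>y\<in>D. dirichlet_fundamental_solution D y (\<lambda>x t. p x y t) \<and>
        (\<forall>q. dirichlet_fundamental_solution D y q \<longrightarrow> (\<forall>x\<in>D. \<forall>t>0. p x y t \<le> q x t))) \<and>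
     (\<forall>x y t. \<not> (x \<in> D \<and> y \<in> D \<and> 0 < t) \<longrightarrow> p x y t = 0)"

definition dirichlet_heat_kernel ::
  "'a::euclidean_space set \<Rightarrow> 'a \<Rightarrow> 'a \<Rightarrow> real \<Rightarrow> real" where
  "dirichlet_heat_kernel D = (THE p. is_dirichlet_heat_kernel D p)"

lemma is_dirichlet_heat_kernel_unique:
  assumes p: "is_dirichlet_heat_kernel D p" and q: "is_dirichlet_heat_kernel D q"
  shows "p = q"
proof (intro ext)
  fix x y t
  show "p x y t = q x y t"
  proof (cases "x \<in> D \<and> y \<in> D \<and> 0 < t")
    case True
    with p q have "p x y t \<le> q x y t" "q x y t \<le> p x y t"
      unfolding is_dirichlet_heat_kernel_def by blast+
    then show ?thesis by simp
  next
    case False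
    with p q show ?thesis unfolding is_dirichlet_heat_kernel_def by metis
  qed
qed

lemma dirichlet_heat_kernel_eq:
  "is_dirichlet_heat_kernel D p \<Longrightarrow> dirichlet_heat_kernel D = p"
  unfolding dirichlet_heat_kernel_def by (blast intro: is_dirichlet_heat_kernel_unique)

definition polar :: "real \<Rightarrow> real \<Rightarrow> real \<times> real" where
  "polar r \<phi> = (r * cos \<phi>, r * sin \<phi>)"

definition half_line :: "(real \<times> real) set" where
  "half_line = {(x1, 0) |x1. 0 \<le> x1}"

definition wedge :: "real \<Rightarrow> (real \<times> real) set" where
  "wedge \<alpha> = {polar r \<phi> |r \<phi>. 0 < r \<and> 0 < \<phi> \<and> \<phi> < \<alpha>}"

definition u_wedge :: "real \<Rightarrow> real \<times> real \<Rightarrow> real \<Rightarrow> real" where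
  "u_wedge \<alpha> x t = (LINT y:wedge \<alpha>|lborel. dirichlet_heat_kernel (UNIV - half_line) x y t)"

definition a_coeff :: "real \<Rightarrow> real" where
  "a_coeff \<alpha> = - 3 / 4 + 1 / 4 *
     (LBINT \<theta>=0..\<infinity>.
        (4 * (sinh ((pi - \<alpha> / 2) * \<theta>))\<^sup>2 - (sinh ((pi - \<alpha>) * \<theta>))\<^sup>2)
        / ((sinh (pi * \<theta> / 2))\<^sup>2 * cosh (pi * \<theta>)))"

end

(*
  The square root z |-> sqrt z maps the slit plane to the upper half-plane, and reflecting the pole
  in Sommerfeld's heat kernel of the double cover gives a fundamental solution with zero boundary
  values. By the maximum principle it is the smallest one, so it is the Dirichlet heat kernel.
  In polar coordinates it has the form F(phi - psi) - F(phi + psi) with F even, where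
  F(gamma) + F(2 pi - gamma) is the free Gaussian kernel. Its double integral over the sector
  therefore depends only on a second antiderivative of F, and splits into Gaussian half-plane terms
  (area and perimeter terms and the explicit double integral) and weighted integrals of F over
  angular ranges away from gamma = 0. There F decays like a Gaussian in both radii, so that these
  integrals may be extended to all radii at an exponentially small cost; the full integrals are
  elementary functions of the angle, which the theta-integral in a(alpha) represents.
*)
theory Submission
  imports Defs "HOL-Probability.Distributions" "HOL-Real_Asymp.Real_Asymp"
begin

subsection \<open>Gaussian integrals and the Sommerfeld function\<close>

text \<open>The obstacle is the direction 0: the integral of F over both radii diverges as the angle
  tends to 0, so a second antiderivative F2 cannot be integrated radially as it stands. With F even
  and F2(0) = 0, the double integral over the sector is 4 F2(alpha) - F2(2 alpha). Each F2(beta) is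
  replaced by its tangent at 2 pi plus a remainder, which sees F only between beta and 2 pi; the
  reflection identity recovers F1(2 pi) and F2(2 pi) from the free kernel and the remainder at pi.
  Since F2(2 pi) occurs 4 - 1 = 3 times, eliminating it gives the remainder at pi the coefficient
  -6. Its radial integral is 1/8, and -6/8 is the -3/4 in a(alpha). The remainders at alpha and 2
  alpha enter with weights 4 and -1 and give the theta-integral. Scaling reduces everything to time
  1 and the radius rho = R / sqrt t, so the error is governed by the slowest of three Gaussian rates
  and m does not depend on R. Radial integrals and theta-integral are both evaluated in closed form,
  the former by trigonometric substitutions, the latter by a cotangent series and the Beta function,
  and then compared.\<close>

definition gauss_int :: "real \<Rightarrow> real" where
  "gauss_int x = (LBINT s=0..x. exp (- s\<^sup>2))"

lemma DERIV_gauss_int: "(gauss_int has_real_derivative exp (- x\<^sup>2)) (at x)"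
proof -
  define a b where "a = min 0 x - 1" and "b = max 0 x + 1"
  have "((\<lambda>u. LBINT s=0..u. exp (- s\<^sup>2)) has_vector_derivative exp (- x\<^sup>2)) (at x within {a..b})"
    unfolding zero_ereal_def
    by (intro interval_integral_FTC2) (auto simp: a_def b_def intro!: continuous_intros)
  then have "((\<lambda>u. LBINT s=0..u. exp (- s\<^sup>2)) has_vector_derivative exp (- x\<^sup>2)) (at x)"
    by (subst (asm) at_within_interior) (auto simp: a_def b_def)
  then show ?thesis
    by (simp add: has_real_derivative_iff_has_vector_derivative gauss_int_def[abs_def])
qed

lemmas DERIV_gauss_int' [derivative_intros] = DERIV_gauss_int[THEN DERIV_chain2]

lemma continuous_on_gauss_int [continuous_intros]:
  "continuous_on A f \<Longrightarrow> continuous_on A (\<lambda>x. gauss_int (f x))"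
  by (rule continuous_on_compose2[of UNIV gauss_int])
     (auto intro!: DERIV_continuous_on DERIV_gauss_int)

lemma gauss_int_0 [simp]: "gauss_int 0 = 0"
  by (simp add: gauss_int_def zero_ereal_def[symmetric])

lemma gauss_int_minus: "gauss_int (- x) = - gauss_int x"
proof -
  have "((\<lambda>y. gauss_int (- y) + gauss_int y) has_real_derivative 0) (at z)" for z
    by (auto intro!: derivative_eq_intros)
  then have "gauss_int (- x) + gauss_int x = gauss_int (- 0) + gauss_int 0"
    using DERIV_isconst_all[of "\<lambda>y. gauss_int (- y) + gauss_int y" x 0] by simp
  then show ?thesis by simp
qed

lemma gauss_int_at_top: "(gauss_int \<longlongrightarrow> sqrt pi / 2) at_top"
proof -
  have "((\<lambda>y. \<integral> x. indicator {.. y} x *\<^sub>R (indicator {0..} (x::real) *\<^sub>R exp (- x\<^sup>2)) \<partial>lborel) \<longlongrightarrow>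
      \<integral> x. indicator {0..} (x::real) *\<^sub>R exp (- x\<^sup>2) \<partial>lborel) at_top"
    by (rule tendsto_integral_at_top) (use gaussian_moment_0 in \<open>simp_all add: has_bochner_integral_iff\<close>)
  also have "(\<integral> x. indicator {0..} (x::real) *\<^sub>R exp (- x\<^sup>2) \<partial>lborel) = sqrt pi / 2"
    using gaussian_moment_0 by (simp add: has_bochner_integral_iff)
  finally show ?thesis
  proof (rule Lim_transform_eventually)
    show "\<forall>\<^sub>F y in at_top. (\<integral> x. indicator {.. y} x *\<^sub>R (indicator {0..} (x::real) *\<^sub>R exp (- x\<^sup>2)) \<partial>lborel) = gauss_int y"
      using eventually_ge_at_top[of "0::real"]
    proof eventually_elim
      case (elim y)
      have "gauss_int y = (LBINT s:{0..y}. exp (- s\<^sup>2))"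
        unfolding gauss_int_def zero_ereal_def using elim by (rule interval_integral_Icc)
      also have "\<dots> = (\<integral> x. indicator {.. y} x *\<^sub>R (indicator {0..} (x::real) *\<^sub>R exp (- x\<^sup>2)) \<partial>lborel)"
        unfolding set_lebesgue_integral_def
        by (intro Bochner_Integration.integral_cong) (auto simp: indicator_def)
      finally show ?case by simp
    qed
  qed
qed

text \<open>\<open>sommerfeld x = exp(x\<^sup>2) (1 + erf x) / 2\<close>; the radial profile of Sommerfeld's solution
  for diffraction by a half-line.\<close>

definition sommerfeld :: "real \<Rightarrow> real" where
  "sommerfeld x = exp (x\<^sup>2) * (1 / 2 + gauss_int x / sqrt pi)"

lemma DERIV_sommerfeld:
  "(sommerfeld has_real_derivative 2 * x * sommerfeld x + 1 / sqrt pi) (at x)"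
  unfolding sommerfeld_def[abs_def]
  by (auto intro!: derivative_eq_intros simp: exp_minus field_simps)

lemmas DERIV_sommerfeld' [derivative_intros] = DERIV_sommerfeld[THEN DERIV_chain2]

lemma continuous_on_sommerfeld [continuous_intros]:
  "continuous_on A f \<Longrightarrow> continuous_on A (\<lambda>x. sommerfeld (f x))"
  unfolding sommerfeld_def by (intro continuous_intros) auto

lemma borel_measurable_sommerfeld [measurable]: "sommerfeld \<in> borel_measurable borel"
  by (intro borel_measurable_continuous_onI continuous_intros)

text \<open>The odd error function cancels. Replacing an angle by 2 pi minus itself negates the
  argument of \<open>sommerfeld\<close>, so this is the source of the fact that the two sheets of
  the double cover add up to the free Gaussian.\<close>

lemma sommerfeld_add_minus: "sommerfeld x + sommerfeld (- x) = exp (x\<^sup>2)"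
  by (simp add: sommerfeld_def gauss_int_minus algebra_simps)

text \<open>Complete the square in the exponent. Writing \<open>sommerfeld\<close> as an integral of
  exponentials gives its monotonicity below, and later allows the radii to be integrated out before
  \<open>v\<close>.\<close>

lemma nn_integral_sommerfeld:
  "(\<integral>\<^sup>+v. ennreal (exp (- v\<^sup>2 + 2 * v * x)) * indicator {0..} v \<partial>lborel) = ennreal (sqrt pi * sommerfeld x)"
proof -
  have "(\<integral>\<^sup>+v. ennreal (exp (- v\<^sup>2 + 2 * v * x)) * indicator {0..} v \<partial>lborel)
    = ennreal (exp (x\<^sup>2) * (sqrt pi / 2) - exp (x\<^sup>2) * gauss_int (0 - x))"
  proof (rule nn_integral_FTC_atLeast[where F = "\<lambda>v. exp (x\<^sup>2) * gauss_int (v - x)"])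
    fix v :: real
    show "((\<lambda>v. exp (x\<^sup>2) * gauss_int (v - x)) has_real_derivative exp (- v\<^sup>2 + 2 * v * x)) (at v)"
      by (auto intro!: derivative_eq_intros simp: mult_exp_exp power2_eq_square algebra_simps)
    show "((\<lambda>v. exp (x\<^sup>2) * gauss_int (v - x)) \<longlongrightarrow> exp (x\<^sup>2) * (sqrt pi / 2)) at_top"
      by (intro tendsto_intros filterlim_compose[OF gauss_int_at_top])
         (use filterlim_tendsto_add_at_top[OF tendsto_const filterlim_ident, of "- x"] in simp)
  qed auto
  also have "exp (x\<^sup>2) * (sqrt pi / 2) - exp (x\<^sup>2) * gauss_int (0 - x) = sqrt pi * sommerfeld x"
    by (simp add: gauss_int_minus sommerfeld_def field_simps)
  finally show ?thesis .
qed

lemma gauss_int_bounds: "- (sqrt pi / 2) \<le> gauss_int x" "gauss_int x \<le> sqrt pi / 2"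
proof -
  have mono: "gauss_int x \<le> gauss_int y" if "x \<le> y" for x y
    using that by (intro DERIV_nonneg_imp_nondecreasing[of x y gauss_int])
      (auto intro!: exI[of _ "exp (- _\<^sup>2)"] DERIV_gauss_int)
  show "gauss_int x \<le> sqrt pi / 2" for x
    by (rule tendsto_lowerbound[OF gauss_int_at_top])
       (auto intro: mono eventually_mono[OF eventually_ge_at_top[of x]])
  from this[of "- x"] show "- (sqrt pi / 2) \<le> gauss_int x"
    by (simp add: gauss_int_minus)
qed

lemma sommerfeld_nonneg: "0 \<le> sommerfeld x"
  unfolding sommerfeld_def using gauss_int_bounds(1)[of x]
  by (intro mult_nonneg_nonneg) (auto simp: field_simps)

lemma sommerfeld_le_exp: "sommerfeld x \<le> exp (x\<^sup>2)"
  using sommerfeld_add_minus[of x] sommerfeld_nonneg[of "- x"] by linarith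

lemma sommerfeld_mono: "x \<le> y \<Longrightarrow> sommerfeld x \<le> sommerfeld y"
proof -
  assume xy: "x \<le> y"
  have "ennreal (sqrt pi * sommerfeld x) \<le> ennreal (sqrt pi * sommerfeld y)"
    unfolding nn_integral_sommerfeld[symmetric]
    by (intro nn_integral_mono) (use xy in \<open>auto split: split_indicator intro!: ennreal_leI mult_left_mono\<close>)
  then show ?thesis by (simp add: sommerfeld_nonneg)
qed

lemma sommerfeld_le_1: "x \<le> 0 \<Longrightarrow> sommerfeld x \<le> 1"
  using sommerfeld_mono[of x 0] sommerfeld_def[of 0] by simp

text \<open>Mean value theorem. The factor \<open>b - a\<close> is what makes the kernel vanish at
  the slit, where the arguments of the direct and the reflected pole coincide;
  \<open>exp (m\<^sup>2)\<close> will be absorbed by the Gaussian prefactor.\<close>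

lemma sommerfeld_diff_le:
  assumes "a \<le> b" "\<bar>b\<bar> \<le> m" "\<bar>a\<bar> \<le> m"
  shows "sommerfeld b - sommerfeld a \<le> (b - a) * (2 * m + 1) * exp (m\<^sup>2)"
proof (cases "a < b")
  case True
  obtain z where z: "a < z" "z < b"
    "sommerfeld b - sommerfeld a = (b - a) * (2 * z * sommerfeld z + 1 / sqrt pi)"
    using MVT2[OF True DERIV_sommerfeld] by auto
  have zm: "\<bar>z\<bar> \<le> m" using z assms by linarith
  have "z\<^sup>2 \<le> m\<^sup>2" using zm power_mono[of "\<bar>z\<bar>" m 2] by simp
  then have sz: "sommerfeld z \<le> exp (m\<^sup>2)" using sommerfeld_le_exp[of z] by (meson exp_le_cancel_iff order_trans)
  have "z * sommerfeld z \<le> m * exp (m\<^sup>2)"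
    using mult_right_mono[of z m "sommerfeld z"] mult_left_mono[OF sz, of m] zm sommerfeld_nonneg[of z]
    by linarith
  moreover have "1 / sqrt pi \<le> exp (m\<^sup>2)"
  proof -
    have "1 / sqrt pi \<le> 1" using pi_gt3 by simp
    also have "1 \<le> exp (m\<^sup>2)" by simp
    finally show ?thesis .
  qed
  ultimately have "2 * z * sommerfeld z + 1 / sqrt pi \<le> (2 * m + 1) * exp (m\<^sup>2)"
    by (simp add: algebra_simps)
  then show ?thesis using z(3) True by (simp add: mult.assoc)
qed (use assms in simp)

subsection \<open>The heat kernel of the slit plane\<close>

abbreviation slit_plane :: "(real \<times> real) set" where
  "slit_plane \<equiv> UNIV - half_line"

text \<open>Real and imaginary part of the square root \<open>\<surd>r e\<^bsup>i\<phi>/2\<^esup>\<close>, \<open>0 < \<phi> < 2\<pi>\<close>, which maps the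
  slit plane onto the upper half-plane.\<close>

definition root_im :: "real \<times> real \<Rightarrow> real" where
  "root_im x = sqrt ((norm x - fst x) / 2)"

definition root_re :: "real \<times> real \<Rightarrow> real" where
  "root_re x = snd x / (2 * root_im x)"

lemma abs_fst_le_norm: "\<bar>fst x\<bar> \<le> norm x" for x :: "real \<times> real"
  by (metis norm_fst_le prod.collapse real_norm_def)

lemma fst_le_norm: "fst x \<le> norm x" for x :: "real \<times> real"
  using abs_fst_le_norm[of x] by simp

lemma norm_prod_sq: "(norm x)\<^sup>2 = (fst x)\<^sup>2 + (snd x)\<^sup>2" for x :: "real \<times> real"
  by (simp add: norm_prod_def)

lemma root_im_sq: "(root_im x)\<^sup>2 = (norm x - fst x) / 2"
  unfolding root_im_def using fst_le_norm[of x] by simp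

lemma root_im_nonneg [simp]: "0 \<le> root_im x"
  unfolding root_im_def using fst_le_norm[of x] by simp

lemma root_im_le: "root_im x \<le> sqrt (norm x)"
  unfolding root_im_def using abs_fst_le_norm[of x] by (intro real_sqrt_le_mono) simp

lemma mem_half_line: "x \<in> half_line \<longleftrightarrow> snd x = 0 \<and> 0 \<le> fst x"
  unfolding half_line_def by (cases x) auto

lemma norm_eq_fst_iff: "norm x = fst x \<longleftrightarrow> x \<in> half_line" for x :: "real \<times> real"
proof
  assume "norm x = fst x"
  then show "x \<in> half_line"
    using norm_prod_sq[of x] norm_ge_zero[of x] by (simp add: mem_half_line)
next
  assume "x \<in> half_line"
  then show "norm x = fst x"
    by (simp add: mem_half_line norm_prod_def)
qed

lemma root_im_eq_0_iff: "root_im x = 0 \<longleftrightarrow> x \<in> half_line"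
  unfolding root_im_def using norm_eq_fst_iff[of x] by simp

lemma slit_plane_iff: "x \<in> slit_plane \<longleftrightarrow> 0 < root_im x"
proof -
  have "0 < root_im x \<longleftrightarrow> root_im x \<noteq> 0"
    using root_im_nonneg[of x] by linarith
  then show ?thesis by (simp add: root_im_eq_0_iff)
qed

lemma root_im_pos: "x \<in> slit_plane \<Longrightarrow> 0 < root_im x"
  using slit_plane_iff by blast

lemma norm_pos_slit: "x \<in> slit_plane \<Longrightarrow> 0 < norm x"
  by (auto simp: mem_half_line)

lemma root_re_im: "x \<in> slit_plane \<Longrightarrow> 2 * root_re x * root_im x = snd x"
  using root_im_pos[of x] by (simp add: root_re_def)

lemma root_re_sq:
  assumes "x \<in> slit_plane" shows "(root_re x)\<^sup>2 = (norm x + fst x) / 2"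
proof -
  have "4 * (root_re x)\<^sup>2 * (root_im x)\<^sup>2 = (snd x)\<^sup>2"
    using root_re_im[OF assms] by (metis power_mult_distrib four_x_squared mult.assoc)
  also have "\<dots> = 4 * ((norm x + fst x) / 2) * (root_im x)\<^sup>2"
    unfolding root_im_sq using norm_prod_sq[of x] by (simp add: power2_eq_square field_simps)
  finally show ?thesis using root_im_pos[OF assms] by simp
qed

lemma norm_eq_root: "x \<in> slit_plane \<Longrightarrow> norm x = (root_re x)\<^sup>2 + (root_im x)\<^sup>2"
  by (simp add: root_re_sq root_im_sq field_simps)

lemma fst_eq_root: "x \<in> slit_plane \<Longrightarrow> fst x = (root_re x)\<^sup>2 - (root_im x)\<^sup>2"
  by (simp add: root_re_sq root_im_sq field_simps)

lemma continuous_on_root_im [continuous_intros]: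
  "continuous_on S f \<Longrightarrow> continuous_on S (\<lambda>p. root_im (f p))"
  unfolding root_im_def by (intro continuous_intros) auto

lemma continuous_on_root_re [continuous_intros]:
  "continuous_on S f \<Longrightarrow> f ` S \<subseteq> slit_plane \<Longrightarrow> continuous_on S (\<lambda>p. root_re (f p))"
  unfolding root_re_def by (intro continuous_intros) (auto simp: root_im_eq_0_iff)

lemma closed_half_line: "closed half_line"
proof -
  have "half_line = root_im -` {0} \<inter> UNIV"
    by (auto simp: root_im_eq_0_iff)
  also have "closed \<dots>"
    by (intro continuous_closed_preimage continuous_intros closed_singleton)
  finally show ?thesis .
qed

lemma open_slit_plane: "open slit_plane"
  using closed_half_line by (simp add: open_Diff)

lemma borel_measurable_root_im [measurable]: "root_im \<in> borel_measurable borel"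
  by (intro borel_measurable_continuous_onI continuous_intros)

lemma borel_measurable_root_re [measurable]: "root_re \<in> borel_measurable borel"
proof -
  have [measurable]: "snd \<in> borel_measurable (borel :: (real \<times> real) measure)"
    by (intro borel_measurable_continuous_onI continuous_intros)
  show ?thesis unfolding root_re_def[abs_def] by measurable
qed

lemma sets_half_line [measurable]: "half_line \<in> sets borel"
  using closed_half_line by simp

lemma DERIV_norm_line:
  fixes x b :: "'a::real_inner" assumes "x \<noteq> 0"
  shows "((\<lambda>s. norm (x + s *\<^sub>R b)) has_real_derivative (x \<bullet> b) / norm x) (at 0)"
proof -
  have "((\<lambda>s. norm (x + s *\<^sub>R b)) has_derivative (\<lambda>h. (h *\<^sub>R b) \<bullet> sgn (x + 0 *\<^sub>R b))) (at 0)"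
    by (rule has_derivative_compose[of "\<lambda>s. x + s *\<^sub>R b" "\<lambda>h. h *\<^sub>R b", where g = norm and g' = "\<lambda>h. h \<bullet> sgn (x + 0 *\<^sub>R b)"])
       (use assms in \<open>auto intro!: derivative_eq_intros has_derivative_norm\<close>)
  then show ?thesis
    unfolding has_field_derivative_def
    by (rule has_derivative_eq_rhs) (auto simp: sgn_div_norm inner_commute field_simps)
qed

text \<open>If w is the square root of x, its derivative in direction b is the complex number b / (2
  w) = b conj(w) / (2 |w|^2), and |w|^2 is \<open>norm x\<close>. This is the imaginary part;
  \<open>DERIV_root_re_line\<close> is the real part.\<close>

lemma DERIV_root_im_line:
  assumes x: "x \<in> slit_plane"
  shows "((\<lambda>s. root_im (x + s *\<^sub>R b)) has_real_derivative
     (snd b * root_re x - fst b * root_im x) / (2 * norm x)) (at 0)"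
proof -
  note pos = root_im_pos[OF x] norm_pos_slit[OF x]
  have pos': "0 < (norm x - fst x) / 2" using pos(1) by (simp add: root_im_def)
  have 1: "((\<lambda>s. (norm (x + s *\<^sub>R b) - fst (x + s *\<^sub>R b)) / 2) has_real_derivative
      ((x \<bullet> b) / norm x - fst b) / 2) (at 0)"
    unfolding fst_add fst_scaleR
    by (rule derivative_eq_intros refl DERIV_norm_line | use norm_pos_slit[OF x] in simp)+
  have "((\<lambda>s. root_im (x + s *\<^sub>R b)) has_real_derivative
     (inverse (root_im x) / 2) * (((x \<bullet> b) / norm x - fst b) / 2)) (at 0)"
    unfolding root_im_def
    by (rule DERIV_chain2[OF _ 1]) (use DERIV_real_sqrt[OF pos'] in simp)
  also have "(inverse (root_im x) / 2) * (((x \<bullet> b) / norm x - fst b) / 2)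
     = (snd b * root_re x - fst b * root_im x) / (2 * norm x)"
  proof -
    define N where "N = snd b * root_re x - fst b * root_im x"
    have "(inverse (root_im x) / 2) * (((x \<bullet> b) / norm x - fst b) / 2)
       = (x \<bullet> b - fst b * norm x) / (4 * root_im x * norm x)"
      using pos by (simp add: field_simps)
    also have "x \<bullet> b - fst b * norm x = 2 * root_im x * N"
      unfolding N_def using root_re_im[OF x]
      by (simp add: inner_prod_def fst_eq_root[OF x] norm_eq_root[OF x] power2_eq_square algebra_simps)
    also have "2 * root_im x * N / (4 * root_im x * norm x) = N / (2 * norm x)"
      using pos by simp
    finally show ?thesis unfolding N_def .
  qed
  finally show ?thesis .
qed

lemma DERIV_root_re_line:
  assumes x: "x \<in> slit_plane"
  shows "((\<lambda>s. root_re (x + s *\<^sub>R b)) has_real_derivative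
     (fst b * root_re x + snd b * root_im x) / (2 * norm x)) (at 0)"
proof -
  note pos = root_im_pos[OF x] norm_pos_slit[OF x]
  have "((\<lambda>s. root_re (x + s *\<^sub>R b)) has_real_derivative
     (snd b * (2 * root_im x) - snd x * (2 * ((snd b * root_re x - fst b * root_im x) / (2 * norm x))))
       / (2 * root_im x * (2 * root_im x))) (at 0)"
    unfolding root_re_def[of "_ + _"]
    by (rule derivative_eq_intros refl DERIV_root_im_line[OF x] | use pos in simp)+
  also have "(snd b * (2 * root_im x) - snd x * (2 * ((snd b * root_re x - fst b * root_im x) / (2 * norm x))))
       / (2 * root_im x * (2 * root_im x)) = (fst b * root_re x + snd b * root_im x) / (2 * norm x)"
    using pos unfolding root_re_im[OF x, symmetric]
    apply (simp add: divide_simps)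
    apply (simp add: norm_eq_root[OF x] power2_eq_square algebra_simps)
    done
  finally show ?thesis .
qed

text \<open>Sommerfeld's heat kernel on the double cover of the punctured plane, with pole at the point whose
  square root is \<open>a + i b\<close>. Suffixes \<open>d\<close>, \<open>x\<close> and \<open>t\<close> mark derivatives, the spatial ones in
  direction \<open>e\<close>.\<close>

context
  fixes a b :: real
begin

text \<open>Inner product of the square root of x with that of the pole; in polar coordinates sqrt
  (r s) cos ((phi - psi) / 2). It is the real part of a holomorphic function of x, hence
  harmonic.\<close>

definition hk_arg :: "real \<times> real \<Rightarrow> real" where
  "hk_arg x = a * root_re x + b * root_im x"

definition hk_arg_d :: "real \<times> real \<Rightarrow> real \<times> real \<Rightarrow> real" where
  "hk_arg_d e x = (fst e * (a * root_re x - b * root_im x) + snd e * (a * root_im x + b * root_re x)) / (2 * norm x)"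

text \<open>The formula is meant for unit vectors: in general the first summand carries the factor
  |e|^2.\<close>

definition hk_arg_dd :: "real \<times> real \<Rightarrow> real \<times> real \<Rightarrow> real" where
  "hk_arg_dd e x = hk_arg x / (4 * (norm x)\<^sup>2) - hk_arg_d e x * (x \<bullet> e) / (norm x)\<^sup>2"

text \<open>\<open>a\<^sup>2 + b\<^sup>2\<close> is the distance s of the pole from the origin, so
  the exponent is -(r + s)^2 / (4 t), the Gaussian of the path through the tip of the slit.\<close>

definition hk_pre :: "real \<times> real \<Rightarrow> real \<Rightarrow> real" where
  "hk_pre x t = exp (- (norm x + (a\<^sup>2 + b\<^sup>2))\<^sup>2 / (4 * t)) / (4 * pi * t)"

definition hk_term :: "real \<times> real \<Rightarrow> real \<Rightarrow> real" where
  "hk_term x t = hk_pre x t * sommerfeld (hk_arg x / sqrt t)"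

text \<open>Logarithmic derivative of \<open>hk_pre\<close>. Adding that of exp
  (\<open>hk_arg\<close>^2 / t) gives \<open>hk_p\<close>, and \<open>hk_pp\<close> is the
  derivative of \<open>hk_p\<close>. By the first-order equation of \<open>sommerfeld\<close>, every
  derivative of the kernel stays a combination of one \<open>sommerfeld\<close> value and a term
  free of it.\<close>

definition hk_e :: "real \<times> real \<Rightarrow> real \<times> real \<Rightarrow> real \<Rightarrow> real" where
  "hk_e e x t = - (norm x + (a\<^sup>2 + b\<^sup>2)) * ((x \<bullet> e) / norm x) / (2 * t)"

definition hk_p :: "real \<times> real \<Rightarrow> real \<times> real \<Rightarrow> real \<Rightarrow> real" where
  "hk_p e x t = hk_e e x t + 2 * hk_arg x * hk_arg_d e x / t"

definition hk_pp :: "real \<times> real \<Rightarrow> real \<times> real \<Rightarrow> real \<Rightarrow> real" where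
  "hk_pp e x t = - (((x \<bullet> e) / norm x)\<^sup>2 + (norm x + (a\<^sup>2 + b\<^sup>2)) * (1 / norm x - (x \<bullet> e)\<^sup>2 / (norm x) ^ 3)) / (2 * t)
     + 2 * ((hk_arg_d e x)\<^sup>2 + hk_arg x * hk_arg_dd e x) / t"

definition hk_x :: "real \<times> real \<Rightarrow> real \<times> real \<Rightarrow> real \<Rightarrow> real" where
  "hk_x e x t = hk_pre x t * (sommerfeld (hk_arg x / sqrt t) * hk_p e x t + hk_arg_d e x / (sqrt pi * sqrt t))"

definition hk_xx :: "real \<times> real \<Rightarrow> real \<times> real \<Rightarrow> real \<Rightarrow> real" where
  "hk_xx e x t = hk_pre x t *
    (hk_e e x t * (sommerfeld (hk_arg x / sqrt t) * hk_p e x t + hk_arg_d e x / (sqrt pi * sqrt t))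
     + ((2 * (hk_arg x / sqrt t) * sommerfeld (hk_arg x / sqrt t) + 1 / sqrt pi) * (hk_arg_d e x / sqrt t) * hk_p e x t
        + sommerfeld (hk_arg x / sqrt t) * hk_pp e x t + hk_arg_dd e x / (sqrt pi * sqrt t)))"

definition hk_t :: "real \<times> real \<Rightarrow> real \<Rightarrow> real" where
  "hk_t x t = hk_pre x t *
    ((- 1 / t + (norm x + (a\<^sup>2 + b\<^sup>2))\<^sup>2 / (4 * t\<^sup>2)) * sommerfeld (hk_arg x / sqrt t)
      - (2 * (hk_arg x / sqrt t) * sommerfeld (hk_arg x / sqrt t) + 1 / sqrt pi) * (hk_arg x / (2 * t * sqrt t)))"

lemma DERIV_hk_arg:
  assumes x: "x \<in> slit_plane"
  shows "((\<lambda>s. hk_arg (x + s *\<^sub>R e)) has_real_derivative hk_arg_d e x) (at 0)"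
  unfolding hk_arg_def hk_arg_d_def
  by (rule derivative_eq_intros refl DERIV_root_im_line[OF x] DERIV_root_re_line[OF x])+
     (use norm_pos_slit[OF x] in \<open>simp add: field_simps\<close>)

lemma DERIV_hk_arg_d:
  assumes x: "x \<in> slit_plane" and e: "norm e = 1"
  shows "((\<lambda>s. hk_arg_d e (x + s *\<^sub>R e)) has_real_derivative hk_arg_dd e x) (at 0)"
proof -
  note r = norm_pos_slit[OF x]
  have e2: "(fst e)\<^sup>2 = 1 - (snd e)\<^sup>2" using norm_prod_sq[of e] e by simp
  define N where "N y = fst e * (a * root_re y - b * root_im y) + snd e * (a * root_im y + b * root_re y)" for y
  have N: "N x = 2 * norm x * hk_arg_d e x" using r by (simp add: hk_arg_d_def N_def)
  define U V where "U = (fst e * root_re x + snd e * root_im x) / (2 * norm x)"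
    and "V = (snd e * root_re x - fst e * root_im x) / (2 * norm x)"
  note DU = DERIV_root_re_line[OF x, of e, folded U_def]
  note DV = DERIV_root_im_line[OF x, of e, folded V_def]
  have "((\<lambda>s. N (x + s *\<^sub>R e)) has_real_derivative
      fst e * (a * U - b * V) + snd e * (a * V + b * U)) (at 0)"
    unfolding N_def
    by (rule DERIV_add[OF DERIV_cmult[OF DERIV_diff[OF DERIV_cmult[OF DU] DERIV_cmult[OF DV]]]
        DERIV_cmult[OF DERIV_add[OF DERIV_cmult[OF DV] DERIV_cmult[OF DU]]]])
  also have "fst e * (a * U - b * V) + snd e * (a * V + b * U)
     = (((fst e)\<^sup>2 + (snd e)\<^sup>2) * hk_arg x) / (2 * norm x)"
  proof -
    define D where "D = inverse (2 * norm x)"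
    show ?thesis
      unfolding U_def V_def hk_arg_def power2_eq_square divide_inverse D_def[symmetric] by algebra
  qed
  also have "\<dots> = hk_arg x / (2 * norm x)" by (simp add: e2)
  finally have DN: "((\<lambda>s. N (x + s *\<^sub>R e)) has_real_derivative hk_arg x / (2 * norm x)) (at 0)" .
  have "x \<noteq> 0" using r by auto
  then have "((\<lambda>s. N (x + s *\<^sub>R e) / (2 * norm (x + s *\<^sub>R e))) has_real_derivative
     ((hk_arg x / (2 * norm x)) * (2 * norm x) - N x * (2 * ((x \<bullet> e) / norm x))) / (2 * norm x * (2 * norm x))) (at 0)"
    using DERIV_divide[OF DN DERIV_cmult[OF DERIV_norm_line, of x 2 e]] by simp
  also have "((hk_arg x / (2 * norm x)) * (2 * norm x) - N x * (2 * ((x \<bullet> e) / norm x))) / (2 * norm x * (2 * norm x))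
    = hk_arg_dd e x"
    unfolding hk_arg_dd_def N using r by (simp add: field_simps power2_eq_square)
  finally show ?thesis by (simp add: N_def hk_arg_d_def[abs_def])
qed

lemma DERIV_hk_pre:
  assumes x: "x \<in> slit_plane" and t: "t > 0"
  shows "((\<lambda>s. hk_pre (x + s *\<^sub>R e) t) has_real_derivative hk_pre x t * hk_e e x t) (at 0)"
proof -
  have *: "((\<lambda>s. exp (- (f s + d)\<^sup>2 / (4 * t)) / k) has_real_derivative
      exp (- (f 0 + d)\<^sup>2 / (4 * t)) / k * (- (f 0 + d) * f' / (2 * t))) (at 0)"
    if f: "(f has_real_derivative f') (at 0)" for f f' d k
  proof -
    have "((\<lambda>s. - (f s + d)\<^sup>2 / (4 * t)) has_real_derivative - (2 * (f' + 0) * (f 0 + d)) / (4 * t)) (at 0)"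
      by (intro DERIV_cdivide DERIV_minus DERIV_cong[OF DERIV_power[OF DERIV_add[OF f DERIV_const]]]) simp
    moreover have "- (2 * (f' + 0) * (f 0 + d)) / (4 * t) = - (f 0 + d) * f' / (2 * t)"
      using t by (simp add: field_simps)
    ultimately have "((\<lambda>s. - (f s + d)\<^sup>2 / (4 * t)) has_real_derivative - (f 0 + d) * f' / (2 * t)) (at 0)"
      by simp
    from DERIV_cdivide[OF DERIV_chain2[OF DERIV_exp this], of k] show ?thesis
      by (simp add: mult.commute)
  qed
  have "x \<noteq> 0" using norm_pos_slit[OF x] by auto
  from *[OF DERIV_norm_line[OF this, of e], of "a\<^sup>2 + b\<^sup>2" "4 * pi * t"] show ?thesis
    unfolding hk_pre_def hk_e_def by (rule DERIV_cong) simp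
qed

lemma DERIV_hk_som:
  assumes x: "x \<in> slit_plane" and t: "t > 0"
  shows "((\<lambda>s. sommerfeld (hk_arg (x + s *\<^sub>R e) / sqrt t)) has_real_derivative
     (2 * (hk_arg x / sqrt t) * sommerfeld (hk_arg x / sqrt t) + 1 / sqrt pi) * (hk_arg_d e x / sqrt t)) (at 0)"
  by (rule DERIV_cong[OF DERIV_chain2[OF DERIV_sommerfeld DERIV_cdivide[OF DERIV_hk_arg[OF x]]]]) simp

lemma DERIV_hk_p:
  assumes x: "x \<in> slit_plane" and t: "t > 0" and e: "norm e = 1"
  shows "((\<lambda>s. hk_p e (x + s *\<^sub>R e) t) has_real_derivative hk_pp e x t) (at 0)"
proof -
  note r = norm_pos_slit[OF x]
  have ee: "e \<bullet> e = 1" using e by (simp add: dot_square_norm)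
  have "x \<noteq> 0" using r by auto
  note dn = DERIV_norm_line[OF this, of e]
  have "((\<lambda>s. (x + s *\<^sub>R e) \<bullet> e) has_real_derivative 1) (at 0)"
    unfolding inner_add_left inner_scaleR_left ee by (auto intro!: derivative_eq_intros)
  from DERIV_divide[OF this dn] r
  have 1: "((\<lambda>s. ((x + s *\<^sub>R e) \<bullet> e) / norm (x + s *\<^sub>R e)) has_real_derivative
      (1 * norm x - (x \<bullet> e) * ((x \<bullet> e) / norm x)) / (norm x * norm x)) (at 0)"
    by simp
  have 2: "((\<lambda>s. hk_e e (x + s *\<^sub>R e) t) has_real_derivative
     (- ((x \<bullet> e) / norm x + 0) * ((x \<bullet> e) / norm x) + (1 * norm x - (x \<bullet> e) * ((x \<bullet> e) / norm x)) / (norm x * norm x) * - (norm x + (a\<^sup>2 + b\<^sup>2))) / (2 * t)) (at 0)"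
    using DERIV_cdivide[OF DERIV_mult[OF DERIV_minus[OF DERIV_add[OF dn DERIV_const]] 1], of "a\<^sup>2 + b\<^sup>2" "2 * t"]
    by (simp add: hk_e_def)
  have 3: "((\<lambda>s. 2 * hk_arg (x + s *\<^sub>R e) * hk_arg_d e (x + s *\<^sub>R e) / t) has_real_derivative
     (2 * hk_arg_d e x * hk_arg_d e x + hk_arg_dd e x * (2 * hk_arg x)) / t) (at 0)"
    using DERIV_cdivide[OF DERIV_mult[OF DERIV_cmult[OF DERIV_hk_arg[OF x, of e], of 2] DERIV_hk_arg_d[OF x e]], of t] by simp
  have 4: "(1 * norm x - (x \<bullet> e) * ((x \<bullet> e) / norm x)) / (norm x * norm x) = 1 / norm x - (x \<bullet> e)\<^sup>2 / (norm x) ^ 3"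
    using r by (simp add: field_simps power2_eq_square power3_eq_cube)
  define w \<rho> n where "w = 1 / norm x - (x \<bullet> e)\<^sup>2 / (norm x) ^ 3" and "\<rho> = (x \<bullet> e) / norm x"
    and "n = norm x + (a\<^sup>2 + b\<^sup>2)"
  have "(- (\<rho> + 0) * \<rho> + w * - n) / (2 * t) + (2 * hk_arg_d e x * hk_arg_d e x + hk_arg_dd e x * (2 * hk_arg x)) / t
    = - (\<rho>\<^sup>2 + n * w) / (2 * t) + 2 * ((hk_arg_d e x)\<^sup>2 + hk_arg x * hk_arg_dd e x) / t"
    using t by (simp add: field_simps power2_eq_square)
  then show ?thesis
    unfolding hk_p_def
    by (intro DERIV_cong[OF DERIV_add[OF 2 3]])
       (simp only: 4, simp only: hk_pp_def w_def[symmetric] \<rho>_def[symmetric] n_def[symmetric])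
qed

lemma DERIV_hk_term:
  assumes x: "x \<in> slit_plane" and t: "t > 0"
  shows "((\<lambda>s. hk_term (x + s *\<^sub>R e) t) has_real_derivative hk_x e x t) (at 0)"
proof -
  have "2 * (hk_arg x / sqrt t) * (hk_arg_d e x / sqrt t) = 2 * hk_arg x * hk_arg_d e x / t"
    using t by simp
  then show ?thesis
    unfolding hk_term_def
    by (intro DERIV_cong[OF DERIV_mult[OF DERIV_hk_pre[OF x t] DERIV_hk_som[OF x t]]])
       (use t in \<open>simp add: hk_x_def hk_p_def algebra_simps\<close>)
qed

lemma DERIV_hk_x:
  assumes x: "x \<in> slit_plane" and t: "t > 0" and e: "norm e = 1"
  shows "((\<lambda>s. hk_x e (x + s *\<^sub>R e) t) has_real_derivative hk_xx e x t) (at 0)"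
  unfolding hk_x_def
  by (rule DERIV_cong[OF DERIV_mult[OF DERIV_hk_pre[OF x t]
         DERIV_add[OF DERIV_mult[OF DERIV_hk_som[OF x t] DERIV_hk_p[OF x t e]] DERIV_cdivide[OF DERIV_hk_arg_d[OF x e]]]]])
     (simp add: hk_xx_def algebra_simps)

lemma DERIV_hk_term_t:
  assumes t: "t > 0"
  shows "((\<lambda>s. hk_term x s) has_real_derivative hk_t x t) (at t)"
proof -
  define d where "d = (norm x + (a\<^sup>2 + b\<^sup>2))\<^sup>2"
  have "((\<lambda>s. - d / (4 * s)) has_real_derivative d / (4 * t\<^sup>2)) (at t)"
    using t by (auto intro!: derivative_eq_intros simp: field_simps power2_eq_square)
  from DERIV_mult[OF DERIV_chain2[OF DERIV_exp this] DERIV_cmult[OF DERIV_inverse, of t "1 / (4 * pi)"]]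
  have 1: "((\<lambda>s. hk_pre x s) has_real_derivative hk_pre x t * (- 1 / t + d / (4 * t\<^sup>2))) (at t)"
    unfolding hk_pre_def d_def[symmetric]
    by (rule DERIV_cong[THEN DERIV_cong_ev[OF refl _ refl, THEN iffD1, rotated]])
       (use t in \<open>auto simp: field_simps power2_eq_square\<close>)
  have 2: "((\<lambda>s. hk_arg x / sqrt s) has_real_derivative - (hk_arg x / (2 * t * sqrt t))) (at t)"
    using t by (auto intro!: derivative_eq_intros simp: field_simps)
  show ?thesis
    unfolding hk_term_def
    by (rule DERIV_cong[OF DERIV_mult[OF 1 DERIV_chain2[OF DERIV_sommerfeld 2]]])
       (simp add: hk_t_def d_def algebra_simps)
qed

text \<open>Write r for the norm of x, s for \<open>hk_arg\<close> and d for
  \<open>a\<^sup>2 + b\<^sup>2\<close>. Only these relations enter: |grad r| = 1, |grad s|^2 = d /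
  (4 r), grad r . grad s = s / (2 r), the Laplacian of r is 1 / r, and that of s is 0.\<close>

lemma hk_laplacian:
  assumes x: "x \<in> slit_plane" and t: "t > 0"
  shows "hk_xx (1, 0) x t + hk_xx (0, 1) x t = hk_t x t"
proof -
  define e f :: "real \<times> real" where "e = (1, 0)" and "f = (0, 1)"
  define r where "r = norm x"
  define d where "d = a\<^sup>2 + b\<^sup>2"
  define s where "s = hk_arg x"
  define H where "H = sommerfeld (hk_arg x / sqrt t)"
  define q where "q = sqrt t"
  have q: "q > 0" "q\<^sup>2 = t" using t by (auto simp: q_def)
  have r: "r > 0" using norm_pos_slit[OF x] by (simp add: r_def)
  define re where "re = (x \<bullet> e) / r"
  define rf where "rf = (x \<bullet> f) / r"
  define se where "se = hk_arg_d e x"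
  define sf where "sf = hk_arg_d f x"
  have rr: "re\<^sup>2 + rf\<^sup>2 = 1"
  proof -
    have "re\<^sup>2 + rf\<^sup>2 = ((fst x)\<^sup>2 + (snd x)\<^sup>2) / r\<^sup>2"
      by (simp add: re_def rf_def e_def f_def power_divide add_divide_distrib inner_prod_def)
    also have "\<dots> = r\<^sup>2 / r\<^sup>2" by (simp only: norm_prod_sq r_def)
    finally show ?thesis using r by simp
  qed
  have xr: "norm x = (root_re x)\<^sup>2 + (root_im x)\<^sup>2" "fst x = (root_re x)\<^sup>2 - (root_im x)\<^sup>2" "snd x = 2 * root_re x * root_im x"
    using norm_eq_root[OF x] fst_eq_root[OF x] root_re_im[OF x] by auto
  have ss: "se\<^sup>2 + sf\<^sup>2 = d / (4 * r)"
  proof -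
    have "se\<^sup>2 + sf\<^sup>2 = ((a * root_re x - b * root_im x)\<^sup>2 + (a * root_im x + b * root_re x)\<^sup>2) / (2 * r)\<^sup>2"
      unfolding se_def sf_def e_def f_def hk_arg_d_def r_def
      by (simp add: power_divide add_divide_distrib[symmetric])
    also have "(a * root_re x - b * root_im x)\<^sup>2 + (a * root_im x + b * root_re x)\<^sup>2 = d * r"
      unfolding d_def r_def xr(1) by (simp add: power2_eq_square algebra_simps)
    finally show ?thesis using r by (simp add: power2_eq_square field_simps)
  qed
  have rs: "re * se + rf * sf = s / (2 * r)"
  proof -
    have "re * se + rf * sf = (fst x * (a * root_re x - b * root_im x) + snd x * (a * root_im x + b * root_re x)) / (2 * r * r)"
    proof -
      define A B where "A = a * root_re x - b * root_im x" and "B = a * root_im x + b * root_re x"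
      have F: "re = fst x / r" "rf = snd x / r" "se = A / (2 * r)" "sf = B / (2 * r)"
        by (simp_all add: re_def rf_def se_def sf_def e_def f_def hk_arg_d_def r_def inner_prod_def A_def B_def)
      show ?thesis using r unfolding A_def[symmetric] B_def[symmetric] F by (simp add: field_simps)
    qed
    also have "fst x * (a * root_re x - b * root_im x) + snd x * (a * root_im x + b * root_re x) = s * r"
      unfolding r_def xr s_def hk_arg_def by (simp add: power2_eq_square algebra_simps)
    finally show ?thesis using r by simp
  qed
  define m where "m = (r + d) / (2 * t)"
  define c where "c = 1 / (sqrt pi * q)"
  define ree rff see sff where "ree = (1 - re\<^sup>2) / r" and "rff = (1 - rf\<^sup>2) / r"
    and "see = s / (4 * r\<^sup>2) - se * re / r" and "sff = s / (4 * r\<^sup>2) - sf * rf / r"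
  have sum2: "ree + rff = 1 / r" "see + sff = 0"
  proof -
    have "ree + rff = (2 - (re\<^sup>2 + rf\<^sup>2)) / r" by (simp add: ree_def rff_def diff_divide_distrib add_divide_distrib)
    then show "ree + rff = 1 / r" by (simp add: rr)
    have "see + sff = s / (2 * r\<^sup>2) - (re * se + rf * sf) / r" by (simp add: see_def sff_def add_divide_distrib field_simps)
    then show "see + sff = 0" using r by (simp add: rs power2_eq_square)
  qed
  have arg: "2 * (s / q) * y / q = 2 * s * y / t" for y using q by (simp add: power2_eq_square)
  \<comment> \<open>One computation serves both coordinate directions; \<open>rg\<close>,
    \<open>sg\<close> and \<open>rgg\<close>, \<open>sgg\<close> stand for the first and second
    derivatives of r and s along \<open>g\<close>.\<close>
  have X: "hk_xx g x t = hk_pre x t *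
     (- m * rg * (H * (- m * rg + 2 * s * sg / t) + c * sg)
      + (2 * s / t * H + c) * sg * (- m * rg + 2 * s * sg / t)
      + H * (- (rg\<^sup>2 + (r + d) * rgg) / (2 * t) + 2 * (sg\<^sup>2 + s * sgg) / t) + c * sgg)"
    if "rg = (x \<bullet> g) / r" "sg = hk_arg_d g x" "rgg = (1 - rg\<^sup>2) / r" "sgg = s / (4 * r\<^sup>2) - sg * rg / r" for g rg sg rgg sgg
  proof -
    have 1: "hk_e g x t = - m * rg" unfolding hk_e_def r_def[symmetric] d_def[symmetric] that(1)[symmetric] m_def
      by (simp only: mult_minus_left minus_divide_left[symmetric] times_divide_eq_left)
    have 2: "hk_p g x t = - m * rg + 2 * s * sg / t" by (simp add: hk_p_def 1 s_def that)
    have 3: "hk_arg_dd g x = sgg" using r by (simp add: hk_arg_dd_def that s_def r_def power2_eq_square)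
    have 4: "1 / norm x - (x \<bullet> g)\<^sup>2 / norm x ^ 3 = rgg"
      using r by (simp add: that r_def[symmetric] power2_eq_square power3_eq_cube field_simps)
    have 5: "hk_pp g x t = - (rg\<^sup>2 + (r + d) * rgg) / (2 * t) + 2 * (sg\<^sup>2 + s * sgg) / t"
      unfolding hk_pp_def 3 4 by (simp add: that s_def r_def d_def)
    have 6: "(2 * (hk_arg x / sqrt t) * sommerfeld (hk_arg x / sqrt t) + 1 / sqrt pi) * (hk_arg_d g x / sqrt t)
       = (2 * s / t * H + c) * sg"
      using q unfolding s_def[symmetric] q_def[symmetric] H_def that(2)[symmetric] c_def q(2)[symmetric]
      by (simp add: field_simps power2_eq_square)
    show ?thesis
      unfolding hk_xx_def 6 1 2 3 5 by (simp add: H_def c_def q_def that(2) algebra_simps)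
  qed
  have T: "hk_t x t = hk_pre x t * ((- 1 / t + (r + d)\<^sup>2 / (4 * t\<^sup>2)) * H - (2 * s / t * H + c) * (s / (2 * t)))"
  proof -
    have "(2 * (hk_arg x / sqrt t) * sommerfeld (hk_arg x / sqrt t) + 1 / sqrt pi) * (hk_arg x / (2 * t * sqrt t))
      = (2 * s / t * H + c) * (s / (2 * t))"
      using q unfolding s_def[symmetric] q_def[symmetric] H_def c_def q(2)[symmetric]
      by (simp add: field_simps power2_eq_square)
    then show ?thesis unfolding hk_t_def by (simp add: r_def d_def H_def)
  qed
  have Pe: "(- m * re) * (- m * re + 2 * s * se / t) + (- m * rf) * (- m * rf + 2 * s * sf / t)
     = m\<^sup>2 - m * s\<^sup>2 / (r * t)"
  proof -
    have "(- m * re) * (- m * re + 2 * s * se / t) + (- m * rf) * (- m * rf + 2 * s * sf / t)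
      = m\<^sup>2 * (re\<^sup>2 + rf\<^sup>2) - 2 * m * s / t * (re * se + rf * sf)"
      by (simp add: power2_eq_square add_divide_distrib algebra_simps)
    then show ?thesis unfolding rr rs using r t by (simp add: field_simps power2_eq_square)
  qed
  have Ps: "se * (- m * re + 2 * s * se / t) + sf * (- m * rf + 2 * s * sf / t) = s * (d - r) / (4 * r * t)"
  proof -
    have "se * (- m * re + 2 * s * se / t) + sf * (- m * rf + 2 * s * sf / t)
      = - m * (re * se + rf * sf) + 2 * s / t * (se\<^sup>2 + sf\<^sup>2)"
      by (simp add: power2_eq_square add_divide_distrib algebra_simps)
    then show ?thesis unfolding rs ss m_def using r t by (simp add: field_simps)
  qed
  have PP: "(- (re\<^sup>2 + (r + d) * ree) / (2 * t) + 2 * (se\<^sup>2 + s * see) / t)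
      + (- (rf\<^sup>2 + (r + d) * rff) / (2 * t) + 2 * (sf\<^sup>2 + s * sff) / t) = - 1 / t"
  proof -
    have "(- (re\<^sup>2 + (r + d) * ree) / (2 * t) + 2 * (se\<^sup>2 + s * see) / t)
      + (- (rf\<^sup>2 + (r + d) * rff) / (2 * t) + 2 * (sf\<^sup>2 + s * sff) / t)
      = - ((re\<^sup>2 + rf\<^sup>2) + (r + d) * (ree + rff)) / (2 * t) + 2 * ((se\<^sup>2 + sf\<^sup>2) + s * (see + sff)) / t"
      by (simp add: add_divide_distrib diff_divide_distrib algebra_simps)
    then show ?thesis unfolding rr ss sum2 using r t by (simp add: field_simps)
  qed
  define pe pf w where "pe = - m * re + 2 * s * se / t" and "pf = - m * rf + 2 * s * sf / t" and "w = 2 * s / t"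
  define qe qf where "qe = - (re\<^sup>2 + (r + d) * ree) / (2 * t) + 2 * (se\<^sup>2 + s * see) / t"
    and "qf = - (rf\<^sup>2 + (r + d) * rff) / (2 * t) + 2 * (sf\<^sup>2 + s * sff) / t"
  \<comment> \<open>The two sides are compared coefficient by coefficient: \<open>Hpart\<close> is
    the coefficient of the \<open>sommerfeld\<close> value \<open>H\<close>, \<open>cpart\<close>
    that of \<open>c\<close>.\<close>
  have Hpart: "(m\<^sup>2 - m * s\<^sup>2 / (r * t)) + w * (s * (d - r) / (4 * r * t)) - 1 / t
     = - 1 / t + (r + d)\<^sup>2 / (4 * t\<^sup>2) - w * (s / (2 * t))"
    unfolding m_def w_def using r t by (simp add: divide_simps) (simp add: algebra_simps power2_eq_square)
  have cpart: "- m * (s / (2 * r)) + s * (d - r) / (4 * r * t) = - (s / (2 * t))"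
    unfolding m_def using r t by (simp add: divide_simps) (simp add: algebra_simps power2_eq_square)
  have "hk_xx e x t + hk_xx f x t = hk_pre x t *
     (H * (- m * re * pe + - m * rf * pf) - m * c * (re * se + rf * sf)
      + (w * H + c) * (se * pe + sf * pf) + H * (qe + qf) + c * (see + sff))"
    unfolding X[OF re_def se_def ree_def see_def] X[OF rf_def sf_def rff_def sff_def]
      pe_def[symmetric] pf_def[symmetric] w_def[symmetric] qe_def[symmetric] qf_def[symmetric]
    by (simp add: algebra_simps)
  also have "\<dots> = hk_pre x t * (H * ((m\<^sup>2 - m * s\<^sup>2 / (r * t)) + w * (s * (d - r) / (4 * r * t)) - 1 / t)
      + c * (- m * (s / (2 * r)) + s * (d - r) / (4 * r * t)))"
    unfolding Pe[folded pe_def pf_def] Ps[folded pe_def pf_def] PP[folded qe_def qf_def] rs sum2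
    by (simp add: add_divide_distrib diff_divide_distrib algebra_simps)
  also have "\<dots> = hk_t x t"
    unfolding Hpart cpart T w_def[symmetric] by (simp add: add_divide_distrib algebra_simps)
  finally show ?thesis by (simp add: e_def f_def)
qed

end

text \<open>Continuity is joint and includes the pole \<open>(A p, B p)\<close>, because solutions
  are later formed by integrating over the pole and differentiated under the integral sign.\<close>

lemma
  assumes X: "continuous_on S X" and T: "continuous_on S T" and A: "continuous_on S A" and B: "continuous_on S B"
    and S: "\<And>p. p \<in> S \<Longrightarrow> X p \<in> slit_plane" "\<And>p. p \<in> S \<Longrightarrow> 0 < T p"
  shows continuous_on_hk_term: "continuous_on S (\<lambda>p. hk_term (A p) (B p) (X p) (T p))"
    and continuous_on_hk_x: "continuous_on S (\<lambda>p. hk_x (A p) (B p) e (X p) (T p))"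
    and continuous_on_hk_xx: "continuous_on S (\<lambda>p. hk_xx (A p) (B p) e (X p) (T p))"
    and continuous_on_hk_t: "continuous_on S (\<lambda>p. hk_t (A p) (B p) (X p) (T p))"
proof -
  note [continuous_intros] = X T A B
  have XS: "X ` S \<subseteq> slit_plane" using S by auto
  have nz: "norm (X p) \<noteq> 0" "X p \<noteq> 0" "T p \<noteq> 0" "sqrt (T p) \<noteq> 0" if "p \<in> S" for p
    using S[OF that] norm_pos_slit[of "X p"] by auto
  have arg[continuous_intros]: "continuous_on S (\<lambda>p. hk_arg (A p) (B p) (X p))"
    unfolding hk_arg_def by (intro continuous_intros XS)
  have arg_d[continuous_intros]: "continuous_on S (\<lambda>p. hk_arg_d (A p) (B p) e (X p))"
    unfolding hk_arg_d_def by (intro continuous_intros XS) (simp add: nz)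
  have arg_dd[continuous_intros]: "continuous_on S (\<lambda>p. hk_arg_dd (A p) (B p) e (X p))"
    unfolding hk_arg_dd_def by (intro continuous_intros) (simp_all add: nz)
  have pre[continuous_intros]: "continuous_on S (\<lambda>p. hk_pre (A p) (B p) (X p) (T p))"
    unfolding hk_pre_def by (intro continuous_intros) (simp_all add: nz)
  have e[continuous_intros]: "continuous_on S (\<lambda>p. hk_e (A p) (B p) e (X p) (T p))"
    unfolding hk_e_def by (intro continuous_intros) (use nz in auto)
  have p[continuous_intros]: "continuous_on S (\<lambda>p. hk_p (A p) (B p) e (X p) (T p))"
    unfolding hk_p_def by (intro continuous_intros) (simp_all add: nz)
  have pp[continuous_intros]: "continuous_on S (\<lambda>p. hk_pp (A p) (B p) e (X p) (T p))"
    unfolding hk_pp_def by (intro continuous_intros) (use nz in auto)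
  show "continuous_on S (\<lambda>p. hk_term (A p) (B p) (X p) (T p))"
    unfolding hk_term_def by (intro continuous_intros) (simp_all add: nz)
  show "continuous_on S (\<lambda>p. hk_x (A p) (B p) e (X p) (T p))"
    unfolding hk_x_def by (intro continuous_intros) (simp_all add: nz)
  show "continuous_on S (\<lambda>p. hk_xx (A p) (B p) e (X p) (T p))"
    unfolding hk_xx_def by (intro continuous_intros) (simp_all add: nz)
  show "continuous_on S (\<lambda>p. hk_t (A p) (B p) (X p) (T p))"
    unfolding hk_t_def by (intro continuous_intros) (simp_all add: nz)
qed

lemma sum_Basis_real_prod: "(\<Sum>b\<in>Basis. f b) = f (1, 0) + f (0, 1)" for f :: "real \<times> real \<Rightarrow> real"
proof -
  have B: "(Basis :: (real \<times> real) set) = {(1, 0), (0, 1)}" by (auto simp: Basis_prod_def)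
  show ?thesis unfolding B by simp
qed

text \<open>Changing the sign of \<open>root_im y\<close> reflects the pole to the other sheet (method of images).\<close>

definition slit_kernel :: "real \<times> real \<Rightarrow> real \<times> real \<Rightarrow> real \<Rightarrow> real" where
  "slit_kernel x y t = hk_term (root_re y) (root_im y) x t - hk_term (root_re y) (- root_im y) x t"

definition slit_kernel_t where
  "slit_kernel_t x y t = hk_t (root_re y) (root_im y) x t - hk_t (root_re y) (- root_im y) x t"

definition slit_kernel_x where
  "slit_kernel_x e x y t = hk_x (root_re y) (root_im y) e x t - hk_x (root_re y) (- root_im y) e x t"

definition slit_kernel_xx where
  "slit_kernel_xx e x y t = hk_xx (root_re y) (root_im y) e x t - hk_xx (root_re y) (- root_im y) e x t"

lemma
  assumes x: "x \<in> slit_plane" and t: "t > 0"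
  shows DERIV_slit_kernel_t: "((\<lambda>s. slit_kernel x y s) has_real_derivative slit_kernel_t x y t) (at t)"
    and DERIV_slit_kernel_x: "((\<lambda>s. slit_kernel (x + s *\<^sub>R e) y t) has_real_derivative slit_kernel_x e x y t) (at 0)"
    and DERIV_slit_kernel_xx: "norm e = 1 \<Longrightarrow> ((\<lambda>s. slit_kernel_x e (x + s *\<^sub>R e) y t) has_real_derivative slit_kernel_xx e x y t) (at 0)"
    and slit_kernel_laplacian: "slit_kernel_xx (1, 0) x y t + slit_kernel_xx (0, 1) x y t = slit_kernel_t x y t"
  unfolding slit_kernel_def slit_kernel_t_def slit_kernel_x_def slit_kernel_xx_def
  using hk_laplacian[OF x t, of "root_re y" "root_im y"] hk_laplacian[OF x t, of "root_re y" "- root_im y"]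
  by (auto intro!: DERIV_diff DERIV_hk_term_t DERIV_hk_term DERIV_hk_x x t)

lemma
  assumes "continuous_on S X" and "continuous_on S T" and "continuous_on S Y"
    and "\<And>p. p \<in> S \<Longrightarrow> X p \<in> slit_plane" "\<And>p. p \<in> S \<Longrightarrow> Y p \<in> slit_plane" "\<And>p. p \<in> S \<Longrightarrow> 0 < T p"
  shows continuous_on_slit_kernel: "continuous_on S (\<lambda>p. slit_kernel (X p) (Y p) (T p))"
    and continuous_on_slit_kernel_x: "continuous_on S (\<lambda>p. slit_kernel_x e (X p) (Y p) (T p))"
    and continuous_on_slit_kernel_xx: "continuous_on S (\<lambda>p. slit_kernel_xx e (X p) (Y p) (T p))"
    and continuous_on_slit_kernel_t: "continuous_on S (\<lambda>p. slit_kernel_t (X p) (Y p) (T p))"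
  unfolding slit_kernel_def slit_kernel_t_def slit_kernel_x_def slit_kernel_xx_def
  by (intro continuous_on_diff continuous_on_hk_term continuous_on_hk_x continuous_on_hk_xx continuous_on_hk_t
      continuous_on_root_re continuous_on_root_im continuous_on_minus assms; use assms in force)+

lemma heat_equation_slit_kernel:
  assumes y: "y \<in> slit_plane"
  shows "heat_equation_on slit_plane (\<lambda>x t. slit_kernel x y t)"
  unfolding heat_equation_on_def
proof (rule conjI; (rule exI[of _ "\<lambda>x t. slit_kernel_t x y t"], rule exI[of _ "\<lambda>e x t. slit_kernel_x e x y t"],
    rule exI[of _ "\<lambda>e x t. slit_kernel_xx e x y t"], intro conjI ballI allI impI)?)
  note cont = continuous_on_slit_kernel continuous_on_slit_kernel_t continuous_on_slit_kernel_x continuous_on_slit_kernel_xx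
  show "continuous_on (slit_plane \<times> {0<..}) (\<lambda>(x, t). slit_kernel x y t)"
    "continuous_on (slit_plane \<times> {0<..}) (\<lambda>(x, t). slit_kernel_t x y t)"
    "continuous_on (slit_plane \<times> {0<..}) (\<lambda>(x, t). slit_kernel_x e x y t)"
    "continuous_on (slit_plane \<times> {0<..}) (\<lambda>(x, t). slit_kernel_xx e x y t)" for e
    using y by (auto simp: case_prod_beta intro!: cont continuous_intros)
next
  fix x e :: "real \<times> real" and t :: real assume x: "x \<in> slit_plane" and t: "0 < t"
  show "((\<lambda>s. slit_kernel x y s) has_real_derivative slit_kernel_t x y t) (at t)"
    by (rule DERIV_slit_kernel_t[OF x t])
  show "((\<lambda>s. slit_kernel (x + s *\<^sub>R e) y t) has_real_derivative slit_kernel_x e x y t) (at 0)"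
    by (rule DERIV_slit_kernel_x[OF x t])
  show "e \<in> Basis \<Longrightarrow> ((\<lambda>s. slit_kernel_x e (x + s *\<^sub>R e) y t) has_real_derivative slit_kernel_xx e x y t) (at 0)"
    by (rule DERIV_slit_kernel_xx[OF x t]) simp
  show "(\<Sum>b\<in>Basis. slit_kernel_xx b x y t) = slit_kernel_t x y t"
    by (simp add: sum_Basis_real_prod slit_kernel_laplacian[OF x t])
qed

lemma borel_measurable_fst_borel [measurable]: "fst \<in> borel_measurable (borel :: ('a::second_countable_topology \<times> 'b::second_countable_topology) measure)"
  by (intro borel_measurable_continuous_onI continuous_intros)

lemma borel_measurable_snd_borel [measurable]: "snd \<in> borel_measurable (borel :: ('a::second_countable_topology \<times> 'b::second_countable_topology) measure)"
  by (intro borel_measurable_continuous_onI continuous_intros)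

lemma nn_integral_lborel_prod_mult:
  fixes f g :: "real \<Rightarrow> real"
  assumes [measurable]: "f \<in> borel_measurable borel" "g \<in> borel_measurable borel"
    and nonneg: "\<And>x. 0 \<le> f x" "\<And>x. 0 \<le> g x"
  shows "(\<integral>\<^sup>+z. ennreal (f (fst z) * g (snd z)) \<partial>lborel) = (\<integral>\<^sup>+x. f x \<partial>lborel) * (\<integral>\<^sup>+x. g x \<partial>lborel)"
proof -
  have "(\<integral>\<^sup>+z. ennreal (f (fst z) * g (snd z)) \<partial>lborel) = (\<integral>\<^sup>+x. \<integral>\<^sup>+y. ennreal (f x * g y) \<partial>lborel \<partial>lborel)"
    unfolding lborel_prod[symmetric] by (subst lborel.nn_integral_fst[symmetric]) auto
  also have "\<dots> = (\<integral>\<^sup>+x. ennreal (f x) * (\<integral>\<^sup>+y. ennreal (g y) \<partial>lborel) \<partial>lborel)"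
    by (intro nn_integral_cong) (simp add: ennreal_mult nonneg nn_integral_cmult)
  also have "\<dots> = (\<integral>\<^sup>+x. f x \<partial>lborel) * (\<integral>\<^sup>+x. g x \<partial>lborel)"
    by (simp add: nn_integral_multc)
  finally show ?thesis .
qed

section \<open>Comparison with the free Gaussian kernel: boundary values and initial values\<close>

definition gauss_kernel :: "real \<times> real \<Rightarrow> real \<times> real \<Rightarrow> real \<Rightarrow> real" where
  "gauss_kernel x y t = exp (- (norm (x - y))\<^sup>2 / (4 * t)) / (4 * pi * t)"

lemma gauss_kernel_sym: "gauss_kernel x y t = gauss_kernel y x t"
  by (simp add: gauss_kernel_def norm_minus_commute)

lemma gauss_kernel_nonneg: "0 < t \<Longrightarrow> 0 \<le> gauss_kernel x y t"
  by (simp add: gauss_kernel_def)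

lemma borel_measurable_gauss_kernel' [measurable]: "(\<lambda>x. gauss_kernel x y t) \<in> borel_measurable borel"
  unfolding gauss_kernel_def by measurable

lemma borel_measurable_gauss_kernel [measurable]: "(\<lambda>y. gauss_kernel x y t) \<in> borel_measurable borel"
  unfolding gauss_kernel_def by measurable

lemma gauss_kernel_normal:
  assumes t: "t > 0"
  shows "gauss_kernel x y t = normal_density (fst x) (sqrt (2 * t)) (fst y) * normal_density (snd x) (sqrt (2 * t)) (snd y)"
proof -
  have "(norm (x - y))\<^sup>2 = (fst y - fst x)\<^sup>2 + (snd y - snd x)\<^sup>2"
    unfolding norm_prod_sq by (simp add: power2_commute)
  then have "- (norm (x - y))\<^sup>2 / (4 * t) = - (fst y - fst x)\<^sup>2 / (4 * t) + - (snd y - snd x)\<^sup>2 / (4 * t)"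
    by (simp only: minus_add_distrib add_divide_distrib diff_conv_add_uminus)
  then have "gauss_kernel x y t = exp (- (fst y - fst x)\<^sup>2 / (4 * t)) * exp (- (snd y - snd x)\<^sup>2 / (4 * t)) / (4 * pi * t)"
    unfolding gauss_kernel_def exp_add[symmetric] by simp
  also have "\<dots> = normal_density (fst x) (sqrt (2 * t)) (fst y) * normal_density (snd x) (sqrt (2 * t)) (snd y)"
  proof -
    define w where "w = sqrt (2 * pi * (sqrt (2 * t))\<^sup>2)"
    have "w * w = 4 * pi * t" using t by (simp add: w_def)
    moreover have "2 * (sqrt (2 * t))\<^sup>2 = 4 * t" using t by simp
    ultimately show ?thesis unfolding normal_density_def w_def[symmetric] by simp
  qed
  finally show ?thesis .
qed

text \<open>Mass 1 and second moment 2 t from each of the two coordinates. The weight has the form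
  \<open>A + B * (norm (x - y))\<^sup>2\<close> because that is how moduli of continuity are bounded
  below.\<close>

lemma nn_integral_gauss_kernel:
  assumes t: "t > 0" and AB: "0 \<le> A" "0 \<le> B"
  shows "(\<integral>\<^sup>+y. ennreal (gauss_kernel x y t * (A + B * (norm (x - y))\<^sup>2)) \<partial>lborel) = ennreal (A + 4 * t * B)"
proof -
  let ?N = "\<lambda>m. normal_density m (sqrt (2 * t))"
  have s: "sqrt (2 * t) > 0" using t by simp
  have [simp]: "0 \<le> ?N m u" for m u by simp
  have N0: "(\<integral>\<^sup>+u. ennreal (?N m u) \<partial>lborel) = 1" for m
    using nn_integral_eq_integral[OF integrable_normal_density[OF s]] integral_normal_density[OF s] by simp
  have N2: "(\<integral>\<^sup>+u. ennreal (?N m u * (u - m)\<^sup>2) \<partial>lborel) = ennreal (2 * t)" for m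
    using nn_integral_eq_integral[of lborel "\<lambda>u. ?N m u * (u - m)\<^sup>2"] normal_moment_even[OF s, of m 1] t
    by (simp add: has_bochner_integral_iff)
  have split: "gauss_kernel x y t * (A + B * (norm (x - y))\<^sup>2) =
      A * (?N (fst x) (fst y) * ?N (snd x) (snd y))
      + B * ((?N (fst x) (fst y) * (fst y - fst x)\<^sup>2) * ?N (snd x) (snd y)
      + ?N (fst x) (fst y) * (?N (snd x) (snd y) * (snd y - snd x)\<^sup>2))" for y
    unfolding gauss_kernel_normal[OF t] norm_prod_sq by (simp add: power2_commute algebra_simps)
  have "(\<integral>\<^sup>+y. ennreal (gauss_kernel x y t * (A + B * (norm (x - y))\<^sup>2)) \<partial>lborel) =
      (\<integral>\<^sup>+y. ennreal A * ennreal (?N (fst x) (fst y) * ?N (snd x) (snd y)) +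
        ennreal B * (ennreal ((?N (fst x) (fst y) * (fst y - fst x)\<^sup>2) * ?N (snd x) (snd y))
         + ennreal (?N (fst x) (fst y) * (?N (snd x) (snd y) * (snd y - snd x)\<^sup>2))) \<partial>lborel)"
    unfolding split using AB by (intro nn_integral_cong) (simp add: ennreal_mult ennreal_plus)
  also have "\<dots> = ennreal A * (\<integral>\<^sup>+y. ennreal (?N (fst x) (fst y) * ?N (snd x) (snd y)) \<partial>lborel)
      + ennreal B * ((\<integral>\<^sup>+y. ennreal ((?N (fst x) (fst y) * (fst y - fst x)\<^sup>2) * ?N (snd x) (snd y)) \<partial>lborel)
      + (\<integral>\<^sup>+y. ennreal (?N (fst x) (fst y) * (?N (snd x) (snd y) * (snd y - snd x)\<^sup>2)) \<partial>lborel))"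
    by (simp add: nn_integral_add nn_integral_cmult)
  also have "\<dots> = ennreal A * 1 + ennreal B * (ennreal (2 * t) + ennreal (2 * t))"
    by (subst (1 2 3) nn_integral_lborel_prod_mult) (auto simp: N0 N2)
  also have "\<dots> = ennreal (A + 4 * t * B)"
    using AB t by (simp add: ennreal_mult[symmetric] ennreal_plus[symmetric] algebra_simps del: ennreal_plus)
  finally show ?thesis .
qed

lemma
  assumes t: "t > 0"
  shows integrable_gauss_kernel: "integrable lborel (\<lambda>y. gauss_kernel x y t)"
    and integral_gauss_kernel: "(\<integral>y. gauss_kernel x y t \<partial>lborel) = 1"
proof -
  have "(\<integral>\<^sup>+y. ennreal (gauss_kernel x y t) \<partial>lborel) = 1"
    using nn_integral_gauss_kernel[OF t, of 1 0 x] by simp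
  then show "integrable lborel (\<lambda>y. gauss_kernel x y t)" "(\<integral>y. gauss_kernel x y t \<partial>lborel) = 1"
    using nn_integral_eq_integrable[of "\<lambda>y. gauss_kernel x y t" lborel 1] gauss_kernel_nonneg[OF t] by auto
qed

lemma integrable_gauss_kernel_mult:
  assumes t: "t > 0" and [measurable]: "f \<in> borel_measurable borel" and M: "\<And>y. \<bar>f y\<bar> \<le> M"
  shows "integrable lborel (\<lambda>y. gauss_kernel x y t * f y)"
proof (rule Bochner_Integration.integrable_bound[OF integrable_mult_left[of M, OF integrable_gauss_kernel[OF t, of x]]])
  show "AE y in lborel. norm (gauss_kernel x y t * f y) \<le> norm (gauss_kernel x y t * M)"
  proof (rule AE_I2)
    fix y
    have "0 \<le> M" using M[of y] by simp
    then show "norm (gauss_kernel x y t * f y) \<le> norm (gauss_kernel x y t * M)"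
      using M[of y] gauss_kernel_nonneg[OF t, of x y] by (simp add: abs_mult mult_left_mono)
  qed
qed (use assms in auto)

text \<open>Chebyshev's argument without a split of the domain: the quadratic term of the hypothesis
  covers the points far from x, and the second moment makes its contribution proportional to
  t.\<close>

lemma gauss_kernel_approx:
  assumes t: "t > 0" and [measurable]: "f \<in> borel_measurable borel" and M: "\<And>y. \<bar>f y\<bar> \<le> M"
    and e: "\<And>y. \<bar>f y - f x\<bar> \<le> e + B * (norm (x - y))\<^sup>2" "0 \<le> e" "0 \<le> B"
  shows "\<bar>(\<integral>y. gauss_kernel x y t * f y \<partial>lborel) - f x\<bar> \<le> e + 4 * t * B"
proof -
  have i1: "integrable lborel (\<lambda>y. gauss_kernel x y t * f y)"
    by (rule integrable_gauss_kernel_mult[OF t _ M]) simp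
  have i2: "integrable lborel (\<lambda>y. gauss_kernel x y t * (e + B * (norm (x - y))\<^sup>2))"
    and v2: "(\<integral>y. gauss_kernel x y t * (e + B * (norm (x - y))\<^sup>2) \<partial>lborel) = e + 4 * t * B"
    using nn_integral_eq_integrable[of "\<lambda>y. gauss_kernel x y t * (e + B * (norm (x - y))\<^sup>2)" lborel "e + 4 * t * B"]
      nn_integral_gauss_kernel[OF t e(2,3), of x] gauss_kernel_nonneg[OF t] e(2,3) t by auto
  have "(\<integral>y. gauss_kernel x y t * f y \<partial>lborel) - f x = (\<integral>y. gauss_kernel x y t * (f y - f x) \<partial>lborel)"
    unfolding right_diff_distrib using i1 integrable_gauss_kernel[OF t, of x] integral_gauss_kernel[OF t, of x]
    by (subst Bochner_Integration.integral_diff) auto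
  also have "\<bar>\<dots>\<bar> \<le> (\<integral>y. gauss_kernel x y t * (e + B * (norm (x - y))\<^sup>2) \<partial>lborel)"
  proof (rule order_trans[OF integral_abs_bound], rule integral_mono)
    show "integrable lborel (\<lambda>y. \<bar>gauss_kernel x y t * (f y - f x)\<bar>)"
      unfolding right_diff_distrib using i1 integrable_gauss_kernel[OF t, of x] by (intro integrable_abs Bochner_Integration.integrable_diff) auto
    show "\<bar>gauss_kernel x y t * (f y - f x)\<bar> \<le> gauss_kernel x y t * (e + B * (norm (x - y))\<^sup>2)" for y
      using gauss_kernel_nonneg[OF t, of x y] e(1)[of y] by (simp add: abs_mult mult_left_mono)
  qed (rule i2)
  finally show ?thesis by (simp add: v2)
qed

text \<open>Half-angle formula: if theta is the angle between x and y, both sides are |x| |y| cos^2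
  (theta / 2).\<close>

lemma hk_arg_sq:
  assumes "x \<in> slit_plane" "y \<in> slit_plane"
  shows "(hk_arg (root_re y) (root_im y) x)\<^sup>2 = (norm x * norm y + x \<bullet> y) / 2"
  unfolding hk_arg_def inner_prod_def norm_eq_root[OF assms(1)] norm_eq_root[OF assms(2)]
    root_re_im[OF assms(1), symmetric] root_re_im[OF assms(2), symmetric] fst_eq_root[OF assms(1)] fst_eq_root[OF assms(2)]
  by (simp add: power2_eq_square field_simps)

text \<open>Cauchy-Schwarz for the two square roots, in the form of Lagrange's identity: inner
  product squared plus cross product squared equals |x| |y|.\<close>

lemma hk_arg_abs_le:
  assumes "x \<in> slit_plane" "y \<in> slit_plane" and b: "b = root_im y \<or> b = - root_im y"
  shows "\<bar>hk_arg (root_re y) b x\<bar> \<le> sqrt (norm x * norm y)"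
proof -
  have "(hk_arg (root_re y) b x)\<^sup>2 + (root_re y * root_im x - b * root_re x)\<^sup>2 = norm x * norm y"
    unfolding hk_arg_def norm_eq_root[OF assms(1)] norm_eq_root[OF assms(2)] using b
    by (auto simp: power2_eq_square algebra_simps)
  then have "(hk_arg (root_re y) b x)\<^sup>2 \<le> norm x * norm y"
    by (metis add.commute le_add_same_cancel2 zero_le_power2)
  then show ?thesis by (simp add: real_le_rsqrt flip: real_sqrt_abs)
qed

lemma hk_arg_flip: "hk_arg a b x - hk_arg a (- b) x = 2 * b * root_im x"
  by (simp add: hk_arg_def)

lemma hk_pre_eq: "y \<in> slit_plane \<Longrightarrow> hk_pre (root_re y) (root_im y) x t = exp (- (norm x + norm y)\<^sup>2 / (4 * t)) / (4 * pi * t)"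
  by (simp add: hk_pre_def norm_eq_root)

lemma slit_kernel_eq:
  "slit_kernel x y t = hk_pre (root_re y) (root_im y) x t *
     (sommerfeld (hk_arg (root_re y) (root_im y) x / sqrt t) - sommerfeld (hk_arg (root_re y) (- root_im y) x / sqrt t))"
  by (simp add: slit_kernel_def hk_term_def hk_pre_def right_diff_distrib)

lemma hk_pre_nonneg: "0 < t \<Longrightarrow> 0 \<le> hk_pre a b x t"
  by (simp add: hk_pre_def)

lemma slit_kernel_nonneg:
  assumes "0 < t" shows "0 \<le> slit_kernel x y t"
  unfolding slit_kernel_eq
proof (intro mult_nonneg_nonneg hk_pre_nonneg)
  have "hk_arg (root_re y) (- root_im y) x \<le> hk_arg (root_re y) (root_im y) x"
    using hk_arg_flip[of "root_re y" "root_im y" x] mult_nonneg_nonneg[OF root_im_nonneg[of y] root_im_nonneg[of x]]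
    by linarith
  then show "0 \<le> sommerfeld (hk_arg (root_re y) (root_im y) x / sqrt t) - sommerfeld (hk_arg (root_re y) (- root_im y) x / sqrt t)"
    using assms by (simp add: sommerfeld_mono divide_right_mono)
qed fact

text \<open>By \<open>hk_arg_sq\<close> the free Gaussian is \<open>hk_pre\<close> times exp of the
  squared argument, and \<open>sommerfeld_add_minus\<close> splits that exponential. The kernel
  removes one half and what is left is manifestly nonnegative.\<close>

lemma gauss_kernel_minus_slit_kernel:
  assumes x: "x \<in> slit_plane" and y: "y \<in> slit_plane" and t: "0 < t"
  shows "gauss_kernel x y t - slit_kernel x y t = hk_pre (root_re y) (root_im y) x t *
     (sommerfeld (- (hk_arg (root_re y) (root_im y) x / sqrt t)) + sommerfeld (hk_arg (root_re y) (- root_im y) x / sqrt t))"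
proof -
  let ?s = "hk_arg (root_re y) (root_im y) x"
  have "gauss_kernel x y t = hk_pre (root_re y) (root_im y) x t * exp ((?s / sqrt t)\<^sup>2)"
  proof -
    have "- (norm (x - y))\<^sup>2 = - (norm x + norm y)\<^sup>2 + 4 * ?s\<^sup>2"
    proof -
      have "(norm (x - y))\<^sup>2 = (norm x)\<^sup>2 - 2 * (x \<bullet> y) + (norm y)\<^sup>2"
        by (simp add: power2_norm_eq_inner inner_diff inner_commute)
      then show ?thesis unfolding hk_arg_sq[OF x y] power2_sum by (simp add: field_simps)
    qed
    then have "- (norm (x - y))\<^sup>2 / (4 * t) = - (norm x + norm y)\<^sup>2 / (4 * t) + (?s / sqrt t)\<^sup>2"
      using t by (simp add: power_divide add_divide_distrib diff_divide_distrib)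
    then show ?thesis
      unfolding gauss_kernel_def hk_pre_eq[OF y] by (simp only: exp_add) simp
  qed
  then show ?thesis
    unfolding slit_kernel_eq sommerfeld_add_minus[symmetric] by (simp add: algebra_simps)
qed

text \<open>Put q = sqrt (|x| |y|) and k = \<open>root_im x * root_im y\<close>. The prefactor is at
  most exp (-q^2 / t), since 2 q \<le> |x| + |y|. An argument that stays 2 k below its extreme value
  q costs at most exp (s^2 / t), and s^2 \<le> (q - 2 k)^2 \<le> q^2 - k^2 when s is
  positive.\<close>

lemma sommerfeld_pre_bound:
  assumes x: "x \<in> slit_plane" and y: "y \<in> slit_plane" and t: "0 < t"
    and s: "s \<le> sqrt (norm x * norm y) - 2 * (root_im x * root_im y)"
  shows "exp (- (norm x + norm y)\<^sup>2 / (4 * t)) * sommerfeld (s / sqrt t) \<le> exp (- (root_im x * root_im y)\<^sup>2 / t)"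
proof -
  define q where "q = sqrt (norm x * norm y)"
  define k where "k = root_im x * root_im y"
  have k: "0 \<le> k" "k \<le> q"
    unfolding k_def q_def real_sqrt_mult by (auto intro!: mult_mono root_im_le)
  have "4 * q\<^sup>2 \<le> (norm x + norm y)\<^sup>2"
    using sum_squares_bound[of "norm x" "norm y"] by (simp add: q_def power2_sum)
  then have 1: "- (norm x + norm y)\<^sup>2 / (4 * t) \<le> - q\<^sup>2 / t"
    using t by (simp add: field_simps)
  show ?thesis
  proof (cases "s \<le> 0")
    case True
    have "exp (- (norm x + norm y)\<^sup>2 / (4 * t)) * sommerfeld (s / sqrt t) \<le> exp (- q\<^sup>2 / t) * 1"
      using True t 1 by (intro mult_mono sommerfeld_le_1 sommerfeld_nonneg) (auto simp: divide_le_0_iff)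
    also have "\<dots> \<le> exp (- k\<^sup>2 / t)"
      using k t by (auto intro!: divide_right_mono power_mono)
    finally show ?thesis by (simp add: k_def)
  next
    case False
    have "s\<^sup>2 \<le> (q - 2 * k)\<^sup>2" using False s by (intro power_mono) (auto simp: q_def k_def)
    also have "(q - 2 * k)\<^sup>2 \<le> q\<^sup>2 - k\<^sup>2"
    proof -
      have "q\<^sup>2 - k\<^sup>2 - (q - 2 * k)\<^sup>2 = k * (4 * q - 5 * k)" by (simp add: power2_eq_square algebra_simps)
      moreover have "2 * k \<le> q" using False s by (simp add: q_def k_def)
      then have "0 \<le> k * (4 * q - 5 * k)" using k by (intro mult_nonneg_nonneg) auto
      ultimately show ?thesis by simp
    qed
    finally have s2: "s\<^sup>2 \<le> q\<^sup>2 - k\<^sup>2" .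
    have "exp (- (norm x + norm y)\<^sup>2 / (4 * t)) * sommerfeld (s / sqrt t) \<le> exp (- q\<^sup>2 / t) * exp ((s / sqrt t)\<^sup>2)"
      using 1 by (intro mult_mono sommerfeld_le_exp sommerfeld_nonneg) auto
    also have "\<dots> = exp ((s\<^sup>2 - q\<^sup>2) / t)"
      using t by (simp add: power_divide exp_add[symmetric] diff_divide_distrib)
    also have "\<dots> \<le> exp (- k\<^sup>2 / t)"
      using s2 t divide_right_mono[of "s\<^sup>2 - q\<^sup>2" "- k\<^sup>2" t] by simp
    finally show ?thesis by (simp add: k_def)
  qed
qed

text \<open>Direct and reflected argument differ by exactly 2 \<open>root_im x * root_im y\<close>,
  and both are at most sqrt (|x| |y|) in absolute value. So both \<open>sommerfeld\<close> arguments
  of \<open>gauss_kernel_minus_slit_kernel\<close> stay below the extreme value by that amount, and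
  at points off the slit the boundary is felt only exponentially little as t tends to 0.\<close>

lemma
  assumes x: "x \<in> slit_plane" and y: "y \<in> slit_plane" and t: "0 < t"
  shows slit_kernel_le_gauss_kernel: "slit_kernel x y t \<le> gauss_kernel x y t"
    and gauss_kernel_minus_slit_kernel_le:
      "gauss_kernel x y t - slit_kernel x y t \<le> exp (- (root_im x * root_im y)\<^sup>2 / t) / (2 * pi * t)"
proof -
  let ?p = "hk_arg (root_re y) (root_im y) x" and ?m = "hk_arg (root_re y) (- root_im y) x"
  show "slit_kernel x y t \<le> gauss_kernel x y t"
    using gauss_kernel_minus_slit_kernel[OF x y t]
      mult_nonneg_nonneg[OF hk_pre_nonneg[OF t, of "root_re y" "root_im y" x]
        add_nonneg_nonneg[OF sommerfeld_nonneg[of "- (?p / sqrt t)"] sommerfeld_nonneg[of "?m / sqrt t"]]]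
    by linarith
  have pm: "?p - ?m = 2 * (root_im x * root_im y)" by (simp add: hk_arg_flip)
  have "- ?p \<le> sqrt (norm x * norm y) - 2 * (root_im x * root_im y)"
    using hk_arg_abs_le[OF x y, of "- root_im y"] pm by simp
  from sommerfeld_pre_bound[OF x y t this]
  have 1: "exp (- (norm x + norm y)\<^sup>2 / (4 * t)) * sommerfeld (- (?p / sqrt t)) \<le> exp (- (root_im x * root_im y)\<^sup>2 / t)"
    by simp
  have "?m \<le> sqrt (norm x * norm y) - 2 * (root_im x * root_im y)"
    using hk_arg_abs_le[OF x y, of "root_im y"] pm by simp
  from sommerfeld_pre_bound[OF x y t this] 1
  have "exp (- (norm x + norm y)\<^sup>2 / (4 * t)) * (sommerfeld (- (?p / sqrt t)) + sommerfeld (?m / sqrt t))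
     \<le> 2 * exp (- (root_im x * root_im y)\<^sup>2 / t)"
    by (simp add: distrib_left)
  then have "exp (- (norm x + norm y)\<^sup>2 / (4 * t)) * (sommerfeld (- (?p / sqrt t)) + sommerfeld (?m / sqrt t)) / (4 * pi * t)
     \<le> 2 * exp (- (root_im x * root_im y)\<^sup>2 / t) / (4 * pi * t)"
    using t by (intro divide_right_mono) auto
  then show "gauss_kernel x y t - slit_kernel x y t \<le> exp (- (root_im x * root_im y)\<^sup>2 / t) / (2 * pi * t)"
    unfolding gauss_kernel_minus_slit_kernel[OF x y t] hk_pre_eq[OF y] by simp
qed

text \<open>The two arguments differ by a multiple of \<open>root_im x\<close>, which is 0 on the
  slit, and \<open>sommerfeld_diff_le\<close> turns this into a linear bound. The bound is uniform
  for x bounded and t away from 0, as the compactness argument in \<open>semigroup_vanishes\<close>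
  requires.\<close>

lemma slit_kernel_boundary_bound:
  assumes x: "x \<in> slit_plane" and y: "y \<in> slit_plane" and t: "0 < t"
  shows "slit_kernel x y t \<le> root_im x * root_im y * (2 * sqrt (norm x * norm y / t) + 1) / (2 * pi * t * sqrt t)"
proof -
  define q where "q = sqrt (norm x * norm y / t)"
  let ?p = "hk_arg (root_re y) (root_im y) x" and ?m = "hk_arg (root_re y) (- root_im y) x"
  have pm: "?p - ?m = 2 * (root_im x * root_im y)" by (simp add: hk_arg_flip)
  have q: "\<bar>?p / sqrt t\<bar> \<le> q" "\<bar>?m / sqrt t\<bar> \<le> q"
    unfolding q_def real_sqrt_divide abs_divide using t hk_arg_abs_le[OF x y]
    by (auto intro!: divide_right_mono)
  have gen: "E / (4 * pi * t) * (2 * k / w * z * X) = (E * X) * (k * z / (2 * pi * t * w))" for E k w z X :: real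
    using t by (cases "w = 0") (auto simp: field_simps)
  have q2: "q\<^sup>2 = norm x * norm y / t" using t by (simp add: q_def)
  have mp: "?m / sqrt t \<le> ?p / sqrt t"
    using pm t mult_nonneg_nonneg[OF root_im_nonneg[of x] root_im_nonneg[of y]]
    by (intro divide_right_mono) (linarith, simp)
  have "sommerfeld (?p / sqrt t) - sommerfeld (?m / sqrt t) \<le> (?p / sqrt t - ?m / sqrt t) * (2 * q + 1) * exp (q\<^sup>2)"
    by (rule sommerfeld_diff_le[OF mp q])
  also have "?p / sqrt t - ?m / sqrt t = 2 * (root_im x * root_im y) / sqrt t"
    by (simp add: diff_divide_distrib[symmetric] pm)
  finally have "slit_kernel x y t \<le> hk_pre (root_re y) (root_im y) x t * (2 * (root_im x * root_im y) / sqrt t * (2 * q + 1) * exp (q\<^sup>2))"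
    unfolding slit_kernel_eq by (intro mult_left_mono hk_pre_nonneg t)
  also have "\<dots> = (exp (- (norm x + norm y)\<^sup>2 / (4 * t)) * exp (q\<^sup>2)) * (root_im x * root_im y * (2 * q + 1) / (2 * pi * t * sqrt t))"
    unfolding hk_pre_eq[OF y] by (rule gen)
  also have "\<dots> \<le> 1 * (root_im x * root_im y * (2 * q + 1) / (2 * pi * t * sqrt t))"
  proof (intro mult_right_mono)
    have "4 * (norm x * norm y) \<le> (norm x + norm y)\<^sup>2"
      using sum_squares_bound[of "norm x" "norm y"] by (simp add: power2_sum)
    then have "- (norm x + norm y)\<^sup>2 / (4 * t) + q\<^sup>2 \<le> 0"
      unfolding q2 using t by (simp add: field_simps)
    then show "exp (- (norm x + norm y)\<^sup>2 / (4 * t)) * exp (q\<^sup>2) \<le> 1"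
      by (simp add: exp_add[symmetric])
    show "0 \<le> root_im x * root_im y * (2 * q + 1) / (2 * pi * t * sqrt t)"
      using t by (intro divide_nonneg_nonneg mult_nonneg_nonneg) (auto simp: q_def)
  qed
  finally show ?thesis by (simp add: q_def)
qed

lemma frontier_slit_plane: "frontier slit_plane \<subseteq> half_line"
proof -
  have "frontier slit_plane \<subseteq> - slit_plane"
    unfolding frontier_def interior_open[OF open_slit_plane] by auto
  then show ?thesis by auto
qed

lemma slit_kernel_boundary:
  assumes y: "y \<in> slit_plane" and t: "0 < t" and z: "z \<in> half_line"
  shows "((\<lambda>x. slit_kernel x y t) \<longlongrightarrow> 0) (at z within slit_plane)"
proof -
  let ?b = "\<lambda>x. root_im x * root_im y * (2 * sqrt (norm x * norm y / t) + 1) / (2 * pi * t * sqrt t)"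
  have "continuous_on UNIV ?b"
    using t by (intro continuous_intros) auto
  then have "isCont ?b z"
    by (rule continuous_on_interior) simp
  then have "(?b \<longlongrightarrow> ?b z) (at z)"
    by (rule isContD)
  moreover have "?b z = 0" using z by (simp add: root_im_eq_0_iff)
  ultimately have "(?b \<longlongrightarrow> 0) (at z)" by simp
  then have "(?b \<longlongrightarrow> 0) (at z within slit_plane)"
    by (rule tendsto_within_subset) simp
  moreover have "\<forall>\<^sub>F x in at z within slit_plane. 0 \<le> slit_kernel x y t"
    using slit_kernel_nonneg[OF t] by simp
  moreover have "\<forall>\<^sub>F x in at z within slit_plane. slit_kernel x y t \<le> ?b x"
    unfolding eventually_at_filter using slit_kernel_boundary_bound[OF _ y t] by (intro always_eventually) auto
  ultimately show ?thesis
    using tendsto_sandwich[of "\<lambda>_. 0" "\<lambda>x. slit_kernel x y t" "at z within slit_plane" ?b 0] by simp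
qed

text \<open>From u^2 / 2 \<le> exp u: two powers of t are gained, one of them pays for the prefactor
  1 / t, and the remaining one makes the difference tend to 0.\<close>

lemma gauss_kernel_minus_slit_kernel_le':
  assumes x: "x \<in> slit_plane" and y: "y \<in> slit_plane" and t: "0 < t"
  shows "gauss_kernel x y t - slit_kernel x y t \<le> t / (pi * (root_im x * root_im y) ^ 4)"
proof -
  define k where "k = (root_im x * root_im y)\<^sup>2"
  have k: "k > 0" using root_im_pos[OF x] root_im_pos[OF y] by (simp add: k_def)
  have "(k / t)\<^sup>2 / 2 \<le> exp (k / t)"
    using exp_lower_Taylor_quadratic[of "k / t"] divide_pos_pos[OF k t] by simp
  then have "exp (- k / t) \<le> 2 * t\<^sup>2 / k\<^sup>2"
    using k t by (simp add: exp_minus field_simps)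
  then have "exp (- k / t) / (2 * pi * t) \<le> 2 * t\<^sup>2 / k\<^sup>2 / (2 * pi * t)"
    using t by (intro divide_right_mono) auto
  also have "\<dots> = t / (pi * k\<^sup>2)" using t by (simp add: power2_eq_square)
  finally show ?thesis
    using gauss_kernel_minus_slit_kernel_le[OF x y t] by (simp add: k_def)
qed

lemma borel_measurable_slit_kernel [measurable]: "(\<lambda>x. slit_kernel x y t) \<in> borel_measurable borel"
  unfolding slit_kernel_eq hk_arg_def hk_pre_def by measurable

text \<open>The Gaussian is an approximate identity, and on the compact support of the test function
  the kernel differs from it by O(t) uniformly.\<close>

lemma initial_delta_slit_kernel:
  assumes y: "y \<in> slit_plane"
  shows "initial_delta_on slit_plane y (\<lambda>x t. slit_kernel x y t)"
  unfolding initial_delta_on_def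
proof (intro allI impI)
  fix f :: "real \<times> real \<Rightarrow> real"
  assume "continuous_on UNIV f \<and> (\<exists>K. compact K \<and> K \<subseteq> slit_plane \<and> (\<forall>x. x \<notin> K \<longrightarrow> f x = 0))"
  then obtain K where f: "continuous_on UNIV f" and K: "compact K" "K \<subseteq> slit_plane" and f0: "\<And>x. x \<notin> K \<Longrightarrow> f x = 0"
    by blast
  have fm[measurable]: "f \<in> borel_measurable borel" using f by (rule borel_measurable_continuous_onI)
  have Km[measurable]: "K \<in> sets borel" using K by (simp add: compact_imp_closed)
  have "bounded (f ` K)"
    using K f by (intro compact_imp_bounded compact_continuous_image) (auto intro: continuous_on_subset)
  then obtain M where M: "M > 0" "\<And>x. x \<in> K \<Longrightarrow> \<bar>f x\<bar> \<le> M" unfolding bounded_pos by auto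
  have M': "\<bar>f x\<bar> \<le> M" for x using M f0[of x] by (cases "x \<in> K") auto
  \<comment> \<open>A continuous positive function on the compact support has a positive lower
    bound; this is where the support has to avoid the slit.\<close>
  obtain c where c: "c > 0" "\<And>x. x \<in> K \<Longrightarrow> c \<le> root_im x * root_im y"
  proof (cases "K = {}")
    case False
    have "continuous_on K (\<lambda>x. root_im x * root_im y)" by (intro continuous_intros)
    from continuous_attains_inf[OF K(1) False this] obtain z where z: "z \<in> K" "\<And>x. x \<in> K \<Longrightarrow> root_im z * root_im y \<le> root_im x * root_im y" by blast
    have "z \<in> slit_plane" using z K by auto
    then have "0 < root_im z * root_im y" using root_im_pos y by simp
    then show ?thesis using that z by blast
  qed (use that[of 1] in auto)
  have Kfin: "emeasure lborel K < \<infinity>" using K(1) by (rule emeasure_compact_finite)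
  define C where "C = M * measure lborel K / (pi * c ^ 4)"
  have main: "\<bar>(LINT x:slit_plane|lborel. slit_kernel x y t * f x) - f y\<bar> \<le> e + 4 * t * B + t * C"
    if t: "t > 0" and e: "\<And>z. \<bar>f z - f y\<bar> \<le> e + B * (norm (y - z))\<^sup>2" "0 \<le> e" "0 \<le> B" for t e B
  proof -
    let ?g = "\<lambda>x. indicator K x * ((gauss_kernel x y t - slit_kernel x y t) * f x)"
    have E1: "(LINT x:slit_plane|lborel. slit_kernel x y t * f x) = (\<integral>x. gauss_kernel y x t * f x - ?g x \<partial>lborel)"
      unfolding set_lebesgue_integral_def using f0 K(2)
      by (intro Bochner_Integration.integral_cong) (auto simp: indicator_def gauss_kernel_sym[of y] algebra_simps)
    have ig: "integrable lborel (\<lambda>x. gauss_kernel y x t * f x)"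
      by (rule integrable_gauss_kernel_mult[OF t _ M']) simp
    have gb: "\<bar>?g x\<bar> \<le> indicator K x * (t / (pi * c ^ 4) * M)" for x
    proof (cases "x \<in> K")
      case True
      then have x: "x \<in> slit_plane" using K by auto
      have "\<bar>gauss_kernel x y t - slit_kernel x y t\<bar> \<le> t / (pi * (root_im x * root_im y) ^ 4)"
        using gauss_kernel_minus_slit_kernel_le'[OF x y t] slit_kernel_le_gauss_kernel[OF x y t] by simp
      also have "\<dots> \<le> t / (pi * c ^ 4)"
        using c(1) c(2)[OF True] t by (intro divide_left_mono mult_left_mono power_mono mult_pos_pos) (auto intro!: zero_less_power)
      finally have "\<bar>gauss_kernel x y t - slit_kernel x y t\<bar> * \<bar>f x\<bar> \<le> t / (pi * c ^ 4) * M"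
        using M'[of x] c t by (intro mult_mono) auto
      then show ?thesis using True by (simp add: abs_mult)
    qed simp
    have ib: "integrable lborel (\<lambda>x. indicator K x * (t / (pi * c ^ 4) * M))"
      using Kfin by (intro integrable_mult_left) auto
    have ig2: "integrable lborel ?g"
      by (rule Bochner_Integration.integrable_bound[OF ib])
         (measurable, intro AE_I2, unfold real_norm_def, rule order_trans[OF gb abs_ge_self])
    have "\<bar>\<integral>x. ?g x \<partial>lborel\<bar> \<le> (\<integral>x. indicator K x * (t / (pi * c ^ 4) * M) \<partial>lborel)"
      by (rule order_trans[OF integral_abs_bound], rule integral_mono[OF integrable_abs[OF ig2] ib gb])
    also have "\<dots> = t * C" by (simp add: C_def)
    finally have "\<bar>\<integral>x. ?g x \<partial>lborel\<bar> \<le> t * C" .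
    moreover note E1
    moreover have "(\<integral>x. gauss_kernel y x t * f x - ?g x \<partial>lborel) = (\<integral>x. gauss_kernel y x t * f x \<partial>lborel) - (\<integral>x. ?g x \<partial>lborel)"
      by (rule Bochner_Integration.integral_diff[OF ig ig2])
    moreover have "\<bar>(\<integral>x. gauss_kernel y x t * f x \<partial>lborel) - f y\<bar> \<le> e + 4 * t * B"
      by (rule gauss_kernel_approx[OF t fm M' e])
    ultimately show ?thesis by linarith
  qed
  show "((\<lambda>t. LINT x:slit_plane|lborel. slit_kernel x y t * f x) \<longlongrightarrow> f y) (at_right 0)"
  proof (rule tendstoI)
    fix e :: real assume e: "e > 0"
    have "isCont f y" using f by (rule continuous_on_interior) simp
    from this[unfolded continuous_at_eps_delta, rule_format, of "e / 2"] e
    obtain d where d: "d > 0" "\<And>z. dist z y < d \<Longrightarrow> dist (f z) (f y) < e / 2"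
      by auto
    \<comment> \<open>With this \<open>B\<close> the quadratic term is at least 2 M outside the ball
      of radius \<open>d\<close>, which exceeds any possible difference of values of
      \<open>f\<close>.\<close>
    define B where "B = 2 * M / d\<^sup>2"
    have B: "0 \<le> B" using M d by (simp add: B_def)
    have fB: "\<bar>f z - f y\<bar> \<le> e / 2 + B * (norm (y - z))\<^sup>2" for z
    proof (cases "dist z y < d")
      case True
      moreover have "0 \<le> B * (norm (y - z))\<^sup>2" using B by simp
      ultimately show ?thesis using d(2)[OF True] unfolding dist_real_def by linarith
    next
      case False
      then have "d\<^sup>2 \<le> (norm (y - z))\<^sup>2" using d by (intro power_mono) (auto simp: dist_norm norm_minus_commute)
      then have "B * d\<^sup>2 \<le> B * (norm (y - z))\<^sup>2" using B by (intro mult_left_mono)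
      moreover have "B * d\<^sup>2 = 2 * M" using d by (simp add: B_def)
      ultimately show ?thesis using M'[of z] M'[of y] e by linarith
    qed
    have "((\<lambda>t. e / 2 + 4 * t * B + t * C) \<longlongrightarrow> e / 2 + 4 * 0 * B + 0 * C) (at_right 0)"
      by (intro tendsto_intros)
    then have "\<forall>\<^sub>F t in at_right 0. e / 2 + 4 * t * B + t * C < e"
      by (rule order_tendstoD(2)) (use e in simp)
    then show "\<forall>\<^sub>F t in at_right 0. dist (LINT x:slit_plane|lborel. slit_kernel x y t * f x) (f y) < e"
      using eventually_at_right_less[of "0::real"]
    proof eventually_elim
      case (elim t)
      then show ?case using main[OF elim(2) fB _ B] e by (simp add: dist_real_def)
    qed
  qed
qed

lemma dirichlet_fundamental_solution_slit_kernel: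
  assumes "y \<in> slit_plane"
  shows "dirichlet_fundamental_solution slit_plane y (\<lambda>x t. slit_kernel x y t)"
  unfolding dirichlet_fundamental_solution_def
  using assms frontier_slit_plane
  by (auto intro!: slit_kernel_nonneg heat_equation_slit_kernel slit_kernel_boundary initial_delta_slit_kernel)

subsection \<open>Maximum principle and minimality\<close>

text \<open>If l were positive, the first derivative would be positive just to the right of 0, and
  the mean value theorem would produce a larger value there.\<close>

lemma second_derivative_local_max:
  fixes f :: "real \<Rightarrow> real"
  assumes d: "d > 0" and f': "\<And>s. \<bar>s\<bar> < d \<Longrightarrow> (f has_real_derivative f' s) (at s)"
    and f'': "(f' has_real_derivative l) (at 0)" and max: "\<And>s. \<bar>s\<bar> < d \<Longrightarrow> f s \<le> f 0"
  shows "l \<le> 0"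
proof (rule ccontr)
  assume "\<not> l \<le> 0"
  then have "l > 0" by simp
  have f0: "f' 0 = 0"
    using DERIV_local_max[OF f'[of 0] d] d max by simp
  obtain k where k: "k > 0" "\<And>h. h > 0 \<Longrightarrow> h < k \<Longrightarrow> f' 0 < f' (0 + h)"
    using DERIV_pos_inc_right[OF f'' \<open>l > 0\<close>] by blast
  define h where "h = min k d / 2"
  have h: "0 < h" "h < k" "h < d" using k d by (auto simp: h_def)
  obtain z where z: "0 < z" "z < h" "f h - f 0 = (h - 0) * f' z"
    using MVT2[OF h(1), of f f'] f' h by force
  have "f' z > 0" using k(2)[of z] z h f0 by simp
  then have "f h > f 0" using z h by (metis diff_gt_0_iff_gt diff_zero mult_pos_pos)
  then show False using max[of h] h by simp
qed

text \<open>The witness part of \<open>heat_equation_on\<close>, split off so that the chosen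
  derivatives can be named and combined.\<close>

definition heat_derivatives where
  "heat_derivatives D u ut ux uxx \<longleftrightarrow>
        continuous_on (D \<times> {0<..}) (\<lambda>(x, t). ut x t) \<and>
        (\<forall>b\<in>Basis. continuous_on (D \<times> {0<..}) (\<lambda>(x, t). ux b x t)) \<and>
        (\<forall>b\<in>Basis. continuous_on (D \<times> {0<..}) (\<lambda>(x, t). uxx b x t)) \<and>
        (\<forall>x\<in>D. \<forall>t>0.
           ((\<lambda>s. u x s) has_real_derivative ut x t) (at t) \<and>
           (\<forall>b\<in>Basis.
              ((\<lambda>s. u (x + s *\<^sub>R b) t) has_real_derivative ux b x t) (at 0) \<and>
              ((\<lambda>s. ux b (x + s *\<^sub>R b) t) has_real_derivative uxx b x t) (at 0)) \<and>
           (\<Sum>b\<in>Basis. uxx b x t) = ut x t)"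

lemma heat_equation_on_iff:
  "heat_equation_on D u \<longleftrightarrow> continuous_on (D \<times> {0<..}) (\<lambda>(x, t). u x t) \<and> (\<exists>ut ux uxx. heat_derivatives D u ut ux uxx)"
  by (simp only: heat_equation_on_def heat_derivatives_def)

lemma heat_derivativesD:
  assumes "heat_derivatives D u ut ux uxx"
  shows "continuous_on (D \<times> {0<..}) (\<lambda>(x, t). ut x t)"
      "\<And>b. b \<in> Basis \<Longrightarrow> continuous_on (D \<times> {0<..}) (\<lambda>(x, t). ux b x t)"
      "\<And>b. b \<in> Basis \<Longrightarrow> continuous_on (D \<times> {0<..}) (\<lambda>(x, t). uxx b x t)"
      "\<And>x t. x \<in> D \<Longrightarrow> t > 0 \<Longrightarrow> ((\<lambda>s. u x s) has_real_derivative ut x t) (at t)"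
      "\<And>x t b. x \<in> D \<Longrightarrow> t > 0 \<Longrightarrow> b \<in> Basis \<Longrightarrow> ((\<lambda>s. u (x + s *\<^sub>R b) t) has_real_derivative ux b x t) (at 0)"
      "\<And>x t b. x \<in> D \<Longrightarrow> t > 0 \<Longrightarrow> b \<in> Basis \<Longrightarrow> ((\<lambda>s. ux b (x + s *\<^sub>R b) t) has_real_derivative uxx b x t) (at 0)"
      "\<And>x t. x \<in> D \<Longrightarrow> t > 0 \<Longrightarrow> (\<Sum>b\<in>Basis. uxx b x t) = ut x t"
  using assms by (simp_all only: heat_derivatives_def)

text \<open>The hypothesis on superlevel sets stands for nonpositive limits at the initial time, on
  the boundary of D and at infinity all at once: a positive value would have to be attained in a
  compact part of the interior. There a maximum of u minus a small multiple of time contradicts the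
  heat equation.\<close>

lemma heat_max_principle:
  fixes u :: "'a::euclidean_space \<Rightarrow> real \<Rightarrow> real"
  assumes D: "open D" and heat: "heat_equation_on D u"
    and K: "\<And>e. e > 0 \<Longrightarrow> \<exists>K \<delta>. compact K \<and> K \<subseteq> D \<and> 0 < \<delta> \<and>
       (\<forall>x\<in>D. \<forall>t. 0 < t \<and> t \<le> T \<and> e \<le> u x t \<longrightarrow> x \<in> K \<and> \<delta> \<le> t)"
    and x: "x \<in> D" and t: "0 < t" "t \<le> T"
  shows "u x t \<le> 0"
proof (rule ccontr)
  assume "\<not> u x t \<le> 0"
  then have pos: "u x t > 0" by simp
  have T: "T > 0" using t by simp
  \<comment> \<open>Half the positive value spread over the time span, so that subtracting
    \<open>\<kappa> * t\<close> leaves at least half of it.\<close>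
  define \<kappa> where "\<kappa> = u x t / (2 * T)"
  have \<kappa>: "\<kappa> > 0" using pos T by (simp add: \<kappa>_def)
  define v where "v y s = u y s - \<kappa> * s" for y s
  define e where "e = u x t / 2"
  have e: "e > 0" using pos by (simp add: e_def)
  have "\<kappa> * t \<le> \<kappa> * T" using t \<kappa> by (intro mult_left_mono) auto
  then have vx: "v x t \<ge> e" using T by (simp add: v_def e_def \<kappa>_def)
  obtain K \<delta> where K: "compact K" "K \<subseteq> D" "0 < \<delta>"
    and Kd: "\<And>y s. y \<in> D \<Longrightarrow> 0 < s \<Longrightarrow> s \<le> T \<Longrightarrow> e \<le> u y s \<Longrightarrow> y \<in> K \<and> \<delta> \<le> s"
    using K[OF e] by blast
  have Kv: "y \<in> K \<and> s \<in> {\<delta>..T}" if "y \<in> D" "0 < s" "s \<le> T" "e \<le> v y s" for y s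
  proof -
    have "0 \<le> \<kappa> * s" using that \<kappa> by simp
    then have "e \<le> u y s" using that(4) unfolding v_def by linarith
    then show ?thesis using Kd[OF that(1-3)] that by auto
  qed
  have cont: "continuous_on (K \<times> {\<delta>..T}) (\<lambda>p. v (fst p) (snd p))"
  proof -
    have "continuous_on (D \<times> {0<..}) (\<lambda>p. u (fst p) (snd p))"
      using heat by (simp add: heat_equation_on_def case_prod_beta)
    then have "continuous_on (K \<times> {\<delta>..T}) (\<lambda>p. u (fst p) (snd p))"
      by (rule continuous_on_subset) (use K in auto)
    then show ?thesis unfolding v_def by (intro continuous_intros)
  qed
  have ne: "K \<times> {\<delta>..T} \<noteq> {}" using Kv[OF x t vx] by auto
  have "compact (K \<times> {\<delta>..T})" using K by (intro compact_Times) auto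
  from continuous_attains_sup[OF this ne cont] obtain x1 t1
    where 1: "x1 \<in> K" "\<delta> \<le> t1" "t1 \<le> T" and m: "\<And>y s. y \<in> K \<Longrightarrow> s \<in> {\<delta>..T} \<Longrightarrow> v y s \<le> v x1 t1"
    by auto
  have max: "v y s \<le> v x1 t1" if "y \<in> D" "0 < s" "s \<le> T" for y s
  proof (cases "e \<le> v y s")
    case True then show ?thesis using Kv[OF that True] m by auto
  next
    case False
    moreover have "e \<le> v x1 t1" using vx m[of x t] Kv[OF x t vx] by auto
    ultimately show ?thesis by simp
  qed
  have x1: "x1 \<in> D" and t1: "t1 > 0" using 1 K by auto
  from heat[unfolded heat_equation_on_iff] obtain ut ux uxx where H: "heat_derivatives D u ut ux uxx" by blast
  note ut = heat_derivativesD(4)[OF H] and ux = heat_derivativesD(5)[OF H]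
    and uxx = heat_derivativesD(6)[OF H] and eq = heat_derivativesD(7)[OF H]
  \<comment> \<open>The maximum is compared with earlier times only, so it may sit at the final time
    T.\<close>
  have "ut x1 t1 \<ge> \<kappa>"
  proof (rule ccontr)
    assume "\<not> ut x1 t1 \<ge> \<kappa>"
    moreover have "((\<lambda>s. v x1 s) has_real_derivative ut x1 t1 - \<kappa>) (at t1)"
      unfolding v_def using ut[OF x1 t1] by (auto intro!: derivative_eq_intros)
    ultimately obtain d where d: "d > 0" "\<And>h. h > 0 \<Longrightarrow> h < d \<Longrightarrow> v x1 t1 < v x1 (t1 - h)"
      using DERIV_neg_dec_left[of "\<lambda>s. v x1 s" "ut x1 t1 - \<kappa>" t1] by auto
    define h where "h = min d t1 / 2"
    have "0 < h" "h < d" "h < t1" using d t1 by (auto simp: h_def)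
    then show False using d(2)[of h] max[OF x1, of "t1 - h"] 1 by auto
  qed
  moreover have "uxx b x1 t1 \<le> 0" if b: "b \<in> Basis" for b
  proof -
    obtain d where d: "d > 0" "ball x1 d \<subseteq> D" using D x1 by (auto simp: open_contains_ball)
    have inD: "x1 + s *\<^sub>R b \<in> D" if "\<bar>s\<bar> < d" for s
      using that d b by (auto simp: dist_norm intro!: subsetD[OF d(2)])
    show ?thesis
    proof (rule second_derivative_local_max[OF d(1), of "\<lambda>s. u (x1 + s *\<^sub>R b) t1" "\<lambda>s. ux b (x1 + s *\<^sub>R b) t1"])
      show "((\<lambda>s. ux b (x1 + s *\<^sub>R b) t1) has_real_derivative uxx b x1 t1) (at 0)"
        by (rule uxx[OF x1 t1 b])
      fix s assume s: "\<bar>s\<bar> < d"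
      have "((\<lambda>r. u ((x1 + s *\<^sub>R b) + r *\<^sub>R b) t1) has_real_derivative ux b (x1 + s *\<^sub>R b) t1) (at 0)"
        by (rule ux[OF inD[OF s] t1 b])
      then have "((\<lambda>r. u (x1 + (r + s) *\<^sub>R b) t1) has_real_derivative ux b (x1 + s *\<^sub>R b) t1) (at 0)"
        by (simp add: algebra_simps)
      then show "((\<lambda>s. u (x1 + s *\<^sub>R b) t1) has_real_derivative ux b (x1 + s *\<^sub>R b) t1) (at s)"
        using DERIV_shift[of "\<lambda>s. u (x1 + s *\<^sub>R b) t1" "ux b (x1 + s *\<^sub>R b) t1" 0 s] by simp
      show "u (x1 + s *\<^sub>R b) t1 \<le> u (x1 + 0 *\<^sub>R b) t1"
        using max[OF inD[OF s] t1 1(3)] by (simp add: v_def)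
    qed
  qed
  then have "(\<Sum>b\<in>Basis. uxx b x1 t1) \<le> 0" by (intro sum_nonpos) auto
  ultimately show False using eq[OF x1 t1] \<kappa> by simp
qed

lemma heat_equation_on_diff:
  assumes "heat_equation_on D u" "heat_equation_on D v"
  shows "heat_equation_on D (\<lambda>x t. u x t - v x t)"
proof -
  from assms(1)[unfolded heat_equation_on_iff] obtain ut ux uxx where Hu: "heat_derivatives D u ut ux uxx" by blast
  note u = assms(1)[unfolded heat_equation_on_iff, THEN conjunct1] heat_derivativesD[OF Hu]
  from assms(2)[unfolded heat_equation_on_iff] obtain vt vx vxx where Hv: "heat_derivatives D v vt vx vxx" by blast
  note v = assms(2)[unfolded heat_equation_on_iff, THEN conjunct1] heat_derivativesD[OF Hv]
  show ?thesis
    unfolding heat_equation_on_def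
  proof (rule conjI; (rule exI[of _ "\<lambda>x t. ut x t - vt x t"], rule exI[of _ "\<lambda>b x t. ux b x t - vx b x t"],
      rule exI[of _ "\<lambda>b x t. uxx b x t - vxx b x t"], intro conjI ballI allI impI)?)
    have cont: "continuous_on (D \<times> {0<..}) (\<lambda>(x, t). f x t - g x t)"
      if "continuous_on (D \<times> {0<..}) (\<lambda>(x, t). f x t)" "continuous_on (D \<times> {0<..}) (\<lambda>(x, t). g x t)"
      for f g :: "'a \<Rightarrow> real \<Rightarrow> real"
      using continuous_on_diff[OF that] by (simp add: case_prod_beta)
    show "continuous_on (D \<times> {0<..}) (\<lambda>(x, t). u x t - v x t)" by (rule cont[OF u(1) v(1)])
    show "continuous_on (D \<times> {0<..}) (\<lambda>(x, t). ut x t - vt x t)" by (rule cont[OF u(2) v(2)])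
    show "continuous_on (D \<times> {0<..}) (\<lambda>(x, t). ux b x t - vx b x t)" if "b \<in> Basis" for b
      by (rule cont[OF u(3)[OF that] v(3)[OF that]])
    show "continuous_on (D \<times> {0<..}) (\<lambda>(x, t). uxx b x t - vxx b x t)" if "b \<in> Basis" for b
      by (rule cont[OF u(4)[OF that] v(4)[OF that]])
    fix x and t :: real assume xt: "x \<in> D" "0 < t"
    show "((\<lambda>s. u x s - v x s) has_real_derivative ut x t - vt x t) (at t)"
      by (rule DERIV_diff[OF u(5)[OF xt] v(5)[OF xt]])
    show "((\<lambda>s. u (x + s *\<^sub>R b) t - v (x + s *\<^sub>R b) t) has_real_derivative ux b x t - vx b x t) (at 0)" if "b \<in> Basis" for b
      by (rule DERIV_diff[OF u(6)[OF xt that] v(6)[OF xt that]])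
    show "((\<lambda>s. ux b (x + s *\<^sub>R b) t - vx b (x + s *\<^sub>R b) t) has_real_derivative uxx b x t - vxx b x t) (at 0)" if "b \<in> Basis" for b
      by (rule DERIV_diff[OF u(7)[OF xt that] v(7)[OF xt that]])
    show "(\<Sum>b\<in>Basis. uxx b x t - vxx b x t) = ut x t - vt x t"
      by (simp only: sum_subtractf u(8)[OF xt] v(8)[OF xt])
  qed
qed

lemma heat_equation_on_time_shift:
  assumes "heat_equation_on D u" and c: "c \<ge> 0"
  shows "heat_equation_on D (\<lambda>x t. u x (t + c))"
proof -
  from assms(1)[unfolded heat_equation_on_iff] obtain ut ux uxx where Hu: "heat_derivatives D u ut ux uxx" by blast
  note u = assms(1)[unfolded heat_equation_on_iff, THEN conjunct1] heat_derivativesD[OF Hu]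
  have cont: "continuous_on (D \<times> {0<..}) (\<lambda>(x, t). f x (t + c))"
    if "continuous_on (D \<times> {0<..}) (\<lambda>(x, t). f x t)" for f :: "'a \<Rightarrow> real \<Rightarrow> real"
  proof -
    have "continuous_on (D \<times> {0<..}) (\<lambda>p. (\<lambda>(x, t). f x t) (fst p, snd p + c))"
      by (rule continuous_on_compose2[OF that]) (use c in \<open>auto intro!: continuous_intros\<close>)
    then show ?thesis by (simp add: case_prod_beta)
  qed
  have shift: "((\<lambda>s. u x (s + c)) has_real_derivative ut x (t + c)) (at t)" if "x \<in> D" "t > 0" for x t
    using u(5)[OF that(1), of "t + c"] that c DERIV_shift[of "\<lambda>s. u x s" "ut x (t + c)" t c] by simp
  show ?thesis
    unfolding heat_equation_on_def
  proof (intro conjI; (rule exI[of _ "\<lambda>x t. ut x (t + c)"], rule exI[of _ "\<lambda>b x t. ux b x (t + c)"],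
      rule exI[of _ "\<lambda>b x t. uxx b x (t + c)"], intro conjI ballI allI impI)?)
    show "continuous_on (D \<times> {0<..}) (\<lambda>(x, t). u x (t + c))" by (rule cont[OF u(1)])
    show "continuous_on (D \<times> {0<..}) (\<lambda>(x, t). ut x (t + c))" by (rule cont[OF u(2)])
    show "continuous_on (D \<times> {0<..}) (\<lambda>(x, t). ux b x (t + c))" if "b \<in> Basis" for b by (rule cont[OF u(3)[OF that]])
    show "continuous_on (D \<times> {0<..}) (\<lambda>(x, t). uxx b x (t + c))" if "b \<in> Basis" for b by (rule cont[OF u(4)[OF that]])
    fix x and t :: real assume xt: "x \<in> D" "0 < t"
    show "((\<lambda>s. u x (s + c)) has_real_derivative ut x (t + c)) (at t)" by (rule shift[OF xt])
    have tc: "0 < t + c" using xt c by simp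
    show "((\<lambda>s. u (x + s *\<^sub>R b) (t + c)) has_real_derivative ux b x (t + c)) (at 0)" if "b \<in> Basis" for b
      by (rule u(6)[OF xt(1) tc that])
    show "((\<lambda>s. ux b (x + s *\<^sub>R b) (t + c)) has_real_derivative uxx b x (t + c)) (at 0)" if "b \<in> Basis" for b
      by (rule u(7)[OF xt(1) tc that])
    show "(\<Sum>b\<in>Basis. uxx b x (t + c)) = ut x (t + c)" by (rule u(8)[OF xt(1) tc])
  qed
qed

section \<open>Evolution of compactly supported data and comparison with a competitor\<close>

definition slit_semigroup :: "real \<times> real \<Rightarrow> real \<times> real \<Rightarrow> (real \<times> real \<Rightarrow> real) \<Rightarrow> real \<times> real \<Rightarrow> real \<Rightarrow> real" where
  "slit_semigroup a b g x t = integral (cbox a b) (\<lambda>z. slit_kernel x z t * g z)"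

lemma continuous_on_compose_snd: "continuous_on B g \<Longrightarrow> continuous_on (S \<times> B) (\<lambda>p. g (snd p))"
  by (erule continuous_on_compose2[of _ _ _ snd]) (auto intro: continuous_intros)

text \<open>The pole ranges over a compact box inside the slit plane, so every derivative passes
  under the integral and the equation of the kernel is inherited.\<close>

lemma heat_equation_slit_semigroup:
  assumes ab: "cbox a b \<subseteq> slit_plane" and g: "continuous_on (cbox a b) g"
  shows "heat_equation_on slit_plane (slit_semigroup a b g)"
proof -
  note gs = continuous_on_compose_snd[OF g]
  have c1: "continuous_on (slit_plane \<times> {0<..}) (\<lambda>p. integral (cbox a b) (\<lambda>z. k (fst p) z (snd p) * g z))"
    if "continuous_on ((slit_plane \<times> {0<..}) \<times> cbox a b) (\<lambda>q. k (fst (fst q)) (snd q) (snd (fst q)))"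
    for k :: "real \<times> real \<Rightarrow> real \<times> real \<Rightarrow> real \<Rightarrow> real"
  proof (rule integral_continuous_on_param)
    show "continuous_on ((slit_plane \<times> {0<..}) \<times> cbox a b) (\<lambda>(p, z). k (fst p) z (snd p) * g z)"
      unfolding case_prod_beta
      by (rule continuous_on_mult[OF that gs])
  qed
  have leib: "((\<lambda>s. integral (cbox a b) (\<lambda>z. f s z * g z)) has_real_derivative integral (cbox a b) (\<lambda>z. f' s0 z * g z)) (at s0)"
    if U: "open U" "convex U" "s0 \<in> U"
      and f: "\<And>s z. s \<in> U \<Longrightarrow> z \<in> cbox a b \<Longrightarrow> ((\<lambda>s. f s z) has_real_derivative f' s z) (at s)"
      and cf: "\<And>s. s \<in> U \<Longrightarrow> continuous_on (cbox a b) (f s)"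
      and cf': "continuous_on (U \<times> cbox a b) (\<lambda>p. f' (fst p) (snd p))"
    for U :: "real set" and f f' :: "real \<Rightarrow> real \<times> real \<Rightarrow> real" and s0
  proof -
    have "((\<lambda>s. integral (cbox a b) (\<lambda>z. f s z * g z)) has_field_derivative integral (cbox a b) (\<lambda>z. f' s0 z * g z)) (at s0 within U)"
    proof (rule leibniz_rule_field_derivative[where f = "\<lambda>s z. f s z * g z" and fx = "\<lambda>s z. f' s z * g z"])
      show "((\<lambda>s. f s z * g z) has_field_derivative f' s z * g z) (at s within U)" if "s \<in> U" "z \<in> cbox a b" for s z
        using DERIV_cmult_right[OF f[OF that], of "g z"] by (rule has_field_derivative_at_within)
      show "(\<lambda>z. f s z * g z) integrable_on cbox a b" if "s \<in> U" for s
        by (rule integrable_continuous[OF continuous_on_mult[OF cf[OF that] g]])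
      show "continuous_on (U \<times> cbox a b) (\<lambda>(s, z). f' s z * g z)"
        unfolding case_prod_beta by (rule continuous_on_mult[OF cf' gs])
    qed (use U in simp_all)
    then show ?thesis unfolding at_within_open[OF U(3) U(1)] .
  qed
  have line: "\<exists>d>0. \<forall>s\<in>{-d<..<d}. x + s *\<^sub>R e \<in> slit_plane" if xs: "x \<in> slit_plane" and "norm e = 1" for x e
  proof -
    obtain d where d: "d > 0" "ball x d \<subseteq> slit_plane" using openE[OF open_slit_plane xs] by blast
    have "x + s *\<^sub>R e \<in> ball x d" if "s \<in> {-d<..<d}" for s
      using that \<open>norm e = 1\<close> by (auto simp: dist_norm)
    then show ?thesis using d by blast
  qed
  have E: "norm e = 1" if "e \<in> Basis" for e :: "real \<times> real" using that by simp
  show ?thesis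
    unfolding heat_equation_on_def
  proof (rule conjI; (rule exI[of _ "\<lambda>x t. integral (cbox a b) (\<lambda>z. slit_kernel_t x z t * g z)"],
      rule exI[of _ "\<lambda>e x t. integral (cbox a b) (\<lambda>z. slit_kernel_x e x z t * g z)"],
      rule exI[of _ "\<lambda>e x t. integral (cbox a b) (\<lambda>z. slit_kernel_xx e x z t * g z)"], intro conjI ballI allI impI)?)
    let ?S = "(slit_plane \<times> {0<..}) \<times> cbox a b"
    have conts: "continuous_on ?S (\<lambda>q. fst (fst q))" "continuous_on ?S (\<lambda>q. snd (fst q))" "continuous_on ?S (\<lambda>q. snd q)"
      by (intro continuous_intros)+
    have doms: "\<And>q. q \<in> ?S \<Longrightarrow> fst (fst q) \<in> slit_plane" "\<And>q. q \<in> ?S \<Longrightarrow> snd q \<in> slit_plane" "\<And>q. q \<in> ?S \<Longrightarrow> 0 < snd (fst q)"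
      using ab by auto
    show "continuous_on (slit_plane \<times> {0<..}) (\<lambda>(x, t). slit_semigroup a b g x t)"
      unfolding case_prod_beta slit_semigroup_def by (rule c1[OF continuous_on_slit_kernel[OF conts doms]])
    show "continuous_on (slit_plane \<times> {0<..}) (\<lambda>(x, t). integral (cbox a b) (\<lambda>z. slit_kernel_t x z t * g z))"
      unfolding case_prod_beta by (rule c1[OF continuous_on_slit_kernel_t[OF conts doms]])
    show "continuous_on (slit_plane \<times> {0<..}) (\<lambda>(x, t). integral (cbox a b) (\<lambda>z. slit_kernel_x e x z t * g z))" for e
      unfolding case_prod_beta by (rule c1[OF continuous_on_slit_kernel_x[OF conts doms]])
    show "continuous_on (slit_plane \<times> {0<..}) (\<lambda>(x, t). integral (cbox a b) (\<lambda>z. slit_kernel_xx e x z t * g z))" for e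
      unfolding case_prod_beta by (rule c1[OF continuous_on_slit_kernel_xx[OF conts doms]])
  next
    fix x :: "real \<times> real" and t :: real assume x: "x \<in> slit_plane" and t: "0 < t"
    have dom: "\<And>z. z \<in> cbox a b \<Longrightarrow> z \<in> slit_plane" using ab by auto
    show "((\<lambda>s. slit_semigroup a b g x s) has_real_derivative integral (cbox a b) (\<lambda>z. slit_kernel_t x z t * g z)) (at t)"
      unfolding slit_semigroup_def
    proof (rule leib[of "{0<..}" t "\<lambda>s z. slit_kernel x z s" "\<lambda>s z. slit_kernel_t x z s"])
      show "((\<lambda>s. slit_kernel x z s) has_real_derivative slit_kernel_t x z s) (at s)" if "s \<in> {0<..}" for s z
        using DERIV_slit_kernel_t[OF x] that by simp
      show "continuous_on (cbox a b) (\<lambda>z. slit_kernel x z s)" if "s \<in> {0<..}" for s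
        by (rule continuous_on_slit_kernel[OF continuous_on_const continuous_on_const continuous_on_id]) (use x dom that in simp_all)
      show "continuous_on ({0<..} \<times> cbox a b) (\<lambda>p. slit_kernel_t x (snd p) (fst p))"
        by (rule continuous_on_slit_kernel_t[OF continuous_on_const continuous_on_fst[OF continuous_on_id] continuous_on_snd[OF continuous_on_id]])
           (use x dom in auto)
    qed (use t in auto)
    have int: "(\<lambda>z. slit_kernel_xx e x z t * g z) integrable_on cbox a b" for e
      by (rule integrable_continuous[OF continuous_on_mult[OF
          continuous_on_slit_kernel_xx[OF continuous_on_const continuous_on_const continuous_on_id] g]]) (use t x dom in simp_all)
    have "(\<Sum>e\<in>Basis. integral (cbox a b) (\<lambda>z. slit_kernel_xx e x z t * g z))
       = integral (cbox a b) (\<lambda>z. slit_kernel_xx (1, 0) x z t * g z + slit_kernel_xx (0, 1) x z t * g z)"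
      unfolding sum_Basis_real_prod by (rule integral_add[symmetric, OF int int])
    also have "\<dots> = integral (cbox a b) (\<lambda>z. slit_kernel_t x z t * g z)"
      using slit_kernel_laplacian[OF x t] by (simp add: distrib_right[symmetric])
    finally show "(\<Sum>e\<in>Basis. integral (cbox a b) (\<lambda>z. slit_kernel_xx e x z t * g z)) = integral (cbox a b) (\<lambda>z. slit_kernel_t x z t * g z)" .
  next
    fix x e :: "real \<times> real" and t :: real assume x: "x \<in> slit_plane" and t: "0 < t" and e: "e \<in> Basis"
    obtain d where d: "d > 0" "\<And>s. s \<in> {-d<..<d} \<Longrightarrow> x + s *\<^sub>R e \<in> slit_plane" using line[OF x E[OF e]] by blast
    \<comment> \<open>Derivatives along a line are only known at parameter 0; at parameter s they
      are obtained by moving the base point to \<open>x + s *\<^sub>R e\<close>.\<close>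
    have shift: "((\<lambda>s. f (x + s *\<^sub>R e)) has_real_derivative l) (at s)"
      if "((\<lambda>r. f ((x + s *\<^sub>R e) + r *\<^sub>R e)) has_real_derivative l) (at 0)" for f :: "real \<times> real \<Rightarrow> real" and s l
      using that DERIV_shift[of "\<lambda>s. f (x + s *\<^sub>R e)" l 0 s] by (simp add: algebra_simps)
    have dom: "\<And>z. z \<in> cbox a b \<Longrightarrow> z \<in> slit_plane" using ab by auto
    have cx: "continuous_on S (\<lambda>p. x + fst p *\<^sub>R e)" for S :: "(real \<times> real \<times> real) set"
      by (intro continuous_intros)
    note c2 = cx continuous_on_const continuous_on_snd[OF continuous_on_id]
    have "((\<lambda>s. slit_semigroup a b g (x + s *\<^sub>R e) t) has_real_derivative integral (cbox a b) (\<lambda>z. slit_kernel_x e (x + 0 *\<^sub>R e) z t * g z)) (at 0)"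
      unfolding slit_semigroup_def
    proof (rule leib[of "{-d<..<d}" 0 "\<lambda>s z. slit_kernel (x + s *\<^sub>R e) z t" "\<lambda>s z. slit_kernel_x e (x + s *\<^sub>R e) z t"])
      show "((\<lambda>s. slit_kernel (x + s *\<^sub>R e) z t) has_real_derivative slit_kernel_x e (x + s *\<^sub>R e) z t) (at s)" if "s \<in> {-d<..<d}" for s z
        by (rule shift) (rule DERIV_slit_kernel_x[OF d(2)[OF that] t])
      show "continuous_on (cbox a b) (\<lambda>z. slit_kernel (x + s *\<^sub>R e) z t)" if "s \<in> {-d<..<d}" for s
        by (rule continuous_on_slit_kernel[OF continuous_on_const continuous_on_const continuous_on_id]) (use d(2)[OF that] t dom in simp_all)
      show "continuous_on ({-d<..<d} \<times> cbox a b) (\<lambda>p. slit_kernel_x e (x + fst p *\<^sub>R e) (snd p) t)"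
        by (rule continuous_on_slit_kernel_x[OF c2]) (use d(2) t dom in auto)
    qed (use d in auto)
    then show "((\<lambda>s. slit_semigroup a b g (x + s *\<^sub>R e) t) has_real_derivative integral (cbox a b) (\<lambda>z. slit_kernel_x e x z t * g z)) (at 0)"
      by simp
    have "((\<lambda>s. integral (cbox a b) (\<lambda>z. slit_kernel_x e (x + s *\<^sub>R e) z t * g z)) has_real_derivative integral (cbox a b) (\<lambda>z. slit_kernel_xx e (x + 0 *\<^sub>R e) z t * g z)) (at 0)"
    proof (rule leib[of "{-d<..<d}" 0 "\<lambda>s z. slit_kernel_x e (x + s *\<^sub>R e) z t" "\<lambda>s z. slit_kernel_xx e (x + s *\<^sub>R e) z t"])
      show "((\<lambda>s. slit_kernel_x e (x + s *\<^sub>R e) z t) has_real_derivative slit_kernel_xx e (x + s *\<^sub>R e) z t) (at s)" if "s \<in> {-d<..<d}" for s z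
        by (rule shift) (rule DERIV_slit_kernel_xx[OF d(2)[OF that] t E[OF e]])
      show "continuous_on (cbox a b) (\<lambda>z. slit_kernel_x e (x + s *\<^sub>R e) z t)" if "s \<in> {-d<..<d}" for s
        by (rule continuous_on_slit_kernel_x[OF continuous_on_const continuous_on_const continuous_on_id]) (use d(2)[OF that] t dom in simp_all)
      show "continuous_on ({-d<..<d} \<times> cbox a b) (\<lambda>p. slit_kernel_xx e (x + fst p *\<^sub>R e) (snd p) t)"
        by (rule continuous_on_slit_kernel_xx[OF c2]) (use d(2) t dom in auto)
    qed (use d in auto)
    then show "((\<lambda>s. integral (cbox a b) (\<lambda>z. slit_kernel_x e (x + s *\<^sub>R e) z t * g z)) has_real_derivative integral (cbox a b) (\<lambda>z. slit_kernel_xx e x z t * g z)) (at 0)"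
      by simp
  qed
qed

lemma uniformly_continuous_compact_support:
  fixes f :: "'a::euclidean_space \<Rightarrow> real"
  assumes f: "continuous_on UNIV f" and K: "compact K" and f0: "\<And>x. x \<notin> K \<Longrightarrow> f x = 0" and e: "e > 0"
  obtains d where "d > 0" "\<And>x z. dist x z < d \<Longrightarrow> \<bar>f z - f x\<bar> < e"
proof -
  obtain r where "\<forall>x\<in>K. norm x \<le> r" using compact_imp_bounded[OF K] unfolding bounded_iff by blast
  then have r: "K \<subseteq> cball 0 r" by auto
  have "uniformly_continuous_on (cball 0 (r + 1)) f"
    by (intro compact_uniformly_continuous continuous_on_subset[OF f]) auto
  then obtain d where d: "d > 0" "\<And>x z. x \<in> cball 0 (r + 1) \<Longrightarrow> z \<in> cball 0 (r + 1) \<Longrightarrow> dist z x < d \<Longrightarrow> dist (f z) (f x) < e"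
    using e unfolding uniformly_continuous_on_def by metis
  show ?thesis
  proof (rule that[of "min d 1"])
    show "\<bar>f z - f x\<bar> < e" if "dist x z < min d 1" for x z
    proof (cases "x \<in> cball 0 r \<or> z \<in> cball 0 r")
      case True
      have "norm x \<le> norm z + dist x z" "norm z \<le> norm x + dist x z"
        using norm_triangle_ineq2[of x z] norm_triangle_ineq2[of z x] by (auto simp: dist_norm norm_minus_commute)
      then have "x \<in> cball 0 (r + 1)" "z \<in> cball 0 (r + 1)" using True that by auto
      then show ?thesis using d(2)[of x z] that by (simp add: dist_commute dist_real_def)
    next
      case False
      then have "x \<notin> K" "z \<notin> K" using r by auto
      then show ?thesis using e f0 by simp
    qed
  qed (use d in simp)
qed

lemma integral_cbox_eq_LINT:
  fixes h :: "real \<times> real \<Rightarrow> real"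
  assumes "continuous_on (cbox a b) h"
  shows "integrable lborel (\<lambda>z. indicator (cbox a b) z * h z)" "integral (cbox a b) h = (\<integral>z. indicator (cbox a b) z * h z \<partial>lborel)"
proof -
  have "integrable lborel (\<lambda>z. indicator (cbox a b) z *\<^sub>R h z)"
    by (rule borel_integrable_compact[OF compact_cbox assms])
  then show "integrable lborel (\<lambda>z. indicator (cbox a b) z * h z)" by simp
  have "set_integrable lborel (cbox a b) h"
    unfolding set_integrable_def by (rule borel_integrable_compact[OF compact_cbox assms])
  from set_borel_integral_eq_integral(2)[OF this]
  show "integral (cbox a b) h = (\<integral>z. indicator (cbox a b) z * h z \<partial>lborel)"
    by (simp add: set_lebesgue_integral_def)
qed

text \<open>The datum \<open>g\<close> will be a competitor at a small positive time, multiplied by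
  a cutoff supported in a box around the pole. The locale collects what the evolution of such a
  datum needs.\<close>

locale slit_comparison =
  fixes a b :: "real \<times> real" and g :: "real \<times> real \<Rightarrow> real" and M :: real
  assumes ab: "cbox a b \<subseteq> slit_plane"
    and g: "continuous_on UNIV g" and g0: "\<And>z. z \<notin> cbox a b \<Longrightarrow> g z = 0"
    and g_nonneg: "\<And>z. 0 \<le> g z" and gM: "\<And>z. g z \<le> M"
begin

lemma g_measurable [measurable]: "g \<in> borel_measurable borel"
  using g by (rule borel_measurable_continuous_onI)

lemma M_nonneg: "0 \<le> M" using g_nonneg gM order_trans by blast

lemma cont_kernel:
  assumes "x \<in> slit_plane" "t > 0"
  shows "continuous_on (cbox a b) (\<lambda>z. slit_kernel x z t * g z)"
  by (rule continuous_on_mult[OF continuous_on_slit_kernel[OF continuous_on_const continuous_on_const continuous_on_id]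
       continuous_on_subset[OF g]]) (use assms ab in auto)

lemma semigroup_bound:
  assumes x: "x \<in> slit_plane" and t: "t > 0" and C: "\<And>z. z \<in> cbox a b \<Longrightarrow> slit_kernel x z t \<le> C"
  shows "slit_semigroup a b g x t \<le> C * M * measure lborel (cbox a b)"
proof -
  have "slit_semigroup a b g x t \<le> integral (cbox a b) (\<lambda>z. C * M)"
    unfolding slit_semigroup_def
  proof (rule integral_le)
    show "(\<lambda>z. slit_kernel x z t * g z) integrable_on cbox a b"
      by (rule integrable_continuous[OF cont_kernel[OF x t]])
    show "slit_kernel x z t * g z \<le> C * M" if "z \<in> cbox a b" for z
      using C[OF that] slit_kernel_nonneg[OF t, of x z] g_nonneg[of z] gM[of z] by (intro mult_mono) auto
  qed auto
  then show ?thesis by (simp add: mult_ac)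
qed

text \<open>Only an upper bound is wanted, so the kernel may be replaced by the Gaussian. This makes
  the estimate uniform in x right up to the slit.\<close>

lemma semigroup_small_time:
  assumes e: "e > 0"
  obtains d where "d > 0" "\<And>x t. x \<in> slit_plane \<Longrightarrow> 0 < t \<Longrightarrow> t < d \<Longrightarrow> slit_semigroup a b g x t \<le> g x + e"
proof -
  have e2: "e / 2 > 0" using e by simp
  obtain d where d: "d > 0" "\<And>x z. dist x z < d \<Longrightarrow> \<bar>g z - g x\<bar> < e / 2"
    using uniformly_continuous_compact_support[OF g compact_cbox g0 e2] by blast
  define B where "B = M / d\<^sup>2"
  have B: "B \<ge> 0" using M_nonneg by (simp add: B_def)
  show ?thesis
  \<comment> \<open>Below this time 4 t B is at most e / 2; the added 1 covers
    \<open>B = 0\<close>.\<close>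
  proof (rule that[of "e / (8 * (B + 1))"])
    show "e / (8 * (B + 1)) > 0" using e B by simp
    fix x t assume x: "x \<in> slit_plane" and t: "0 < t" "t < e / (8 * (B + 1))"
    have "\<bar>g z - g x\<bar> \<le> e / 2 + B * (norm (x - z))\<^sup>2" for z
    proof (cases "dist x z < d")
      case True
      moreover have "0 \<le> B * (norm (x - z))\<^sup>2" using B by simp
      ultimately show ?thesis using d(2)[OF True] by linarith
    next
      case False
      then have "d\<^sup>2 \<le> (norm (x - z))\<^sup>2" using d by (intro power_mono) (auto simp: dist_norm)
      then have "B * d\<^sup>2 \<le> B * (norm (x - z))\<^sup>2" using B by (intro mult_left_mono)
      moreover have "B * d\<^sup>2 = M" using d by (simp add: B_def)
      ultimately show ?thesis using gM[of z] gM[of x] g_nonneg[of z] g_nonneg[of x] e by linarith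
    qed
    from gauss_kernel_approx[OF t(1) g_measurable _ this, of M] g_nonneg gM e B
    have "\<bar>(\<integral>z. gauss_kernel x z t * g z \<partial>lborel) - g x\<bar> \<le> e / 2 + 4 * t * B" by simp
    moreover have "slit_semigroup a b g x t \<le> (\<integral>z. gauss_kernel x z t * g z \<partial>lborel)"
      unfolding slit_semigroup_def integral_cbox_eq_LINT(2)[OF cont_kernel[OF x t(1)]]
    proof (rule integral_mono)
      show "integrable lborel (\<lambda>z. indicator (cbox a b) z * (slit_kernel x z t * g z))"
        by (rule integral_cbox_eq_LINT(1)[OF cont_kernel[OF x t(1)]])
      show "integrable lborel (\<lambda>z. gauss_kernel x z t * g z)"
        by (rule integrable_gauss_kernel_mult[OF t(1) g_measurable, of M]) (use g_nonneg gM in simp)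
      show "indicator (cbox a b) z * (slit_kernel x z t * g z) \<le> gauss_kernel x z t * g z" for z
      proof (cases "z \<in> cbox a b")
        case True
        then have "z \<in> slit_plane" using ab by blast
        then show ?thesis using True slit_kernel_le_gauss_kernel[OF x _ t(1)] g_nonneg[of z] by (simp add: mult_right_mono)
      qed (simp add: g0)
    qed
    moreover have "4 * t * B \<le> e / 2"
    proof -
      have "t * (8 * (B + 1)) < e" using t B by (simp add: pos_less_divide_eq)
      then show ?thesis using t B by (simp add: algebra_simps)
    qed
    ultimately show "slit_semigroup a b g x t \<le> g x + e" by linarith
  qed
qed

text \<open>Far out, bounding the Gaussian by the reciprocal of its exponent cancels t against the
  prefactor and gives decay in x uniformly in time. Near the slit,
  \<open>slit_kernel_boundary_bound\<close> is uniform for \<open>\<delta> \<le> t\<close>. Hence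
  one compact set contains the superlevel sets of all these times.\<close>

lemma semigroup_vanishes:
  assumes e: "e > 0" and \<delta>: "\<delta> > 0"
  obtains K where "compact K" "K \<subseteq> slit_plane"
    "\<And>x t. x \<in> slit_plane \<Longrightarrow> \<delta> \<le> t \<Longrightarrow> e \<le> slit_semigroup a b g x t \<Longrightarrow> x \<in> K"
proof -
  define V where "V = M * measure lborel (cbox a b)"
  have V: "V \<ge> 0" using M_nonneg by (simp add: V_def)
  obtain r where r: "r \<ge> 0" "\<And>z. z \<in> cbox a b \<Longrightarrow> norm z \<le> r"
    using bounded_pos[of "cbox a b"] bounded_cbox by (metis less_imp_le)
  \<comment> \<open>At distance more than \<open>L\<close> from the box's ball the solution is at
    most V / L, and this \<open>L\<close> makes V / L smaller than e.\<close>
  define L where "L = 1 + V / e"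
  have L: "L \<ge> 1" using V e by (simp add: L_def)
  define \<rho> where "\<rho> = r + L"
  define C where "C = sqrt r * (2 * sqrt (\<rho> * r / \<delta>) + 1) / (2 * pi * \<delta> * sqrt \<delta>)"
  have C: "C \<ge> 0" unfolding C_def using r L \<delta> by (intro divide_nonneg_nonneg mult_nonneg_nonneg add_nonneg_nonneg) (auto simp: \<rho>_def)
  \<comment> \<open>Near the slit the solution is at most \<open>root_im x * (C * V)\<close>; the
    added 1 makes the comparison strict and keeps the quotient meaningful when
    \<open>C * V = 0\<close>.\<close>
  define \<eta> where "\<eta> = e / (C * V + 1)"
  have CV: "C * V \<ge> 0" using C V by simp
  have \<eta>: "\<eta> > 0" unfolding \<eta>_def using e CV by (intro divide_pos_pos) auto
  define K where "K = {x. norm x \<le> \<rho> \<and> \<eta> \<le> root_im x}"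
  show ?thesis
  proof (rule that[of K])
    have "closed {x. \<eta> \<le> root_im x}"
      by (intro closed_Collect_le continuous_intros)
    moreover have "K = cball 0 \<rho> \<inter> {x. \<eta> \<le> root_im x}" by (auto simp: K_def)
    ultimately show "compact K" by (simp add: compact_Int_closed)
    show "K \<subseteq> slit_plane" using \<eta> by (auto simp: K_def root_im_eq_0_iff[symmetric])
    fix x t assume x: "x \<in> slit_plane" and t: "\<delta> \<le> t" and ex: "e \<le> slit_semigroup a b g x t"
    have t0: "t > 0" using t \<delta> by simp
    have nx: "norm x \<le> \<rho>"
    proof (rule ccontr)
      assume "\<not> norm x \<le> \<rho>"
      then have far: "norm x > r + L" by (simp add: \<rho>_def)
      have "slit_kernel x z t \<le> 1 / (pi * L\<^sup>2)" if z: "z \<in> cbox a b" for z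
      proof -
        have zs: "z \<in> slit_plane" using z ab by auto
        have "L \<le> norm (x - z)" using far r(2)[OF z] norm_triangle_ineq2[of x z] by linarith
        then have w: "L\<^sup>2 \<le> (norm (x - z))\<^sup>2" using L by (intro power_mono) auto
        have L2: "L\<^sup>2 > 0" using L by simp
        have "L\<^sup>2 / (4 * t) \<le> exp ((norm (x - z))\<^sup>2 / (4 * t))"
        proof -
          have "L\<^sup>2 / (4 * t) \<le> (norm (x - z))\<^sup>2 / (4 * t)" using w t0 by (intro divide_right_mono) auto
          also have "\<dots> \<le> exp ((norm (x - z))\<^sup>2 / (4 * t))"
            using exp_ge_add_one_self[of "(norm (x - z))\<^sup>2 / (4 * t)"] by linarith
          finally show ?thesis .
        qed
        then have "exp (- (norm (x - z))\<^sup>2 / (4 * t)) \<le> 4 * t / L\<^sup>2"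
          using L2 t0 by (simp add: exp_minus field_simps)
        then have "gauss_kernel x z t \<le> (4 * t / L\<^sup>2) / (4 * pi * t)"
          unfolding gauss_kernel_def using t0 by (intro divide_right_mono) auto
        also have "\<dots> = 1 / (pi * L\<^sup>2)" using t0 by simp
        finally show ?thesis using slit_kernel_le_gauss_kernel[OF x zs t0] by simp
      qed
      from semigroup_bound[OF x t0 this] have "slit_semigroup a b g x t \<le> 1 / (pi * L\<^sup>2) * V"
        by (simp add: V_def)
      also have "\<dots> \<le> 1 / L * V"
      proof (intro mult_right_mono divide_left_mono V)
        have "1 * L \<le> pi * L\<^sup>2"
          unfolding power2_eq_square mult.assoc[symmetric] using L pi_gt3
          by (intro mult_right_mono) (auto intro: order_trans[of 1 "pi * 1"])
        then show "L \<le> pi * L\<^sup>2" by simp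
      qed (use L in auto)
      also have "\<dots> < e"
      proof -
        have "e * L = e + V" using e by (simp add: L_def field_simps)
        then have "V < e * L" using e by simp
        then show ?thesis using L by (simp add: pos_divide_less_eq)
      qed
      finally show False using ex by simp
    qed
    moreover have "\<eta> \<le> root_im x"
    proof (rule ccontr)
      assume "\<not> \<eta> \<le> root_im x"
      have "slit_kernel x z t \<le> root_im x * C" if z: "z \<in> cbox a b" for z
      proof -
        have zs: "z \<in> slit_plane" using z ab by auto
        have "slit_kernel x z t \<le> root_im x * root_im z * (2 * sqrt (norm x * norm z / t) + 1) / (2 * pi * t * sqrt t)"
          by (rule slit_kernel_boundary_bound[OF x zs t0])
        also have "\<dots> \<le> root_im x * sqrt r * (2 * sqrt (\<rho> * r / \<delta>) + 1) / (2 * pi * \<delta> * sqrt \<delta>)"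
        proof (intro frac_le mult_mono add_mono)
          show "root_im z \<le> sqrt r" using root_im_le[of z] r(2)[OF z] by (meson order_trans real_sqrt_le_mono)
          show "sqrt (norm x * norm z / t) \<le> sqrt (\<rho> * r / \<delta>)"
          proof (intro real_sqrt_le_mono frac_le mult_mono)
            show "0 \<le> \<rho> * r" using r(1) L by (simp add: \<rho>_def)
            show "0 \<le> \<rho>" using r(1) L by (simp add: \<rho>_def)
          qed (use nx r(2)[OF z] t \<delta> in simp_all)
          show "0 \<le> root_im x * sqrt r * (2 * sqrt (\<rho> * r / \<delta>) + 1)"
            using r(1) L \<delta> by (intro mult_nonneg_nonneg add_nonneg_nonneg) (auto simp: \<rho>_def)
        qed (use t \<delta> r(1) in auto)
        finally show ?thesis by (simp add: C_def)
      qed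
      from semigroup_bound[OF x t0 this] have "slit_semigroup a b g x t \<le> root_im x * (C * V)"
        by (simp add: V_def mult.assoc)
      also have "\<dots> \<le> \<eta> * (C * V)" using \<open>\<not> \<eta> \<le> root_im x\<close> CV by (intro mult_right_mono) auto
      also have "\<dots> < \<eta> * (C * V + 1)" using \<eta> by simp
      also have "\<dots> = e" using CV by (simp add: \<eta>_def)
      finally show False using ex by simp
    qed
    ultimately show "x \<in> K" by (simp add: K_def)
  qed
qed

text \<open>Maximum principle for the difference. At small times the evolution is at most g + e / 4,
  and g lies below q at time c. Near the slit and at infinity the evolution is small by
  \<open>semigroup_vanishes\<close>, and q is nonnegative.\<close>

lemma semigroup_le:
  assumes q: "heat_equation_on slit_plane q" and q_nonneg: "\<And>x t. x \<in> slit_plane \<Longrightarrow> t > 0 \<Longrightarrow> 0 \<le> q x t"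
    and c: "c > 0" and gq: "\<And>z. z \<in> cbox a b \<Longrightarrow> g z \<le> q z c"
    and x: "x \<in> slit_plane" and t: "t > 0"
  shows "slit_semigroup a b g x t \<le> q x (t + c)"
proof -
  have "slit_semigroup a b g x t - q x (t + c) \<le> 0"
  proof (rule heat_max_principle[where T = t and u = "\<lambda>x t. slit_semigroup a b g x t - q x (t + c)", OF open_slit_plane _ _ x t order_refl])
    show "heat_equation_on slit_plane (\<lambda>x t. slit_semigroup a b g x t - q x (t + c))"
      using c by (intro heat_equation_on_diff heat_equation_slit_semigroup heat_equation_on_time_shift q ab continuous_on_subset[OF g]) auto
    fix e :: real assume e: "e > 0"
    have e4: "e / 4 > 0" using e by simp
    obtain d1 where d1: "d1 > 0" "\<And>x t. x \<in> slit_plane \<Longrightarrow> 0 < t \<Longrightarrow> t < d1 \<Longrightarrow> slit_semigroup a b g x t \<le> g x + e / 4"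
      using semigroup_small_time[OF e4] by blast
    have "continuous_on (slit_plane \<times> {0<..}) (\<lambda>p. q (fst p) (snd p))"
      using q by (simp add: heat_equation_on_def case_prod_beta)
    then have "continuous_on (cbox a b \<times> {c..2 * c}) (\<lambda>p. q (fst p) (snd p))"
      by (rule continuous_on_subset) (use ab c in auto)
    then have "uniformly_continuous_on (cbox a b \<times> {c..2 * c}) (\<lambda>p. q (fst p) (snd p))"
      by (intro compact_uniformly_continuous compact_Times) auto
    then obtain d2 where d2: "d2 > 0" "\<And>p p'. p \<in> cbox a b \<times> {c..2 * c} \<Longrightarrow> p' \<in> cbox a b \<times> {c..2 * c} \<Longrightarrow> dist p' p < d2 \<Longrightarrow>
        dist (q (fst p') (snd p')) (q (fst p) (snd p)) < e / 4"
      using e4 unfolding uniformly_continuous_on_def by metis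
    \<comment> \<open>The bound by \<open>c\<close> keeps \<open>s + c\<close> inside the window
      from c to 2 c, on which \<open>q\<close> is uniformly continuous.\<close>
    define \<delta> where "\<delta> = min (min d1 d2) c"
    have \<delta>: "\<delta> > 0" using d1 d2 c by (simp add: \<delta>_def)
    obtain K where K: "compact K" "K \<subseteq> slit_plane"
      "\<And>x t. x \<in> slit_plane \<Longrightarrow> \<delta> \<le> t \<Longrightarrow> e \<le> slit_semigroup a b g x t \<Longrightarrow> x \<in> K"
      using semigroup_vanishes[OF e \<delta>] by blast
    have "z \<in> K \<and> \<delta> \<le> s" if z: "z \<in> slit_plane" and s: "0 < s" and ez: "e \<le> slit_semigroup a b g z s - q z (s + c)" for z s
    proof -
      have qz: "0 \<le> q z (s + c)" using q_nonneg[OF z] s c by simp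
      have "\<delta> \<le> s"
      proof (rule ccontr)
        assume "\<not> \<delta> \<le> s"
        then have sd: "s < d1" "s < d2" "s < c" by (auto simp: \<delta>_def)
        have 1: "slit_semigroup a b g z s \<le> g z + e / 4" by (rule d1(2)[OF z s sd(1)])
        show False
        proof (cases "z \<in> cbox a b")
          case True
          have "dist (q z (s + c)) (q z c) < e / 4"
            using d2(2)[of "(z, c)" "(z, s + c)"] True s sd c by (simp add: dist_Pair_Pair dist_real_def)
          then show False using 1 gq[OF True] ez e by (simp add: dist_real_def abs_less_iff)
        next
          case False
          then show False using 1 g0[OF False] ez qz e by simp
        qed
      qed
      moreover have "z \<in> K" by (rule K(3)[OF z \<open>\<delta> \<le> s\<close>]) (use ez qz in simp)
      ultimately show ?thesis by simp
    qed
    then show "\<exists>K \<delta>. compact K \<and> K \<subseteq> slit_plane \<and> 0 < \<delta> \<and>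
       (\<forall>x\<in>slit_plane. \<forall>s. 0 < s \<and> s \<le> t \<and> e \<le> slit_semigroup a b g x s - q x (s + c) \<longrightarrow> x \<in> K \<and> \<delta> \<le> s)"
      using K(1,2) \<delta> by blast
  qed
  then show ?thesis by simp
qed

end

text \<open>A competitor \<open>q\<close> dominates the solution that starts from \<open>q\<close> at time \<open>c\<close>, cut off near \<open>y\<close>;
  let \<open>c\<close> tend to 0.\<close>

lemma slit_kernel_minimal:
  assumes y: "y \<in> slit_plane" and q: "dirichlet_fundamental_solution slit_plane y q"
    and x: "x \<in> slit_plane" and t: "t > 0"
  shows "slit_kernel x y t \<le> q x t"
proof -
  note q' = q[unfolded dirichlet_fundamental_solution_def]
  note q_nonneg = q'[THEN conjunct1, rule_format] and heat = q'[THEN conjunct2, THEN conjunct1]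
    and delta = q'[THEN conjunct2, THEN conjunct2, THEN conjunct2]
  have qc: "continuous_on (slit_plane \<times> {0<..}) (\<lambda>p. q (fst p) (snd p))"
    using heat[unfolded heat_equation_on_iff, THEN conjunct1] by (simp add: case_prod_beta)
  obtain a b where ab: "cbox a b \<subseteq> slit_plane" and yb: "y \<in> box a b" and "\<forall>i\<in>Basis. a \<bullet> i < b \<bullet> i"
    by (rule open_contains_cbox[OF open_slit_plane y])
  obtain \<rho> where \<rho>: "\<rho> > 0" "ball y \<rho> \<subseteq> box a b" by (rule openE[OF open_box yb])
  \<comment> \<open>A tent of height 1 at \<open>y\<close>, supported in the ball inside the
    box.\<close>
  define \<psi> where "\<psi> z = max 0 (1 - dist z y / \<rho>)" for z
  have \<psi>: "0 \<le> \<psi> z" "\<psi> z \<le> 1" for z using \<rho>(1) by (auto simp: \<psi>_def)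
  have k0: "\<psi> z = 0" if "z \<notin> ball y \<rho>" for z
  proof -
    have "1 \<le> dist z y / \<rho>" using that \<rho>(1) by (simp add: dist_commute)
    then show ?thesis by (simp add: \<psi>_def)
  qed
  have ky: "\<psi> y = 1" by (simp add: \<psi>_def)
  have kc: "continuous_on UNIV \<psi>" unfolding \<psi>_def by (intro continuous_intros) (use \<rho>(1) in simp)
  have ball_cbox: "ball y \<rho> \<subseteq> cbox a b" using \<rho>(2) box_subset_cbox by blast
  have cutoff: "continuous_on UNIV (\<lambda>z. if z \<in> cbox a b then \<psi> z * h z else 0)"
    if h: "continuous_on (cbox a b) h" for h
  proof -
    have "continuous_on (cbox a b \<union> (- ball y \<rho>)) (\<lambda>z. if z \<in> cbox a b then \<psi> z * h z else 0)"
    proof (rule continuous_on_cases)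
      show "continuous_on (cbox a b) (\<lambda>z. \<psi> z * h z)"
        by (rule continuous_on_mult[OF continuous_on_subset[OF kc subset_UNIV] h])
      show "\<forall>z. z \<in> cbox a b \<and> \<not> z \<in> cbox a b \<or> z \<in> - ball y \<rho> \<and> z \<in> cbox a b \<longrightarrow> \<psi> z * h z = 0"
        by (simp add: k0)
    qed (simp_all add: closed_Compl closed_cbox)
    moreover have "cbox a b \<union> (- ball y \<rho>) = UNIV" using ball_cbox by auto
    ultimately show ?thesis by simp
  qed
  \<comment> \<open>As a function of the pole, the cut-off kernel is an admissible test function
    whose value at \<open>y\<close> is the wanted kernel value. The initial condition of
    \<open>q\<close> therefore recovers that value as a limit.\<close>
  define f where "f z = (if z \<in> cbox a b then \<psi> z * slit_kernel x z t else 0)" for z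
  have f: "continuous_on UNIV f"
    unfolding f_def
    by (rule cutoff, rule continuous_on_slit_kernel[OF continuous_on_const continuous_on_const continuous_on_id])
       (use x t ab in auto)
  have "((\<lambda>c. LINT z:slit_plane|lborel. q z c * f z) \<longlongrightarrow> f y) (at_right 0)"
  proof (rule delta[unfolded initial_delta_on_def, rule_format])
    show "continuous_on UNIV f \<and> (\<exists>K. compact K \<and> K \<subseteq> slit_plane \<and> (\<forall>x. x \<notin> K \<longrightarrow> f x = 0))"
      by (intro conjI f exI[of _ "cbox a b"] compact_cbox ab) (simp add: f_def)
  qed
  moreover have "f y = slit_kernel x y t"
    using yb box_subset_cbox ky by (auto simp: f_def)
  ultimately have lim1: "((\<lambda>c. LINT z:slit_plane|lborel. q z c * f z) \<longlongrightarrow> slit_kernel x y t) (at_right 0)" by simp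
  have lim2: "((\<lambda>c. q x (t + c)) \<longlongrightarrow> q x t) (at_right 0)"
  proof -
    have "continuous_on {-t<..} (\<lambda>c. q (fst (x, t + c)) (snd (x, t + c)))"
      by (rule continuous_on_compose2[OF qc]) (use x in \<open>auto intro!: continuous_intros\<close>)
    then have "isCont (\<lambda>c. q x (t + c)) 0"
      using continuous_on_interior[of "{-t<..}" "\<lambda>c. q x (t + c)" 0] t by (simp add: interior_open)
    then have "((\<lambda>c. q x (t + c)) \<longlongrightarrow> q x (t + 0)) (at 0)" by (rule isContD)
    then show ?thesis by (simp add: filterlim_at_split)
  qed
  \<comment> \<open>Regrouping the product moves the cutoff from the kernel to \<open>q\<close>: the
    pairing becomes the evolution, up to time t, of the datum \<open>\<psi> z * q z c\<close>, to
    which the comparison applies.\<close>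
  have ineq: "(LINT z:slit_plane|lborel. q z c * f z) \<le> q x (t + c)" if c: "c > 0" for c
  proof -
    define g where "g z = (if z \<in> cbox a b then \<psi> z * q z c else 0)" for z
    have qcc: "continuous_on (cbox a b) (\<lambda>z. q z c)"
    proof -
      have "continuous_on (cbox a b) (\<lambda>z. q (fst (z, c)) (snd (z, c)))"
        by (rule continuous_on_compose2[OF qc]) (use ab c in \<open>auto intro!: continuous_intros\<close>)
      then show ?thesis by simp
    qed
    have gc: "continuous_on UNIV g" unfolding g_def by (rule cutoff[OF qcc])
    have g_le: "g z \<le> q z c" if "z \<in> cbox a b" for z
      using that \<psi>[of z] q_nonneg[of z c] c ab by (auto simp: g_def intro!: mult_left_le_one_le)
    have g_nn: "0 \<le> g z" for z
      using \<psi>[of z] q_nonneg[of z c] c ab by (auto simp: g_def)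
    obtain M where M: "\<And>z. z \<in> cbox a b \<Longrightarrow> g z \<le> M" "0 \<le> M"
    proof -
      have "bounded (g ` cbox a b)"
        by (intro compact_imp_bounded compact_continuous_image continuous_on_subset[OF gc]) auto
      then obtain M where "M > 0" "\<And>z. z \<in> cbox a b \<Longrightarrow> \<bar>g z\<bar> \<le> M" unfolding bounded_pos by auto
      then show ?thesis using that[of M] by (meson abs_le_D1 less_imp_le)
    qed
    interpret slit_comparison a b g M
      by standard (use ab gc g_nn M in \<open>auto simp: g_def\<close>)
    have "(LINT z:slit_plane|lborel. q z c * f z) = (\<integral>z. indicator (cbox a b) z * (slit_kernel x z t * g z) \<partial>lborel)"
      unfolding set_lebesgue_integral_def using ab
      by (intro Bochner_Integration.integral_cong) (auto simp: f_def g_def indicator_def)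
    also have "\<dots> = slit_semigroup a b g x t"
      unfolding slit_semigroup_def by (rule integral_cbox_eq_LINT(2)[OF cont_kernel[OF x t], symmetric])
    also have "\<dots> \<le> q x (t + c)"
      by (rule semigroup_le[OF heat q_nonneg c g_le x t])
    finally show ?thesis .
  qed
  show ?thesis
    by (rule tendsto_le[OF _ lim2 lim1])
       (use ineq in \<open>auto intro: eventually_mono[OF eventually_at_right_less[of "0::real"]]\<close>)
qed

section \<open>Identification of the Dirichlet heat kernel\<close>

definition slit_heat_kernel :: "real \<times> real \<Rightarrow> real \<times> real \<Rightarrow> real \<Rightarrow> real" where
  "slit_heat_kernel x y t = (if x \<in> slit_plane \<and> y \<in> slit_plane \<and> 0 < t then slit_kernel x y t else 0)"

text \<open>Allows the explicit kernel to be replaced by its extension by 0. Openness of D carries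
  the derivatives over, since the two functions agree near every point of D.\<close>

lemma heat_equation_on_cong:
  assumes D: "open D" and eq: "\<And>x t. x \<in> D \<Longrightarrow> 0 < t \<Longrightarrow> u x t = v x t" and u: "heat_equation_on D u"
  shows "heat_equation_on D v"
proof -
  from u[unfolded heat_equation_on_iff] obtain ut ux uxx where H: "heat_derivatives D u ut ux uxx" by blast
  note d = heat_derivativesD[OF H]
  have "continuous_on (D \<times> {0<..}) (\<lambda>(x, t). u x t)" using u[unfolded heat_equation_on_iff] by blast
  then have c: "continuous_on (D \<times> {0<..}) (\<lambda>(x, t). v x t)"
    by (rule continuous_on_eq) (use eq in auto)
  have dt: "((\<lambda>s. v x s) has_real_derivative ut x t) (at t)" if "x \<in> D" "0 < t" for x t
    by (rule has_field_derivative_transform_within_open[OF d(4)[OF that], of "{0<..}"])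
       (use that in \<open>simp_all add: eq\<close>)
  have dx: "((\<lambda>s. v (x + s *\<^sub>R b) t) has_real_derivative ux b x t) (at 0)" if "x \<in> D" "0 < t" "b \<in> Basis" for x t b
  proof (rule has_field_derivative_transform_within_open[OF d(5)[OF that], of "(\<lambda>s. x + s *\<^sub>R b) -` D"])
    show "open ((\<lambda>s. x + s *\<^sub>R b) -` D)" by (intro open_vimage D continuous_intros)
  qed (use that in \<open>simp_all add: eq\<close>)
  have "heat_derivatives D v ut ux uxx"
    unfolding heat_derivatives_def
  proof (intro conjI ballI allI impI)
    show "continuous_on (D \<times> {0<..}) (\<lambda>(x, t). ut x t)" by (rule d)
    show "continuous_on (D \<times> {0<..}) (\<lambda>(x, t). ux b x t)" if "b \<in> Basis" for b by (rule d(2)[OF that])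
    show "continuous_on (D \<times> {0<..}) (\<lambda>(x, t). uxx b x t)" if "b \<in> Basis" for b by (rule d(3)[OF that])
    fix x and t :: real assume xt: "x \<in> D" "0 < t"
    show "((\<lambda>s. v x s) has_real_derivative ut x t) (at t)" by (rule dt[OF xt])
    show "((\<lambda>s. v (x + s *\<^sub>R b) t) has_real_derivative ux b x t) (at 0)" if "b \<in> Basis" for b by (rule dx[OF xt that])
    show "((\<lambda>s. ux b (x + s *\<^sub>R b) t) has_real_derivative uxx b x t) (at 0)" if "b \<in> Basis" for b by (rule d(6)[OF xt that])
    show "(\<Sum>b\<in>Basis. uxx b x t) = ut x t" by (rule d(7)[OF xt])
  qed
  with c show ?thesis unfolding heat_equation_on_iff by blast
qed

lemma dirichlet_fundamental_solution_cong:
  assumes D: "open D" and eq: "\<And>x t. x \<in> D \<Longrightarrow> 0 < t \<Longrightarrow> u x t = v x t" and u: "dirichlet_fundamental_solution D y u"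
  shows "dirichlet_fundamental_solution D y v"
proof -
  note u1 = u[unfolded dirichlet_fundamental_solution_def, THEN conjunct1, rule_format]
  note u2 = u[unfolded dirichlet_fundamental_solution_def, THEN conjunct2, THEN conjunct1]
  note u3 = u[unfolded dirichlet_fundamental_solution_def, THEN conjunct2, THEN conjunct2, THEN conjunct1, rule_format]
  note u4 = u[unfolded dirichlet_fundamental_solution_def, THEN conjunct2, THEN conjunct2, THEN conjunct2]
  have "initial_delta_on D y v"
    unfolding initial_delta_on_def
  proof (intro allI impI)
    fix f :: "'a \<Rightarrow> real" assume f: "continuous_on UNIV f \<and> (\<exists>K. compact K \<and> K \<subseteq> D \<and> (\<forall>x. x \<notin> K \<longrightarrow> f x = 0))"
    have "((\<lambda>t. LINT x:D|lborel. u x t * f x) \<longlongrightarrow> f y) (at_right 0)"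
      by (rule u4[unfolded initial_delta_on_def, rule_format, OF f])
    then show "((\<lambda>t. LINT x:D|lborel. v x t * f x) \<longlongrightarrow> f y) (at_right 0)"
    proof (rule Lim_transform_eventually)
      show "\<forall>\<^sub>F t in at_right 0. (LINT x:D|lborel. u x t * f x) = (LINT x:D|lborel. v x t * f x)"
        using eventually_at_right_less[of "0::real"]
      proof eventually_elim
        case (elim t)
        show ?case unfolding set_lebesgue_integral_def
          by (intro Bochner_Integration.integral_cong refl) (use eq[OF _ elim] in \<open>auto simp: indicator_def\<close>)
      qed
    qed
  qed
  moreover have "\<forall>t>0. \<forall>z\<in>frontier D. ((\<lambda>x. v x t) \<longlongrightarrow> 0) (at z within D)"
  proof (intro allI impI ballI)
    fix t :: real and z assume t: "0 < t" and z: "z \<in> frontier D"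
    have "((\<lambda>x. u x t) \<longlongrightarrow> 0) (at z within D)" by (rule u3[OF t z])
    then show "((\<lambda>x. v x t) \<longlongrightarrow> 0) (at z within D)"
      by (rule Lim_transform_eventually) (simp add: eventually_at_filter eq[OF _ t])
  qed
  moreover have "heat_equation_on D v" by (rule heat_equation_on_cong[OF D eq u2])
  moreover have "\<forall>x\<in>D. \<forall>t>0. 0 \<le> v x t" using u1 by (simp add: eq[symmetric])
  ultimately show ?thesis unfolding dirichlet_fundamental_solution_def by blast
qed

theorem is_dirichlet_heat_kernel_slit: "is_dirichlet_heat_kernel slit_plane slit_heat_kernel"
  unfolding is_dirichlet_heat_kernel_def
proof (intro conjI ballI allI impI)
  fix y :: "real \<times> real" assume y: "y \<in> slit_plane"
  show "dirichlet_fundamental_solution slit_plane y (\<lambda>x t. slit_heat_kernel x y t)"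
    by (rule dirichlet_fundamental_solution_cong[OF open_slit_plane _ dirichlet_fundamental_solution_slit_kernel[OF y]])
       (use y in \<open>simp add: slit_heat_kernel_def\<close>)
  show "slit_heat_kernel x y t \<le> q x t"
    if "dirichlet_fundamental_solution slit_plane y q" "x \<in> slit_plane" "0 < t" for q x t
    using slit_kernel_minimal[OF y that] y that by (simp add: slit_heat_kernel_def)
next
  show "slit_heat_kernel x y t = 0" if "\<not> (x \<in> slit_plane \<and> y \<in> slit_plane \<and> 0 < t)" for x y t
    using that unfolding slit_heat_kernel_def by (rule if_not_P)
qed

lemma dirichlet_heat_kernel_slit: "dirichlet_heat_kernel slit_plane = slit_heat_kernel"
  by (rule dirichlet_heat_kernel_eq[OF is_dirichlet_heat_kernel_slit])

subsection \<open>Polar coordinates\<close>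

text \<open>The derivative may blow up at the ends of the interval, as for the tangent. The compact
  substitution rule is applied on an exhausting sequence of closed intervals, and monotone
  convergence passes to the limit on both sides.\<close>

lemma nn_integral_substitution_open:
  fixes f :: "real \<Rightarrow> ennreal" and g g' :: "real \<Rightarrow> real"
  assumes [measurable]: "f \<in> borel_measurable borel" "g \<in> borel_measurable borel" "g' \<in> borel_measurable borel"
    and g: "\<And>x. x \<in> {a<..<b} \<Longrightarrow> (g has_real_derivative g' x) (at x)"
    and g': "continuous_on {a<..<b} g'" and pos: "\<And>x. x \<in> {a<..<b} \<Longrightarrow> 0 < g' x"
    and ab: "a < b" and S[measurable]: "S \<in> sets borel" and img: "g ` {a<..<b} = S"
  shows "(\<integral>\<^sup>+x. f x * indicator S x \<partial>lborel) = (\<integral>\<^sup>+x. f (g x) * ennreal (g' x) * indicator {a<..<b} x \<partial>lborel)"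
proof -
  \<comment> \<open>The summand 3 keeps 2 h below \<open>b - a\<close> already for
    \<open>n = 0\<close>.\<close>
  define h where "h n = (b - a) / (real n + 3)" for n :: nat
  have h: "0 < h n" "2 * h n < b - a" for n
    using ab mult_strict_right_mono[OF ab, of "1 + real n"] by (auto simp: h_def field_simps)
  have hm: "h n \<le> h m" if "m \<le> n" for m n
    unfolding h_def using ab that by (intro divide_left_mono) auto
  have h0: "h \<longlonglongrightarrow> 0" unfolding h_def by real_asymp
  let ?I = "\<lambda>n. {a + h n..b - h n}"
  have sub: "?I n \<subseteq> {a<..<b}" for n using h(1)[of n] by auto
  have Imono: "?I m \<subseteq> ?I n" if "m \<le> n" for m n using hm[OF that] by auto
  have cover: "\<exists>n. x \<in> ?I n" if "x \<in> {a<..<b}" for x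
  proof -
    have "\<forall>\<^sub>F n in sequentially. h n < min (x - a) (b - x)"
      using h0 by (rule order_tendstoD(2)) (use that in auto)
    then obtain n where "h n < min (x - a) (b - x)" unfolding eventually_sequentially by blast
    then show ?thesis by (intro exI[of _ n]) auto
  qed
  have UI: "(\<Union>n. ?I n) = {a<..<b}" using cover sub by blast
  have gmono: "g x < g y" if "x \<in> {a<..<b}" "y \<in> {a<..<b}" "x < y" for x y
    by (rule DERIV_pos_imp_increasing[OF that(3)]) (use that g pos in \<open>metis greaterThanLessThan_iff le_less_trans less_le_trans\<close>)
  have gI: "g ` ?I n = {g (a + h n)..g (b - h n)}" for n
  proof (rule antisym)
    show "g ` ?I n \<subseteq> {g (a + h n)..g (b - h n)}"
    proof
      fix y assume "y \<in> g ` ?I n"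
      then obtain x where x: "x \<in> ?I n" "y = g x" by blast
      have "g (a + h n) \<le> g x" using gmono[of "a + h n" x] x sub[of n] h[of n] by (cases "a + h n = x") force+
      moreover have "g x \<le> g (b - h n)" using gmono[of x "b - h n"] x sub[of n] h[of n] by (cases "x = b - h n") force+
      ultimately show "y \<in> {g (a + h n)..g (b - h n)}" using x by simp
    qed
    show "{g (a + h n)..g (b - h n)} \<subseteq> g ` ?I n"
    proof
      fix y assume y: "y \<in> {g (a + h n)..g (b - h n)}"
      have "continuous_on (?I n) g"
        by (rule DERIV_continuous_on[where D = g'], rule has_field_derivative_at_within, rule g) (use sub[of n] in blast)
      then obtain x where "a + h n \<le> x" "x \<le> b - h n" "g x = y"
        using IVT'[of g "a + h n" y "b - h n"] y h[of n] by auto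
      then show "y \<in> g ` ?I n" by auto
    qed
  qed
  have US: "(\<Union>n. {g (a + h n)..g (b - h n)}) = S"
    unfolding gI[symmetric] img[symmetric] UI[symmetric] by blast
  have step: "(\<integral>\<^sup>+x. f x * indicator {g (a + h n)..g (b - h n)} x \<partial>lborel) =
      (\<integral>\<^sup>+x. f (g x) * ennreal (g' x) * indicator (?I n) x \<partial>lborel)" for n
  proof (rule nn_integral_substitution_aux)
    show "(g has_real_derivative g' x) (at x)" if "x \<in> ?I n" for x using g that sub[of n] by blast
    show "continuous_on (?I n) g'" by (rule continuous_on_subset[OF g' sub])
    show "0 \<le> g' x" if "x \<in> ?I n" for x using pos[of x] that sub[of n] by force
    show "a + h n < b - h n" using h(2)[of n] by simp
  qed auto
  have SUPind: "(SUP n. k x * indicator (A n) x) = k x * indicator (\<Union>n. A n) x" if "incseq A"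
    for A :: "nat \<Rightarrow> real set" and k :: "real \<Rightarrow> ennreal" and x
  proof -
    have "(SUP n. indicator (A n) x) = (indicator (\<Union>n. A n) x :: ennreal)"
    proof (rule SUP_eqI)
      show "indicator (A n) x \<le> (indicator (\<Union>n. A n) x :: ennreal)" for n
        by (auto split: split_indicator)
      fix y :: ennreal assume y: "\<And>n. n \<in> UNIV \<Longrightarrow> indicator (A n) x \<le> y"
      show "indicator (\<Union>n. A n) x \<le> y"
      proof (cases "x \<in> (\<Union>n. A n)")
        case True
        then obtain n where "x \<in> A n" by blast
        then show ?thesis using y[of n] True by simp
      qed simp
    qed
    then show ?thesis by (simp add: SUP_mult_left_ennreal[symmetric])
  qed
  have inc: "incseq (\<lambda>n x. k x * indicator (A n) x)" if A: "incseq A" for A :: "nat \<Rightarrow> real set" and k :: "real \<Rightarrow> ennreal"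
  proof (intro monoI le_funI mult_left_mono)
    fix m n :: nat and x assume "m \<le> n"
    then have "A m \<subseteq> A n" by (rule monoD[OF A])
    then show "indicator (A m) x \<le> (indicator (A n) x :: ennreal)" by (auto split: split_indicator)
  qed simp
  have inc1: "incseq ?I" by (rule monoI) (rule Imono)
  have inc2: "incseq (\<lambda>n. {g (a + h n)..g (b - h n)})"
    unfolding gI[symmetric] by (rule monoI) (rule image_mono[OF Imono])
  have "(\<integral>\<^sup>+x. f x * indicator S x \<partial>lborel) = (\<integral>\<^sup>+x. (SUP n. f x * indicator {g (a + h n)..g (b - h n)} x) \<partial>lborel)"
    unfolding SUPind[OF inc2] US ..
  also have "\<dots> = (SUP n. \<integral>\<^sup>+x. f x * indicator {g (a + h n)..g (b - h n)} x \<partial>lborel)"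
    by (rule nn_integral_monotone_convergence_SUP[OF inc[OF inc2]]) measurable
  also have "\<dots> = (SUP n. \<integral>\<^sup>+x. f (g x) * ennreal (g' x) * indicator (?I n) x \<partial>lborel)"
    unfolding step ..
  also have "\<dots> = (\<integral>\<^sup>+x. (SUP n. f (g x) * ennreal (g' x) * indicator (?I n) x) \<partial>lborel)"
    by (rule nn_integral_monotone_convergence_SUP[OF inc[OF inc1], symmetric]) measurable
  also have "\<dots> = (\<integral>\<^sup>+x. f (g x) * ennreal (g' x) * indicator {a<..<b} x \<partial>lborel)"
    unfolding SUPind[OF inc1, of "\<lambda>x. f (g x) * ennreal (g' x)"] UI ..
  finally show ?thesis .
qed

lemma tan_image_Ioo: "(\<lambda>x. c * tan x) ` {-(pi/2)<..<pi/2} = UNIV" if "c > 0" for c :: real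
proof -
  have "y \<in> (\<lambda>x. c * tan x) ` {-(pi/2)<..<pi/2}" for y
    by (rule image_eqI[of _ _ "arctan (y / c)"]) (use that arctan_lbound arctan_ubound in \<open>auto simp: tan_arctan\<close>)
  then show ?thesis by auto
qed

text \<open>Polar coordinates by one-dimensional substitutions only: x = y tan psi for fixed height
  y, then y = r cos psi for fixed psi, and finally phi = pi / 2 - psi. Since y is positive, psi runs
  through the full range of the tangent.\<close>

lemma nn_integral_half_plane_polar:
  fixes F :: "real \<times> real \<Rightarrow> ennreal"
  assumes F[measurable]: "F \<in> borel_measurable (borel \<Otimes>\<^sub>M borel)"
  shows "(\<integral>\<^sup>+y. (\<integral>\<^sup>+x. F (x, y) \<partial>lborel) * indicator {0<..} y \<partial>lborel)
    = (\<integral>\<^sup>+\<phi>. (\<integral>\<^sup>+r. F (r * cos \<phi>, r * sin \<phi>) * ennreal r * indicator {0<..} r \<partial>lborel) * indicator {0<..<pi} \<phi> \<partial>lborel)"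
proof -
  let ?J = "{-(pi/2)<..<pi/2}"
  have tan_meas[measurable]: "tan \<in> borel_measurable (borel :: real measure)"
    unfolding tan_def[abs_def] by measurable
  have inner: "(\<integral>\<^sup>+x. F (x, y) \<partial>lborel) = (\<integral>\<^sup>+\<psi>. F (y * tan \<psi>, y) * ennreal (y / (cos \<psi>)\<^sup>2) * indicator ?J \<psi> \<partial>lborel)"
    if y: "y > 0" for y
  proof -
    have "(\<integral>\<^sup>+x. F (x, y) * indicator UNIV x \<partial>lborel) = (\<integral>\<^sup>+\<psi>. F (y * tan \<psi>, y) * ennreal (y / (cos \<psi>)\<^sup>2) * indicator ?J \<psi> \<partial>lborel)"
    proof (rule nn_integral_substitution_open)
      have cz: "cos \<psi> > 0" if "\<psi> \<in> ?J" for \<psi> using that by (auto intro!: cos_gt_zero_pi)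
      show "((\<lambda>\<psi>. y * tan \<psi>) has_real_derivative y / (cos \<psi>)\<^sup>2) (at \<psi>)" if "\<psi> \<in> ?J" for \<psi>
        using cz[OF that] by (auto intro!: derivative_eq_intros simp: field_simps)
      show "continuous_on ?J (\<lambda>\<psi>. y / (cos \<psi>)\<^sup>2)"
        by (intro continuous_intros) (use cz in force)
      show "0 < y / (cos \<psi>)\<^sup>2" if "\<psi> \<in> ?J" for \<psi> using cz[OF that] y by simp
      show "(\<lambda>\<psi>. y * tan \<psi>) ` ?J = UNIV" by (rule tan_image_Ioo[OF y])
    qed auto
    then show ?thesis by simp
  qed
  have "(\<integral>\<^sup>+y. (\<integral>\<^sup>+x. F (x, y) \<partial>lborel) * indicator {0<..} y \<partial>lborel)
    = (\<integral>\<^sup>+y. \<integral>\<^sup>+\<psi>. F (y * tan \<psi>, y) * ennreal (y / (cos \<psi>)\<^sup>2) * indicator ?J \<psi> * indicator {0<..} y \<partial>lborel \<partial>lborel)"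
    by (intro nn_integral_cong) (auto simp: inner nn_integral_multc[symmetric] split: split_indicator)
  also have "\<dots> = (\<integral>\<^sup>+\<psi>. \<integral>\<^sup>+y. F (y * tan \<psi>, y) * ennreal (y / (cos \<psi>)\<^sup>2) * indicator ?J \<psi> * indicator {0<..} y \<partial>lborel \<partial>lborel)"
    by (rule lborel_pair.Fubini') measurable
  also have "\<dots> = (\<integral>\<^sup>+\<psi>. (\<integral>\<^sup>+r. F (r * sin \<psi>, r * cos \<psi>) * ennreal r * indicator {0<..} r \<partial>lborel) * indicator ?J \<psi> \<partial>lborel)"
  proof (intro nn_integral_cong)
    fix \<psi> :: real
    show "(\<integral>\<^sup>+y. F (y * tan \<psi>, y) * ennreal (y / (cos \<psi>)\<^sup>2) * indicator ?J \<psi> * indicator {0<..} y \<partial>lborel)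
      = (\<integral>\<^sup>+r. F (r * sin \<psi>, r * cos \<psi>) * ennreal r * indicator {0<..} r \<partial>lborel) * indicator ?J \<psi>"
    proof (cases "\<psi> \<in> ?J")
      case True
      then have c: "cos \<psi> > 0" by (auto intro!: cos_gt_zero_pi)
      have "(\<integral>\<^sup>+y. F (y * tan \<psi>, y) * ennreal (y / (cos \<psi>)\<^sup>2) * indicator {0<..} y \<partial>lborel)
        = ennreal \<bar>cos \<psi>\<bar> * (\<integral>\<^sup>+r. F ((0 + cos \<psi> * r) * tan \<psi>, 0 + cos \<psi> * r) * ennreal ((0 + cos \<psi> * r) / (cos \<psi>)\<^sup>2) * indicator {0<..} (0 + cos \<psi> * r) \<partial>lborel)"
        using c by (intro nn_integral_real_affine) auto
      also have "\<dots> = (\<integral>\<^sup>+r. ennreal (cos \<psi>) * (F (r * sin \<psi>, r * cos \<psi>) * ennreal (r / cos \<psi>) * indicator {0<..} r) \<partial>lborel)"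
        using c by (subst nn_integral_cmult[symmetric])
          (auto intro!: nn_integral_cong simp: tan_def power2_eq_square zero_less_mult_iff field_simps split: split_indicator)
      also have "\<dots> = (\<integral>\<^sup>+r. F (r * sin \<psi>, r * cos \<psi>) * ennreal r * indicator {0<..} r \<partial>lborel)"
      proof (intro nn_integral_cong)
        fix r :: real
        have eq: "ennreal (cos \<psi>) * ennreal (r / cos \<psi>) = ennreal r"
          using c by (subst ennreal_mult'[symmetric]) auto
        have "ennreal (cos \<psi>) * (F (r * sin \<psi>, r * cos \<psi>) * ennreal (r / cos \<psi>) * indicator {0<..} r)
           = F (r * sin \<psi>, r * cos \<psi>) * (ennreal (cos \<psi>) * ennreal (r / cos \<psi>)) * indicator {0<..} r"
          by (simp only: mult_ac)
        then show "ennreal (cos \<psi>) * (F (r * sin \<psi>, r * cos \<psi>) * ennreal (r / cos \<psi>) * indicator {0<..} r)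
           = F (r * sin \<psi>, r * cos \<psi>) * ennreal r * indicator {0<..} r"
          by (simp only: eq)
      qed
      finally show ?thesis using True by simp
    qed simp
  qed
  also have "\<dots> = ennreal \<bar>-1\<bar> * (\<integral>\<^sup>+\<phi>. (\<integral>\<^sup>+r. F (r * sin (pi/2 + -1 * \<phi>), r * cos (pi/2 + -1 * \<phi>)) * ennreal r * indicator {0<..} r \<partial>lborel) * indicator ?J (pi/2 + -1 * \<phi>) \<partial>lborel)"
    by (rule nn_integral_real_affine) auto
  also have "\<dots> = (\<integral>\<^sup>+\<phi>. (\<integral>\<^sup>+r. F (r * cos \<phi>, r * sin \<phi>) * ennreal r * indicator {0<..} r \<partial>lborel) * indicator {0<..<pi} \<phi> \<partial>lborel)"
    by (simp add: sin_diff cos_diff) (intro nn_integral_cong, auto split: split_indicator)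
  finally show ?thesis .
qed

text \<open>The lower half-plane is the image of the upper one under the point reflection z to -z,
  which shifts the angle by pi. The line between them is a null set.\<close>

lemma polar_plane:
  fixes f :: "real \<times> real \<Rightarrow> ennreal"
  assumes f[measurable]: "f \<in> borel_measurable borel"
  shows "(\<integral>\<^sup>+z. f z \<partial>lborel) = (\<integral>\<^sup>+\<phi>. (\<integral>\<^sup>+r. f (polar r \<phi>) * ennreal r * indicator {0<..} r \<partial>lborel) * indicator {0<..<2*pi} \<phi> \<partial>lborel)"
proof -
  have fm[measurable]: "f \<in> borel_measurable (borel \<Otimes>\<^sub>M borel)" using f by (simp add: borel_prod)
  define G where "G \<phi> = (\<integral>\<^sup>+r. f (r * cos \<phi>, r * sin \<phi>) * ennreal r * indicator {0<..} r \<partial>lborel)" for \<phi>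
  have G[measurable]: "G \<in> borel_measurable borel" unfolding G_def by measurable
  have "(\<integral>\<^sup>+z. f z \<partial>lborel) = (\<integral>\<^sup>+y. \<integral>\<^sup>+x. f (x, y) \<partial>lborel \<partial>lborel)"
    unfolding lborel_prod[symmetric] by (rule lborel_pair.nn_integral_snd[symmetric]) measurable
  also have "\<dots> = (\<integral>\<^sup>+y. (\<integral>\<^sup>+x. f (x, y) \<partial>lborel) * indicator {0<..} y + (\<integral>\<^sup>+x. f (x, y) \<partial>lborel) * indicator {..<0} y \<partial>lborel)"
  proof (rule nn_integral_cong_AE)
    have "AE y in lborel. y \<noteq> (0::real)" by (rule AE_lborel_singleton)
    then show "AE y in lborel. (\<integral>\<^sup>+x. f (x, y) \<partial>lborel) = (\<integral>\<^sup>+x. f (x, y) \<partial>lborel) * indicator {0<..} y + (\<integral>\<^sup>+x. f (x, y) \<partial>lborel) * indicator {..<0} y"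
      by eventually_elim (auto split: split_indicator)
  qed
  also have "\<dots> = (\<integral>\<^sup>+y. (\<integral>\<^sup>+x. f (x, y) \<partial>lborel) * indicator {0<..} y \<partial>lborel) + (\<integral>\<^sup>+y. (\<integral>\<^sup>+x. f (x, y) \<partial>lborel) * indicator {..<0} y \<partial>lborel)"
    by (rule nn_integral_add) measurable
  also have "(\<integral>\<^sup>+y. (\<integral>\<^sup>+x. f (x, y) \<partial>lborel) * indicator {0<..} y \<partial>lborel) = (\<integral>\<^sup>+\<phi>. G \<phi> * indicator {0<..<pi} \<phi> \<partial>lborel)"
    unfolding G_def by (rule nn_integral_half_plane_polar[OF fm])
  also have "(\<integral>\<^sup>+y. (\<integral>\<^sup>+x. f (x, y) \<partial>lborel) * indicator {..<0} y \<partial>lborel)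
     = (\<integral>\<^sup>+y. (\<integral>\<^sup>+x. (\<lambda>z. f (- fst z, - snd z)) (x, y) \<partial>lborel) * indicator {0<..} y \<partial>lborel)"
  proof -
    have 1: "(\<integral>\<^sup>+x. f (x, y) \<partial>lborel) = (\<integral>\<^sup>+x. f (- x, y) \<partial>lborel)" for y
      using nn_integral_real_affine[of "\<lambda>x. f (x, y)" "-1" 0] by simp
    have "(\<integral>\<^sup>+y. (\<integral>\<^sup>+x. f (x, y) \<partial>lborel) * indicator {..<0} y \<partial>lborel) = (\<integral>\<^sup>+y. (\<integral>\<^sup>+x. f (x, - y) \<partial>lborel) * indicator {..<0} (- y) \<partial>lborel)"
      using nn_integral_real_affine[of "\<lambda>y. (\<integral>\<^sup>+x. f (x, y) \<partial>lborel) * indicator {..<0} y" "-1" 0] by simp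
    then show ?thesis using 1 by (auto intro!: nn_integral_cong split: split_indicator)
  qed
  also have "\<dots> = (\<integral>\<^sup>+\<phi>. G (pi + 1 * \<phi>) * indicator {pi<..<2*pi} (pi + 1 * \<phi>) \<partial>lborel)"
  proof (subst nn_integral_half_plane_polar)
    show "(\<lambda>z. f (- fst z, - snd z)) \<in> borel_measurable (borel \<Otimes>\<^sub>M borel)" by measurable
  qed (auto intro!: nn_integral_cong simp: G_def split: split_indicator)
  also have "\<dots> = (\<integral>\<^sup>+\<phi>. G \<phi> * indicator {pi<..<2*pi} \<phi> \<partial>lborel)"
    using nn_integral_real_affine[of "\<lambda>\<phi>. G \<phi> * indicator {pi<..<2*pi} \<phi>" 1 pi] by simp
  also have "(\<integral>\<^sup>+\<phi>. G \<phi> * indicator {0<..<pi} \<phi> \<partial>lborel) + (\<integral>\<^sup>+\<phi>. G \<phi> * indicator {pi<..<2*pi} \<phi> \<partial>lborel)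
     = (\<integral>\<^sup>+\<phi>. G \<phi> * indicator {0<..<pi} \<phi> + G \<phi> * indicator {pi<..<2*pi} \<phi> \<partial>lborel)"
    by (rule nn_integral_add[symmetric]) measurable
  also have "\<dots> = (\<integral>\<^sup>+\<phi>. G \<phi> * indicator {0<..<2*pi} \<phi> \<partial>lborel)"
  proof (rule nn_integral_cong_AE)
    have "AE \<phi> in lborel. \<phi> \<noteq> pi" by (rule AE_lborel_singleton)
    then show "AE \<phi> in lborel. G \<phi> * indicator {0<..<pi} \<phi> + G \<phi> * indicator {pi<..<2*pi} \<phi> = G \<phi> * indicator {0<..<2*pi} \<phi>"
      by eventually_elim (auto split: split_indicator)
  qed
  finally show ?thesis by (simp add: G_def polar_def)
qed

lemma polar_inj:
  assumes "r > 0" "s > 0" "\<phi> \<in> {0<..<2*pi}" "\<psi> \<in> {0<..<2*pi}" "polar r \<phi> = polar s \<psi>"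
  shows "\<phi> = \<psi>"
proof -
  have e: "r * cos \<phi> = s * cos \<psi>" "r * sin \<phi> = s * sin \<psi>" using assms(5) by (auto simp: polar_def)
  have "r\<^sup>2 = (r * cos \<phi>)\<^sup>2 + (r * sin \<phi>)\<^sup>2" by (simp add: power_mult_distrib distrib_left[symmetric])
  also have "\<dots> = s\<^sup>2" unfolding e by (simp add: power_mult_distrib distrib_left[symmetric])
  finally have "r = s" using assms(1,2) by (simp add: power2_eq_iff)
  then have "cos \<phi> = cos \<psi>" "sin \<phi> = sin \<psi>" using e assms(1) by auto
  then have "cos (\<phi> - \<psi>) = 1" by (simp add: cos_diff power2_eq_square[symmetric])
  then obtain n :: int where n: "\<phi> - \<psi> = of_int n * 2 * pi" using cos_one_2pi_int by blast
  have "\<bar>of_int n * 2 * pi\<bar> < 1 * 2 * pi" unfolding n[symmetric] using assms(3,4) by auto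
  then have "\<bar>of_int n :: real\<bar> < 1" by (simp add: abs_mult)
  then have "n = 0" by linarith
  then show ?thesis using n by simp
qed

lemma polar_wedge_iff:
  assumes "0 < r" "\<phi> \<in> {0<..<2*pi}" "\<alpha> \<le> 2 * pi"
  shows "polar r \<phi> \<in> wedge \<alpha> \<longleftrightarrow> \<phi> < \<alpha>"
proof
  assume "polar r \<phi> \<in> wedge \<alpha>"
  then obtain s \<psi> where s: "polar r \<phi> = polar s \<psi>" "0 < s" "0 < \<psi>" "\<psi> < \<alpha>" unfolding wedge_def by blast
  have "\<phi> = \<psi>" by (rule polar_inj[OF assms(1) s(2) assms(2) _ s(1)]) (use s assms in auto)
  then show "\<phi> < \<alpha>" using s by simp
qed (use assms in \<open>auto simp: wedge_def\<close>)

lemma nn_integral_wedge_polar: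
  fixes f :: "real \<times> real \<Rightarrow> ennreal"
  assumes [measurable]: "f \<in> borel_measurable borel" "wedge \<alpha> \<in> sets borel" and a: "\<alpha> \<le> 2 * pi"
  shows "(\<integral>\<^sup>+z. f z * indicator (wedge \<alpha>) z \<partial>lborel) = (\<integral>\<^sup>+\<phi>. (\<integral>\<^sup>+r. f (polar r \<phi>) * ennreal r * indicator {0<..} r \<partial>lborel) * indicator {0<..<\<alpha>} \<phi> \<partial>lborel)"
proof -
  have "(\<integral>\<^sup>+z. f z * indicator (wedge \<alpha>) z \<partial>lborel) = (\<integral>\<^sup>+\<phi>. (\<integral>\<^sup>+r. (f (polar r \<phi>) * indicator (wedge \<alpha>) (polar r \<phi>)) * ennreal r * indicator {0<..} r \<partial>lborel) * indicator {0<..<2*pi} \<phi> \<partial>lborel)"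
    by (rule polar_plane) measurable
  also have "\<dots> = (\<integral>\<^sup>+\<phi>. (\<integral>\<^sup>+r. f (polar r \<phi>) * ennreal r * indicator {0<..} r \<partial>lborel) * indicator {0<..<\<alpha>} \<phi> \<partial>lborel)"
  proof (intro nn_integral_cong)
    fix \<phi> :: real
    show "(\<integral>\<^sup>+r. (f (polar r \<phi>) * indicator (wedge \<alpha>) (polar r \<phi>)) * ennreal r * indicator {0<..} r \<partial>lborel) * indicator {0<..<2*pi} \<phi>
       = (\<integral>\<^sup>+r. f (polar r \<phi>) * ennreal r * indicator {0<..} r \<partial>lborel) * indicator {0<..<\<alpha>} \<phi>"
    proof (cases "\<phi> \<in> {0<..<2*pi}")
      case True
      have "f (polar r \<phi>) * indicator (wedge \<alpha>) (polar r \<phi>) * ennreal r * indicator {0<..} r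
         = f (polar r \<phi>) * ennreal r * indicator {0<..} r * indicator {0<..<\<alpha>} \<phi>" for r
        using polar_wedge_iff[OF _ True a, of r] True by (auto split: split_indicator)
      then show ?thesis using True by (auto split: split_indicator)
    qed (use a in \<open>auto split: split_indicator\<close>)
  qed
  finally show ?thesis .
qed

subsection \<open>The double angular integral\<close>

lemma antiderivative_ex:
  fixes F :: "real \<Rightarrow> real"
  assumes F: "continuous_on UNIV F"
  obtains F1 where "\<And>x. (F1 has_real_derivative F x) (at x)" "F1 0 = 0"
proof -
  define F1 where "F1 u = (LBINT y=ereal 0..ereal u. F y)" for u :: real
  show ?thesis
  proof (rule that[of F1])
    fix x :: real
    define a b where "a = min 0 x - 1" and "b = max 0 x + 1"
    have "((\<lambda>u. LBINT s=ereal 0..u. F s) has_vector_derivative F x) (at x within {a..b})"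
      by (intro interval_integral_FTC2 continuous_on_subset[OF F]) (auto simp: a_def b_def)
    moreover have "at x within {a..b} = at x" by (rule at_within_interior) (auto simp: a_def b_def)
    ultimately have "((\<lambda>u. LBINT s=ereal 0..u. F s) has_vector_derivative F x) (at x)" by simp
    then show "(F1 has_real_derivative F x) (at x)"
      by (simp add: has_real_derivative_iff_has_vector_derivative F1_def[abs_def] zero_ereal_def)
  next
    show "F1 0 = 0" by (simp add: F1_def zero_ereal_def[symmetric])
  qed
qed

text \<open>Unordered interval: the angle 2 alpha can lie on either side of 2 pi.\<close>

definition between :: "real \<Rightarrow> real \<Rightarrow> real set" where
  "between b c = {min b c..max b c}"

text \<open>Integration by parts. The absolute value makes the formula the same in both orders of b
  and c: the weight and the orientation change sign together.\<close>

lemma integral_weight: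
  fixes F F1 F2 :: "real \<Rightarrow> real"
  assumes F1: "\<And>x. x \<in> between b c \<Longrightarrow> (F1 has_real_derivative F x) (at x)" and F2: "\<And>x. x \<in> between b c \<Longrightarrow> (F2 has_real_derivative F1 x) (at x)"
  shows "((\<lambda>x. \<bar>b - x\<bar> * F x) has_integral (F2 b - F2 c - (b - c) * F1 c)) (between b c)"
proof -
  have D: "((\<lambda>x. (b - x) * F1 x + F2 x) has_real_derivative (b - x) * F x) (at x)" if "x \<in> between b c" for x
    using DERIV_add[OF DERIV_mult[OF DERIV_diff[OF DERIV_const DERIV_ident] F1[OF that]] F2[OF that], of b]
    by (simp add: algebra_simps)
  have V: "((\<lambda>x. (b - x) * F1 x + F2 x) has_vector_derivative (b - x) * F x) (at x within between b c)" if "x \<in> between b c" for x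
    using D[OF that] by (meson has_field_derivative_at_within has_real_derivative_iff_has_vector_derivative)
  show ?thesis
  proof (cases "c \<le> b")
    case True
    then have bt: "between b c = {c..b}" by (auto simp: between_def)
    have "((\<lambda>x. (b - x) * F x) has_integral ((b - b) * F1 b + F2 b - ((b - c) * F1 c + F2 c))) {c..b}"
      by (rule fundamental_theorem_of_calculus[OF True]) (use V bt in auto)
    then have "((\<lambda>x. (b - x) * F x) has_integral (F2 b - F2 c - (b - c) * F1 c)) {c..b}" by (simp add: algebra_simps)
    then show ?thesis unfolding bt by (rule has_integral_eq[rotated]) auto
  next
    case False
    then have cb: "b \<le> c" and bt: "between b c = {b..c}" by (auto simp: between_def)
    have "((\<lambda>x. (b - x) * F x) has_integral ((b - c) * F1 c + F2 c - ((b - b) * F1 b + F2 b))) {b..c}"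
      by (rule fundamental_theorem_of_calculus[OF cb]) (use V bt in auto)
    from has_integral_neg[OF this]
    have "((\<lambda>x. - ((b - x) * F x)) has_integral (F2 b - F2 c - (b - c) * F1 c)) {b..c}" by (simp add: algebra_simps)
    then show ?thesis unfolding bt by (rule has_integral_eq[rotated]) (auto simp: algebra_simps)
  qed
qed

text \<open>Taylor's integral remainder: the value at b of a second antiderivative of F, minus its
  tangent at 2 pi.\<close>

definition weight_int :: "(real \<Rightarrow> real) \<Rightarrow> real \<Rightarrow> real" where
  "weight_int F b = integral (between b (2 * pi)) (\<lambda>x. \<bar>b - x\<bar> * F x)"

text \<open>The double angular integral only involves the second antiderivative of \<open>F\<close>. It is rewritten
  so that \<open>F\<close> itself is only integrated away from its maximum at \<open>0\<close>.\<close>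

lemma angular_decomposition:
  fixes F F0 :: "real \<Rightarrow> real"
  assumes F: "continuous_on UNIV F" and even: "\<And>x. F (- x) = F x" and F0: "\<And>x. F x + F (2 * pi - x) = F0 x"
    and a: "0 \<le> a"
  shows "integral {0..a} (\<lambda>p. integral {0..a} (\<lambda>q. F (p - q) - F (p + q))) =
    (2 * a - 3 * pi) * integral {0..pi} F0 + 3 * integral {0..pi} (\<lambda>x. (pi - x) * F0 x)
     - 6 * weight_int F pi + 4 * weight_int F a - weight_int F (2 * a)"
proof -
  obtain F1 where F1: "\<And>x. (F1 has_real_derivative F x) (at x)" "F1 0 = 0" using antiderivative_ex[OF F] by blast
  have F1c: "continuous_on UNIV F1" using F1 by (intro DERIV_continuous_on) auto
  obtain F2 where F2: "\<And>x. (F2 has_real_derivative F1 x) (at x)" "F2 0 = 0" using antiderivative_ex[OF F1c] by blast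
  have F1odd: "F1 (- x) = - F1 x" for x
  proof -
    have "((\<lambda>y. F1 (- y) + F1 y) has_real_derivative 0) (at z)" for z
      using DERIV_add[OF DERIV_chain2[OF F1(1) DERIV_minus[OF DERIV_ident]] F1(1), of z] by (simp add: even)
    then show ?thesis using DERIV_isconst_all[of "\<lambda>y. F1 (- y) + F1 y" x 0] F1(2) by simp
  qed
  have F2even: "F2 (- x) = F2 x" for x
  proof -
    have "((\<lambda>y. F2 (- y) - F2 y) has_real_derivative 0) (at z)" for z
      using DERIV_diff[OF DERIV_chain2[OF F2(1) DERIV_minus[OF DERIV_ident]] F2(1), of z] by (simp add: F1odd)
    then show ?thesis using DERIV_isconst_all[of "\<lambda>y. F2 (- y) - F2 y" x 0] F2(2) by simp
  qed
  have FTC: "integral {u..v} g' = g v - g u" if "u \<le> v" "\<And>x. (g has_real_derivative g' x) (at x)" for u v and g g' :: "real \<Rightarrow> real"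
    using fundamental_theorem_of_calculus[OF that(1), of g g'] that(2)
    by (auto intro!: integral_unique simp: has_real_derivative_iff_has_vector_derivative[symmetric] intro: has_field_derivative_at_within)
  have in1: "integral {0..a} (\<lambda>q. F (p - q) - F (p + q)) = 2 * F1 p - F1 (p - a) - F1 (p + a)" for p
  proof -
    have "((\<lambda>q. - F1 (p - q) - F1 (p + q)) has_real_derivative F (p - q) - F (p + q)) (at q)" for q
    proof -
      have d1: "((\<lambda>q. F1 (p - q)) has_real_derivative F (p - q) * (0 - 1)) (at q)"
        by (rule DERIV_chain2[OF F1(1) DERIV_diff[OF DERIV_const DERIV_ident]])
      have d2: "((\<lambda>q. F1 (p + q)) has_real_derivative F (p + q) * (0 + 1)) (at q)"
        by (rule DERIV_chain2[OF F1(1) DERIV_add[OF DERIV_const DERIV_ident]])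
      show ?thesis using DERIV_diff[OF DERIV_minus[OF d1] d2] by simp
    qed
    from FTC[OF a this] show ?thesis by simp
  qed
  \<comment> \<open>By evenness and F2(0) = 0 the end p = a contributes 2 F2(a) - F2(2 a) and the
    end p = 0 contributes -2 F2(a) with a minus sign, in total 4 F2(a) - F2(2 a).\<close>
  have "((\<lambda>p. 2 * F2 p - F2 (p - a) - F2 (p + a)) has_real_derivative 2 * F1 p - F1 (p - a) - F1 (p + a)) (at p)" for p
  proof -
    have d1: "((\<lambda>p. F2 (p - a)) has_real_derivative F1 (p - a) * (1 - 0)) (at p)"
      by (rule DERIV_chain2[OF F2(1) DERIV_diff[OF DERIV_ident DERIV_const]])
    have d2: "((\<lambda>p. F2 (p + a)) has_real_derivative F1 (p + a) * (1 + 0)) (at p)"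
      by (rule DERIV_chain2[OF F2(1) DERIV_add[OF DERIV_ident DERIV_const]])
    show ?thesis using DERIV_diff[OF DERIV_diff[OF DERIV_cmult[OF F2(1), of 2 p] d1] d2] by simp
  qed
  from FTC[OF a this]
  have L: "integral {0..a} (\<lambda>p. integral {0..a} (\<lambda>q. F (p - q) - F (p + q))) = 4 * F2 a - F2 (2 * a)"
    unfolding in1 by (simp add: F2even F2(2))
  have W: "weight_int F b = F2 b - F2 (2 * pi) - (b - 2 * pi) * F1 (2 * pi)" for b
    unfolding weight_int_def by (rule integral_unique[OF integral_weight[OF F1(1) F2(1)]])
  have F0': "F0 = (\<lambda>x. F x + F (2 * pi - x))" using F0 by auto
  have D1: "((\<lambda>x. F1 x - F1 (2 * pi - x)) has_real_derivative F0 x) (at x)" for x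
  proof -
    have "((\<lambda>q. F1 (2 * pi - q)) has_real_derivative F (2 * pi - x) * (0 - 1)) (at x)"
      by (rule DERIV_chain2[OF F1(1) DERIV_diff[OF DERIV_const DERIV_ident]])
    from DERIV_diff[OF F1(1)[of x] this] show ?thesis by (simp add: F0')
  qed
  have I0: "integral {0..pi} F0 = F1 (2 * pi)"
    using FTC[OF _ D1, of 0 pi] by (simp add: F1(2))
  have D2: "((\<lambda>x. F2 x + F2 (2 * pi - x)) has_real_derivative F1 x - F1 (2 * pi - x)) (at x)" for x
  proof -
    have "((\<lambda>q. F2 (2 * pi - q)) has_real_derivative F1 (2 * pi - x) * (0 - 1)) (at x)"
      by (rule DERIV_chain2[OF F2(1) DERIV_diff[OF DERIV_const DERIV_ident]])
    from DERIV_add[OF F2(1)[of x] this] show ?thesis by simp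
  qed
  have D3: "((\<lambda>x. (pi - x) * (F1 x - F1 (2 * pi - x)) + (F2 x + F2 (2 * pi - x))) has_real_derivative (pi - x) * F0 x) (at x)" for x
  proof -
    have "((\<lambda>x. pi - x) has_real_derivative 0 - 1) (at x)" by (rule DERIV_diff[OF DERIV_const DERIV_ident])
    from DERIV_add[OF DERIV_mult[OF this D1] D2] show ?thesis by (simp add: algebra_simps)
  qed
  have I1: "integral {0..pi} (\<lambda>x. (pi - x) * F0 x) = 2 * F2 pi + pi * F1 (2 * pi) - F2 (2 * pi)"
    using FTC[OF _ D3, of 0 pi] by (simp add: F1(2) F2(2))
  \<comment> \<open>Write I0 and I1 for the two integrals of F0, and W for
    \<open>weight_int F\<close>. \<open>I0\<close> is F1(2 pi), and \<open>I1\<close> together with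
    \<open>W\<close> at pi gives F2(2 pi) = I1 - 2 W(pi) + pi I0. It enters three times, which
    explains the factors 3 and -6.\<close>
  show ?thesis
    unfolding L I0 I1 W by (simp add: algebra_simps)
qed

subsection \<open>Radial integrals\<close>

lemma nn_integral_gaussian_4:
  assumes A: "A > 0"
  shows "(\<integral>\<^sup>+r. ennreal (r ^ 4 * exp (- (r\<^sup>2 * A))) * indicator {0<..} r \<partial>lborel) = ennreal (3 * sqrt pi / (8 * sqrt A ^ 5))"
proof -
  have g: "has_bochner_integral lborel (\<lambda>x. indicator {0..} x *\<^sub>R (exp (- x\<^sup>2) * x ^ 4)) (3 * sqrt pi / 8)"
    using gaussian_moment_even_pos[of 2] by (simp add: fact_numeral mult.commute)
  have "(\<integral>\<^sup>+x. ennreal (indicator {0..} x *\<^sub>R (exp (- x\<^sup>2) * x ^ 4)) \<partial>lborel) = ennreal (3 * sqrt pi / 8)"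
    using nn_integral_eq_integral[of lborel "\<lambda>x. indicator {0..} x *\<^sub>R (exp (- x\<^sup>2) * x ^ 4)"] g
    by (auto simp: has_bochner_integral_iff)
  also have "(\<integral>\<^sup>+x. ennreal (indicator {0..} x *\<^sub>R (exp (- x\<^sup>2) * x ^ 4)) \<partial>lborel) = (\<integral>\<^sup>+x. ennreal (x ^ 4 * exp (- x\<^sup>2)) * indicator {0<..} x \<partial>lborel)"
    by (intro nn_integral_cong) (auto split: split_indicator simp: mult.commute less_le)
  also have "\<dots> = ennreal \<bar>sqrt A\<bar> * (\<integral>\<^sup>+r. ennreal ((0 + sqrt A * r) ^ 4 * exp (- (0 + sqrt A * r)\<^sup>2)) * indicator {0<..} (0 + sqrt A * r) \<partial>lborel)"
    by (rule nn_integral_real_affine) (use A in auto)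
  also have "\<dots> = (\<integral>\<^sup>+r. ennreal (sqrt A ^ 5) * (ennreal (r ^ 4 * exp (- (r\<^sup>2 * A))) * indicator {0<..} r) \<partial>lborel)"
    using A
    by (subst nn_integral_cmult[symmetric])
       (auto intro!: nn_integral_cong simp: ennreal_mult'[symmetric] power_mult_distrib zero_less_mult_iff eval_nat_numeral mult_ac split: split_indicator)
  also have "\<dots> = ennreal (sqrt A ^ 5) * (\<integral>\<^sup>+r. ennreal (r ^ 4 * exp (- (r\<^sup>2 * A))) * indicator {0<..} r \<partial>lborel)"
    by (rule nn_integral_cmult) measurable
  finally have "ennreal (sqrt A ^ 5) * (\<integral>\<^sup>+r. ennreal (r ^ 4 * exp (- (r\<^sup>2 * A))) * indicator {0<..} r \<partial>lborel) = ennreal (3 * sqrt pi / 8)" by simp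
  then have "ennreal (1 / sqrt A ^ 5) * (ennreal (sqrt A ^ 5) * (\<integral>\<^sup>+r. ennreal (r ^ 4 * exp (- (r\<^sup>2 * A))) * indicator {0<..} r \<partial>lborel)) = ennreal (1 / sqrt A ^ 5) * ennreal (3 * sqrt pi / 8)"
    by simp
  moreover have "ennreal (1 / sqrt A ^ 5) * ennreal (sqrt A ^ 5) = 1"
    using A by (simp add: ennreal_mult'[symmetric])
  moreover have "ennreal (1 / sqrt A ^ 5) * ennreal (3 * sqrt pi / 8) = ennreal (3 * sqrt pi / (8 * sqrt A ^ 5))"
    using A by (simp add: ennreal_mult'[symmetric])
  ultimately show ?thesis by (simp add: mult.assoc[symmetric])
qed

text \<open>With u = w + b and D = a^2 - b^2 the integrand is (u^2 + D) to the power -5/2, which has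
  an algebraic antiderivative. The condition |b| < a makes D positive.\<close>

lemma nn_integral_inverse_5_halves:
  fixes a b :: real
  assumes ab: "\<bar>b\<bar> < a"
  shows "(\<integral>\<^sup>+w. ennreal (1 / sqrt (a\<^sup>2 + w\<^sup>2 + 2 * w * b) ^ 5) * indicator {0..} w \<partial>lborel) = ennreal ((2 * a + b) / (3 * a ^ 3 * (a + b)\<^sup>2))"
proof -
  define D where "D = a\<^sup>2 - b\<^sup>2"
  have "b\<^sup>2 < a\<^sup>2" using ab power_strict_mono[of "\<bar>b\<bar>" a 2] by simp
  then have D: "D > 0" by (simp add: D_def)
  have a: "a > 0" using ab by simp
  define X where "X w = a\<^sup>2 + w\<^sup>2 + 2 * w * b" for w
  have X: "X w = (w + b)\<^sup>2 + D" for w by (simp add: X_def D_def power2_eq_square algebra_simps)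
  have Xp: "X w > 0" for w using D by (simp add: X add_nonneg_pos)
  define F where "F w = (w + b) / (3 * D * sqrt (X w) ^ 3) + 2 * (w + b) / (3 * D\<^sup>2 * sqrt (X w))" for w
  have dX: "((\<lambda>w. sqrt (X w)) has_real_derivative (w + b) / sqrt (X w)) (at w)" for w
    unfolding X using Xp[of w] by (auto intro!: derivative_eq_intros simp: X field_simps)
  have dF: "(F has_real_derivative 1 / sqrt (X w) ^ 5) (at w)" for w
  proof -
    define q where "q = sqrt (X w)"
    define u where "u = w + b"
    have q: "q > 0" "q\<^sup>2 = u\<^sup>2 + D" using Xp[of w] by (auto simp: q_def u_def X)
    have du: "((\<lambda>w. w + b) has_real_derivative 1) (at w)" by (auto intro!: derivative_eq_intros)
    note d = dX[of w, folded q_def u_def]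
    have d3: "((\<lambda>w. 3 * D * sqrt (X w) ^ 3) has_real_derivative 3 * D * (3 * (u / q) * q\<^sup>2)) (at w)"
      using DERIV_cmult[OF DERIV_power[OF d, of 3], of "3 * D"] by (simp add: q_def mult_ac)
    have d1: "((\<lambda>w. 3 * D\<^sup>2 * sqrt (X w)) has_real_derivative 3 * D\<^sup>2 * (u / q)) (at w)"
      using DERIV_cmult[OF d, of "3 * D\<^sup>2"] by simp
    have "(F has_real_derivative (1 * (3 * D * q ^ 3) - u * (3 * D * (3 * (u / q) * q\<^sup>2))) / (3 * D * q ^ 3 * (3 * D * q ^ 3))
       + (2 * 1 * (3 * D\<^sup>2 * q) - 2 * u * (3 * D\<^sup>2 * (u / q))) / (3 * D\<^sup>2 * q * (3 * D\<^sup>2 * q))) (at w)"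
      unfolding F_def using DERIV_add[OF DERIV_divide[OF du d3] DERIV_divide[OF DERIV_cmult[OF du, of 2] d1]] q D
      by (simp add: q_def u_def)
    also have "(1 * (3 * D * q ^ 3) - u * (3 * D * (3 * (u / q) * q\<^sup>2))) / (3 * D * q ^ 3 * (3 * D * q ^ 3))
       + (2 * 1 * (3 * D\<^sup>2 * q) - 2 * u * (3 * D\<^sup>2 * (u / q))) / (3 * D\<^sup>2 * q * (3 * D\<^sup>2 * q))
       = (q\<^sup>2 - 3 * u\<^sup>2) / (3 * D * q ^ 5) + 2 * (q\<^sup>2 - u\<^sup>2) / (3 * D\<^sup>2 * q ^ 3)"
    proof -
      have 1: "(1 * (3 * D * q ^ 3) - u * (3 * D * (3 * (u / q) * q\<^sup>2))) / (3 * D * q ^ 3 * (3 * D * q ^ 3)) = (q\<^sup>2 - 3 * u\<^sup>2) / (3 * D * q ^ 5)"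
        using q(1) D by (simp add: divide_simps) (simp add: eval_nat_numeral algebra_simps)
      have 2: "(2 * 1 * (3 * D\<^sup>2 * q) - 2 * u * (3 * D\<^sup>2 * (u / q))) / (3 * D\<^sup>2 * q * (3 * D\<^sup>2 * q)) = 2 * (q\<^sup>2 - u\<^sup>2) / (3 * D\<^sup>2 * q ^ 3)"
        using q(1) D by (simp add: divide_simps) (simp add: eval_nat_numeral algebra_simps)
      show ?thesis unfolding 1 2 ..
    qed
    also have "\<dots> = 1 / q ^ 5"
    proof -
      have u2: "u\<^sup>2 = q\<^sup>2 - D" using q by simp
      have q5: "q ^ 5 = q ^ 3 * q\<^sup>2" by (simp add: eval_nat_numeral)
      have "(q\<^sup>2 - 3 * u\<^sup>2) / (3 * D * q ^ 5) = (3 * D - 2 * q\<^sup>2) / (3 * D * q ^ 5)" unfolding u2 by simp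
      moreover have "2 * (q\<^sup>2 - u\<^sup>2) / (3 * D\<^sup>2 * q ^ 3) = 2 * q\<^sup>2 / (3 * D * q ^ 5)"
        unfolding u2 q5 using q(1) D by (simp add: power2_eq_square)
      ultimately show ?thesis using q(1) D by (simp add: add_divide_distrib[symmetric])
    qed
    finally show ?thesis by (simp add: q_def)
  qed
  have "(F \<longlongrightarrow> 2 * inverse (D\<^sup>2) / 3) at_top"
    unfolding F_def X using D by real_asymp
  then have lim: "(F \<longlongrightarrow> 2 / (3 * D\<^sup>2)) at_top"
    by (simp add: field_simps)
  have "(\<integral>\<^sup>+w. ennreal (1 / sqrt (X w) ^ 5) * indicator {0..} w \<partial>lborel) = ennreal (2 / (3 * D\<^sup>2) - F 0)"
    by (rule nn_integral_FTC_atLeast[OF _ dF _ lim]) (use Xp in \<open>auto simp: X_def less_imp_le\<close>)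
  also have "2 / (3 * D\<^sup>2) - F 0 = (2 * a + b) / (3 * a ^ 3 * (a + b)\<^sup>2)"
  proof -
    have Df: "D = (a - b) * (a + b)" by (simp add: D_def power2_eq_square algebra_simps)
    have nz: "a - b > 0" "a + b > 0" using ab by auto
    have "sqrt (X 0) = a" using a by (simp add: X_def)
    then have "F 0 = b / (3 * D * a ^ 3) + 2 * b / (3 * D\<^sup>2 * a)" by (simp add: F_def)
    moreover have "b / (3 * D * a ^ 3) = b * D / (3 * D\<^sup>2 * a ^ 3)" using D by (simp add: power2_eq_square)
    moreover have "2 * b / (3 * D\<^sup>2 * a) = 2 * b * a\<^sup>2 / (3 * D\<^sup>2 * a ^ 3)" using a by (simp add: eval_nat_numeral)
    moreover have "2 / (3 * D\<^sup>2) = 2 * a ^ 3 / (3 * D\<^sup>2 * a ^ 3)" using a by simp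
    ultimately have "2 / (3 * D\<^sup>2) - F 0 = (2 * a ^ 3 - b * D - 2 * b * a\<^sup>2) / (3 * D\<^sup>2 * a ^ 3)"
      by (simp add: diff_divide_distrib add_divide_distrib)
    \<comment> \<open>The factor (a - b)^2 cancels against D^2 = (a - b)^2 (a + b)^2, so nothing
      singular remains as b approaches a.\<close>
    also have "2 * a ^ 3 - b * D - 2 * b * a\<^sup>2 = (a - b)\<^sup>2 * (2 * a + b)"
      unfolding D_def by (simp add: eval_nat_numeral algebra_simps)
    also have "(a - b)\<^sup>2 * (2 * a + b) / (3 * D\<^sup>2 * a ^ 3) = (2 * a + b) / (3 * a ^ 3 * (a + b)\<^sup>2)"
      unfolding Df power_mult_distrib using nz a by (simp add: field_simps)
    finally show ?thesis .
  qed
  finally show ?thesis by (simp add: X_def)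
qed

lemma tan_sq_image: "(\<lambda>x. (tan (x / 2))\<^sup>2) ` {0<..<pi} = {0<..}"
proof (intro antisym subsetI)
  fix y :: real assume "y \<in> {0<..}"
  then have y: "sqrt y > 0" "(sqrt y)\<^sup>2 = y" by auto
  show "y \<in> (\<lambda>x. (tan (x / 2))\<^sup>2) ` {0<..<pi}"
    by (rule image_eqI[of _ _ "2 * arctan (sqrt y)"]) (use y arctan_ubound[of "sqrt y"] in \<open>auto simp: tan_arctan\<close>)
next
  fix y assume "y \<in> (\<lambda>x. (tan (x / 2))\<^sup>2) ` {0<..<pi}"
  then obtain x where x: "0 < x" "x < pi" "y = (tan (x / 2))\<^sup>2" by auto
  have "tan (x / 2) > 0" using x by (intro tan_gt_zero) auto
  then show "y \<in> {0<..}" using x by simp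
qed

text \<open>Insert the integral form of \<open>sommerfeld\<close> and scale by s = r y and v = r w.
  The variable r then occurs as r^4 times a Gaussian: r^2 from the Jacobians, and one power from
  each rescaling. Integrating over r, then over w, leaves a function of y, which y = tan^2 (omega /
  2) makes trigonometric.\<close>

lemma radial_integral:
  assumes c: "-1 < c" "c < 1"
  shows "(\<integral>\<^sup>+r. (\<integral>\<^sup>+s. ennreal (r * s / (4 * pi) * exp (- (r + s)\<^sup>2 / 4) * sommerfeld (- c * sqrt (r * s))) * indicator {0<..} s \<partial>lborel) * indicator {0<..} r \<partial>lborel)
    = (\<integral>\<^sup>+\<omega>. ennreal ((sin \<omega>) ^ 3 * (1 + c * sin \<omega> / 2) / (8 * pi * (1 + c * sin \<omega>)\<^sup>2)) * indicator {0<..<pi} \<omega> \<partial>lborel)"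
proof -
  \<comment> \<open>After the scaling the whole exponent is -r^2 times this quadratic form in
    w.\<close>
  define A where "A y w = ((1 + y) / 2)\<^sup>2 + w\<^sup>2 + 2 * w * (sqrt y * c)" for y w :: real
  have [measurable]: "(\<lambda>p. A (fst p) (snd p)) \<in> borel_measurable (borel \<Otimes>\<^sub>M borel)" unfolding A_def by measurable
  have ab: "\<bar>sqrt y * c\<bar> < (1 + y) / 2" if "y > 0" for y
  proof -
    have "\<bar>c\<bar> < 1" using c by auto
    then have "\<bar>sqrt y * c\<bar> < sqrt y * 1" using that by (simp add: abs_mult)
    also have "sqrt y * 1 \<le> (1 + y) / 2"
      using sum_squares_bound[of 1 "sqrt y"] that by simp
    finally show ?thesis .
  qed
  have Ap: "A y w > 0" if y: "y > 0" for y w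
  proof -
    have "(sqrt y * c)\<^sup>2 < ((1 + y) / 2)\<^sup>2"
      using ab[OF y] power_strict_mono[of "\<bar>sqrt y * c\<bar>" "(1 + y) / 2" 2] by simp
    moreover have "A y w = (w + sqrt y * c)\<^sup>2 + (((1 + y) / 2)\<^sup>2 - (sqrt y * c)\<^sup>2)"
      by (simp add: A_def power2_sum)
    ultimately show ?thesis using zero_le_power2[of "w + sqrt y * c"] by linarith
  qed
  let ?f = "\<lambda>r y w. ennreal (y / (4 * pi * sqrt pi) * (r ^ 4 * exp (- (r\<^sup>2 * A y w)))) * indicator {0<..} y * indicator {0..} w * indicator {0<..} r"
  have step1: "(\<integral>\<^sup>+s. ennreal (r * s / (4 * pi) * exp (- (r + s)\<^sup>2 / 4) * sommerfeld (- c * sqrt (r * s))) * indicator {0<..} s \<partial>lborel) * indicator {0<..} r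
      = (\<integral>\<^sup>+y. \<integral>\<^sup>+w. ?f r y w \<partial>lborel \<partial>lborel)" for r
  proof (cases "r > 0")
    case r: True
    have "(\<integral>\<^sup>+s. ennreal (r * s / (4 * pi) * exp (- (r + s)\<^sup>2 / 4) * sommerfeld (- c * sqrt (r * s))) * indicator {0<..} s \<partial>lborel)
      = ennreal \<bar>r\<bar> * (\<integral>\<^sup>+y. ennreal (r * (0 + r * y) / (4 * pi) * exp (- (r + (0 + r * y))\<^sup>2 / 4) * sommerfeld (- c * sqrt (r * (0 + r * y)))) * indicator {0<..} (0 + r * y) \<partial>lborel)"
      by (rule nn_integral_real_affine) (use r in auto)
    also have "\<dots> = (\<integral>\<^sup>+y. ennreal r * (ennreal (r * (0 + r * y) / (4 * pi) * exp (- (r + (0 + r * y))\<^sup>2 / 4) * sommerfeld (- c * sqrt (r * (0 + r * y)))) * indicator {0<..} (0 + r * y)) \<partial>lborel)"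
      using r by (subst nn_integral_cmult) auto
    also have "\<dots> = (\<integral>\<^sup>+y. \<integral>\<^sup>+w. ?f r y w \<partial>lborel \<partial>lborel)"
    proof (intro nn_integral_cong)
      fix y :: real
      show "ennreal r * (ennreal (r * (0 + r * y) / (4 * pi) * exp (- (r + (0 + r * y))\<^sup>2 / 4) * sommerfeld (- c * sqrt (r * (0 + r * y)))) * indicator {0<..} (0 + r * y)) = (\<integral>\<^sup>+w. ?f r y w \<partial>lborel)"
      proof (cases "y > 0")
        case y: True
        define x where "x = - c * (r * sqrt y)"
        have xs: "- c * sqrt (r * (0 + r * y)) = x"
          using r y by (simp add: x_def real_sqrt_mult)
        define Z where "Z = r * (r * (r * y)) / (4 * pi * sqrt pi) * exp (- (r + r * y)\<^sup>2 / 4)"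
        have Z: "Z \<ge> 0" using r y by (simp add: Z_def)
        have "ennreal (sqrt pi * sommerfeld x) = ennreal \<bar>r\<bar> * (\<integral>\<^sup>+w. ennreal (exp (- (0 + r * w)\<^sup>2 + 2 * (0 + r * w) * x)) * indicator {0..} (0 + r * w) \<partial>lborel)"
          unfolding nn_integral_sommerfeld[symmetric] by (rule nn_integral_real_affine) (use r in auto)
        also have "\<dots> = (\<integral>\<^sup>+w. ennreal r * (ennreal (exp (- (r * w)\<^sup>2 + 2 * (r * w) * x)) * indicator {0..} w) \<partial>lborel)"
          using r by (subst nn_integral_cmult[symmetric]) (auto intro!: nn_integral_cong simp: zero_le_mult_iff split: split_indicator)
        finally have S: "ennreal (sqrt pi * sommerfeld x) = (\<integral>\<^sup>+w. ennreal r * (ennreal (exp (- (r * w)\<^sup>2 + 2 * (r * w) * x)) * indicator {0..} w) \<partial>lborel)" .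
        have "ennreal r * (ennreal (r * (0 + r * y) / (4 * pi) * exp (- (r + (0 + r * y))\<^sup>2 / 4) * sommerfeld x) * indicator {0<..} (0 + r * y))
          = ennreal Z * ennreal (sqrt pi * sommerfeld x)"
          using r y Z sommerfeld_nonneg[of x] by (simp add: ennreal_mult'[symmetric] ennreal_mult''[symmetric] Z_def field_simps)
        also have "\<dots> = (\<integral>\<^sup>+w. ennreal Z * (ennreal r * (ennreal (exp (- (r * w)\<^sup>2 + 2 * (r * w) * x)) * indicator {0..} w)) \<partial>lborel)"
          unfolding S by (rule nn_integral_cmult[symmetric]) measurable
        also have "\<dots> = (\<integral>\<^sup>+w. ?f r y w \<partial>lborel)"
        proof (intro nn_integral_cong)
          fix w :: real
          have E: "exp (- (r + r * y)\<^sup>2 / 4) * exp (- (r * w)\<^sup>2 + 2 * (r * w) * x) = exp (- (r\<^sup>2 * A y w))"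
            unfolding exp_add[symmetric] A_def x_def by (simp add: power2_eq_square field_simps)
          have "Z * (r * exp (- (r * w)\<^sup>2 + 2 * (r * w) * x)) = y / (4 * pi * sqrt pi) * (r ^ 4 * exp (- (r\<^sup>2 * A y w)))"
            unfolding E[symmetric] Z_def by (simp add: eval_nat_numeral)
          then have "ennreal Z * (ennreal r * ennreal (exp (- (r * w)\<^sup>2 + 2 * (r * w) * x))) = ennreal (y / (4 * pi * sqrt pi) * (r ^ 4 * exp (- (r\<^sup>2 * A y w))))"
            using Z r by (simp add: ennreal_mult'[symmetric] ennreal_mult''[symmetric])
          then show "ennreal Z * (ennreal r * (ennreal (exp (- (r * w)\<^sup>2 + 2 * (r * w) * x)) * indicator {0..} w)) = ?f r y w"
            using r y by (simp add: mult.assoc[symmetric])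
        qed
        finally show ?thesis unfolding xs .
      qed (use r in \<open>simp add: zero_less_mult_iff\<close>)
    qed
    finally show ?thesis using r by simp
  qed simp
  have "(\<integral>\<^sup>+r. (\<integral>\<^sup>+s. ennreal (r * s / (4 * pi) * exp (- (r + s)\<^sup>2 / 4) * sommerfeld (- c * sqrt (r * s))) * indicator {0<..} s \<partial>lborel) * indicator {0<..} r \<partial>lborel)
    = (\<integral>\<^sup>+r. \<integral>\<^sup>+y. \<integral>\<^sup>+w. ?f r y w \<partial>lborel \<partial>lborel \<partial>lborel)"
    unfolding step1 ..
  also have "\<dots> = (\<integral>\<^sup>+y. \<integral>\<^sup>+r. \<integral>\<^sup>+w. ?f r y w \<partial>lborel \<partial>lborel \<partial>lborel)"
    unfolding A_def by (rule lborel_pair.Fubini') measurable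
  also have "\<dots> = (\<integral>\<^sup>+y. \<integral>\<^sup>+w. \<integral>\<^sup>+r. ?f r y w \<partial>lborel \<partial>lborel \<partial>lborel)"
    unfolding A_def by (intro nn_integral_cong lborel_pair.Fubini') measurable
  also have "\<dots> = (\<integral>\<^sup>+y. ennreal (y * (2 * ((1 + y) / 2) + sqrt y * c) / (32 * pi * ((1 + y) / 2) ^ 3 * ((1 + y) / 2 + sqrt y * c)\<^sup>2)) * indicator {0<..} y \<partial>lborel)"
  proof (intro nn_integral_cong)
    fix y :: real
    show "(\<integral>\<^sup>+w. \<integral>\<^sup>+r. ?f r y w \<partial>lborel \<partial>lborel) = ennreal (y * (2 * ((1 + y) / 2) + sqrt y * c) / (32 * pi * ((1 + y) / 2) ^ 3 * ((1 + y) / 2 + sqrt y * c)\<^sup>2)) * indicator {0<..} y"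
    proof (cases "y > 0")
      case y: True
      let ?a = "(1 + y) / 2" and ?b = "sqrt y * c"
      have "(\<integral>\<^sup>+r. ?f r y w \<partial>lborel) = ennreal (3 * y / (32 * pi)) * (ennreal (1 / sqrt (A y w) ^ 5) * indicator {0..} w)" for w
      proof -
        have "(\<integral>\<^sup>+r. ?f r y w \<partial>lborel) = (\<integral>\<^sup>+r. (ennreal (y / (4 * pi * sqrt pi)) * indicator {0..} w) * (ennreal (r ^ 4 * exp (- (r\<^sup>2 * A y w))) * indicator {0<..} r) \<partial>lborel)"
        proof (intro nn_integral_cong)
          fix r
          have "ennreal (y / (4 * pi * sqrt pi) * (r ^ 4 * exp (- (r\<^sup>2 * A y w)))) = ennreal (y / (4 * pi * sqrt pi)) * ennreal (r ^ 4 * exp (- (r\<^sup>2 * A y w)))"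
            using y by (intro ennreal_mult') simp
          then show "?f r y w = (ennreal (y / (4 * pi * sqrt pi)) * indicator {0..} w) * (ennreal (r ^ 4 * exp (- (r\<^sup>2 * A y w))) * indicator {0<..} r)"
            using y by (simp only: mult_ac indicator_simps greaterThan_iff mult_1_right mult_1_left)
        qed
        also have "\<dots> = (ennreal (y / (4 * pi * sqrt pi)) * indicator {0..} w) * ennreal (3 * sqrt pi / (8 * sqrt (A y w) ^ 5))"
          by (subst nn_integral_cmult) (auto simp: nn_integral_gaussian_4[OF Ap[OF y]])
        also have "\<dots> = (ennreal (y / (4 * pi * sqrt pi)) * ennreal (3 * sqrt pi / (8 * sqrt (A y w) ^ 5))) * indicator {0..} w"
          by (simp only: mult_ac)
        also have "ennreal (y / (4 * pi * sqrt pi)) * ennreal (3 * sqrt pi / (8 * sqrt (A y w) ^ 5)) = ennreal (3 * y / (32 * pi)) * ennreal (1 / sqrt (A y w) ^ 5)"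
          using y Ap[OF y, of w] by (simp add: ennreal_mult'[symmetric] field_simps)
        finally show ?thesis by (simp add: mult.assoc)
      qed
      then have "(\<integral>\<^sup>+w. \<integral>\<^sup>+r. ?f r y w \<partial>lborel \<partial>lborel) = (\<integral>\<^sup>+w. ennreal (3 * y / (32 * pi)) * (ennreal (1 / sqrt (A y w) ^ 5) * indicator {0..} w) \<partial>lborel)"
        by simp
      also have "\<dots> = ennreal (3 * y / (32 * pi)) * ennreal ((2 * ?a + ?b) / (3 * ?a ^ 3 * (?a + ?b)\<^sup>2))"
        unfolding A_def using nn_integral_inverse_5_halves[OF ab[OF y]] by (subst nn_integral_cmult) auto
      also have "\<dots> = ennreal (y * (2 * ?a + ?b) / (32 * pi * ?a ^ 3 * (?a + ?b)\<^sup>2))"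
      proof -
        have gen: "3 * y / (32 * pi) * (n / (3 * p * q)) = y * n / (32 * pi * p * q)" for n p q :: real
          by (simp add: field_simps)
        show ?thesis using y by (subst ennreal_mult'[symmetric]) (auto simp only: gen, auto)
      qed
      finally show ?thesis using y by simp
    qed simp
  qed
  \<comment> \<open>Under y = tan^2 (omega / 2) the quotient of sqrt y by (1 + y) / 2 becomes sin
    omega, which produces the factors 1 + c sin omega.\<close>
  also have "\<dots> = (\<integral>\<^sup>+\<omega>. ennreal ((tan (\<omega>/2))\<^sup>2 * (2 * ((1 + (tan (\<omega>/2))\<^sup>2) / 2) + sqrt ((tan (\<omega>/2))\<^sup>2) * c) / (32 * pi * ((1 + (tan (\<omega>/2))\<^sup>2) / 2) ^ 3 * ((1 + (tan (\<omega>/2))\<^sup>2) / 2 + sqrt ((tan (\<omega>/2))\<^sup>2) * c)\<^sup>2))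
      * ennreal (tan (\<omega>/2) / (cos (\<omega>/2))\<^sup>2) * indicator {0<..<pi} \<omega> \<partial>lborel)"
  proof (rule nn_integral_substitution_open)
    have tan_meas[measurable]: "tan \<in> borel_measurable (borel :: real measure)"
      unfolding tan_def[abs_def] by measurable
    show "(\<lambda>\<omega>::real. (tan (\<omega>/2))\<^sup>2) \<in> borel_measurable borel" "(\<lambda>\<omega>::real. tan (\<omega>/2) / (cos (\<omega>/2))\<^sup>2) \<in> borel_measurable borel" by measurable
    have cz: "cos (\<omega>/2) > 0" if "\<omega> \<in> {0<..<pi}" for \<omega> using that by (intro cos_gt_zero) auto
    show "((\<lambda>\<omega>. (tan (\<omega>/2))\<^sup>2) has_real_derivative tan (\<omega>/2) / (cos (\<omega>/2))\<^sup>2) (at \<omega>)" if "\<omega> \<in> {0<..<pi}" for \<omega>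
      using cz[OF that] by (auto intro!: derivative_eq_intros simp: field_simps)
    show "continuous_on {0<..<pi} (\<lambda>\<omega>. tan (\<omega>/2) / (cos (\<omega>/2))\<^sup>2)"
      by (intro continuous_intros) (use cz in force)+
    show "0 < tan (\<omega>/2) / (cos (\<omega>/2))\<^sup>2" if "\<omega> \<in> {0<..<pi}" for \<omega>
      using cz[OF that] that by (intro divide_pos_pos tan_gt_zero) auto
    show "(\<lambda>\<omega>. (tan (\<omega>/2))\<^sup>2) ` {0<..<pi} = {0<..}" by (rule tan_sq_image)
  qed auto
  also have "\<dots> = (\<integral>\<^sup>+\<omega>. ennreal ((sin \<omega>) ^ 3 * (1 + c * sin \<omega> / 2) / (8 * pi * (1 + c * sin \<omega>)\<^sup>2)) * indicator {0<..<pi} \<omega> \<partial>lborel)"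
  proof (intro nn_integral_cong)
    fix \<omega> :: real
    show "ennreal ((tan (\<omega>/2))\<^sup>2 * (2 * ((1 + (tan (\<omega>/2))\<^sup>2) / 2) + sqrt ((tan (\<omega>/2))\<^sup>2) * c) / (32 * pi * ((1 + (tan (\<omega>/2))\<^sup>2) / 2) ^ 3 * ((1 + (tan (\<omega>/2))\<^sup>2) / 2 + sqrt ((tan (\<omega>/2))\<^sup>2) * c)\<^sup>2))
      * ennreal (tan (\<omega>/2) / (cos (\<omega>/2))\<^sup>2) * indicator {0<..<pi} \<omega>
      = ennreal ((sin \<omega>) ^ 3 * (1 + c * sin \<omega> / 2) / (8 * pi * (1 + c * sin \<omega>)\<^sup>2)) * indicator {0<..<pi} \<omega>"
    proof (cases "\<omega> \<in> {0<..<pi}")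
      case True
      define k where "k = cos (\<omega>/2)"
      define h where "h = sin (\<omega>/2)"
      have k: "k > 0" using True unfolding k_def by (intro cos_gt_zero) auto
      have h: "h > 0" using True unfolding h_def by (intro sin_gt_zero) auto
      have hk: "h\<^sup>2 + k\<^sup>2 = 1" by (simp add: h_def k_def)
      have S: "sin \<omega> = 2 * h * k" using sin_double[of "\<omega>/2"] by (simp add: h_def k_def)
      have T: "tan (\<omega>/2) = h / k" by (simp add: tan_def h_def k_def)
      have T2: "1 + (tan (\<omega>/2))\<^sup>2 = 1 / k\<^sup>2"
        unfolding T using k hk by (simp add: power_divide field_simps)
      have sT: "sqrt ((tan (\<omega>/2))\<^sup>2) = h / k" unfolding T using h k by simp
      have Sp: "0 < sin \<omega>" unfolding S using h k by simp
      have cs: "1 + c * sin \<omega> > 0"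
      proof -
        have "- 1 * sin \<omega> < c * sin \<omega>" using Sp c by (intro mult_strict_right_mono) auto
        then show ?thesis using sin_le_one[of \<omega>] by linarith
      qed
      have 1: "2 * (1 / k\<^sup>2 / 2) + h / k * c = (2 + c * sin \<omega>) / (2 * k\<^sup>2)"
        unfolding S using k by (simp add: field_simps power2_eq_square)
      have 2: "1 / k\<^sup>2 / 2 + h / k * c = (1 + c * sin \<omega>) / (2 * k\<^sup>2)"
        unfolding S using k by (simp add: field_simps power2_eq_square)
      have gen: "(h / k)\<^sup>2 * (P / (2 * k\<^sup>2)) / (32 * pi * (1 / k\<^sup>2 / 2) ^ 3 * (Q / (2 * k\<^sup>2))\<^sup>2) * (h / k / k\<^sup>2) = (2 * h * k) ^ 3 * (P / 2) / (8 * pi * Q\<^sup>2)" if "Q \<noteq> 0" for P Q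
        using k that by (simp add: field_simps eval_nat_numeral)
      have E: "(h / k)\<^sup>2 * (2 * (1 / k\<^sup>2 / 2) + h / k * c) / (32 * pi * (1 / k\<^sup>2 / 2) ^ 3 * (1 / k\<^sup>2 / 2 + h / k * c)\<^sup>2) * (h / k / k\<^sup>2)
        = sin \<omega> ^ 3 * (1 + c * sin \<omega> / 2) / (8 * pi * (1 + c * sin \<omega>)\<^sup>2)"
        unfolding 1 2 using cs by (subst gen) (auto simp: S add_divide_distrib)
      have Y0: "0 \<le> h / k / k\<^sup>2" using h k by simp
      show ?thesis
        by (simp only: T T2[unfolded T] sT[unfolded T] k_def[symmetric] ennreal_mult''[symmetric, OF Y0] E)
    qed simp
  qed
  finally show ?thesis .
qed

lemma nn_integral_Icc:
  fixes f :: "real \<Rightarrow> real"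
  assumes f: "continuous_on {a..b} f" and nonneg: "\<And>x. x \<in> {a..b} \<Longrightarrow> 0 \<le> f x"
  shows "(\<integral>\<^sup>+x. ennreal (f x) * indicator {a..b} x \<partial>lborel) = ennreal (integral {a..b} f)"
proof -
  have int: "set_integrable lborel {a..b} f"
    unfolding set_integrable_def by (rule borel_integrable_compact[OF compact_Icc f])
  have "(\<integral>\<^sup>+x. ennreal (f x) * indicator {a..b} x \<partial>lborel) = (\<integral>\<^sup>+x. ennreal (indicator {a..b} x *\<^sub>R f x) \<partial>lborel)"
    by (intro nn_integral_cong) (auto split: split_indicator)
  also have "\<dots> = ennreal (\<integral>x. indicator {a..b} x *\<^sub>R f x \<partial>lborel)"
    by (rule nn_integral_eq_integral) (use int nonneg in \<open>auto simp: set_integrable_def split: split_indicator\<close>)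
  also have "(\<integral>x. indicator {a..b} x *\<^sub>R f x \<partial>lborel) = integral {a..b} f"
    using set_borel_integral_eq_integral(2)[OF int] by (simp add: set_lebesgue_integral_def)
  finally show ?thesis .
qed

section \<open>A second antiderivative, in the angle, of the radial integral\<close>

lemma one_plus_c_sin_pos: "-1 < c \<Longrightarrow> 0 \<le> \<omega> \<Longrightarrow> \<omega> \<le> pi \<Longrightarrow> 0 < 1 + c * sin \<omega>" for c :: real
proof -
  assume c: "-1 < c" and w: "0 \<le> \<omega>" "\<omega> \<le> pi"
  have s: "0 \<le> sin \<omega>" using w by (rule sin_ge_zero)
  show ?thesis
  proof (cases "sin \<omega> = 0")
    case False
    then have "- 1 * sin \<omega> < c * sin \<omega>" using s c by (intro mult_strict_right_mono) auto
    then show ?thesis using sin_le_one[of \<omega>] by linarith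
  qed simp
qed

lemma one_plus_c_sin_nz: "-1 < c \<Longrightarrow> \<omega> \<in> {0..pi} \<Longrightarrow> 1 + c * sin \<omega> \<noteq> 0" for c :: real
  using one_plus_c_sin_pos[of c \<omega>] by simp

text \<open>\<open>kern_mass (- cos (\<gamma> / 2))\<close> will be the radial integral of the kernel in direction \<open>\<gamma>\<close>, and
  \<open>- K0 (- cos (\<gamma> / 2)) / (8 * pi)\<close> a second antiderivative of it.\<close>

definition K0 :: "real \<Rightarrow> real" where
  "K0 c = integral {0..pi} (\<lambda>\<omega>. (2 * c + sin \<omega>) / (1 + c * sin \<omega>))"
definition K1 :: "real \<Rightarrow> real" where
  "K1 c = integral {0..pi} (\<lambda>\<omega>. (2 - (sin \<omega>)\<^sup>2) / (1 + c * sin \<omega>)\<^sup>2)"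
definition K2 :: "real \<Rightarrow> real" where
  "K2 c = integral {0..pi} (\<lambda>\<omega>. - 2 * sin \<omega> * (2 - (sin \<omega>)\<^sup>2) / (1 + c * sin \<omega>) ^ 3)"
definition kern_mass :: "real \<Rightarrow> real" where
  "kern_mass c = integral {0..pi} (\<lambda>\<omega>. (sin \<omega>) ^ 3 * (1 + c * sin \<omega> / 2) / (8 * pi * (1 + c * sin \<omega>)\<^sup>2))"

text \<open>The parameter range \<open>{-1<..}\<close> serves two purposes: 1 + c sin omega is
  positive there, and it is an open neighbourhood of the parameters \<rho> \<ge> 0 that occur in the
  edge term.\<close>

lemma leibniz_interval:
  fixes f f' :: "real \<Rightarrow> real \<Rightarrow> real" and a b :: real
  assumes f: "\<And>c \<omega>. -1 < c \<Longrightarrow> \<omega> \<in> {a..b} \<Longrightarrow> ((\<lambda>c. f c \<omega>) has_real_derivative f' c \<omega>) (at c)"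
    and cf: "\<And>c. -1 < c \<Longrightarrow> continuous_on {a..b} (f c)"
    and cf': "continuous_on ({-1<..} \<times> {a..b}) (\<lambda>(c, \<omega>). f' c \<omega>)" and c: "-1 < c"
  shows "((\<lambda>c. integral {a..b} (f c)) has_real_derivative integral {a..b} (f' c)) (at c)"
proof -
  have "((\<lambda>c. integral (cbox a b) (f c)) has_field_derivative integral (cbox a b) (f' c)) (at c within {-1<..})"
  proof (rule leibniz_rule_field_derivative)
    show "((\<lambda>x. f x t) has_field_derivative f' x t) (at x within {-1<..})" if "x \<in> {-1<..}" "t \<in> cbox a b" for x t
      by (rule has_field_derivative_at_within[OF f]) (use that in auto)
    show "f x integrable_on cbox a b" if "x \<in> {-1<..}" for x
      unfolding cbox_interval by (rule integrable_continuous_interval[OF cf]) (use that in simp)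
    show "continuous_on ({-1<..} \<times> cbox a b) (\<lambda>(x, t). f' x t)" using cf' by (simp add: cbox_interval)
  qed (use c in auto)
  moreover have "at c within {-1<..} = at c" by (rule at_within_open) (use c in auto)
  ultimately show ?thesis by (simp add: cbox_interval)
qed

lemma DERIV_K0:
  assumes "-1 < c" shows "(K0 has_real_derivative K1 c) (at c)"
  unfolding K0_def[abs_def] K1_def
proof (rule leibniz_interval[OF _ _ _ assms])
  fix c \<omega> :: real assume c: "-1 < c" and w: "\<omega> \<in> {0..pi}"
  have p: "0 < 1 + c * sin \<omega>" using one_plus_c_sin_pos[OF c] w by simp
  show "((\<lambda>c. (2 * c + sin \<omega>) / (1 + c * sin \<omega>)) has_real_derivative (2 - (sin \<omega>)\<^sup>2) / (1 + c * sin \<omega>)\<^sup>2) (at c)"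
    using p by (auto intro!: derivative_eq_intros simp: power2_eq_square algebra_simps)
next
  fix c :: real assume c: "-1 < c"
  show "continuous_on {0..pi} (\<lambda>\<omega>. (2 * c + sin \<omega>) / (1 + c * sin \<omega>))"
    by (intro continuous_intros) (use one_plus_c_sin_pos[OF c] in force)
next
  show "continuous_on ({-1<..} \<times> {0..pi}) (\<lambda>(c, \<omega>). (2 - (sin \<omega>)\<^sup>2) / (1 + c * sin \<omega>)\<^sup>2)"
    unfolding case_prod_beta by (intro continuous_intros) (use one_plus_c_sin_pos in force)
qed

lemma DERIV_K1:
  assumes "-1 < c" shows "(K1 has_real_derivative K2 c) (at c)"
  unfolding K1_def[abs_def] K2_def
proof (rule leibniz_interval[OF _ _ _ assms])
  fix c \<omega> :: real assume c: "-1 < c" and w: "\<omega> \<in> {0..pi}"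
  have p: "0 < 1 + c * sin \<omega>" using one_plus_c_sin_pos[OF c] w by simp
  define q where "q = 1 + c * sin \<omega>"
  have d: "((\<lambda>c. (1 + c * sin \<omega>)\<^sup>2) has_real_derivative 2 * sin \<omega> * q) (at c)"
    by (auto intro!: derivative_eq_intros simp: q_def)
  have "((\<lambda>c. (2 - (sin \<omega>)\<^sup>2) / (1 + c * sin \<omega>)\<^sup>2) has_real_derivative (0 * q\<^sup>2 - (2 - (sin \<omega>)\<^sup>2) * (2 * sin \<omega> * q)) / (q\<^sup>2 * q\<^sup>2)) (at c)"
    using DERIV_divide[OF DERIV_const d] p by (simp add: q_def)
  also have "(0 * q\<^sup>2 - (2 - (sin \<omega>)\<^sup>2) * (2 * sin \<omega> * q)) / (q\<^sup>2 * q\<^sup>2) = - 2 * sin \<omega> * (2 - (sin \<omega>)\<^sup>2) / q ^ 3"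
    using p by (simp add: q_def[symmetric] divide_simps) (simp add: eval_nat_numeral)
  finally show "((\<lambda>c. (2 - (sin \<omega>)\<^sup>2) / (1 + c * sin \<omega>)\<^sup>2) has_real_derivative - 2 * sin \<omega> * (2 - (sin \<omega>)\<^sup>2) / (1 + c * sin \<omega>) ^ 3) (at c)"
    by (simp add: q_def)
next
  fix c :: real assume c: "-1 < c"
  show "continuous_on {0..pi} (\<lambda>\<omega>. (2 - (sin \<omega>)\<^sup>2) / (1 + c * sin \<omega>)\<^sup>2)"
    by (intro continuous_intros) (use one_plus_c_sin_pos[OF c] in force)
next
  show "continuous_on ({-1<..} \<times> {0..pi}) (\<lambda>(c, \<omega>). - 2 * sin \<omega> * (2 - (sin \<omega>)\<^sup>2) / (1 + c * sin \<omega>) ^ 3)"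
    unfolding case_prod_beta by (intro continuous_intros) (use one_plus_c_sin_pos in force)
qed

lemma continuous_on_kern_mass: "continuous_on {-1<..} kern_mass"
proof -
  have "continuous_on {-1<..} (\<lambda>c. integral (cbox 0 pi) (\<lambda>\<omega>. (sin \<omega>) ^ 3 * (1 + c * sin \<omega> / 2) / (8 * pi * (1 + c * sin \<omega>)\<^sup>2)))"
    by (rule integral_continuous_on_param, unfold case_prod_beta, intro continuous_intros)
       (use one_plus_c_sin_pos in force)+
  then show ?thesis by (simp add: kern_mass_def[abs_def] cbox_interval)
qed

text \<open>The integrands differ by the derivative of
  \<open>cos \<omega> (c S / 2 + S\<^sup>2 / 2 + c S\<^sup>3 / 4) / (1 + c S)\<^sup>2\<close>, where \<open>S = sin \<omega>\<close>.\<close>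

lemma K_ode:
  assumes c: "-1 < c"
  shows "- ((1 - c\<^sup>2) * K2 c - c * K1 c) / (32 * pi) = kern_mass c"
proof -
  have pos: "0 < 1 + c * sin \<omega>" if "\<omega> \<in> {0..pi}" for \<omega> using one_plus_c_sin_pos[OF c] that by simp
  let ?f1 = "\<lambda>\<omega>. (2 - (sin \<omega>)\<^sup>2) / (1 + c * sin \<omega>)\<^sup>2"
  let ?f2 = "\<lambda>\<omega>. - 2 * sin \<omega> * (2 - (sin \<omega>)\<^sup>2) / (1 + c * sin \<omega>) ^ 3"
  let ?R = "\<lambda>\<omega>. cos \<omega> * (c * sin \<omega> / 2 + (sin \<omega>)\<^sup>2 / 2 + c * (sin \<omega>) ^ 3 / 4) / (1 + c * sin \<omega>)\<^sup>2"
  let ?dR = "\<lambda>\<omega>. ((- sin \<omega> * (c * sin \<omega> / 2 + (sin \<omega>)\<^sup>2 / 2 + c * (sin \<omega>) ^ 3 / 4) + (1 - (sin \<omega>)\<^sup>2) * (c / 2 + sin \<omega> + 3 * c * (sin \<omega>)\<^sup>2 / 4)) * (1 + c * sin \<omega>)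
     - 2 * c * (1 - (sin \<omega>)\<^sup>2) * (c * sin \<omega> / 2 + (sin \<omega>)\<^sup>2 / 2 + c * (sin \<omega>) ^ 3 / 4)) / (1 + c * sin \<omega>) ^ 3"
  have i1: "(?f1 has_integral K1 c) {0..pi}"
    unfolding K1_def by (intro integrable_integral integrable_continuous_interval continuous_intros) (use pos in force)
  have i2: "(?f2 has_integral K2 c) {0..pi}"
    unfolding K2_def by (intro integrable_integral integrable_continuous_interval continuous_intros) (use pos in force)
  have "(?dR has_integral (?R pi - ?R 0)) {0..pi}"
  proof (rule fundamental_theorem_of_calculus)
    fix \<omega> :: real assume w: "\<omega> \<in> {0..pi}"
    define q where "q = 1 + c * sin \<omega>"
    have q: "q > 0" using pos[OF w] by (simp add: q_def)
    define P where "P = c * sin \<omega> / 2 + (sin \<omega>)\<^sup>2 / 2 + c * (sin \<omega>) ^ 3 / 4"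
    define P' where "P' = c / 2 + sin \<omega> + 3 * c * (sin \<omega>)\<^sup>2 / 4"
    have dP: "((\<lambda>\<omega>. c * sin \<omega> / 2 + (sin \<omega>)\<^sup>2 / 2 + c * (sin \<omega>) ^ 3 / 4) has_real_derivative cos \<omega> * P') (at \<omega>)"
      unfolding P'_def by (auto intro!: derivative_eq_intros simp: algebra_simps)
    have dq: "((\<lambda>\<omega>. (1 + c * sin \<omega>)\<^sup>2) has_real_derivative 2 * c * cos \<omega> * q) (at \<omega>)"
      unfolding q_def by (auto intro!: derivative_eq_intros simp: algebra_simps)
    have "(?R has_real_derivative ((- sin \<omega> * P + cos \<omega> * P' * cos \<omega>) * q\<^sup>2 - cos \<omega> * P * (2 * c * cos \<omega> * q)) / (q\<^sup>2 * q\<^sup>2)) (at \<omega>)"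
      using DERIV_divide[OF DERIV_mult[OF DERIV_cos dP] dq] q unfolding q_def P_def by simp
    also have "((- sin \<omega> * P + cos \<omega> * P' * cos \<omega>) * q\<^sup>2 - cos \<omega> * P * (2 * c * cos \<omega> * q)) / (q\<^sup>2 * q\<^sup>2)
       = ((- sin \<omega> * P + (cos \<omega>)\<^sup>2 * P') * q - 2 * c * (cos \<omega>)\<^sup>2 * P) / q ^ 3"
      using q by (simp add: divide_simps) (simp add: eval_nat_numeral algebra_simps)
    finally have "(?R has_real_derivative ?dR \<omega>) (at \<omega>)"
      by (simp add: q_def P_def P'_def cos_squared_eq)
    then show "(?R has_vector_derivative ?dR \<omega>) (at \<omega> within {0..pi})"
      by (meson has_field_derivative_at_within has_real_derivative_iff_has_vector_derivative)
  qed simp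
  \<comment> \<open>The total derivative integrates to 0, since \<open>?R\<close> contains a factor
    sin omega and vanishes at both ends.\<close>
  then have iR: "(?dR has_integral 0) {0..pi}" by simp
  have "((\<lambda>\<omega>. (- ((1 - c\<^sup>2) * ?f2 \<omega> - c * ?f1 \<omega>) / 4 - ?dR \<omega>) * (1 / (8 * pi))) has_integral
     (- ((1 - c\<^sup>2) * K2 c - c * K1 c) / 4 - 0) * (1 / (8 * pi))) {0..pi}"
    by (intro has_integral_mult_left has_integral_diff has_integral_divide has_integral_neg has_integral_mult_right i1 i2 iR)
  moreover have "(- ((1 - c\<^sup>2) * ?f2 \<omega> - c * ?f1 \<omega>) / 4 - ?dR \<omega>) * (1 / (8 * pi)) =
     (sin \<omega>) ^ 3 * (1 + c * sin \<omega> / 2) / (8 * pi * (1 + c * sin \<omega>)\<^sup>2)" if w: "\<omega> \<in> {0..pi}" for \<omega>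
  proof -
    define S where "S = sin \<omega>"
    define q where "q = 1 + c * S"
    have q: "q > 0" using pos[OF w] by (simp add: q_def S_def)
    have "- ((1 - c\<^sup>2) * (- 2 * S * (2 - S\<^sup>2) / q ^ 3) - c * ((2 - S\<^sup>2) / q\<^sup>2)) / 4
       - ((- S * (c * S / 2 + S\<^sup>2 / 2 + c * S ^ 3 / 4) + (1 - S\<^sup>2) * (c / 2 + S + 3 * c * S\<^sup>2 / 4)) * q
     - 2 * c * (1 - S\<^sup>2) * (c * S / 2 + S\<^sup>2 / 2 + c * S ^ 3 / 4)) / q ^ 3
      = (((1 - c\<^sup>2) * (2 * S * (2 - S\<^sup>2)) + c * (2 - S\<^sup>2) * q) / 4
       - ((- S * (c * S / 2 + S\<^sup>2 / 2 + c * S ^ 3 / 4) + (1 - S\<^sup>2) * (c / 2 + S + 3 * c * S\<^sup>2 / 4)) * q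
     - 2 * c * (1 - S\<^sup>2) * (c * S / 2 + S\<^sup>2 / 2 + c * S ^ 3 / 4))) / q ^ 3"
    proof -
      have gen: "- (A * (B / q ^ 3) - c * (T / q\<^sup>2)) / 4 - Z / q ^ 3 = ((- (A * B) + c * T * q) / 4 - Z) / q ^ 3" for A B T Z
        using q by (simp add: divide_simps) (simp add: eval_nat_numeral algebra_simps)
      show ?thesis unfolding gen by simp
    qed
    also have "((1 - c\<^sup>2) * (2 * S * (2 - S\<^sup>2)) + c * (2 - S\<^sup>2) * q) / 4
       - ((- S * (c * S / 2 + S\<^sup>2 / 2 + c * S ^ 3 / 4) + (1 - S\<^sup>2) * (c / 2 + S + 3 * c * S\<^sup>2 / 4)) * q
     - 2 * c * (1 - S\<^sup>2) * (c * S / 2 + S\<^sup>2 / 2 + c * S ^ 3 / 4)) = S ^ 3 * (1 + c * S / 2) * q"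
      unfolding q_def by (simp add: field_simps) (simp add: eval_nat_numeral algebra_simps)
    also have "S ^ 3 * (1 + c * S / 2) * q / q ^ 3 = S ^ 3 * (1 + c * S / 2) / q\<^sup>2"
      using q by (simp add: eval_nat_numeral)
    finally show ?thesis unfolding q_def S_def by simp
  qed
  ultimately have "((\<lambda>\<omega>. (sin \<omega>) ^ 3 * (1 + c * sin \<omega> / 2) / (8 * pi * (1 + c * sin \<omega>)\<^sup>2)) has_integral
     (- ((1 - c\<^sup>2) * K2 c - c * K1 c) / 4 - 0) * (1 / (8 * pi))) {0..pi}"
    by (rule has_integral_eq[rotated])
  then show ?thesis unfolding kern_mass_def by (subst integral_unique) auto
qed

definition edge_fun :: "real \<Rightarrow> real" where
  "edge_fun \<beta> = - K0 (- cos (\<beta> / 2)) / (8 * pi)"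

lemma cos_half_less_1:
  assumes "0 < \<beta>" "\<beta> < 4 * pi" shows "cos (\<beta> / 2) < 1"
proof -
  have "cos (2 * (\<beta> / 4)) = 1 - 2 * (sin (\<beta> / 4))\<^sup>2" by (rule cos_double_sin)
  moreover have "sin (\<beta> / 4) > 0" using assms by (intro sin_gt_zero) auto
  ultimately show ?thesis by simp
qed

text \<open>Chain rule for c = -cos (beta / 2). Two differentiations in beta turn K0 into ((1 - c^2)
  K2 - c K1) / 4, which is exactly the combination evaluated by \<open>K_ode\<close>.\<close>

lemma
  assumes b: "0 < \<beta>" "\<beta> < 4 * pi"
  shows DERIV_edge_fun: "(edge_fun has_real_derivative - K1 (- cos (\<beta> / 2)) * sin (\<beta> / 2) / (16 * pi)) (at \<beta>)"
    and DERIV_edge_fun2: "((\<lambda>\<beta>. - K1 (- cos (\<beta> / 2)) * sin (\<beta> / 2) / (16 * pi)) has_real_derivative kern_mass (- cos (\<beta> / 2))) (at \<beta>)"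
proof -
  define c where "c = - cos (\<beta> / 2)"
  have c: "-1 < c" using cos_half_less_1[OF b] by (simp add: c_def)
  have dc: "((\<lambda>\<beta>. - cos (\<beta> / 2)) has_real_derivative sin (\<beta> / 2) / 2) (at \<beta>)"
    by (auto intro!: derivative_eq_intros)
  have ds: "((\<lambda>\<beta>. sin (\<beta> / 2)) has_real_derivative cos (\<beta> / 2) / 2) (at \<beta>)"
    by (auto intro!: derivative_eq_intros)
  have k0: "((\<lambda>\<beta>. K0 (- cos (\<beta> / 2))) has_real_derivative K1 c * (sin (\<beta> / 2) / 2)) (at \<beta>)"
    using DERIV_chain2[OF DERIV_K0[OF c, unfolded c_def] dc] by (simp add: c_def)
  have k1: "((\<lambda>\<beta>. K1 (- cos (\<beta> / 2))) has_real_derivative K2 c * (sin (\<beta> / 2) / 2)) (at \<beta>)"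
    using DERIV_chain2[OF DERIV_K1[OF c, unfolded c_def] dc] by (simp add: c_def)
  show "(edge_fun has_real_derivative - K1 (- cos (\<beta> / 2)) * sin (\<beta> / 2) / (16 * pi)) (at \<beta>)"
    unfolding edge_fun_def[abs_def]
    by (rule DERIV_cong[OF DERIV_cdivide[OF DERIV_minus[OF k0]]]) (simp add: c_def)
  show "((\<lambda>\<beta>. - K1 (- cos (\<beta> / 2)) * sin (\<beta> / 2) / (16 * pi)) has_real_derivative kern_mass (- cos (\<beta> / 2))) (at \<beta>)"
  proof (rule DERIV_cong[OF DERIV_cdivide[OF DERIV_mult[OF DERIV_minus[OF k1] ds]]])
    have s2: "(sin (\<beta> / 2))\<^sup>2 = 1 - c\<^sup>2" by (simp add: c_def sin_squared_eq)
    have cc: "cos (\<beta> / 2) = - c" by (simp add: c_def)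
    have "(- (K2 c * (sin (\<beta> / 2) / 2)) * sin (\<beta> / 2) + cos (\<beta> / 2) / 2 * - K1 (- cos (\<beta> / 2))) / (16 * pi)
      = - ((sin (\<beta> / 2))\<^sup>2 * K2 c - c * K1 c) / (32 * pi)"
      unfolding cc by (simp add: power2_eq_square field_simps)
    then show "(- (K2 c * (sin (\<beta> / 2) / 2)) * sin (\<beta> / 2) + cos (\<beta> / 2) / 2 * - K1 (- cos (\<beta> / 2))) / (16 * pi) = kern_mass (- cos (\<beta> / 2))"
      unfolding s2 K_ode[OF c] by (simp add: c_def)
  qed
qed

lemma kern_mass_nonneg: "-1 < c \<Longrightarrow> c \<le> 1 \<Longrightarrow> 0 \<le> kern_mass c"
  unfolding kern_mass_def
proof (intro integral_nonneg)
  assume c: "-1 < c"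
  show "(\<lambda>\<omega>. (sin \<omega>) ^ 3 * (1 + c * sin \<omega> / 2) / (8 * pi * (1 + c * sin \<omega>)\<^sup>2)) integrable_on {0..pi}"
    by (intro integrable_continuous_interval continuous_intros) (auto dest: one_plus_c_sin_nz[OF c])
  fix \<omega> assume w: "\<omega> \<in> {0..pi}"
  have "0 < 1 + c * sin \<omega>" "0 \<le> sin \<omega>" using one_plus_c_sin_pos[OF c, of \<omega>] w sin_ge_zero[of \<omega>] by auto
  then show "0 \<le> (sin \<omega>) ^ 3 * (1 + c * sin \<omega> / 2) / (8 * pi * (1 + c * sin \<omega>)\<^sup>2)"
    by (intro divide_nonneg_nonneg mult_nonneg_nonneg) auto
qed

text \<open>Sommerfeld's kernel at time 1 in polar coordinates, with both Jacobians \<open>r\<close> and \<open>s\<close>.\<close>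

definition kern :: "real \<Rightarrow> real \<Rightarrow> real \<Rightarrow> real" where
  "kern r s \<gamma> = r * s / (4 * pi) * exp (- (r + s)\<^sup>2 / 4) * sommerfeld (sqrt (r * s) * cos (\<gamma> / 2))"

lemma continuous_on_kern: "continuous_on A (kern r s)"
  unfolding kern_def[abs_def] by (intro continuous_intros) auto

lemma kern_nonneg: "0 \<le> r \<Longrightarrow> 0 \<le> s \<Longrightarrow> 0 \<le> kern r s \<gamma>"
  unfolding kern_def by (intro mult_nonneg_nonneg sommerfeld_nonneg) auto

lemma borel_measurable_kern [measurable (raw)]:
  assumes [measurable]: "f \<in> borel_measurable M" "g \<in> borel_measurable M" "h \<in> borel_measurable M"
  shows "(\<lambda>x. kern (f x) (g x) (h x)) \<in> borel_measurable M"
  unfolding kern_def by measurable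

text \<open>\<open>radial_integral\<close> with c = -cos (gamma / 2). The direction 2 pi gives c =
  1, outside its range, and is negligible in the later angular integral. As gamma tends to 0 or 4
  pi, c tends to -1 and the mass diverges.\<close>

lemma nn_integral_kern:
  assumes g: "0 < \<gamma>" "\<gamma> < 4 * pi" "\<gamma> \<noteq> 2 * pi"
  shows "(\<integral>\<^sup>+r. (\<integral>\<^sup>+s. ennreal (kern r s \<gamma>) * indicator {0<..} s \<partial>lborel) * indicator {0<..} r \<partial>lborel) = ennreal (kern_mass (- cos (\<gamma> / 2)))"
proof -
  define c where "c = - cos (\<gamma> / 2)"
  have c1: "-1 < c" using cos_half_less_1[OF g(1,2)] by (simp add: c_def)
  have c2: "c < 1"
  proof -
    have "(cos (\<gamma> / 2))\<^sup>2 = 1 - (sin (\<gamma> / 2))\<^sup>2" by (simp add: cos_squared_eq)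
    moreover have "sin (\<gamma> / 2) \<noteq> 0"
    proof (cases "\<gamma> < 2 * pi")
      case True then show ?thesis using sin_gt_zero[of "\<gamma> / 2"] g by simp
    next
      case False then show ?thesis using sin_lt_zero[of "\<gamma> / 2"] g by simp
    qed
    ultimately have "c\<^sup>2 < 1\<^sup>2" by (simp add: c_def)
    then show ?thesis by (rule power2_less_imp_less) simp
  qed
  have "(\<integral>\<^sup>+r. (\<integral>\<^sup>+s. ennreal (kern r s \<gamma>) * indicator {0<..} s \<partial>lborel) * indicator {0<..} r \<partial>lborel)
     = (\<integral>\<^sup>+\<omega>. ennreal ((sin \<omega>) ^ 3 * (1 + c * sin \<omega> / 2) / (8 * pi * (1 + c * sin \<omega>)\<^sup>2)) * indicator {0<..<pi} \<omega> \<partial>lborel)"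
    using radial_integral[OF c1 c2] by (simp add: kern_def c_def mult.commute)
  also have "\<dots> = (\<integral>\<^sup>+\<omega>. ennreal ((sin \<omega>) ^ 3 * (1 + c * sin \<omega> / 2) / (8 * pi * (1 + c * sin \<omega>)\<^sup>2)) * indicator {0..pi} \<omega> \<partial>lborel)"
  proof (rule nn_integral_cong_AE)
    have "AE \<omega> in lborel. \<omega> \<noteq> (0::real)" "AE \<omega> in lborel. \<omega> \<noteq> pi" by (rule AE_lborel_singleton)+
    then show "AE \<omega> in lborel. ennreal ((sin \<omega>) ^ 3 * (1 + c * sin \<omega> / 2) / (8 * pi * (1 + c * sin \<omega>)\<^sup>2)) * indicator {0<..<pi} \<omega>
       = ennreal ((sin \<omega>) ^ 3 * (1 + c * sin \<omega> / 2) / (8 * pi * (1 + c * sin \<omega>)\<^sup>2)) * indicator {0..pi} \<omega>"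
      by eventually_elim (auto split: split_indicator)
  qed
  also have "\<dots> = ennreal (kern_mass c)"
    unfolding kern_mass_def
  proof (rule nn_integral_Icc)
    show "continuous_on {0..pi} (\<lambda>\<omega>. (sin \<omega>) ^ 3 * (1 + c * sin \<omega> / 2) / (8 * pi * (1 + c * sin \<omega>)\<^sup>2))"
      by (intro continuous_intros) (auto dest: one_plus_c_sin_nz[OF c1])
    fix \<omega> assume w: "\<omega> \<in> {0..pi}"
    have "0 < 1 + c * sin \<omega>" "0 \<le> sin \<omega>" using one_plus_c_sin_pos[OF c1, of \<omega>] w sin_ge_zero[of \<omega>] by auto
    then show "0 \<le> (sin \<omega>) ^ 3 * (1 + c * sin \<omega> / 2) / (8 * pi * (1 + c * sin \<omega>)\<^sup>2)"
      by (intro divide_nonneg_nonneg mult_nonneg_nonneg) auto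
  qed
  finally show ?thesis by (simp add: c_def)
qed

lemma ennreal_weight_int:
  assumes "0 \<le> r" "0 \<le> s"
  shows "ennreal (weight_int (kern r s) \<beta>) = (\<integral>\<^sup>+\<gamma>. ennreal (\<bar>\<beta> - \<gamma>\<bar> * kern r s \<gamma>) * indicator (between \<beta> (2 * pi)) \<gamma> \<partial>lborel)"
  unfolding weight_int_def between_def
  by (rule nn_integral_Icc[symmetric])
     (use assms in \<open>auto intro!: continuous_intros continuous_on_kern kern_nonneg mult_nonneg_nonneg\<close>)

text \<open>All integrands are nonnegative, so the angle can be moved outside. What remains is the
  weighted integral of \<open>kern_mass\<close>, a Taylor remainder of its second antiderivative
  \<open>edge_fun\<close>.\<close>

lemma nn_integral_weight_kern:
  assumes b: "0 < \<beta>" "\<beta> < 4 * pi"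
  shows "(\<integral>\<^sup>+r. (\<integral>\<^sup>+s. ennreal (weight_int (kern r s) \<beta>) * indicator {0<..} s \<partial>lborel) * indicator {0<..} r \<partial>lborel)
    = ennreal (edge_fun \<beta> - edge_fun (2 * pi))"
proof -
  let ?I = "between \<beta> (2 * pi)"
  have [measurable]: "?I \<in> sets borel" by (simp add: between_def)
  have I: "0 < \<gamma>" "\<gamma> < 4 * pi" if "\<gamma> \<in> ?I" for \<gamma> using that b pi_gt_zero by (auto simp: between_def)
  let ?f = "\<lambda>r s \<gamma>. ennreal (\<bar>\<beta> - \<gamma>\<bar> * kern r s \<gamma>) * indicator ?I \<gamma> * indicator {0<..} s * indicator {0<..} r"
  have "(\<integral>\<^sup>+r. (\<integral>\<^sup>+s. ennreal (weight_int (kern r s) \<beta>) * indicator {0<..} s \<partial>lborel) * indicator {0<..} r \<partial>lborel)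
    = (\<integral>\<^sup>+r. \<integral>\<^sup>+s. \<integral>\<^sup>+\<gamma>. ?f r s \<gamma> \<partial>lborel \<partial>lborel \<partial>lborel)"
  proof (intro nn_integral_cong)
    fix r :: real
    show "(\<integral>\<^sup>+s. ennreal (weight_int (kern r s) \<beta>) * indicator {0<..} s \<partial>lborel) * indicator {0<..} r = (\<integral>\<^sup>+s. \<integral>\<^sup>+\<gamma>. ?f r s \<gamma> \<partial>lborel \<partial>lborel)"
    proof (cases "r > 0")
      case True
      then show ?thesis
        by (auto intro!: nn_integral_cong simp: ennreal_weight_int split: split_indicator)
    qed simp
  qed
  also have "\<dots> = (\<integral>\<^sup>+r. \<integral>\<^sup>+\<gamma>. \<integral>\<^sup>+s. ?f r s \<gamma> \<partial>lborel \<partial>lborel \<partial>lborel)"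
    by (intro nn_integral_cong lborel_pair.Fubini') measurable
  also have "\<dots> = (\<integral>\<^sup>+\<gamma>. \<integral>\<^sup>+r. \<integral>\<^sup>+s. ?f r s \<gamma> \<partial>lborel \<partial>lborel \<partial>lborel)"
    by (rule lborel_pair.Fubini') measurable
  also have "\<dots> = (\<integral>\<^sup>+\<gamma>. ennreal (\<bar>\<beta> - \<gamma>\<bar> * kern_mass (- cos (\<gamma> / 2))) * indicator ?I \<gamma> \<partial>lborel)"
  proof (rule nn_integral_cong_AE)
    have "AE \<gamma> in lborel. \<gamma> \<noteq> 2 * pi" by (rule AE_lborel_singleton)
    then show "AE \<gamma> in lborel. (\<integral>\<^sup>+r. \<integral>\<^sup>+s. ?f r s \<gamma> \<partial>lborel \<partial>lborel) = ennreal (\<bar>\<beta> - \<gamma>\<bar> * kern_mass (- cos (\<gamma> / 2))) * indicator ?I \<gamma>"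
    proof eventually_elim
      case (elim \<gamma>)
      show ?case
      proof (cases "\<gamma> \<in> ?I")
        case True
        have 1: "?f r s \<gamma> = ennreal \<bar>\<beta> - \<gamma>\<bar> * (ennreal (kern r s \<gamma>) * indicator {0<..} s * indicator {0<..} r)" for r s
          using True by (simp add: ennreal_mult' mult.assoc)
        have "(\<integral>\<^sup>+r. \<integral>\<^sup>+s. ?f r s \<gamma> \<partial>lborel \<partial>lborel) = (\<integral>\<^sup>+r. ennreal \<bar>\<beta> - \<gamma>\<bar> * ((\<integral>\<^sup>+s. ennreal (kern r s \<gamma>) * indicator {0<..} s \<partial>lborel) * indicator {0<..} r) \<partial>lborel)"
          unfolding 1 by (intro nn_integral_cong) (subst nn_integral_cmult, measurable, subst nn_integral_multc, measurable)
        also have "\<dots> = ennreal \<bar>\<beta> - \<gamma>\<bar> * (\<integral>\<^sup>+r. (\<integral>\<^sup>+s. ennreal (kern r s \<gamma>) * indicator {0<..} s \<partial>lborel) * indicator {0<..} r \<partial>lborel)"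
          by (rule nn_integral_cmult) measurable
        also have "\<dots> = ennreal (\<bar>\<beta> - \<gamma>\<bar> * kern_mass (- cos (\<gamma> / 2)))"
          unfolding nn_integral_kern[OF I[OF True] elim] by (simp add: ennreal_mult')
        finally show ?thesis using True by simp
      qed simp
    qed
  qed
  also have "\<dots> = ennreal (integral ?I (\<lambda>\<gamma>. \<bar>\<beta> - \<gamma>\<bar> * kern_mass (- cos (\<gamma> / 2))))"
    unfolding between_def
  proof (rule nn_integral_Icc)
    show "continuous_on {min \<beta> (2 * pi)..max \<beta> (2 * pi)} (\<lambda>\<gamma>. \<bar>\<beta> - \<gamma>\<bar> * kern_mass (- cos (\<gamma> / 2)))"
    proof (intro continuous_on_mult continuous_on_compose2[OF continuous_on_kern_mass])
      show "(\<lambda>\<gamma>. - cos (\<gamma> / 2)) ` {min \<beta> (2 * pi)..max \<beta> (2 * pi)} \<subseteq> {-1<..}"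
        using I cos_half_less_1 by (auto simp: between_def)
    qed (intro continuous_intros; simp)+
    show "0 \<le> \<bar>\<beta> - \<gamma>\<bar> * kern_mass (- cos (\<gamma> / 2))" if "\<gamma> \<in> {min \<beta> (2 * pi)..max \<beta> (2 * pi)}" for \<gamma>
      using I[of \<gamma>] that cos_half_less_1[of \<gamma>] cos_ge_minus_one[of "\<gamma> / 2"] by (intro mult_nonneg_nonneg kern_mass_nonneg) (auto simp: between_def)
  qed
  \<comment> \<open>The tangent of \<open>edge_fun\<close> at 2 pi is horizontal, as its derivative
    contains sin (beta / 2). Only the difference of values survives.\<close>
  also have "integral ?I (\<lambda>\<gamma>. \<bar>\<beta> - \<gamma>\<bar> * kern_mass (- cos (\<gamma> / 2))) = edge_fun \<beta> - edge_fun (2 * pi)"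
    using integral_unique[OF integral_weight[of \<beta> "2 * pi", OF DERIV_edge_fun2[OF I] DERIV_edge_fun[OF I]]] by simp
  finally show ?thesis .
qed

subsection \<open>The integral over theta\<close>

text \<open>Integrability and value in one predicate, so that differences of nonnegative integrands
  can be formed. The open half-line avoids the point 0, where the integrands divide by sinh
  0.\<close>

definition has_pos_integral :: "(real \<Rightarrow> real) \<Rightarrow> real \<Rightarrow> bool" where
  "has_pos_integral f I \<longleftrightarrow> has_bochner_integral lborel (\<lambda>\<theta>. indicator {0<..} \<theta> * f \<theta>) I"

lemma has_pos_integral_nn:
  assumes [measurable]: "f \<in> borel_measurable borel" and nonneg: "\<And>\<theta>. 0 < \<theta> \<Longrightarrow> 0 \<le> f \<theta>"
    and I: "(\<integral>\<^sup>+\<theta>. ennreal (f \<theta>) * indicator {0<..} \<theta> \<partial>lborel) = ennreal I" "0 \<le> I"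
  shows "has_pos_integral f I"
  unfolding has_pos_integral_def
proof (rule has_bochner_integral_nn_integral)
  have "(\<integral>\<^sup>+\<theta>. ennreal (indicator {0<..} \<theta> * f \<theta>) \<partial>lborel) = (\<integral>\<^sup>+\<theta>. ennreal (f \<theta>) * indicator {0<..} \<theta> \<partial>lborel)"
    by (intro nn_integral_cong) (auto split: split_indicator)
  then show "(\<integral>\<^sup>+\<theta>. ennreal (indicator {0<..} \<theta> * f \<theta>) \<partial>lborel) = ennreal I" using I by simp
  show "AE \<theta> in lborel. 0 \<le> indicator {0<..} \<theta> * f \<theta>" using nonneg by (auto split: split_indicator)
qed (use I in auto)

lemma has_pos_integral_cong:
  "(\<And>\<theta>. 0 < \<theta> \<Longrightarrow> f \<theta> = g \<theta>) \<Longrightarrow> has_pos_integral f I \<Longrightarrow> has_pos_integral g I"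
proof -
  assume fg: "\<And>\<theta>. 0 < \<theta> \<Longrightarrow> f \<theta> = g \<theta>" and "has_pos_integral f I"
  moreover have "(\<lambda>\<theta>. indicator {0<..} \<theta> * f \<theta>) = (\<lambda>\<theta>. indicator {0<..} \<theta> * g \<theta>)"
    using fg by (intro ext) (auto split: split_indicator)
  ultimately show ?thesis by (simp add: has_pos_integral_def)
qed

lemma has_pos_integral_add: "has_pos_integral f I \<Longrightarrow> has_pos_integral g J \<Longrightarrow> has_pos_integral (\<lambda>\<theta>. f \<theta> + g \<theta>) (I + J)"
  unfolding has_pos_integral_def distrib_left by (rule has_bochner_integral_add)

lemma has_pos_integral_diff: "has_pos_integral f I \<Longrightarrow> has_pos_integral g J \<Longrightarrow> has_pos_integral (\<lambda>\<theta>. f \<theta> - g \<theta>) (I - J)"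
  unfolding has_pos_integral_def right_diff_distrib by (rule has_bochner_integral_diff)

lemma has_pos_integral_cmult: "has_pos_integral f I \<Longrightarrow> has_pos_integral (\<lambda>\<theta>. c * f \<theta>) (c * I)"
  unfolding has_pos_integral_def mult.left_commute[of _ c] by (rule has_bochner_integral_mult_right)

text \<open>Logarithmic derivative of the reflection formula for Gamma, whose real form is taken
  from the complex one.\<close>

lemma Digamma_reflection:
  fixes x :: real
  assumes x: "0 < x" "x < 1"
  shows "Digamma (1 - x) - Digamma x = pi * cot (pi * x)"
proof -
  have refl: "Gamma y * Gamma (1 - y) = pi / sin (pi * y)" for y :: real
  proof -
    have "complex_of_real (Gamma y * Gamma (1 - y)) = of_real (pi / sin (pi * y))"
      using Gamma_reflection_complex[of "of_real y"]
      by (simp add: Gamma_complex_of_real[symmetric] sin_of_real[symmetric])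
    then show ?thesis by (simp only: of_real_eq_iff)
  qed
  have nz: "x \<notin> \<int>\<^sub>\<le>\<^sub>0" "1 - x \<notin> \<int>\<^sub>\<le>\<^sub>0" using x by (auto elim!: nonpos_Ints_cases)
  have s: "sin (pi * x) > 0" using x by (intro sin_gt_zero) auto
  have d1: "((\<lambda>y. Gamma y * Gamma (1 - y)) has_real_derivative
      Gamma x * Digamma x * Gamma (1 - x) + Gamma (1 - x) * Digamma (1 - x) * (0 - 1) * Gamma x) (at x)"
    by (rule DERIV_mult[OF has_field_derivative_Gamma[OF nz(1)] DERIV_chain2[OF has_field_derivative_Gamma[OF nz(2)] DERIV_diff[OF DERIV_const DERIV_ident]]])
  have d2: "((\<lambda>y. pi / sin (pi * y)) has_real_derivative - (pi * (pi * cos (pi * x)) / (sin (pi * x) * sin (pi * x)))) (at x)"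
    using s by (auto intro!: derivative_eq_intros)
  have "Gamma x * Digamma x * Gamma (1 - x) + Gamma (1 - x) * Digamma (1 - x) * (0 - 1) * Gamma x
    = - (pi * (pi * cos (pi * x)) / (sin (pi * x) * sin (pi * x)))"
    by (rule DERIV_unique[OF d1]) (use d2 refl in simp)
  then have "(Gamma x * Gamma (1 - x)) * (Digamma (1 - x) - Digamma x) = pi * (pi * cos (pi * x)) / (sin (pi * x) * sin (pi * x))"
    by (simp add: algebra_simps)
  then have "pi / sin (pi * x) * (Digamma (1 - x) - Digamma x) = pi / sin (pi * x) * (pi * cot (pi * x))"
    unfolding refl by (simp add: cot_def)
  then show ?thesis using s by simp
qed

text \<open>Partial fractions of the cotangent. Each summand is a difference of reciprocals; the
  logarithms in the limit formulas for \<open>Digamma (1 + x)\<close> and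
  \<open>Digamma (1 - x)\<close> cancel, and the reflection formula evaluates the
  difference.\<close>

lemma sums_cot:
  fixes x :: real
  assumes x: "0 < x" "x < 1"
  shows "(\<lambda>n. 2 * x\<^sup>2 / ((real n + 1)\<^sup>2 - x\<^sup>2)) sums (1 - pi * x * cot (pi * x))"
proof -
  have lim1: "(\<lambda>m. ln (real m) - (\<Sum>n<m. inverse (1 + x + real n))) \<longlonglongrightarrow> Digamma (1 + x)"
    using Digamma_LIMSEQ[of "1 + x"] x by simp
  have lim2: "(\<lambda>m. ln (real m) - (\<Sum>n<m. inverse (1 - x + real n))) \<longlonglongrightarrow> Digamma (1 - x)"
    using Digamma_LIMSEQ[of "1 - x"] x by simp
  have t: "x * (inverse (1 - x + real n) - inverse (1 + x + real n)) = 2 * x\<^sup>2 / ((real n + 1)\<^sup>2 - x\<^sup>2)" for n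
  proof -
    have p: "1 - x + real n > 0" "1 + x + real n > 0" using x by (auto intro: add_pos_nonneg)
    have "(real n + 1)\<^sup>2 - x\<^sup>2 = (1 - x + real n) * (1 + x + real n)" by (simp add: power2_eq_square algebra_simps)
    moreover have "inverse (1 - x + real n) - inverse (1 + x + real n) = 2 * x / ((1 - x + real n) * (1 + x + real n))"
      using p by (simp add: field_simps)
    ultimately show ?thesis by (simp add: power2_eq_square)
  qed
  have "(\<lambda>m. x * ((ln (real m) - (\<Sum>n<m. inverse (1 + x + real n))) - (ln (real m) - (\<Sum>n<m. inverse (1 - x + real n))))) \<longlonglongrightarrow> x * (Digamma (1 + x) - Digamma (1 - x))"
    by (intro tendsto_intros lim1 lim2)
  also have "(\<lambda>m. x * ((ln (real m) - (\<Sum>n<m. inverse (1 + x + real n))) - (ln (real m) - (\<Sum>n<m. inverse (1 - x + real n)))))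
     = (\<lambda>m. \<Sum>n<m. 2 * x\<^sup>2 / ((real n + 1)\<^sup>2 - x\<^sup>2))"
    by (simp add: t[symmetric] sum_distrib_left[symmetric] sum_subtractf)
  also have "x * (Digamma (1 + x) - Digamma (1 - x)) = 1 - pi * x * cot (pi * x)"
  proof -
    have "Digamma (1 + x) = Digamma x + 1 / x" using Digamma_plus1[of x] x by (simp add: add.commute)
    then have "Digamma (1 + x) - Digamma (1 - x) = 1 / x - pi * cot (pi * x)"
      using Digamma_reflection[OF x] by simp
    then show ?thesis using x by (simp add: field_simps)
  qed
  finally show ?thesis unfolding sums_def .
qed

section \<open>Two hyperbolic integrals\<close>

lemma borel_measurable_cosh [measurable]: "cosh \<in> borel_measurable (borel :: real measure)"
  and borel_measurable_sinh [measurable]: "sinh \<in> borel_measurable (borel :: real measure)"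
  by (intro borel_measurable_continuous_onI continuous_intros)+

lemma cosh_double_sinh: "cosh (2 * x) = 2 * (sinh x)\<^sup>2 + (1::real)"
  by (simp add: cosh_double_cosh cosh_square_eq)

lemma has_pos_integral_exp_cosh:
  assumes p: "0 \<le> \<psi>" "\<psi> < k"
  shows "(\<integral>\<^sup>+\<theta>. ennreal (exp (- k * \<theta>) * (cosh (\<psi> * \<theta>) - 1)) * indicator {0<..} \<theta> \<partial>lborel) = ennreal (\<psi>\<^sup>2 / (k * (k\<^sup>2 - \<psi>\<^sup>2)))"
proof -
  define u v where "u = k - \<psi>" and "v = k + \<psi>"
  have k: "k > 0" "u > 0" "v > 0" using p by (auto simp: u_def v_def)
  define F where "F \<theta> = - exp (- u * \<theta>) / (2 * u) - exp (- v * \<theta>) / (2 * v) + exp (- k * \<theta>) / k" for \<theta>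
  have "(\<integral>\<^sup>+\<theta>. ennreal (exp (- k * \<theta>) * (cosh (\<psi> * \<theta>) - 1)) * indicator {0..} \<theta> \<partial>lborel) = ennreal (0 - F 0)"
  proof (rule nn_integral_FTC_atLeast)
    have dE: "((\<lambda>\<theta>. exp (- c * \<theta>)) has_real_derivative - c * exp (- c * \<theta>)) (at \<theta>)" for c \<theta> :: real
      by (auto intro!: derivative_eq_intros)
    show "(F has_real_derivative exp (- k * \<theta>) * (cosh (\<psi> * \<theta>) - 1)) (at \<theta>)" for \<theta>
    proof -
      have "exp (- k * \<theta>) * cosh (\<psi> * \<theta>) = (exp (- u * \<theta>) + exp (- v * \<theta>)) / 2"
        by (simp add: cosh_def u_def v_def exp_add[symmetric] distrib_left algebra_simps)
      then have "exp (- k * \<theta>) * (cosh (\<psi> * \<theta>) - 1) = - (- u * exp (- u * \<theta>)) / (2 * u) - - v * exp (- v * \<theta>) / (2 * v) + - k * exp (- k * \<theta>) / k"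
        using k by (simp add: right_diff_distrib)
      then show ?thesis
        unfolding F_def using DERIV_add[OF DERIV_diff[OF DERIV_cdivide[OF DERIV_minus[OF dE[of u \<theta>]], of "2 * u"] DERIV_cdivide[OF dE[of v \<theta>], of "2 * v"]] DERIV_cdivide[OF dE[of k \<theta>], of k]]
        by simp
    qed
    show "(F \<longlongrightarrow> 0) at_top" 
    proof -
      have lim: "((\<lambda>\<theta>. exp (- c * \<theta>)) \<longlongrightarrow> 0) at_top" if "c > 0" for c :: real
        using that by real_asymp
      have "(F \<longlongrightarrow> - 0 / (2 * u) - 0 / (2 * v) + 0 / k) at_top"
        unfolding F_def using k by (intro tendsto_intros lim) auto
      then show ?thesis by simp
    qed
    show "0 \<le> exp (- k * \<theta>) * (cosh (\<psi> * \<theta>) - 1)" for \<theta>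
      using cosh_real_ge_1[of "\<psi> * \<theta>"] by simp
  qed auto
  also have "(\<integral>\<^sup>+\<theta>. ennreal (exp (- k * \<theta>) * (cosh (\<psi> * \<theta>) - 1)) * indicator {0..} \<theta> \<partial>lborel) = (\<integral>\<^sup>+\<theta>. ennreal (exp (- k * \<theta>) * (cosh (\<psi> * \<theta>) - 1)) * indicator {0<..} \<theta> \<partial>lborel)"
    by (intro nn_integral_cong) (auto split: split_indicator simp: less_le)
  also have "0 - F 0 = \<psi>\<^sup>2 / (k * (k\<^sup>2 - \<psi>\<^sup>2))"
  proof -
    have 1: "k\<^sup>2 - \<psi>\<^sup>2 = u * v" by (simp add: u_def v_def power2_eq_square algebra_simps)
    have "0 - F 0 = ((v + u) * k - 2 * (u * v)) / (2 * (u * v) * k)"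
      unfolding F_def using k by (simp add: field_simps)
    also have "(v + u) * k - 2 * (u * v) = 2 * \<psi>\<^sup>2" by (simp add: u_def v_def power2_eq_square algebra_simps)
    finally show ?thesis unfolding 1 using k by (simp add: mult.commute)
  qed
  finally show ?thesis .
qed

text \<open>With q = exp (-pi theta), 1 / sinh^2 (pi theta / 2) is 4 times the series of n q^n, a
  differentiated geometric series. Termwise integration, justified by nonnegativity, gives the
  partial fractions of the cotangent.\<close>

lemma integral_cosh_over_sinh_sq:
  assumes p: "0 < \<psi>" "\<psi> < pi"
  shows "has_pos_integral (\<lambda>\<theta>. (cosh (\<psi> * \<theta>) - 1) / (sinh (pi * \<theta> / 2))\<^sup>2) (2 / pi * (1 - \<psi> * cot \<psi>))"
proof -
  define x where "x = \<psi> / pi"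
  have x: "0 < x" "x < 1" "pi * x = \<psi>" using p by (auto simp: x_def)
  have trm: "(cosh (\<psi> * \<theta>) - 1) / (sinh (pi * \<theta> / 2))\<^sup>2 = (\<Sum>n. 4 * (real n + 1) * (exp (- ((real n + 1) * pi) * \<theta>) * (cosh (\<psi> * \<theta>) - 1)))"
    and sm: "summable (\<lambda>n. 4 * (real n + 1) * (exp (- ((real n + 1) * pi) * \<theta>) * (cosh (\<psi> * \<theta>) - 1)))" if t: "\<theta> > 0" for \<theta>
  proof -
    define q where "q = exp (- (pi * \<theta>))"
    have q: "0 < q" "q < 1" using t by (auto simp: q_def)
    have "(\<lambda>n. of_nat (Suc n) * q ^ n) sums (1 / (1 - q)\<^sup>2)"
      using geometric_deriv_sums[of q] q by simp
    note geo = sums_mult[OF this, of "4 * q * (cosh (\<psi> * \<theta>) - 1)"]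
    have "4 * q * C * (of_nat (Suc n) * q ^ n) = 4 * (real n + 1) * (q ^ Suc n * C)" for n C
      by (simp add: algebra_simps)
    with geo have "(\<lambda>n. 4 * (real n + 1) * (q ^ Suc n * (cosh (\<psi> * \<theta>) - 1))) sums (4 * q * (cosh (\<psi> * \<theta>) - 1) * (1 / (1 - q)\<^sup>2))"
      by (simp only:)
    moreover have "q ^ Suc n = exp (- ((real n + 1) * pi) * \<theta>)" for n
      unfolding q_def exp_of_nat_mult[symmetric] by (simp add: algebra_simps)
    moreover have "4 * q * (cosh (\<psi> * \<theta>) - 1) * (1 / (1 - q)\<^sup>2) = (cosh (\<psi> * \<theta>) - 1) / (sinh (pi * \<theta> / 2))\<^sup>2"
    proof -
      define e where "e = exp (- (pi * \<theta> / 2))"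
      have e: "e > 0" "q = e\<^sup>2" by (auto simp: e_def q_def exp_double[symmetric])
      have "sinh (pi * \<theta> / 2) = (1 / e - e) / 2" by (simp add: sinh_def e_def exp_minus field_simps)
      also have "\<dots> = (1 - q) / (2 * e)" using e by (simp add: field_simps power2_eq_square)
      finally have "(sinh (pi * \<theta> / 2))\<^sup>2 = (1 - q)\<^sup>2 / (4 * q)" by (simp add: power_divide power_mult_distrib e(2))
      then show ?thesis by simp
    qed
    ultimately have s: "(\<lambda>n. 4 * (real n + 1) * (exp (- ((real n + 1) * pi) * \<theta>) * (cosh (\<psi> * \<theta>) - 1))) sums ((cosh (\<psi> * \<theta>) - 1) / (sinh (pi * \<theta> / 2))\<^sup>2)"
      by simp
    show "(cosh (\<psi> * \<theta>) - 1) / (sinh (pi * \<theta> / 2))\<^sup>2 = (\<Sum>n. 4 * (real n + 1) * (exp (- ((real n + 1) * pi) * \<theta>) * (cosh (\<psi> * \<theta>) - 1)))"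
      using s by (simp add: sums_iff)
    show "summable (\<lambda>n. 4 * (real n + 1) * (exp (- ((real n + 1) * pi) * \<theta>) * (cosh (\<psi> * \<theta>) - 1)))"
      using s by (simp add: sums_iff)
  qed
  have nn: "0 \<le> 4 * (real n + 1) * (exp (- ((real n + 1) * pi) * \<theta>) * (cosh (\<psi> * \<theta>) - 1))" for n \<theta>
    using cosh_real_ge_1[of "\<psi> * \<theta>"] by simp
  have "(\<integral>\<^sup>+\<theta>. ennreal ((cosh (\<psi> * \<theta>) - 1) / (sinh (pi * \<theta> / 2))\<^sup>2) * indicator {0<..} \<theta> \<partial>lborel)
     = (\<integral>\<^sup>+\<theta>. (\<Sum>n. ennreal (4 * (real n + 1) * (exp (- ((real n + 1) * pi) * \<theta>) * (cosh (\<psi> * \<theta>) - 1))) * indicator {0<..} \<theta>) \<partial>lborel)"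
  proof (intro nn_integral_cong)
    fix \<theta> :: real
    show "ennreal ((cosh (\<psi> * \<theta>) - 1) / (sinh (pi * \<theta> / 2))\<^sup>2) * indicator {0<..} \<theta>
      = (\<Sum>n. ennreal (4 * (real n + 1) * (exp (- ((real n + 1) * pi) * \<theta>) * (cosh (\<psi> * \<theta>) - 1))) * indicator {0<..} \<theta>)"
    proof (cases "\<theta> > 0")
      case True
      then show ?thesis unfolding trm[OF True] using suminf_ennreal2[OF nn sm[OF True]] by simp
    qed simp
  qed
  also have "\<dots> = (\<Sum>n. \<integral>\<^sup>+\<theta>. ennreal (4 * (real n + 1) * (exp (- ((real n + 1) * pi) * \<theta>) * (cosh (\<psi> * \<theta>) - 1))) * indicator {0<..} \<theta> \<partial>lborel)"
    by (rule nn_integral_suminf) measurable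
  also have "\<dots> = (\<Sum>n. ennreal (2 / pi * (2 * x\<^sup>2 / ((real n + 1)\<^sup>2 - x\<^sup>2))))"
  proof (intro suminf_cong)
    fix n
    define k where "k = (real n + 1) * pi"
    have kp: "\<psi> < k" "k > 0"
    proof -
      have "1 * pi \<le> (real n + 1) * pi" by (intro mult_right_mono) auto
      then show "\<psi> < k" "k > 0" using p pi_gt_zero unfolding k_def by linarith+
    qed
    have "(\<integral>\<^sup>+\<theta>. ennreal (4 * (real n + 1) * (exp (- k * \<theta>) * (cosh (\<psi> * \<theta>) - 1))) * indicator {0<..} \<theta> \<partial>lborel)
      = (\<integral>\<^sup>+\<theta>. ennreal (4 * (real n + 1)) * (ennreal (exp (- k * \<theta>) * (cosh (\<psi> * \<theta>) - 1)) * indicator {0<..} \<theta>) \<partial>lborel)"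
    proof (intro nn_integral_cong)
      fix \<theta> :: real
      have "ennreal (4 * (real n + 1) * (exp (- k * \<theta>) * (cosh (\<psi> * \<theta>) - 1))) = ennreal (4 * (real n + 1)) * ennreal (exp (- k * \<theta>) * (cosh (\<psi> * \<theta>) - 1))"
        by (rule ennreal_mult') simp
      then show "ennreal (4 * (real n + 1) * (exp (- k * \<theta>) * (cosh (\<psi> * \<theta>) - 1))) * indicator {0<..} \<theta> = ennreal (4 * (real n + 1)) * (ennreal (exp (- k * \<theta>) * (cosh (\<psi> * \<theta>) - 1)) * indicator {0<..} \<theta>)"
        by (simp only: mult.assoc)
    qed
    also have "\<dots> = ennreal (4 * (real n + 1)) * ennreal (\<psi>\<^sup>2 / (k * (k\<^sup>2 - \<psi>\<^sup>2)))"
      using has_pos_integral_exp_cosh[of \<psi> k] p kp by (subst nn_integral_cmult) auto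
    also have "\<dots> = ennreal (4 * (real n + 1) * (\<psi>\<^sup>2 / (k * (k\<^sup>2 - \<psi>\<^sup>2))))"
      by (rule ennreal_mult'[symmetric]) simp
    also have "4 * (real n + 1) * (\<psi>\<^sup>2 / (k * (k\<^sup>2 - \<psi>\<^sup>2))) = 2 / pi * (2 * x\<^sup>2 / ((real n + 1)\<^sup>2 - x\<^sup>2))"
    proof -
      have "k\<^sup>2 - \<psi>\<^sup>2 = pi\<^sup>2 * ((real n + 1)\<^sup>2 - x\<^sup>2)" unfolding x(3)[symmetric] k_def by (simp add: power2_eq_square algebra_simps)
      then have "4 * (real n + 1) * (\<psi>\<^sup>2 / (k * (k\<^sup>2 - \<psi>\<^sup>2))) = 4 * (real n + 1) * ((pi * x)\<^sup>2 / ((real n + 1) * pi * (pi\<^sup>2 * ((real n + 1)\<^sup>2 - x\<^sup>2))))"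
        unfolding x(3)[symmetric] by (simp add: k_def)
      also have "\<dots> = 2 / pi * (2 * x\<^sup>2 / ((real n + 1)\<^sup>2 - x\<^sup>2))"
      proof -
        have "4 * N * ((pi * x)\<^sup>2 / (N * pi * (pi\<^sup>2 * Q))) = 2 / pi * (2 * x\<^sup>2 / Q)" if "N > 0" for N Q :: real
          using that by (simp add: power_mult_distrib)
        from this[of "real n + 1"] show ?thesis by simp
      qed
      finally show ?thesis .
    qed
    finally show "(\<integral>\<^sup>+\<theta>. ennreal (4 * (real n + 1) * (exp (- ((real n + 1) * pi) * \<theta>) * (cosh (\<psi> * \<theta>) - 1))) * indicator {0<..} \<theta> \<partial>lborel) = ennreal (2 / pi * (2 * x\<^sup>2 / ((real n + 1)\<^sup>2 - x\<^sup>2)))"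
      by (simp add: k_def)
  qed
  also have "\<dots> = ennreal (2 / pi * (1 - \<psi> * cot \<psi>))"
  proof -
    have s: "(\<lambda>n. 2 / pi * (2 * x\<^sup>2 / ((real n + 1)\<^sup>2 - x\<^sup>2))) sums (2 / pi * (1 - \<psi> * cot \<psi>))"
      using sums_mult[OF sums_cot[OF x(1,2)], of "2 / pi"] by (simp add: x(3))
    have "0 \<le> 2 / pi * (2 * x\<^sup>2 / ((real n + 1)\<^sup>2 - x\<^sup>2))" for n
    proof -
      have "x\<^sup>2 \<le> (real n + 1)\<^sup>2" using x by (intro power_mono) auto
      then show ?thesis by simp
    qed
    from suminf_ennreal2[OF this] s show ?thesis by (simp add: sums_iff)
  qed
  finally have I: "(\<integral>\<^sup>+\<theta>. ennreal ((cosh (\<psi> * \<theta>) - 1) / (sinh (pi * \<theta> / 2))\<^sup>2) * indicator {0<..} \<theta> \<partial>lborel) = ennreal (2 / pi * (1 - \<psi> * cot \<psi>))" .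
  have nonneg: "0 \<le> 2 / pi * (1 - \<psi> * cot \<psi>)"
  proof -
    have "0 \<le> 1 - pi * x * cot (pi * x)"
    proof (rule sums_le[OF _ sums_zero sums_cot[OF x(1,2)]])
      fix n
      have "x\<^sup>2 \<le> (real n + 1)\<^sup>2" using x by (intro power_mono) auto
      then show "0 \<le> 2 * x\<^sup>2 / ((real n + 1)\<^sup>2 - x\<^sup>2)" by simp
    qed
    then show ?thesis by (simp add: x(3))
  qed
  show ?thesis
  proof (rule has_pos_integral_nn[OF _ _ I nonneg])
    show "0 \<le> (cosh (\<psi> * \<theta>) - 1) / (sinh (pi * \<theta> / 2))\<^sup>2" for \<theta> using cosh_real_ge_1[of "\<psi> * \<theta>"] by simp
    show "(\<lambda>\<theta>. (cosh (\<psi> * \<theta>) - 1) / (sinh (pi * \<theta> / 2))\<^sup>2) \<in> borel_measurable borel" by measurable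
  qed
qed

text \<open>A Beta integral: the substitution x = ln (t / (1 - t)) turns B(a, 1 - a) into the
  integral of exp (a x) / (1 + exp x) over the line, and the reflection formula evaluates it.
  Folding the line at 0 produces the hyperbolic cosine.\<close>

lemma integral_cosh_over_cosh:
  assumes p: "0 \<le> \<psi>" "\<psi> < pi"
  shows "has_pos_integral (\<lambda>\<theta>. cosh (\<psi> * \<theta>) / cosh (pi * \<theta>)) (1 / (2 * cos (\<psi> / 2)))"
proof -
  \<comment> \<open>Chosen so that at x = 2 pi theta the integrand exp (a x) / (1 + exp x) is exp
    (psi theta) / (2 cosh (pi theta)).\<close>
  define a where "a = \<psi> / (2 * pi) + 1 / 2"
  have a: "0 < a" "a < 1" "pi * a = pi / 2 + \<psi> / 2" "2 * pi * a - pi = \<psi>"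
    using p by (auto simp: a_def field_simps add_pos_nonneg)
  have c: "cos (\<psi> / 2) > 0" using p by (intro cos_gt_zero_pi) auto
  let ?b = "\<lambda>t. t powr (a - 1) * (1 - t) powr ((1 - a) - 1)"
  have "(?b has_integral Beta a (1 - a)) {0..1}"
    using a by (intro has_integral_Beta_real) auto
  moreover have Bv: "Beta a (1 - a) = pi / cos (\<psi> / 2)"
  proof -
    have "complex_of_real (Gamma a * Gamma (1 - a)) = of_real (pi / sin (pi * a))"
      using Gamma_reflection_complex[of "of_real a"]
      by (simp add: Gamma_complex_of_real[symmetric] sin_of_real[symmetric])
    then have "Gamma a * Gamma (1 - a) = pi / sin (pi * a)" by (simp only: of_real_eq_iff)
    then show ?thesis by (simp add: Beta_def a(3) sin_add)
  qed
  ultimately have "(\<integral>\<^sup>+t. ennreal (indicator {0..1} t * ?b t) \<partial>lborel) = ennreal (pi / cos (\<psi> / 2))"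
    using nn_integral_has_integral_lebesgue[of "{0..1}" ?b "Beta a (1 - a)"] by simp
  also have "(\<integral>\<^sup>+t. ennreal (indicator {0..1} t * ?b t) \<partial>lborel) = (\<integral>\<^sup>+t. ennreal (exp (a * ln (t / (1 - t))) / (1 + exp (ln (t / (1 - t))))) * ennreal (1 / (t * (1 - t))) * indicator {0<..<1} t \<partial>lborel)"
  proof (rule nn_integral_cong_AE)
    have "AE t in lborel. t \<noteq> (0::real)" "AE t in lborel. t \<noteq> (1::real)" by (rule AE_lborel_singleton)+
    then show "AE t in lborel. ennreal (indicator {0..1} t * ?b t) = ennreal (exp (a * ln (t / (1 - t))) / (1 + exp (ln (t / (1 - t))))) * ennreal (1 / (t * (1 - t))) * indicator {0<..<1} t"
    proof eventually_elim
      case (elim t)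
      show ?case
      proof (cases "t \<in> {0<..<1}")
        case True
        then have t: "0 < t" "0 < 1 - t" by auto
        have "?b t = exp (a * ln (t / (1 - t))) / (1 + exp (ln (t / (1 - t)))) * (1 / (t * (1 - t)))"
        proof -
          have "1 + exp (ln (t / (1 - t))) = 1 / (1 - t)" using t by (simp add: field_simps)
          moreover have "exp (a * ln (t / (1 - t))) = t powr a / (1 - t) powr a"
            using t by (simp add: ln_div powr_def right_diff_distrib exp_diff)
          moreover have "?b t = t powr a / t * (1 / (1 - t) powr a)"
            using t by (simp add: powr_diff powr_minus divide_inverse)
          ultimately show ?thesis using t by simp
        qed
        then show ?thesis using True by (subst ennreal_mult''[symmetric]) auto
      qed (use elim in \<open>auto split: split_indicator\<close>)
    qed
  qed
  also have "\<dots> = (\<integral>\<^sup>+x. ennreal (exp (a * x) / (1 + exp x)) * indicator UNIV x \<partial>lborel)"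
  proof (rule nn_integral_substitution_open[symmetric])
    show "((\<lambda>t. ln (t / (1 - t))) has_real_derivative 1 / (t * (1 - t))) (at t)" if "t \<in> {0<..<1}" for t :: real
    proof -
      have t: "0 < t" "0 < 1 - t" using that by auto
      have "((\<lambda>t. t / (1 - t)) has_real_derivative (1 * (1 - t) - t * (0 - 1)) / ((1 - t) * (1 - t))) (at t)"
        by (rule DERIV_divide[OF DERIV_ident DERIV_diff[OF DERIV_const DERIV_ident]]) (use t in simp)
      then have "((\<lambda>t. t / (1 - t)) has_real_derivative 1 / ((1 - t) * (1 - t))) (at t)" by simp
      from DERIV_chain2[OF DERIV_ln this] t
      have "((\<lambda>t. ln (t / (1 - t))) has_real_derivative inverse (t / (1 - t)) * (1 / ((1 - t) * (1 - t)))) (at t)" by simp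
      moreover have "inverse (t / u) * (1 / (u * u)) = 1 / (t * u)" if "u > 0" for u using t that by (simp add: field_simps)
      ultimately show ?thesis using t(2) by simp
    qed
    show "continuous_on {0<..<1} (\<lambda>t::real. 1 / (t * (1 - t)))" by (intro continuous_intros) auto
    show "(\<lambda>t. ln (t / (1 - t))) ` {0<..<1} = (UNIV :: real set)"
    proof -
      have "x \<in> (\<lambda>t. ln (t / (1 - t))) ` {0<..<1}" for x :: real
      proof (rule image_eqI[of _ _ "exp x / (1 + exp x)"])
        have "1 + exp x > 0" by (simp add: add_pos_pos)
        then have "1 - exp x / (1 + exp x) = 1 / (1 + exp x)" by (simp add: field_simps)
        then show "x = ln (exp x / (1 + exp x) / (1 - exp x / (1 + exp x)))" using \<open>1 + exp x > 0\<close> by simp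
        show "exp x / (1 + exp x) \<in> {0<..<1}" using \<open>1 + exp x > 0\<close> by simp
      qed
      then show ?thesis by auto
    qed
  qed auto
  also have "\<dots> = (\<integral>\<^sup>+x. ennreal (exp (a * x) / (1 + exp x)) \<partial>lborel)" by simp
  also have "\<dots> = ennreal \<bar>2 * pi\<bar> * (\<integral>\<^sup>+\<theta>. ennreal (exp (a * (0 + 2 * pi * \<theta>)) / (1 + exp (0 + 2 * pi * \<theta>))) \<partial>lborel)"
    by (rule nn_integral_real_affine) auto
  also have "(\<integral>\<^sup>+\<theta>. ennreal (exp (a * (0 + 2 * pi * \<theta>)) / (1 + exp (0 + 2 * pi * \<theta>))) \<partial>lborel) = (\<integral>\<^sup>+\<theta>. ennreal (exp (\<psi> * \<theta>) / (2 * cosh (pi * \<theta>))) \<partial>lborel)"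
  proof (intro nn_integral_cong)
    fix \<theta> :: real
    have "1 + exp (2 * pi * \<theta>) = exp (pi * \<theta>) * (2 * cosh (pi * \<theta>))"
      by (simp add: cosh_def field_simps exp_add[symmetric])
    moreover have "exp (a * (2 * pi * \<theta>)) = exp (pi * \<theta>) * exp (\<psi> * \<theta>)"
      unfolding a(4)[symmetric] exp_add[symmetric] by (simp add: algebra_simps)
    ultimately show "ennreal (exp (a * (0 + 2 * pi * \<theta>)) / (1 + exp (0 + 2 * pi * \<theta>))) = ennreal (exp (\<psi> * \<theta>) / (2 * cosh (pi * \<theta>)))"
      by simp
  qed
  also have "\<dots> = (\<integral>\<^sup>+\<theta>. ennreal (cosh (\<psi> * \<theta>) / cosh (pi * \<theta>)) * indicator {0<..} \<theta> \<partial>lborel)"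
  proof -
    have "(\<integral>\<^sup>+\<theta>. ennreal (exp (\<psi> * \<theta>) / (2 * cosh (pi * \<theta>))) \<partial>lborel)
      = (\<integral>\<^sup>+\<theta>. ennreal (exp (\<psi> * \<theta>) / (2 * cosh (pi * \<theta>))) * indicator {0<..} \<theta> + ennreal (exp (\<psi> * \<theta>) / (2 * cosh (pi * \<theta>))) * indicator {..<0} \<theta> \<partial>lborel)"
    proof (rule nn_integral_cong_AE)
      have "AE t in lborel. t \<noteq> (0::real)" by (rule AE_lborel_singleton)
      then show "AE \<theta> in lborel. ennreal (exp (\<psi> * \<theta>) / (2 * cosh (pi * \<theta>))) = ennreal (exp (\<psi> * \<theta>) / (2 * cosh (pi * \<theta>))) * indicator {0<..} \<theta> + ennreal (exp (\<psi> * \<theta>) / (2 * cosh (pi * \<theta>))) * indicator {..<0} \<theta>"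
        by eventually_elim (auto split: split_indicator)
    qed
    also have "\<dots> = (\<integral>\<^sup>+\<theta>. ennreal (exp (\<psi> * \<theta>) / (2 * cosh (pi * \<theta>))) * indicator {0<..} \<theta> \<partial>lborel) + (\<integral>\<^sup>+\<theta>. ennreal (exp (\<psi> * \<theta>) / (2 * cosh (pi * \<theta>))) * indicator {..<0} \<theta> \<partial>lborel)"
      by (rule nn_integral_add) measurable
    also have "(\<integral>\<^sup>+\<theta>. ennreal (exp (\<psi> * \<theta>) / (2 * cosh (pi * \<theta>))) * indicator {..<0} \<theta> \<partial>lborel)
       = ennreal \<bar>-1\<bar> * (\<integral>\<^sup>+\<theta>. ennreal (exp (\<psi> * (0 + -1 * \<theta>)) / (2 * cosh (pi * (0 + -1 * \<theta>)))) * indicator {..<0} (0 + -1 * \<theta>) \<partial>lborel)"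
      by (rule nn_integral_real_affine) auto
    also have "\<dots> = (\<integral>\<^sup>+\<theta>. ennreal (exp (- (\<psi> * \<theta>)) / (2 * cosh (pi * \<theta>))) * indicator {0<..} \<theta> \<partial>lborel)"
      by (auto intro!: nn_integral_cong split: split_indicator)
    also have "(\<integral>\<^sup>+\<theta>. ennreal (exp (\<psi> * \<theta>) / (2 * cosh (pi * \<theta>))) * indicator {0<..} \<theta> \<partial>lborel) + (\<integral>\<^sup>+\<theta>. ennreal (exp (- (\<psi> * \<theta>)) / (2 * cosh (pi * \<theta>))) * indicator {0<..} \<theta> \<partial>lborel)
       = (\<integral>\<^sup>+\<theta>. ennreal (exp (\<psi> * \<theta>) / (2 * cosh (pi * \<theta>))) * indicator {0<..} \<theta> + ennreal (exp (- (\<psi> * \<theta>)) / (2 * cosh (pi * \<theta>))) * indicator {0<..} \<theta> \<partial>lborel)"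
      by (rule nn_integral_add[symmetric]) measurable
    also have "\<dots> = (\<integral>\<^sup>+\<theta>. ennreal (cosh (\<psi> * \<theta>) / cosh (pi * \<theta>)) * indicator {0<..} \<theta> \<partial>lborel)"
    proof (intro nn_integral_cong)
      fix \<theta> :: real
      have cp: "cosh (pi * \<theta>) > 0" by (rule cosh_real_pos)
      have "ennreal (exp (\<psi> * \<theta>) / (2 * cosh (pi * \<theta>))) + ennreal (exp (- (\<psi> * \<theta>)) / (2 * cosh (pi * \<theta>))) = ennreal (cosh (\<psi> * \<theta>) / cosh (pi * \<theta>))"
        using cp by (subst ennreal_plus[symmetric]) (auto simp: cosh_def[of "\<psi> * \<theta>"] add_divide_distrib[symmetric] less_imp_le)
      then show "ennreal (exp (\<psi> * \<theta>) / (2 * cosh (pi * \<theta>))) * indicator {0<..} \<theta> + ennreal (exp (- (\<psi> * \<theta>)) / (2 * cosh (pi * \<theta>))) * indicator {0<..} \<theta>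
        = ennreal (cosh (\<psi> * \<theta>) / cosh (pi * \<theta>)) * indicator {0<..} \<theta>"
        by (simp add: distrib_right[symmetric])
    qed
    finally show ?thesis .
  qed
  finally have I: "ennreal (2 * pi) * (\<integral>\<^sup>+\<theta>. ennreal (cosh (\<psi> * \<theta>) / cosh (pi * \<theta>)) * indicator {0<..} \<theta> \<partial>lborel) = ennreal (pi / cos (\<psi> / 2))"
    by simp
  have "(\<integral>\<^sup>+\<theta>. ennreal (cosh (\<psi> * \<theta>) / cosh (pi * \<theta>)) * indicator {0<..} \<theta> \<partial>lborel) = ennreal (1 / (2 * pi)) * (ennreal (2 * pi) * (\<integral>\<^sup>+\<theta>. ennreal (cosh (\<psi> * \<theta>) / cosh (pi * \<theta>)) * indicator {0<..} \<theta> \<partial>lborel))"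
    by (simp add: mult.assoc[symmetric] ennreal_mult'[symmetric])
  also have "\<dots> = ennreal (1 / (2 * cos (\<psi> / 2)))"
    unfolding I using c by (simp add: ennreal_mult'[symmetric])
  finally show ?thesis
    by (intro has_pos_integral_nn) (use c cosh_real_pos in \<open>auto intro!: divide_nonneg_pos less_imp_le\<close>)
qed


text \<open>Half-angle substitution centred at pi / 2: t = tan (omega / 2 - pi / 4) stays finite on
  the whole interval, unlike tan (omega / 2), and sin omega = (1 - t^2) / (1 + t^2). The parameter
  cos x is rationalised likewise by T = tan (x / 2).\<close>

lemma integral_inverse_one_plus_cos_sin:
  assumes x: "0 < x" "x < pi"
  shows "integral {0..pi} (\<lambda>\<omega>. 1 / (1 + cos x * sin \<omega>)) = 2 * x / sin x"
proof -
  have sx: "sin x > 0" using x by (intro sin_gt_zero) auto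
  define T where "T = tan (x / 2)"
  have cx2: "cos (x / 2) > 0" using x by (intro cos_gt_zero_pi) auto
  have T: "T > 0" unfolding T_def using x by (intro tan_gt_zero) auto
  have T2: "1 + T\<^sup>2 > 0" by (simp add: add_pos_nonneg)
  have cT: "cos x = (1 - T\<^sup>2) / (1 + T\<^sup>2)" and sT: "sin x = 2 * T / (1 + T\<^sup>2)"
    using cos_tan_half[of "x / 2"] sin_tan_half[of "x / 2"] cx2 by (auto simp: T_def)
  define F where "F \<omega> = 2 / sin x * arctan (T * tan (\<omega> / 2 - pi / 4))" for \<omega>
  have "((\<lambda>\<omega>. 1 / (1 + cos x * sin \<omega>)) has_integral (F pi - F 0)) {0..pi}"
  proof (rule fundamental_theorem_of_calculus)
    fix \<omega> :: real assume w: "\<omega> \<in> {0..pi}"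
    define y where "y = \<omega> / 2 - pi / 4"
    have "- (pi / 2) < y" "y < pi / 2" using w pi_gt_zero unfolding y_def atLeastAtMost_iff by linarith+
    then have cy: "cos y > 0" by (rule cos_gt_zero_pi)
    define t where "t = tan y"
    have st: "sin \<omega> = (1 - t\<^sup>2) / (1 + t\<^sup>2)"
    proof -
      have "sin \<omega> = cos (2 * y)" by (simp add: y_def cos_diff algebra_simps)
      then show ?thesis using cos_tan_half[of y] cy by (simp add: t_def)
    qed
    have t2: "1 + t\<^sup>2 > 0" by (simp add: add_pos_nonneg)
    have dt: "((\<lambda>\<omega>. tan (\<omega> / 2 - pi / 4)) has_real_derivative (1 + t\<^sup>2) / 2) (at \<omega>)"
    proof -
      have "((\<lambda>\<omega>. tan (\<omega> / 2 - pi / 4)) has_real_derivative inverse ((cos y)\<^sup>2) * (1 / 2 - 0)) (at \<omega>)"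
        unfolding y_def
        by (rule DERIV_chain2[OF DERIV_tan DERIV_diff[OF DERIV_cdivide[OF DERIV_ident] DERIV_const]]) (use cy y_def in simp)
      moreover have "inverse ((cos y)\<^sup>2) = 1 + t\<^sup>2" using cy tan_sec[of y] by (simp add: t_def power_inverse)
      ultimately show ?thesis by simp
    qed
    have "(F has_real_derivative 2 / sin x * (inverse (1 + (T * t)\<^sup>2) * (T * ((1 + t\<^sup>2) / 2)))) (at \<omega>)"
      unfolding F_def
      using DERIV_cmult[OF DERIV_chain2[OF DERIV_arctan DERIV_cmult[OF dt, of T]], of "2 / sin x"] by (simp add: t_def y_def)
    also have "2 / sin x * (inverse (1 + (T * t)\<^sup>2) * (T * ((1 + t\<^sup>2) / 2))) = 1 / (1 + cos x * sin \<omega>)"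
    proof -
      have p: "1 + (T * t)\<^sup>2 > 0" by (simp add: add_pos_nonneg)
      have "1 + cos x * sin \<omega> = ((1 + T\<^sup>2) * (1 + t\<^sup>2) + (1 - T\<^sup>2) * (1 - t\<^sup>2)) / ((1 + T\<^sup>2) * (1 + t\<^sup>2))"
        unfolding cT st using T2 t2 by (simp add: add_divide_distrib)
      also have "(1 + T\<^sup>2) * (1 + t\<^sup>2) + (1 - T\<^sup>2) * (1 - t\<^sup>2) = 2 * (1 + (T * t)\<^sup>2)"
        by (simp add: power2_eq_square algebra_simps)
      finally have "1 / (1 + cos x * sin \<omega>) = (1 + T\<^sup>2) * (1 + t\<^sup>2) / (2 * (1 + (T * t)\<^sup>2))" by simp
      moreover have "2 / sin x = (1 + T\<^sup>2) / T" unfolding sT using T by (simp add: field_simps)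
      moreover have "a / T * (inverse P * (T * (b / 2))) = a * b / (2 * P)" if "P > 0" for a b P :: real
        using T that by (simp add: field_simps)
      ultimately show ?thesis using p by (simp only:)
    qed
    finally show "(F has_vector_derivative 1 / (1 + cos x * sin \<omega>)) (at \<omega> within {0..pi})"
      by (meson has_field_derivative_at_within has_real_derivative_iff_has_vector_derivative)
  qed simp
  moreover have "F pi - F 0 = 2 * x / sin x"
  proof -
    have "F pi = 2 / sin x * (x / 2)" "F 0 = 2 / sin x * (- (x / 2))"
      using x by (auto simp: F_def T_def tan_45 arctan_tan arctan_minus tan_minus)
    then show ?thesis by simp
  qed
  ultimately show ?thesis by (simp add: integral_unique)
qed

text \<open>Partial fractions in sin omega reduce to the preceding integral. The parameters 0 and 1,
  where the closed form divides by cos x or sin x, are the subject of \<open>K0_0\<close> and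
  \<open>K0_1\<close>.\<close>

lemma K0_cos:
  assumes x: "0 < x" "x < pi" and c: "cos x \<noteq> 0"
  shows "K0 (cos x) = 2 * cos x * (2 * x / sin x) + (pi - 2 * x / sin x) / cos x"
proof -
  have c1: "-1 < cos x" using cos_monotone_0_pi[of x pi] x by simp
  have int: "(\<lambda>\<omega>. 1 / (1 + cos x * sin \<omega>)) integrable_on {0..pi}"
    by (intro integrable_continuous_interval continuous_intros) (auto dest: one_plus_c_sin_nz[OF c1])
  have "((\<lambda>\<omega>. 2 * cos x * (1 / (1 + cos x * sin \<omega>)) + (1 - 1 / (1 + cos x * sin \<omega>)) / cos x) has_integral
      (2 * cos x * (2 * x / sin x) + ((pi - 0) - 2 * x / sin x) / cos x)) {0..pi}"
    using integrable_integral[OF int] integral_inverse_one_plus_cos_sin[OF x] has_integral_const_real[of "1::real" 0 pi]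
    by (intro has_integral_add has_integral_mult_right has_integral_divide has_integral_diff) simp_all
  then have "((\<lambda>\<omega>. (2 * cos x + sin \<omega>) / (1 + cos x * sin \<omega>)) has_integral
      (2 * cos x * (2 * x / sin x) + ((pi - 0) - 2 * x / sin x) / cos x)) {0..pi}"
  proof (rule has_integral_eq[rotated])
    fix \<omega> :: real assume w: "\<omega> \<in> {0..pi}"
    have "1 + cos x * sin \<omega> \<noteq> 0" by (rule one_plus_c_sin_nz[OF c1 w])
    then show "2 * cos x * (1 / (1 + cos x * sin \<omega>)) + (1 - 1 / (1 + cos x * sin \<omega>)) / cos x = (2 * cos x + sin \<omega>) / (1 + cos x * sin \<omega>)"
    proof -
      have "2 * C * (1 / q) + (1 - 1 / q) / C = (2 * C + S) / q" if "q = 1 + C * S" "q \<noteq> 0" "C \<noteq> 0" for q C S :: real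
      proof -
        have "1 - 1 / q = C * S / q" using that by (simp add: diff_divide_eq_iff)
        then show ?thesis using that by (simp add: add_divide_distrib)
      qed
      from this[OF refl \<open>1 + cos x * sin \<omega> \<noteq> 0\<close> c] show ?thesis .
    qed
  qed
  then show ?thesis by (simp add: K0_def integral_unique)
qed

lemma K0_0: "K0 0 = 2"
proof -
  have "((\<lambda>\<omega>. sin \<omega>) has_integral (- cos pi - - cos 0)) {0..pi}"
    by (rule fundamental_theorem_of_calculus)
       (auto intro!: derivative_eq_intros simp: has_real_derivative_iff_has_vector_derivative[symmetric])
  then show ?thesis by (simp add: K0_def integral_unique)
qed

lemma K0_1: "K0 1 = pi + 2"
proof -
  define F where "F \<omega> = \<omega> + tan (\<omega> / 2 - pi / 4)" for \<omega>
  have "((\<lambda>\<omega>. (2 * 1 + sin \<omega>) / (1 + 1 * sin \<omega>)) has_integral (F pi - F 0)) {0..pi}"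
  proof (rule fundamental_theorem_of_calculus)
    fix \<omega> :: real assume w: "\<omega> \<in> {0..pi}"
    define y where "y = \<omega> / 2 - pi / 4"
    have "- (pi / 2) < y" "y < pi / 2" using w pi_gt_zero unfolding y_def atLeastAtMost_iff by linarith+
    then have cy: "cos y > 0" by (rule cos_gt_zero_pi)
    have "sin \<omega> = cos (2 * y)" by (simp add: y_def cos_diff algebra_simps)
    then have s: "1 + sin \<omega> = 2 * (cos y)\<^sup>2" by (simp add: cos_double_cos)
    have "((\<lambda>\<omega>. tan (\<omega> / 2 - pi / 4)) has_real_derivative inverse ((cos y)\<^sup>2) * (1 / 2 - 0)) (at \<omega>)"
      unfolding y_def
      by (rule DERIV_chain2[OF DERIV_tan DERIV_diff[OF DERIV_cdivide[OF DERIV_ident] DERIV_const]]) (use cy y_def in simp)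
    from DERIV_add[OF DERIV_ident this]
    have "(F has_real_derivative 1 + inverse ((cos y)\<^sup>2) * (1 / 2 - 0)) (at \<omega>)" by (simp add: F_def[abs_def])
    also have "1 + inverse ((cos y)\<^sup>2) * (1 / 2 - 0) = (1 + (1 + sin \<omega>)) / (1 + sin \<omega>)"
      unfolding s using cy by (simp add: field_simps)
    finally show "(F has_vector_derivative (2 * 1 + sin \<omega>) / (1 + 1 * sin \<omega>)) (at \<omega> within {0..pi})"
      by (simp add: has_field_derivative_at_within has_real_derivative_iff_has_vector_derivative[symmetric])
  qed simp
  moreover have "F pi - F 0 = pi + 2" by (simp add: F_def tan_45 tan_minus)
  ultimately show ?thesis by (simp add: K0_def integral_unique)
qed

text \<open>Building block of the integrand in \<open>a_coeff\<close>: since 2 sinh^2 y = cosh (2 y)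
  - 1, that integrand is a combination of two of these.\<close>

definition theta_fun :: "real \<Rightarrow> real \<Rightarrow> real" where
  "theta_fun \<psi> \<theta> = (cosh (\<psi> * \<theta>) - 1) / ((sinh (pi * \<theta> / 2))\<^sup>2 * cosh (pi * \<theta>))"

lemma cosh_pi_sinh: "cosh (pi * \<theta>) = 1 + 2 * (sinh (pi * \<theta> / 2))\<^sup>2"
proof -
  have "cosh (2 * (pi * \<theta> / 2)) = 2 * (sinh (pi * \<theta> / 2))\<^sup>2 + 1"
    using cosh_double_sinh[of "pi * \<theta> / 2"] by simp
  then show ?thesis by simp
qed

lemma sinh_half_pos: "\<theta> > 0 \<Longrightarrow> sinh (pi * \<theta> / 2) > 0"
  by simp

text \<open>With S = sinh^2 (pi theta / 2) the denominator is S (1 + 2 S). Its partial fractions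
  separate the two hyperbolic integrals, each of which converges because psi is below pi.\<close>

lemma theta_integral_small:
  assumes p: "0 < \<psi>" "\<psi> < pi"
  shows "has_pos_integral (theta_fun \<psi>) (2 / pi * (1 - \<psi> * cot \<psi>) - 1 / cos (\<psi> / 2) + 1)"
proof -
  have "has_pos_integral (\<lambda>\<theta>. (cosh (\<psi> * \<theta>) - 1) / (sinh (pi * \<theta> / 2))\<^sup>2 - 2 * (cosh (\<psi> * \<theta>) / cosh (pi * \<theta>)) + 2 * (cosh (0 * \<theta>) / cosh (pi * \<theta>)))
     (2 / pi * (1 - \<psi> * cot \<psi>) - 2 * (1 / (2 * cos (\<psi> / 2))) + 2 * (1 / (2 * cos (0 / 2))))"
    using p by (intro has_pos_integral_add has_pos_integral_diff has_pos_integral_cmult integral_cosh_over_sinh_sq integral_cosh_over_cosh) auto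
  then have "has_pos_integral (theta_fun \<psi>) (2 / pi * (1 - \<psi> * cot \<psi>) - 2 * (1 / (2 * cos (\<psi> / 2))) + 2 * (1 / (2 * cos (0 / 2))))"
  proof (rule has_pos_integral_cong[rotated])
    fix \<theta> :: real assume t: "0 < \<theta>"
    define S where "S = (sinh (pi * \<theta> / 2))\<^sup>2"
    have S: "S > 0" using sinh_half_pos[OF t] t by (simp add: S_def)
    have "1 + 2 * S > 0" using S by simp
    have "X / S - 2 * (Y / (1 + 2 * S)) + 2 * (1 / (1 + 2 * S)) = X / (S * (1 + 2 * S))" if "Y = X + 1" for X Y
      using S that by (simp add: divide_simps) (simp add: algebra_simps)
    from this[of "cosh (\<psi> * \<theta>)" "cosh (\<psi> * \<theta>) - 1"]
    show "(cosh (\<psi> * \<theta>) - 1) / (sinh (pi * \<theta> / 2))\<^sup>2 - 2 * (cosh (\<psi> * \<theta>) / cosh (pi * \<theta>)) + 2 * (cosh (0 * \<theta>) / cosh (pi * \<theta>)) = theta_fun \<psi> \<theta>"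
      unfolding theta_fun_def cosh_pi_sinh S_def by simp
  qed
  then show ?thesis by simp
qed

text \<open>Here the numerator is 2 sinh^2 (pi theta / 2) and cancels. The general closed form has
  no meaning at this value, where cot psi and 1 / cos (psi / 2) both have poles.\<close>

lemma theta_integral_pi: "has_pos_integral (theta_fun pi) 1"
proof -
  have "has_pos_integral (\<lambda>\<theta>. 2 * (cosh (0 * \<theta>) / cosh (pi * \<theta>))) (2 * (1 / (2 * cos (0 / 2))))"
    by (intro has_pos_integral_cmult integral_cosh_over_cosh) auto
  then have "has_pos_integral (theta_fun pi) (2 * (1 / (2 * cos (0 / 2))))"
  proof (rule has_pos_integral_cong[rotated])
    fix \<theta> :: real assume t: "0 < \<theta>"
    show "2 * (cosh (0 * \<theta>) / cosh (pi * \<theta>)) = theta_fun pi \<theta>"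
      unfolding theta_fun_def cosh_pi_sinh using sinh_half_pos[OF t] t by simp
  qed
  then show ?thesis by simp
qed

lemma cosh_add_cosh_pi: "cosh (\<psi> * \<theta>) + cosh ((2 * pi - \<psi>) * \<theta>) = 2 * cosh ((\<psi> - pi) * \<theta>) * cosh (pi * \<theta>)"
proof -
  have "\<psi> * \<theta> = (\<psi> - pi) * \<theta> + pi * \<theta>" "(2 * pi - \<psi>) * \<theta> = pi * \<theta> - (\<psi> - pi) * \<theta>" by (auto simp: algebra_simps)
  then show ?thesis by (simp only: cosh_add cosh_diff) simp
qed

text \<open>For psi above pi the two pieces of the partial fraction diverge separately. The identity
  \<open>cosh_add_cosh_pi\<close> reflects psi to 2 pi - psi, at the price of a term with psi - pi;
  both parameters are below pi, and the same closed form results.\<close>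

lemma theta_integral_large:
  assumes p: "pi < \<psi>" "\<psi> < 2 * pi"
  shows "has_pos_integral (theta_fun \<psi>) (2 / pi * (1 - \<psi> * cot \<psi>) - 1 / cos (\<psi> / 2) + 1)"
proof -
  define \<psi>' where "\<psi>' = 2 * pi - \<psi>"
  have p': "0 < \<psi>'" "\<psi>' < pi" using p by (auto simp: \<psi>'_def)
  have "has_pos_integral (\<lambda>\<theta>. 2 * ((cosh ((\<psi> - pi) * \<theta>) - 1) / (sinh (pi * \<theta> / 2))\<^sup>2) + 4 * (cosh (0 * \<theta>) / cosh (pi * \<theta>)) - theta_fun \<psi>' \<theta>)
     (2 * (2 / pi * (1 - (\<psi> - pi) * cot (\<psi> - pi))) + 4 * (1 / (2 * cos (0 / 2))) - (2 / pi * (1 - \<psi>' * cot \<psi>') - 1 / cos (\<psi>' / 2) + 1))"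
    using p p' by (intro has_pos_integral_add has_pos_integral_diff has_pos_integral_cmult integral_cosh_over_sinh_sq integral_cosh_over_cosh theta_integral_small) auto
  then have "has_pos_integral (theta_fun \<psi>) (2 * (2 / pi * (1 - (\<psi> - pi) * cot (\<psi> - pi))) + 4 * (1 / (2 * cos (0 / 2))) - (2 / pi * (1 - \<psi>' * cot \<psi>') - 1 / cos (\<psi>' / 2) + 1))"
  proof (rule has_pos_integral_cong[rotated])
    fix \<theta> :: real assume t: "0 < \<theta>"
    define S where "S = (sinh (pi * \<theta> / 2))\<^sup>2"
    have S: "S > 0" using sinh_half_pos[OF t] t by (simp add: S_def)
    define X where "X = cosh ((\<psi> - pi) * \<theta>)"
    define Y where "Y = cosh (\<psi>' * \<theta>)"
    have c: "cosh (\<psi> * \<theta>) = 2 * X * (1 + 2 * S) - Y"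
      using cosh_add_cosh_pi[of \<psi> \<theta>] unfolding cosh_pi_sinh X_def Y_def S_def \<psi>'_def by simp
    have "2 * ((X - 1) / S) + 4 * (1 / (1 + 2 * S)) - (Y - 1) / (S * (1 + 2 * S)) = (2 * X * (1 + 2 * S) - Y - 1) / (S * (1 + 2 * S))"
      using S by (simp add: divide_simps) (simp add: algebra_simps)
    then show "2 * ((cosh ((\<psi> - pi) * \<theta>) - 1) / (sinh (pi * \<theta> / 2))\<^sup>2) + 4 * (cosh (0 * \<theta>) / cosh (pi * \<theta>)) - theta_fun \<psi>' \<theta> = theta_fun \<psi> \<theta>"
      unfolding theta_fun_def c unfolding cosh_pi_sinh X_def Y_def S_def by simp
  qed
  moreover have "2 * (2 / pi * (1 - (\<psi> - pi) * cot (\<psi> - pi))) + 4 * (1 / (2 * cos (0 / 2))) - (2 / pi * (1 - \<psi>' * cot \<psi>') - 1 / cos (\<psi>' / 2) + 1)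
     = 2 / pi * (1 - \<psi> * cot \<psi>) - 1 / cos (\<psi> / 2) + 1"
  proof -
    have 1: "cot (\<psi> - pi) = cot \<psi>" by (simp add: cot_def sin_diff cos_diff)
    have 2: "cot \<psi>' = - cot \<psi>" by (simp add: cot_def \<psi>'_def sin_diff cos_diff)
    have "\<psi>' / 2 = pi - \<psi> / 2" by (simp add: \<psi>'_def)
    then have 3: "cos (\<psi>' / 2) = - cos (\<psi> / 2)" by (simp only: cos_diff) simp
    show ?thesis unfolding 1 2 3 by (simp add: \<psi>'_def field_simps)
  qed
  ultimately show ?thesis by (simp only:)
qed

text \<open>Two closed forms are compared: that of the theta-integral and that of K0 at cos (psi /
  2), with psi = |2 pi - beta|. The values psi = 0 and psi = pi are the removable singularities of
  these forms. Angles beyond 2 pi follow because both sides are even in psi.\<close>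

lemma theta_integral:
  assumes b: "0 < \<beta>" "\<beta> < 4 * pi"
  shows "has_pos_integral (theta_fun (2 * pi - \<beta>)) (8 * (edge_fun \<beta> - edge_fun (2 * pi)))"
proof -
  have E: "8 * (edge_fun (2 * pi - \<psi>) - edge_fun (2 * pi)) = (pi + 2 - K0 (cos (\<psi> / 2))) / pi" for \<psi>
  proof -
    have "(2 * pi - \<psi>) / 2 = pi - \<psi> / 2" by simp
    then have "- cos ((2 * pi - \<psi>) / 2) = cos (\<psi> / 2)" by (simp only: cos_diff) simp
    then show ?thesis by (simp add: edge_fun_def K0_1 diff_divide_distrib add_divide_distrib)
  qed
  have main: "has_pos_integral (theta_fun \<psi>) ((pi + 2 - K0 (cos (\<psi> / 2))) / pi)" if p: "0 \<le> \<psi>" "\<psi> < 2 * pi" for \<psi>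
  proof -
    consider "\<psi> = 0" | "\<psi> = pi" | "0 < \<psi>" "\<psi> < 2 * pi" "\<psi> \<noteq> pi" using p by linarith
    then show ?thesis
    proof cases
      case 1
      have "theta_fun 0 = (\<lambda>\<theta>. 0)" by (simp add: theta_fun_def[abs_def])
      then show ?thesis using 1 by (simp add: K0_1 has_pos_integral_def has_bochner_integral_zero)
    next
      case 2
      then show ?thesis using theta_integral_pi by (simp add: K0_0)
    next
      case 3
      have I: "has_pos_integral (theta_fun \<psi>) (2 / pi * (1 - \<psi> * cot \<psi>) - 1 / cos (\<psi> / 2) + 1)"
        using theta_integral_small[of \<psi>] theta_integral_large[of \<psi>] 3 by (cases "\<psi> < pi") auto
      define x where "x = \<psi> / 2"
      have x: "0 < x" "x < pi" "\<psi> = 2 * x" using 3 by (auto simp: x_def)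
      have s: "sin x > 0" using x by (intro sin_gt_zero) auto
      have c: "cos x \<noteq> 0"
      proof (cases "x < pi / 2")
        case True then show ?thesis using cos_gt_zero[of x] x by simp
      next
        case False
        then have "pi / 2 < x" using 3 by (simp add: x_def)
        then have "cos x < cos (pi / 2)" using x by (intro cos_monotone_0_pi) auto
        then show ?thesis by simp
      qed
      have "cot (2 * x) = (2 * (cos x)\<^sup>2 - 1) / (2 * sin x * cos x)" unfolding cot_def sin_double cos_double_cos ..
      also have "\<dots> = cos x / sin x - 1 / (2 * sin x * cos x)" using s c by (simp add: field_simps power2_eq_square)
      finally have ct: "cot (2 * x) = cos x / sin x - 1 / (2 * sin x * cos x)" .
      have "2 / pi * (1 - \<psi> * cot \<psi>) - 1 / cos (\<psi> / 2) + 1 = (pi + 2 - K0 (cos (\<psi> / 2))) / pi"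
      proof -
        \<comment> \<open>After the double-angle formula for the cotangent the identity is rational
          in pi, sin x and cos x, and holds without any relation between them.\<close>
        have "2 / P * (1 - 2 * x * (C / S - 1 / (2 * S * C))) - 1 / C + 1 = (P + 2 - (2 * C * (2 * x / S) + (P - 2 * x / S) / C)) / P"
          if "P > 0" "S > 0" "C \<noteq> 0" for P S C :: real
          using that by (simp add: divide_simps) (simp add: algebra_simps)
        from this[of pi "sin x" "cos x"] s c show ?thesis
          unfolding x_def[symmetric] K0_cos[OF x(1,2) c] unfolding x(3) ct by simp
      qed
      then show ?thesis using I by simp
    qed
  qed
  have even: "theta_fun (- \<psi>) = theta_fun \<psi>" for \<psi> by (simp add: theta_fun_def[abs_def])
  show ?thesis
  proof (cases "\<beta> \<le> 2 * pi")
    case True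
    then show ?thesis using main[of "2 * pi - \<beta>"] E[of "2 * pi - \<beta>"] b by simp
  next
    case False
    have "cos (- ((2 * pi - \<beta>) / 2)) = cos ((2 * pi - \<beta>) / 2)" by (rule cos_minus)
    moreover have "- ((2 * pi - \<beta>) / 2) = (\<beta> - 2 * pi) / 2" by (simp add: field_simps)
    ultimately have "cos ((\<beta> - 2 * pi) / 2) = cos ((2 * pi - \<beta>) / 2)" by simp
    then show ?thesis using main[of "\<beta> - 2 * pi"] even[of "\<beta> - 2 * pi"] E[of "2 * pi - \<beta>"] False b by simp
  qed
qed

text \<open>The direction pi has weight -6 in \<open>angular_decomposition\<close>, so this value is
  the origin of the -3 / 4 in \<open>a_coeff\<close>.\<close>

lemma edge_fun_pi: "edge_fun pi - edge_fun (2 * pi) = 1 / 8"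
  by (simp add: edge_fun_def K0_0 K0_1 field_simps)

text \<open>The integrand is 2 \<open>theta_fun (2 * pi - \<alpha>)\<close> minus half of
  \<open>theta_fun (2 * pi - 2 * \<alpha>)\<close>. With the factor 8 of
  \<open>theta_integral\<close> and the 1 / 4 in front this gives the weights 4 and -1 of
  \<open>angular_decomposition\<close>.\<close>

lemma a_coeff_eq:
  assumes a: "0 < \<alpha>" "\<alpha> < 2 * pi"
  shows "a_coeff \<alpha> = - 3 / 4 + 4 * (edge_fun \<alpha> - edge_fun (2 * pi)) - (edge_fun (2 * \<alpha>) - edge_fun (2 * pi))"
proof -
  have "has_pos_integral (\<lambda>\<theta>. 2 * theta_fun (2 * pi - \<alpha>) \<theta> - 1 / 2 * theta_fun (2 * pi - 2 * \<alpha>) \<theta>)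
     (2 * (8 * (edge_fun \<alpha> - edge_fun (2 * pi))) - 1 / 2 * (8 * (edge_fun (2 * \<alpha>) - edge_fun (2 * pi))))"
    using a by (intro has_pos_integral_diff has_pos_integral_cmult theta_integral) auto
  then have I: "has_pos_integral (\<lambda>\<theta>. (4 * (sinh ((pi - \<alpha> / 2) * \<theta>))\<^sup>2 - (sinh ((pi - \<alpha>) * \<theta>))\<^sup>2) / ((sinh (pi * \<theta> / 2))\<^sup>2 * cosh (pi * \<theta>)))
     (2 * (8 * (edge_fun \<alpha> - edge_fun (2 * pi))) - 1 / 2 * (8 * (edge_fun (2 * \<alpha>) - edge_fun (2 * pi))))"
  proof (rule has_pos_integral_cong[rotated])
    fix \<theta> :: real
    have sq: "(sinh y)\<^sup>2 = (cosh (2 * y) - 1) / 2" for y :: real using cosh_double_sinh[of y] by simp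
    have ar: "2 * ((pi - \<alpha> / 2) * \<theta>) = (2 * pi - \<alpha>) * \<theta>" "2 * ((pi - \<alpha>) * \<theta>) = (2 * pi - 2 * \<alpha>) * \<theta>" by (auto simp: algebra_simps)
    show "2 * theta_fun (2 * pi - \<alpha>) \<theta> - 1 / 2 * theta_fun (2 * pi - 2 * \<alpha>) \<theta>
      = (4 * (sinh ((pi - \<alpha> / 2) * \<theta>))\<^sup>2 - (sinh ((pi - \<alpha>) * \<theta>))\<^sup>2) / ((sinh (pi * \<theta> / 2))\<^sup>2 * cosh (pi * \<theta>))"
      unfolding theta_fun_def sq[of "(pi - \<alpha> / 2) * \<theta>"] sq[of "(pi - \<alpha>) * \<theta>"] ar
      by (simp add: diff_divide_distrib mult.commute mult.left_commute)
  qed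
  then have "(LBINT \<theta>=0..\<infinity>. (4 * (sinh ((pi - \<alpha> / 2) * \<theta>))\<^sup>2 - (sinh ((pi - \<alpha>) * \<theta>))\<^sup>2) / ((sinh (pi * \<theta> / 2))\<^sup>2 * cosh (pi * \<theta>)))
    = 2 * (8 * (edge_fun \<alpha> - edge_fun (2 * pi))) - 1 / 2 * (8 * (edge_fun (2 * \<alpha>) - edge_fun (2 * pi)))"
    unfolding interval_lebesgue_integral_0_infty set_lebesgue_integral_def has_pos_integral_def
    by (simp add: has_bochner_integral_integral_eq)
  then show ?thesis unfolding a_coeff_def by (simp add: diff_divide_distrib)
qed

subsection \<open>The edge term\<close>

lemma nn_integral_Ioo_eq_Icc:
  fixes f :: "real \<Rightarrow> ennreal"
  shows "(\<integral>\<^sup>+x. f x * indicator {a<..<b} x \<partial>lborel) = (\<integral>\<^sup>+x. f x * indicator {a..b} x \<partial>lborel)"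
proof (rule nn_integral_cong_AE)
  have "AE x in lborel. x \<noteq> a" "AE x in lborel. x \<noteq> b" by (rule AE_lborel_singleton)+
  then show "AE x in lborel. f x * indicator {a<..<b} x = f x * indicator {a..b} x"
    by eventually_elim (auto split: split_indicator)
qed

lemma nn_integral_normal_density:
  assumes "s > 0" shows "(\<integral>\<^sup>+u. ennreal (normal_density m s u) \<partial>lborel) = 1"
  using nn_integral_eq_integral[OF integrable_normal_density[OF assms]] integral_normal_density[OF assms] by simp

lemma nn_integral_normal_density_half_line:
  "(\<integral>\<^sup>+y. ennreal (normal_density m (sqrt 2) y) * indicator {0<..} y \<partial>lborel) = ennreal (1 / 2 + gauss_int (m / 2) / sqrt pi)"
proof -
  define F where "F y = gauss_int ((y - m) / 2) / sqrt pi" for y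
  have "(\<integral>\<^sup>+y. ennreal (normal_density m (sqrt 2) y) * indicator {0..} y \<partial>lborel) = ennreal (1 / 2 - F 0)"
  proof (rule nn_integral_FTC_atLeast)
    show "(F has_real_derivative normal_density m (sqrt 2) y) (at y)" for y
    proof -
      have "((\<lambda>y. (y - m) / 2) has_real_derivative (1 - 0) / 2) (at y)"
        by (rule DERIV_cdivide[OF DERIV_diff[OF DERIV_ident DERIV_const]])
      from DERIV_cdivide[OF DERIV_chain2[OF DERIV_gauss_int this], of "sqrt pi"]
      have "(F has_real_derivative exp (- ((y - m) / 2)\<^sup>2) * ((1 - 0) / 2) / sqrt pi) (at y)" by (simp add: F_def[abs_def])
      moreover have "exp (- ((y - m) / 2)\<^sup>2) * ((1 - 0) / 2) / sqrt pi = normal_density m (sqrt 2) y"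
      proof -
        have "sqrt (pi * 4) = 2 * sqrt pi" using real_sqrt_mult[of pi 4] by simp
        then show ?thesis by (simp add: normal_density_def power_divide mult.commute)
      qed
      ultimately show ?thesis by simp
    qed
    have "filterlim (\<lambda>y. (y - m) / 2) at_top at_top" by real_asymp
    from filterlim_compose[OF gauss_int_at_top this]
    have "(F \<longlongrightarrow> sqrt pi / 2 / sqrt pi) at_top" unfolding F_def by (intro tendsto_intros) auto
    then show "(F \<longlongrightarrow> 1 / 2) at_top" by simp
  qed auto
  also have "(\<integral>\<^sup>+y. ennreal (normal_density m (sqrt 2) y) * indicator {0..} y \<partial>lborel) = (\<integral>\<^sup>+y. ennreal (normal_density m (sqrt 2) y) * indicator {0<..} y \<partial>lborel)"
  proof (rule nn_integral_cong_AE)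
    show "AE y in lborel. ennreal (normal_density m (sqrt 2) y) * indicator {0..} y = ennreal (normal_density m (sqrt 2) y) * indicator {0<..} y"
      using AE_lborel_singleton[of "0::real"] by eventually_elim (auto split: split_indicator)
  qed
  also have "1 / 2 - F 0 = 1 / 2 + gauss_int (m / 2) / sqrt pi"
    using gauss_int_minus[of "m / 2"] by (simp add: F_def)
  finally show ?thesis .
qed

lemma gauss_kernel_polar:
  "gauss_kernel (polar r \<beta>) (s * cos \<psi>, s * sin \<psi>) 1 = exp (- (r\<^sup>2 + s\<^sup>2 - 2 * r * s * cos (\<psi> - \<beta>)) / 4) / (4 * pi)"
proof -
  have "(norm (polar r \<beta> - (s * cos \<psi>, s * sin \<psi>)))\<^sup>2 = (r * cos \<beta> - s * cos \<psi>)\<^sup>2 + (r * sin \<beta> - s * sin \<psi>)\<^sup>2"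
    by (simp add: norm_prod_sq polar_def)
  also have "\<dots> = r\<^sup>2 * ((cos \<beta>)\<^sup>2 + (sin \<beta>)\<^sup>2) + s\<^sup>2 * ((cos \<psi>)\<^sup>2 + (sin \<psi>)\<^sup>2) - 2 * r * s * cos (\<psi> - \<beta>)"
    unfolding cos_diff by algebra
  finally show ?thesis by (simp add: gauss_kernel_def)
qed

text \<open>The mass which the Gaussian of time 1 around \<open>(r, 0)\<close> has in direction \<open>\<gamma>\<close>.\<close>

definition angular_density :: "real \<Rightarrow> real \<Rightarrow> ennreal" where
  "angular_density r \<gamma> = (\<integral>\<^sup>+s. ennreal (s / (4 * pi) * exp (- (r\<^sup>2 + s\<^sup>2 - 2 * r * s * cos \<gamma>) / 4)) * indicator {0<..} s \<partial>lborel)"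

lemma borel_measurable_angular_density [measurable]: "angular_density r \<in> borel_measurable borel"
  unfolding angular_density_def[abs_def] by measurable

lemma angular_density_minus: "angular_density r (- \<gamma>) = angular_density r \<gamma>"
  by (simp add: angular_density_def)

text \<open>After a rotation by beta the left side is the mass that the time-1 Gaussian around
  \<open>polar r \<beta>\<close> gives to the upper half-plane. The second coordinate is normal with
  mean r sin beta and variance 2.\<close>

lemma nn_integral_angular_density_half_plane:
  "(\<integral>\<^sup>+\<psi>. angular_density r (\<psi> - \<beta>) * indicator {0<..<pi} \<psi> \<partial>lborel) = ennreal (1 / 2 + gauss_int (r * sin \<beta> / 2) / sqrt pi)"
proof -
  define F where "F z = ennreal (gauss_kernel (polar r \<beta>) z 1)" for z
  have F[measurable]: "F \<in> borel_measurable (borel \<Otimes>\<^sub>M borel)"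
    unfolding F_def[abs_def] borel_prod by measurable
  have "angular_density r (\<psi> - \<beta>) = (\<integral>\<^sup>+s. F (s * cos \<psi>, s * sin \<psi>) * ennreal s * indicator {0<..} s \<partial>lborel)" for \<psi>
    unfolding angular_density_def
  proof (intro nn_integral_cong)
    fix s :: real
    show "ennreal (s / (4 * pi) * exp (- (r\<^sup>2 + s\<^sup>2 - 2 * r * s * cos (\<psi> - \<beta>)) / 4)) * indicator {0<..} s = F (s * cos \<psi>, s * sin \<psi>) * ennreal s * indicator {0<..} s"
    proof (cases "s > 0")
      case True
      have "s / (4 * pi) * X = X / (4 * pi) * s" for X by simp
      then show ?thesis unfolding F_def gauss_kernel_polar using True by (simp only: ennreal_mult'[symmetric] less_imp_le ennreal_mult'')
    qed simp
  qed
  then have "(\<integral>\<^sup>+\<psi>. angular_density r (\<psi> - \<beta>) * indicator {0<..<pi} \<psi> \<partial>lborel) = (\<integral>\<^sup>+y. (\<integral>\<^sup>+x. F (x, y) \<partial>lborel) * indicator {0<..} y \<partial>lborel)"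
    by (simp only: nn_integral_half_plane_polar[OF F])
  also have "\<dots> = (\<integral>\<^sup>+y. ennreal (normal_density (r * sin \<beta>) (sqrt 2) y) * indicator {0<..} y \<partial>lborel)"
  proof -
    have "(\<integral>\<^sup>+x. F (x, y) \<partial>lborel) = ennreal (normal_density (r * sin \<beta>) (sqrt 2) y)" for y
    proof -
      have "F (x, y) = ennreal (normal_density (r * cos \<beta>) (sqrt 2) x) * ennreal (normal_density (r * sin \<beta>) (sqrt 2) y)" for x
        unfolding F_def by (subst gauss_kernel_normal) (simp_all add: polar_def ennreal_mult')
      then have "(\<integral>\<^sup>+x. F (x, y) \<partial>lborel) = (\<integral>\<^sup>+x. ennreal (normal_density (r * cos \<beta>) (sqrt 2) x) \<partial>lborel) * ennreal (normal_density (r * sin \<beta>) (sqrt 2) y)"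
        by (simp add: nn_integral_multc)
      then show ?thesis by (simp add: nn_integral_normal_density)
    qed
    then show ?thesis by simp
  qed
  finally show ?thesis unfolding nn_integral_normal_density_half_line .
qed

text \<open>The sector \<open>0 < \<gamma> < \<beta>\<close> and the mirror image of the sector \<open>0 < \<gamma> < \<pi> - \<beta>\<close> form a half-plane,
  whose Gaussian mass is known.\<close>

lemma nn_integral_angular_density_weighted:
  "(\<integral>\<^sup>+\<gamma>. ennreal (pi - \<gamma>) * angular_density r \<gamma> * indicator {0<..<pi} \<gamma> \<partial>lborel)
    = (\<integral>\<^sup>+\<beta>. ennreal (1 / 2 + gauss_int (r * sin \<beta> / 2) / sqrt pi) * indicator {0<..<pi/2} \<beta> \<partial>lborel)"
proof -
  define \<Phi> where "\<Phi> \<beta> = (\<integral>\<^sup>+\<gamma>. angular_density r \<gamma> * indicator {0<..<\<beta>} \<gamma> \<partial>lborel)" for \<beta>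
  have eq: "angular_density r \<gamma> * indicator {0<..<\<beta>} \<gamma> = angular_density r \<gamma> * of_bool (0 < \<gamma> \<and> \<gamma> < \<beta>)" for \<gamma> \<beta>
    by (auto split: split_indicator)
  have \<Phi>_meas[measurable]: "\<Phi> \<in> borel_measurable borel" unfolding \<Phi>_def[abs_def] eq by measurable
  \<comment> \<open>The weight pi - gamma is the length of the set of beta between gamma and pi, so
    the weighted integral is an integral over beta of unweighted sector masses.\<close>
  have "(\<integral>\<^sup>+\<gamma>. ennreal (pi - \<gamma>) * angular_density r \<gamma> * indicator {0<..<pi} \<gamma> \<partial>lborel)
     = (\<integral>\<^sup>+\<gamma>. (\<integral>\<^sup>+\<beta>. angular_density r \<gamma> * of_bool (0 < \<gamma> \<and> \<gamma> < \<beta> \<and> \<beta> < pi) \<partial>lborel) \<partial>lborel)"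
  proof (intro nn_integral_cong)
    fix \<gamma> :: real
    have "(\<integral>\<^sup>+\<beta>. angular_density r \<gamma> * of_bool (0 < \<gamma> \<and> \<gamma> < \<beta> \<and> \<beta> < pi) \<partial>lborel) = (\<integral>\<^sup>+\<beta>. (angular_density r \<gamma> * of_bool (0 < \<gamma>)) * indicator {\<gamma><..<pi} \<beta> \<partial>lborel)"
      by (intro nn_integral_cong) (auto split: split_indicator)
    also have "\<dots> = angular_density r \<gamma> * of_bool (0 < \<gamma>) * emeasure lborel {\<gamma><..<pi}" by (rule nn_integral_cmult_indicator) simp
    finally show "ennreal (pi - \<gamma>) * angular_density r \<gamma> * indicator {0<..<pi} \<gamma> = (\<integral>\<^sup>+\<beta>. angular_density r \<gamma> * of_bool (0 < \<gamma> \<and> \<gamma> < \<beta> \<and> \<beta> < pi) \<partial>lborel)"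
      by (cases "\<gamma> < pi") (auto simp: mult.commute split: split_indicator)
  qed
  also have "\<dots> = (\<integral>\<^sup>+\<beta>. (\<integral>\<^sup>+\<gamma>. angular_density r \<gamma> * of_bool (0 < \<gamma> \<and> \<gamma> < \<beta> \<and> \<beta> < pi) \<partial>lborel) \<partial>lborel)"
    by (rule lborel_pair.Fubini'[symmetric]) measurable
  also have "\<dots> = (\<integral>\<^sup>+\<beta>. \<Phi> \<beta> * indicator {0<..<pi} \<beta> \<partial>lborel)"
  proof (intro nn_integral_cong)
    fix \<beta> :: real
    have "(\<integral>\<^sup>+\<gamma>. angular_density r \<gamma> * of_bool (0 < \<gamma> \<and> \<gamma> < \<beta> \<and> \<beta> < pi) \<partial>lborel) = (\<integral>\<^sup>+\<gamma>. angular_density r \<gamma> * indicator {0<..<\<beta>} \<gamma> * of_bool (0 < \<beta> \<and> \<beta> < pi) \<partial>lborel)"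
      by (intro nn_integral_cong) (auto split: split_indicator)
    then show "(\<integral>\<^sup>+\<gamma>. angular_density r \<gamma> * of_bool (0 < \<gamma> \<and> \<gamma> < \<beta> \<and> \<beta> < pi) \<partial>lborel) = \<Phi> \<beta> * indicator {0<..<pi} \<beta>"
      by (auto simp: \<Phi>_def split: split_indicator)
  qed
  also have "\<dots> = (\<integral>\<^sup>+\<beta>. \<Phi> \<beta> * indicator {0<..<pi/2} \<beta> + \<Phi> \<beta> * indicator {pi/2<..<pi} \<beta> \<partial>lborel)"
  proof (rule nn_integral_cong_AE)
    have h: "0 < pi / 2" "pi / 2 < pi" by auto
    show "AE \<beta> in lborel. \<Phi> \<beta> * indicator {0<..<pi} \<beta> = \<Phi> \<beta> * indicator {0<..<pi/2} \<beta> + \<Phi> \<beta> * indicator {pi/2<..<pi} \<beta>"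
      using AE_lborel_singleton[of "pi/2"]
    proof eventually_elim
      case (elim \<beta>)
      then show ?case using h by (auto split: split_indicator)
    qed
  qed
  also have "\<dots> = (\<integral>\<^sup>+\<beta>. \<Phi> \<beta> * indicator {0<..<pi/2} \<beta> \<partial>lborel) + (\<integral>\<^sup>+\<beta>. \<Phi> \<beta> * indicator {pi/2<..<pi} \<beta> \<partial>lborel)"
    by (rule nn_integral_add) measurable
  \<comment> \<open>Reflecting beta to pi - beta pairs the two halves of the range, which brings
    together the two sectors that form a half-plane.\<close>
  also have "(\<integral>\<^sup>+\<beta>. \<Phi> \<beta> * indicator {pi/2<..<pi} \<beta> \<partial>lborel) = (\<integral>\<^sup>+\<beta>. \<Phi> (pi + (-1) * \<beta>) * indicator {pi/2<..<pi} (pi + (-1) * \<beta>) \<partial>lborel)"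
    by (subst nn_integral_real_affine[of _ "-1" pi]) auto
  also have "\<dots> = (\<integral>\<^sup>+\<beta>. \<Phi> (pi - \<beta>) * indicator {0<..<pi/2} \<beta> \<partial>lborel)"
    by (intro nn_integral_cong) (auto split: split_indicator)
  also have "(\<integral>\<^sup>+\<beta>. \<Phi> \<beta> * indicator {0<..<pi/2} \<beta> \<partial>lborel) + (\<integral>\<^sup>+\<beta>. \<Phi> (pi - \<beta>) * indicator {0<..<pi/2} \<beta> \<partial>lborel)
     = (\<integral>\<^sup>+\<beta>. \<Phi> \<beta> * indicator {0<..<pi/2} \<beta> + \<Phi> (pi - \<beta>) * indicator {0<..<pi/2} \<beta> \<partial>lborel)"
    by (rule nn_integral_add[symmetric]) measurable
  also have "\<dots> = (\<integral>\<^sup>+\<beta>. ennreal (1 / 2 + gauss_int (r * sin \<beta> / 2) / sqrt pi) * indicator {0<..<pi/2} \<beta> \<partial>lborel)"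
  proof (intro nn_integral_cong)
    fix \<beta> :: real
    show "\<Phi> \<beta> * indicator {0<..<pi/2} \<beta> + \<Phi> (pi - \<beta>) * indicator {0<..<pi/2} \<beta> = ennreal (1 / 2 + gauss_int (r * sin \<beta> / 2) / sqrt pi) * indicator {0<..<pi/2} \<beta>"
    proof (cases "\<beta> \<in> {0<..<pi/2}")
      case True
      have "ennreal (1 / 2 + gauss_int (r * sin \<beta> / 2) / sqrt pi) = (\<integral>\<^sup>+\<psi>. angular_density r (\<psi> - \<beta>) * indicator {0<..<pi} \<psi> \<partial>lborel)"
        by (rule nn_integral_angular_density_half_plane[symmetric])
      also have "\<dots> = (\<integral>\<^sup>+\<gamma>. angular_density r (\<beta> + 1 * \<gamma> - \<beta>) * indicator {0<..<pi} (\<beta> + 1 * \<gamma>) \<partial>lborel)"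
        by (subst nn_integral_real_affine[of _ 1 \<beta>]) auto
      also have "\<dots> = (\<integral>\<^sup>+\<gamma>. angular_density r \<gamma> * indicator {-\<beta><..<0} \<gamma> + angular_density r \<gamma> * indicator {0<..<pi - \<beta>} \<gamma> \<partial>lborel)"
      proof (rule nn_integral_cong_AE)
        show "AE \<gamma> in lborel. angular_density r (\<beta> + 1 * \<gamma> - \<beta>) * indicator {0<..<pi} (\<beta> + 1 * \<gamma>) = angular_density r \<gamma> * indicator {-\<beta><..<0} \<gamma> + angular_density r \<gamma> * indicator {0<..<pi - \<beta>} \<gamma>"
          using AE_lborel_singleton[of "0::real"] by eventually_elim (use True in \<open>auto split: split_indicator\<close>)
      qed
      also have "\<dots> = (\<integral>\<^sup>+\<gamma>. angular_density r \<gamma> * indicator {-\<beta><..<0} \<gamma> \<partial>lborel) + (\<integral>\<^sup>+\<gamma>. angular_density r \<gamma> * indicator {0<..<pi - \<beta>} \<gamma> \<partial>lborel)"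
        by (rule nn_integral_add) measurable
      also have "(\<integral>\<^sup>+\<gamma>. angular_density r \<gamma> * indicator {-\<beta><..<0} \<gamma> \<partial>lborel) = (\<integral>\<^sup>+\<gamma>. angular_density r (0 + (-1) * \<gamma>) * indicator {-\<beta><..<0} (0 + (-1) * \<gamma>) \<partial>lborel)"
        by (subst nn_integral_real_affine[of _ "-1" 0]) auto
      also have "\<dots> = \<Phi> \<beta>" unfolding \<Phi>_def by (intro nn_integral_cong) (auto simp: angular_density_minus split: split_indicator)
      finally show ?thesis using True by (simp add: \<Phi>_def)
    qed simp
  qed
  finally show ?thesis .
qed

text \<open>The free heat kernel at time 1 with both Jacobians; it plays the part of F0 in
  \<open>angular_decomposition\<close>.\<close>

definition kern0 :: "real \<Rightarrow> real \<Rightarrow> real \<Rightarrow> real" where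
  "kern0 r s \<gamma> = r * s / (4 * pi) * exp (- (r\<^sup>2 + s\<^sup>2 - 2 * r * s * cos \<gamma>) / 4)"

lemma kern0_nonneg: "0 \<le> r \<Longrightarrow> 0 \<le> s \<Longrightarrow> 0 \<le> kern0 r s \<gamma>"
  by (simp add: kern0_def)

lemma borel_measurable_kern0 [measurable (raw)]:
  assumes [measurable]: "f \<in> borel_measurable M" "g \<in> borel_measurable M" "h \<in> borel_measurable M"
  shows "(\<lambda>x. kern0 (f x) (g x) (h x)) \<in> borel_measurable M"
  unfolding kern0_def by measurable

lemma nn_integral_kern0:
  assumes r: "0 \<le> r" and w: "continuous_on {0..pi} w" "\<And>\<gamma>. \<gamma> \<in> {0..pi} \<Longrightarrow> 0 \<le> w \<gamma>" and [measurable]: "w \<in> borel_measurable borel"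
  shows "(\<integral>\<^sup>+s. ennreal (integral {0..pi} (\<lambda>\<gamma>. w \<gamma> * kern0 r s \<gamma>)) * indicator {0<..} s \<partial>lborel)
    = ennreal r * (\<integral>\<^sup>+\<gamma>. ennreal (w \<gamma>) * angular_density r \<gamma> * indicator {0<..<pi} \<gamma> \<partial>lborel)"
proof -
  have "(\<integral>\<^sup>+s. ennreal (integral {0..pi} (\<lambda>\<gamma>. w \<gamma> * kern0 r s \<gamma>)) * indicator {0<..} s \<partial>lborel)
     = (\<integral>\<^sup>+s. (\<integral>\<^sup>+\<gamma>. ennreal (w \<gamma> * kern0 r s \<gamma>) * indicator {0..pi} \<gamma> * indicator {0<..} s \<partial>lborel) \<partial>lborel)"
  proof (intro nn_integral_cong)
    fix s :: real
    show "ennreal (integral {0..pi} (\<lambda>\<gamma>. w \<gamma> * kern0 r s \<gamma>)) * indicator {0<..} s = (\<integral>\<^sup>+\<gamma>. ennreal (w \<gamma> * kern0 r s \<gamma>) * indicator {0..pi} \<gamma> * indicator {0<..} s \<partial>lborel)"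
    proof (cases "s > 0")
      case True
      show ?thesis
      proof -
        have c: "continuous_on {0..pi} (\<lambda>\<gamma>. w \<gamma> * kern0 r s \<gamma>)" unfolding kern0_def by (intro continuous_intros w) auto
        have "0 \<le> w \<gamma> * kern0 r s \<gamma>" if "\<gamma> \<in> {0..pi}" for \<gamma>
          using w(2)[OF that] kern0_nonneg[OF r, of s] True by simp
        from nn_integral_Icc[OF c this] True show ?thesis by simp
      qed
    qed simp
  qed
  also have "\<dots> = (\<integral>\<^sup>+\<gamma>. (\<integral>\<^sup>+s. ennreal (w \<gamma> * kern0 r s \<gamma>) * indicator {0..pi} \<gamma> * indicator {0<..} s \<partial>lborel) \<partial>lborel)"
    by (rule lborel_pair.Fubini') measurable
  also have "\<dots> = (\<integral>\<^sup>+\<gamma>. (ennreal r * (ennreal (w \<gamma>) * angular_density r \<gamma>)) * indicator {0..pi} \<gamma> \<partial>lborel)"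
  proof (intro nn_integral_cong)
    fix \<gamma> :: real
    show "(\<integral>\<^sup>+s. ennreal (w \<gamma> * kern0 r s \<gamma>) * indicator {0..pi} \<gamma> * indicator {0<..} s \<partial>lborel) = ennreal r * (ennreal (w \<gamma>) * angular_density r \<gamma>) * indicator {0..pi} \<gamma>"
    proof (cases "\<gamma> \<in> {0..pi}")
      case True
      have "ennreal (w \<gamma> * kern0 r s \<gamma>) * indicator {0..pi} \<gamma> * indicator {0<..} s
        = ennreal (r * w \<gamma>) * (ennreal (s / (4 * pi) * exp (- (r\<^sup>2 + s\<^sup>2 - 2 * r * s * cos \<gamma>) / 4)) * indicator {0<..} s)" for s
      proof (cases "s > 0")
        case True
        have "w \<gamma> * kern0 r s \<gamma> = (r * w \<gamma>) * (s / (4 * pi) * exp (- (r\<^sup>2 + s\<^sup>2 - 2 * r * s * cos \<gamma>) / 4))" by (simp add: kern0_def)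
        then show ?thesis using True \<open>\<gamma> \<in> {0..pi}\<close> by (simp add: ennreal_mult''[symmetric] del: ennreal_mult'')
      qed simp
      then show ?thesis using True r w(2)[OF True] by (simp add: angular_density_def nn_integral_cmult ennreal_mult' mult.assoc)
    qed simp
  qed
  also have "\<dots> = (\<integral>\<^sup>+\<gamma>. ennreal r * (ennreal (w \<gamma>) * angular_density r \<gamma> * indicator {0<..<pi} \<gamma>) \<partial>lborel)"
    unfolding nn_integral_Ioo_eq_Icc[symmetric] by (simp only: mult.assoc)
  also have "\<dots> = ennreal r * (\<integral>\<^sup>+\<gamma>. ennreal (w \<gamma>) * angular_density r \<gamma> * indicator {0<..<pi} \<gamma> \<partial>lborel)"
    by (rule nn_integral_cmult) measurable
  finally show ?thesis .
qed

text \<open>The integrand is half the complementary error function at rho sin beta / 2: the Gaussian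
  mass lost across a line at distance rho sin beta.\<close>

definition erfc_ang :: "real \<Rightarrow> real" where
  "erfc_ang \<rho> = integral {0..pi/2} (\<lambda>\<beta>. 1 / 2 - gauss_int (\<rho> * sin \<beta> / 2) / sqrt pi)"
text \<open>The inner integral of the theorem after zeta = sin beta. For positive rho it equals 2
  D(rho / 2) / rho with Dawson's function D, whence the name.\<close>

definition dawson_ang :: "real \<Rightarrow> real" where
  "dawson_ang \<rho> = integral {0..pi/2} (\<lambda>\<beta>. sin \<beta> * exp (- (\<rho> * sin \<beta> / 2)\<^sup>2))"
definition dawson_ang_d :: "real \<Rightarrow> real" where
  "dawson_ang_d \<rho> = integral {0..pi/2} (\<lambda>\<beta>. sin \<beta> * (exp (- (\<rho> * sin \<beta> / 2)\<^sup>2) * - (\<rho> * (sin \<beta>)\<^sup>2 / 2)))"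

lemma DERIV_erfc_ang:
  assumes "0 \<le> \<rho>" shows "(erfc_ang has_real_derivative - dawson_ang \<rho> / (2 * sqrt pi)) (at \<rho>)"
proof -
  have "(erfc_ang has_real_derivative integral {0..pi/2} (\<lambda>\<beta>. - (exp (- (\<rho> * sin \<beta> / 2)\<^sup>2) * (sin \<beta> / 2)) / sqrt pi)) (at \<rho>)"
    unfolding erfc_ang_def[abs_def]
  proof (rule leibniz_interval)
    show "((\<lambda>\<rho>. 1 / 2 - gauss_int (\<rho> * sin \<beta> / 2) / sqrt pi) has_real_derivative - (exp (- (\<rho> * sin \<beta> / 2)\<^sup>2) * (sin \<beta> / 2)) / sqrt pi) (at \<rho>)" for \<rho> \<beta>
      using DERIV_diff[OF DERIV_const[of "1 / 2"] DERIV_cdivide[OF DERIV_chain2[OF DERIV_gauss_int DERIV_cdivide[OF DERIV_cmult_right[OF DERIV_ident, of "sin \<beta>"], of 2]], of "sqrt pi"]]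
      by simp
    show "continuous_on ({-1<..} \<times> {0..pi/2}) (\<lambda>(\<rho>, \<beta>). - (exp (- (\<rho> * sin \<beta> / 2)\<^sup>2) * (sin \<beta> / 2)) / sqrt pi)"
      unfolding case_prod_beta by (intro continuous_intros) auto
  qed (use assms in \<open>auto intro!: continuous_intros\<close>)
  also have "integral {0..pi/2} (\<lambda>\<beta>. - (exp (- (\<rho> * sin \<beta> / 2)\<^sup>2) * (sin \<beta> / 2)) / sqrt pi)
     = integral {0..pi/2} (\<lambda>\<beta>. (- 1 / (2 * sqrt pi)) * (sin \<beta> * exp (- (\<rho> * sin \<beta> / 2)\<^sup>2)))"
    by (rule arg_cong[of _ _ "integral {0..pi/2}"]) (simp add: fun_eq_iff)
  also have "\<dots> = - dawson_ang \<rho> / (2 * sqrt pi)" by (simp add: dawson_ang_def)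
  finally show ?thesis .
qed

lemma DERIV_dawson_ang:
  assumes "0 \<le> \<rho>" shows "(dawson_ang has_real_derivative dawson_ang_d \<rho>) (at \<rho>)"
  unfolding dawson_ang_def[abs_def] dawson_ang_d_def
proof (rule leibniz_interval)
  show "((\<lambda>\<rho>. sin \<beta> * exp (- (\<rho> * sin \<beta> / 2)\<^sup>2)) has_real_derivative sin \<beta> * (exp (- (\<rho> * sin \<beta> / 2)\<^sup>2) * - (\<rho> * (sin \<beta>)\<^sup>2 / 2))) (at \<rho>)" for \<rho> \<beta>
    by (rule derivative_eq_intros refl | simp add: power2_eq_square)+
  show "continuous_on ({-1<..} \<times> {0..pi/2}) (\<lambda>(\<rho>, \<beta>). sin \<beta> * (exp (- (\<rho> * sin \<beta> / 2)\<^sup>2) * - (\<rho> * (sin \<beta>)\<^sup>2 / 2)))"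
    unfolding case_prod_beta by (intro continuous_intros) auto
qed (use assms in \<open>auto intro!: continuous_intros\<close>)

text \<open>Dawson's equation in this scaling. The left side is the integral of the beta-derivative
  of -cos beta exp (-(rho sin beta / 2)^2), whose boundary values give 1.\<close>

lemma dawson_ang_ode: "\<rho> * dawson_ang_d \<rho> + dawson_ang \<rho> + \<rho>\<^sup>2 / 2 * dawson_ang \<rho> = 1"
proof -
  let ?E = "\<lambda>\<beta>. exp (- (\<rho> * sin \<beta> / 2)\<^sup>2)"
  have 1: "((\<lambda>\<beta>. sin \<beta> * ?E \<beta>) has_integral dawson_ang \<rho>) {0..pi/2}"
    unfolding dawson_ang_def by (intro integrable_integral integrable_continuous_interval continuous_intros) auto
  have 2: "((\<lambda>\<beta>. sin \<beta> * (?E \<beta> * - (\<rho> * (sin \<beta>)\<^sup>2 / 2))) has_integral dawson_ang_d \<rho>) {0..pi/2}"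
    unfolding dawson_ang_d_def by (intro integrable_integral integrable_continuous_interval continuous_intros) auto
  have I: "((\<lambda>\<beta>. \<rho> * (sin \<beta> * (?E \<beta> * - (\<rho> * (sin \<beta>)\<^sup>2 / 2))) + sin \<beta> * ?E \<beta> + \<rho>\<^sup>2 / 2 * (sin \<beta> * ?E \<beta>)) has_integral
     (\<rho> * dawson_ang_d \<rho> + dawson_ang \<rho> + \<rho>\<^sup>2 / 2 * dawson_ang \<rho>)) {0..pi/2}"
    by (intro has_integral_add has_integral_mult_right 1 2)
  have J: "((\<lambda>\<beta>. \<rho> * (sin \<beta> * (?E \<beta> * - (\<rho> * (sin \<beta>)\<^sup>2 / 2))) + sin \<beta> * ?E \<beta> + \<rho>\<^sup>2 / 2 * (sin \<beta> * ?E \<beta>)) has_integral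
     (- (cos (pi/2) * ?E (pi/2)) - - (cos 0 * ?E 0))) {0..pi/2}"
  proof (rule fundamental_theorem_of_calculus)
    fix \<beta> :: real
    define e S C where "e = ?E \<beta>" and "S = sin \<beta>" and "C = cos \<beta>"
    have "((\<lambda>\<beta>. - (cos \<beta> * ?E \<beta>)) has_real_derivative - (- sin \<beta> * ?E \<beta> + ?E \<beta> * - (\<rho>\<^sup>2 * sin \<beta> * cos \<beta> / 2) * cos \<beta>)) (at \<beta>)"
      by (rule derivative_eq_intros refl | simp add: power2_eq_square)+
    also have "- (- sin \<beta> * ?E \<beta> + ?E \<beta> * - (\<rho>\<^sup>2 * sin \<beta> * cos \<beta> / 2) * cos \<beta>) = S * e + \<rho>\<^sup>2 / 2 * S * e * C\<^sup>2"
      unfolding e_def[symmetric] unfolding S_def[symmetric] C_def[symmetric] by (simp add: power2_eq_square)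
    also have "C\<^sup>2 = 1 - S\<^sup>2" unfolding C_def S_def by (rule cos_squared_eq)
    also have "S * e + \<rho>\<^sup>2 / 2 * S * e * (1 - S\<^sup>2) = \<rho> * (S * (e * - (\<rho> * S\<^sup>2 / 2))) + S * e + \<rho>\<^sup>2 / 2 * (S * e)"
      by algebra
    finally show "((\<lambda>\<beta>. - (cos \<beta> * ?E \<beta>)) has_vector_derivative \<rho> * (sin \<beta> * (?E \<beta> * - (\<rho> * (sin \<beta>)\<^sup>2 / 2))) + sin \<beta> * ?E \<beta> + \<rho>\<^sup>2 / 2 * (sin \<beta> * ?E \<beta>)) (at \<beta> within {0..pi/2})"
      unfolding e_def S_def has_real_derivative_iff_has_vector_derivative by (rule has_vector_derivative_at_within)
  qed simp
  from has_integral_unique[OF I J] show ?thesis by simp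
qed

text \<open>The closed form of the double integral in the theorem, with \<open>\<rho> = R / sqrt t\<close>.\<close>

definition edge_E :: "real \<Rightarrow> real" where
  "edge_E \<rho> = (1 + dawson_ang \<rho> - sqrt pi * \<rho> * erfc_ang \<rho>) / 2"

text \<open>The angles between 0 and pi form a half-plane whose edge passes through the centre of
  the Gaussian, so they carry mass 1 / 2; the Jacobian r then yields the integral of r / 2.\<close>

lemma nn_integral_kern0_total:
  assumes "0 < \<rho>"
  shows "(\<integral>\<^sup>+r. (\<integral>\<^sup>+s. ennreal (integral {0..pi} (kern0 r s)) * indicator {0<..} s \<partial>lborel) * indicator {0<..\<rho>} r \<partial>lborel) = ennreal (\<rho>\<^sup>2 / 4)"
proof -
  have in1: "(\<integral>\<^sup>+s. ennreal (integral {0..pi} (kern0 r s)) * indicator {0<..} s \<partial>lborel) = ennreal (r / 2)" if r: "0 \<le> r" for r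
  proof -
    have "(\<integral>\<^sup>+s. ennreal (integral {0..pi} (kern0 r s)) * indicator {0<..} s \<partial>lborel) = ennreal r * (\<integral>\<^sup>+\<gamma>. angular_density r \<gamma> * indicator {0<..<pi} \<gamma> \<partial>lborel)"
      using nn_integral_kern0[OF r, of "\<lambda>_. 1"] by simp
    also have "(\<integral>\<^sup>+\<gamma>. angular_density r \<gamma> * indicator {0<..<pi} \<gamma> \<partial>lborel) = ennreal (1 / 2)"
      using nn_integral_angular_density_half_plane[of r 0] by simp
    also have "ennreal r * ennreal (1 / 2) = ennreal (r * (1 / 2))" by (rule ennreal_mult'[symmetric]) (use r in simp)
    finally show ?thesis by simp
  qed
  have "(\<integral>\<^sup>+r. (\<integral>\<^sup>+s. ennreal (integral {0..pi} (kern0 r s)) * indicator {0<..} s \<partial>lborel) * indicator {0<..\<rho>} r \<partial>lborel)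
      = (\<integral>\<^sup>+r. ennreal (r / 2) * indicator {0..\<rho>} r \<partial>lborel)"
  proof (rule nn_integral_cong_AE)
    show "AE r in lborel. (\<integral>\<^sup>+s. ennreal (integral {0..pi} (kern0 r s)) * indicator {0<..} s \<partial>lborel) * indicator {0<..\<rho>} r = ennreal (r / 2) * indicator {0..\<rho>} r"
      using AE_lborel_singleton[of "0::real"] by eventually_elim (auto simp: in1 split: split_indicator)
  qed
  also have "\<dots> = ennreal (\<rho>\<^sup>2 / 4 - 0\<^sup>2 / 4)"
    by (rule nn_integral_FTC_Icc[where F = "\<lambda>r. r\<^sup>2 / 4"]) (use assms in \<open>auto intro!: derivative_eq_intros simp: has_real_derivative_iff_has_vector_derivative[symmetric]\<close>)
  finally show ?thesis by simp
qed

text \<open>The radial integrand is r times pi / 2 minus \<open>erfc_ang r\<close>: the first part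
  is the bulk term, the second the boundary layer that becomes the perimeter term and
  \<open>edge_E\<close>. Nonnegativity is stated separately because \<open>ennreal\<close> would
  hide a negative value.\<close>

lemma
  assumes "0 < \<rho>"
  shows nn_integral_kern0_weighted: "(\<integral>\<^sup>+r. (\<integral>\<^sup>+s. ennreal (integral {0..pi} (\<lambda>\<gamma>. (pi - \<gamma>) * kern0 r s \<gamma>)) * indicator {0<..} s \<partial>lborel) * indicator {0<..\<rho>} r \<partial>lborel)
    = ennreal (pi * \<rho>\<^sup>2 / 4 - \<rho> / sqrt pi * (1 - edge_E \<rho>))" (is "?L = _")
    and kern0_weighted_nonneg: "0 \<le> pi * \<rho>\<^sup>2 / 4 - \<rho> / sqrt pi * (1 - edge_E \<rho>)"
proof -
  have bd: "0 \<le> 1 / 2 + gauss_int x / sqrt pi" for x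
    using gauss_int_bounds(1)[of x] by (simp add: field_simps)
  have e: "pi / 2 - erfc_ang r = integral {0..pi/2} (\<lambda>\<beta>. 1 / 2 + gauss_int (r * sin \<beta> / 2) / sqrt pi)" for r
  proof -
    have c: "((\<lambda>\<beta>. 1 / 2 - gauss_int (r * sin \<beta> / 2) / sqrt pi) has_integral erfc_ang r) {0..pi/2}"
      unfolding erfc_ang_def by (intro integrable_integral integrable_continuous_interval continuous_intros) auto
    have "((\<lambda>\<beta>. 1 - (1 / 2 - gauss_int (r * sin \<beta> / 2) / sqrt pi)) has_integral ((pi / 2 - 0) - erfc_ang r)) {0..pi/2}"
      using has_integral_diff[OF has_integral_const_real[of "1::real" 0 "pi/2"] c] by simp
    then show ?thesis by (simp add: integral_unique)
  qed
  have nn: "0 \<le> pi / 2 - erfc_ang r" for r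
    unfolding e by (rule Henstock_Kurzweil_Integration.integral_nonneg) (auto intro!: integrable_continuous_interval continuous_intros bd)
  have in1: "(\<integral>\<^sup>+s. ennreal (integral {0..pi} (\<lambda>\<gamma>. (pi - \<gamma>) * kern0 r s \<gamma>)) * indicator {0<..} s \<partial>lborel) = ennreal (r * (pi / 2 - erfc_ang r))" if r: "0 \<le> r" for r
  proof -
    have "(\<integral>\<^sup>+s. ennreal (integral {0..pi} (\<lambda>\<gamma>. (pi - \<gamma>) * kern0 r s \<gamma>)) * indicator {0<..} s \<partial>lborel)
      = ennreal r * (\<integral>\<^sup>+\<beta>. ennreal (1 / 2 + gauss_int (r * sin \<beta> / 2) / sqrt pi) * indicator {0..pi/2} \<beta> \<partial>lborel)"
      unfolding nn_integral_Ioo_eq_Icc[symmetric] nn_integral_angular_density_weighted[symmetric]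
      by (rule nn_integral_kern0[OF r]) (auto intro!: continuous_intros)
    also have "(\<integral>\<^sup>+\<beta>. ennreal (1 / 2 + gauss_int (r * sin \<beta> / 2) / sqrt pi) * indicator {0..pi/2} \<beta> \<partial>lborel) = ennreal (pi / 2 - erfc_ang r)"
      unfolding e by (rule nn_integral_Icc) (auto intro!: continuous_intros bd)
    finally show ?thesis using r nn[of r] by (simp add: ennreal_mult')
  qed
  \<comment> \<open>An antiderivative of \<open>r * (pi / 2 - erfc_ang r)\<close>; differentiating
    it produces \<open>dawson_ang_d\<close>, which \<open>dawson_ang_ode\<close> eliminates.\<close>
  define F where "F r = pi * r\<^sup>2 / 4 - r / sqrt pi * (1 - edge_E r)" for r
  have em: "erfc_ang \<in> borel_measurable borel"
  proof -
    have "continuous_on UNIV (\<lambda>r. integral (cbox 0 (pi/2)) (\<lambda>\<beta>. 1 / 2 - gauss_int (r * sin \<beta> / 2) / sqrt pi))"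
      by (rule integral_continuous_on_param) (auto intro!: continuous_intros simp: case_prod_beta)
    then show ?thesis unfolding erfc_ang_def[abs_def] by (intro borel_measurable_continuous_onI) (simp add: cbox_interval)
  qed
  have dF: "(F has_real_derivative r * (pi / 2 - erfc_ang r)) (at r)" and fn: "0 \<le> r * (pi / 2 - erfc_ang r)" if r: "0 \<le> r" for r
  proof -
    show "0 \<le> r * (pi / 2 - erfc_ang r)" using r nn by simp
        define P where "P = sqrt pi"
    have P: "P > 0" "P * P = pi" by (simp_all add: P_def)
    define H H' e where "H = dawson_ang r" and "H' = dawson_ang_d r" and "e = erfc_ang r"
    have ode: "r * H' = 1 - H - r * r * H / 2" using dawson_ang_ode[of r] by (simp add: H_def H'_def power2_eq_square)
    have "(edge_E has_real_derivative (0 + H' - (P * 1 * e + - H / (2 * P) * (P * r))) / 2) (at r)"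
      unfolding edge_E_def[abs_def] P_def H_def H'_def e_def
      by (rule DERIV_cdivide[OF DERIV_diff[OF DERIV_add[OF DERIV_const DERIV_dawson_ang[OF r(1)]] DERIV_mult[OF DERIV_cmult[OF DERIV_ident] DERIV_erfc_ang[OF r(1)]]]])
    from DERIV_diff[OF DERIV_cdivide[OF DERIV_cmult[OF DERIV_power[OF DERIV_ident, where n = 2], of pi], of 4] DERIV_mult[OF DERIV_cdivide[OF DERIV_ident, of P] DERIV_diff[OF DERIV_const this, of 1]]]
    have "(F has_real_derivative pi * r / 2 - (1 / P * (1 - edge_E r) + (0 - (0 + H' - (P * 1 * e + - H / (2 * P) * (P * r))) / 2) * (r / P))) (at r)"
      by (simp add: F_def[abs_def] P_def)
    also have "pi * r / 2 - (1 / P * (1 - edge_E r) + (0 - (0 + H' - (P * 1 * e + - H / (2 * P) * (P * r))) / 2) * (r / P)) = r * (pi / 2 - e)"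
    proof -
      have E: "edge_E r = (1 + H - P * r * e) / 2" by (simp add: edge_E_def H_def P_def e_def)
      have a: "- H / (2 * P) * (P * r) = - H * r / 2" using P by simp
      have "1 / P * (1 - edge_E r) + (0 - (0 + H' - (P * 1 * e + - H * r / 2)) / 2) * (r / P)
        = (2 * (1 - edge_E r) - r * H' + r * P * e - r * r * H / 2) / (2 * P)"
        using P(1) by (simp add: field_simps)
      also have "2 * (1 - edge_E r) - r * H' + r * P * e - r * r * H / 2 = 2 * P * (r * e)"
        unfolding E ode by (simp add: field_simps)
      also have "2 * P * (r * e) / (2 * P) = r * e" using P(1) by simp
      finally have "1 / P * (1 - edge_E r) + (0 - (0 + H' - (P * 1 * e + - H * r / 2)) / 2) * (r / P) = r * e" .
      then show ?thesis unfolding a by (simp only: right_diff_distrib) simp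
    qed
    finally show "(F has_real_derivative r * (pi / 2 - erfc_ang r)) (at r)"
      unfolding e_def .
  qed
  have "F 0 \<le> F \<rho>"
  proof (rule DERIV_nonneg_imp_nondecreasing[of 0 \<rho> F])
    show "0 \<le> \<rho>" using assms by simp
    show "\<exists>y. (F has_real_derivative y) (at x) \<and> 0 \<le> y" if "0 \<le> x" for x
      using dF[OF that] fn[OF that] by blast
  qed
  then show "0 \<le> pi * \<rho>\<^sup>2 / 4 - \<rho> / sqrt pi * (1 - edge_E \<rho>)" by (simp add: F_def)
  have "(\<integral>\<^sup>+r. (\<integral>\<^sup>+s. ennreal (integral {0..pi} (\<lambda>\<gamma>. (pi - \<gamma>) * kern0 r s \<gamma>)) * indicator {0<..} s \<partial>lborel) * indicator {0<..\<rho>} r \<partial>lborel)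
      = (\<integral>\<^sup>+r. ennreal (r * (pi / 2 - erfc_ang r)) * indicator {0..\<rho>} r \<partial>lborel)"
  proof (rule nn_integral_cong_AE)
    show "AE r in lborel. (\<integral>\<^sup>+s. ennreal (integral {0..pi} (\<lambda>\<gamma>. (pi - \<gamma>) * kern0 r s \<gamma>)) * indicator {0<..} s \<partial>lborel) * indicator {0<..\<rho>} r = ennreal (r * (pi / 2 - erfc_ang r)) * indicator {0..\<rho>} r"
      using AE_lborel_singleton[of "0::real"] by eventually_elim (auto simp: in1 split: split_indicator)
  qed
  also have "\<dots> = ennreal (F \<rho> - F 0)"
  proof (rule nn_integral_FTC_Icc)
    show "(\<lambda>r. r * (pi / 2 - erfc_ang r)) \<in> borel_measurable borel" using em by measurable
  qed (use assms dF fn in auto)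
  finally show "?L = ennreal (pi * \<rho>\<^sup>2 / 4 - \<rho> / sqrt pi * (1 - edge_E \<rho>))" by (simp add: F_def)
qed

section \<open>The explicit double integral over v and zeta\<close>

lemma set_integral_eq_enn2real:
  fixes f :: "real \<Rightarrow> real"
  assumes [measurable]: "f \<in> borel_measurable borel" "S \<in> sets borel" and nonneg: "\<And>x. x \<in> S \<Longrightarrow> 0 \<le> f x"
  shows "(LINT x:S|lborel. f x) = enn2real (\<integral>\<^sup>+x. ennreal (f x) * indicator S x \<partial>lborel)"
proof -
  have "(LINT x:S|lborel. f x) = enn2real (\<integral>\<^sup>+x. ennreal (indicator S x *\<^sub>R f x) \<partial>lborel)"
    unfolding set_lebesgue_integral_def
    by (rule integral_eq_nn_integral) (use nonneg in \<open>auto split: split_indicator\<close>)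
  also have "(\<integral>\<^sup>+x. ennreal (indicator S x *\<^sub>R f x) \<partial>lborel) = (\<integral>\<^sup>+x. ennreal (f x) * indicator S x \<partial>lborel)"
    by (intro nn_integral_cong) (auto split: split_indicator)
  finally show ?thesis .
qed

lemma dawson_ang_nonneg: "0 \<le> dawson_ang y" and dawson_ang_le: "dawson_ang y \<le> pi / 2"
proof -
  have i: "(\<lambda>\<beta>. sin \<beta> * exp (- (y * sin \<beta> / 2)\<^sup>2)) integrable_on {0..pi/2}"
    by (intro integrable_continuous_interval continuous_intros) auto
  have s: "0 \<le> sin \<beta>" if "\<beta> \<in> {0..pi/2}" for \<beta> using that pi_ge_zero by (intro sin_ge_zero) auto
  show "0 \<le> dawson_ang y" unfolding dawson_ang_def
    by (rule Henstock_Kurzweil_Integration.integral_nonneg[OF i]) (use s in simp)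
  have "dawson_ang y \<le> integral {0..pi/2} (\<lambda>_. 1)" unfolding dawson_ang_def
  proof (rule integral_le[OF i])
    fix \<beta> :: real assume "\<beta> \<in> {0..pi/2}"
    then have "sin \<beta> * exp (- (y * sin \<beta> / 2)\<^sup>2) \<le> 1 * 1" using s by (intro mult_mono) auto
    then show "sin \<beta> * exp (- (y * sin \<beta> / 2)\<^sup>2) \<le> 1" by simp
  qed auto
  then show "dawson_ang y \<le> pi / 2" by simp
qed

lemma borel_measurable_dawson_ang [measurable]: "dawson_ang \<in> borel_measurable borel"
proof -
  have "continuous_on UNIV (\<lambda>y. integral (cbox 0 (pi/2)) (\<lambda>\<beta>. sin \<beta> * exp (- (y * sin \<beta> / 2)\<^sup>2)))"
    by (rule integral_continuous_on_param) (auto intro!: continuous_intros simp: case_prod_beta)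
  then show ?thesis unfolding dawson_ang_def[abs_def] by (intro borel_measurable_continuous_onI) (simp add: cbox_interval)
qed

text \<open>Dominated convergence with majorant 1. The integrand tends to 0 in every direction
  except beta = 0, which is a null set.\<close>

lemma erfc_ang_at_top: "(erfc_ang \<longlongrightarrow> 0) at_top"
proof -
  let ?f = "\<lambda>\<rho> \<beta>. 1 / 2 - gauss_int (\<rho> * sin \<beta> / 2) / sqrt pi"
  have e: "erfc_ang \<rho> = (\<integral>\<beta>. indicator {0..pi/2} \<beta> *\<^sub>R ?f \<rho> \<beta> \<partial>lborel)" for \<rho>
  proof -
    have "set_integrable lborel {0..pi/2} (?f \<rho>)" unfolding set_integrable_def
      by (rule borel_integrable_compact) (auto intro!: continuous_intros)
    from set_borel_integral_eq_integral(2)[OF this] show ?thesis by (simp add: erfc_ang_def set_lebesgue_integral_def)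
  qed
  have [measurable]: "gauss_int \<in> borel_measurable borel" by (intro borel_measurable_continuous_onI continuous_intros)
  have "((\<lambda>\<rho>. \<integral>\<beta>. indicator {0..pi/2} \<beta> *\<^sub>R ?f \<rho> \<beta> \<partial>lborel) \<longlongrightarrow> (\<integral>\<beta>. 0 \<partial>(lborel :: real measure))) at_top"
  proof (rule integral_dominated_convergence_at_top)
    show "integrable lborel (\<lambda>\<beta>. indicator {0..pi/2} \<beta> :: real)" by simp
    show "\<forall>\<^sub>F \<rho> in at_top. AE \<beta> in lborel. norm (indicator {0..pi/2} \<beta> *\<^sub>R ?f \<rho> \<beta>) \<le> indicator {0..pi/2} \<beta>"
    proof (intro always_eventually allI AE_I2)
      fix \<rho> \<beta> :: real
      have "- (1 / 2) \<le> gauss_int (\<rho> * sin \<beta> / 2) / sqrt pi" "gauss_int (\<rho> * sin \<beta> / 2) / sqrt pi \<le> 1 / 2"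
        using gauss_int_bounds[of "\<rho> * sin \<beta> / 2"] by (auto simp: field_simps)
      then show "norm (indicator {0..pi/2} \<beta> *\<^sub>R ?f \<rho> \<beta>) \<le> indicator {0..pi/2} \<beta>"
        by (auto split: split_indicator)
    qed
    show "AE \<beta> in lborel. ((\<lambda>\<rho>. indicator {0..pi/2} \<beta> *\<^sub>R ?f \<rho> \<beta>) \<longlongrightarrow> 0) at_top"
      using AE_lborel_singleton[of "0::real"]
    proof eventually_elim
      case (elim \<beta>)
      show ?case
      proof (cases "\<beta> \<in> {0..pi/2}")
        case True
        have "\<beta> < pi" using True pi_gt_zero unfolding atLeastAtMost_iff by linarith
        then have "sin \<beta> > 0" using True elim by (intro sin_gt_zero) auto
        then have "filterlim (\<lambda>\<rho>. \<rho> * sin \<beta> / 2) at_top at_top" by real_asymp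
        from filterlim_compose[OF gauss_int_at_top this]
        have "((\<lambda>\<rho>. ?f \<rho> \<beta>) \<longlongrightarrow> 1 / 2 - sqrt pi / 2 / sqrt pi) at_top" by (intro tendsto_intros) auto
        then show ?thesis using True by simp
      qed simp
    qed
  qed measurable
  then show ?thesis by (simp add: e[abs_def])
qed

lemma sin_image_Ioo: "sin ` {0<..<pi/2} = {0<..<1::real}"
proof (intro equalityI subsetI)
  fix x :: real assume "x \<in> sin ` {0<..<pi/2}"
  then obtain \<beta> where b: "x = sin \<beta>" "0 < \<beta>" "\<beta> < pi / 2" by auto
  then have "sin \<beta> < sin (pi / 2)" by (intro sin_monotone_2pi) auto
  moreover have "0 < sin \<beta>" using b by (intro sin_gt_zero) auto
  ultimately show "x \<in> {0<..<1}" using b by simp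
next
  fix x :: real assume x: "x \<in> {0<..<1}"
  have "arcsin 0 < arcsin x" "arcsin x < arcsin 1" using arcsin_less_arcsin[of 0 x] arcsin_less_arcsin[of x 1] x by auto
  then show "x \<in> sin ` {0<..<pi/2}" using x by (intro image_eqI[of _ _ "arcsin x"]) auto
qed

lemma nn_integral_dawson:
  "(\<integral>\<^sup>+\<zeta>. ennreal (\<zeta> / sqrt (1 - \<zeta>\<^sup>2) * exp (- (y * \<zeta> / 2)\<^sup>2)) * indicator {0<..<1} \<zeta> \<partial>lborel) = ennreal (dawson_ang y)"
proof -
  have "(\<integral>\<^sup>+\<zeta>. ennreal (\<zeta> / sqrt (1 - \<zeta>\<^sup>2) * exp (- (y * \<zeta> / 2)\<^sup>2)) * indicator {0<..<1} \<zeta> \<partial>lborel)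
    = (\<integral>\<^sup>+\<beta>. ennreal (sin \<beta> / sqrt (1 - (sin \<beta>)\<^sup>2) * exp (- (y * sin \<beta> / 2)\<^sup>2)) * ennreal (cos \<beta>) * indicator {0<..<pi/2} \<beta> \<partial>lborel)"
    by (rule nn_integral_substitution_open) (auto intro!: cos_gt_zero_pi continuous_intros sin_image_Ioo DERIV_sin simp: less_trans[OF _ pi_half_gt_zero])
  also have "\<dots> = (\<integral>\<^sup>+\<beta>. ennreal (sin \<beta> * exp (- (y * sin \<beta> / 2)\<^sup>2)) * indicator {0<..<pi/2} \<beta> \<partial>lborel)"
  proof (intro nn_integral_cong)
    fix \<beta> :: real
    show "ennreal (sin \<beta> / sqrt (1 - (sin \<beta>)\<^sup>2) * exp (- (y * sin \<beta> / 2)\<^sup>2)) * ennreal (cos \<beta>) * indicator {0<..<pi/2} \<beta> = ennreal (sin \<beta> * exp (- (y * sin \<beta> / 2)\<^sup>2)) * indicator {0<..<pi/2} \<beta>"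
    proof (cases "\<beta> \<in> {0<..<pi/2}")
      case True
      have c: "cos \<beta> > 0" using True by (intro cos_gt_zero) auto
      have "sqrt (1 - (sin \<beta>)\<^sup>2) = cos \<beta>" unfolding cos_squared_eq[symmetric] using c by simp
      then have "sin \<beta> / sqrt (1 - (sin \<beta>)\<^sup>2) * X * cos \<beta> = sin \<beta> * X" for X using c by simp
      then show ?thesis using c by (simp only: ennreal_mult''[symmetric] less_imp_le)
    qed simp
  qed
  also have "\<dots> = ennreal (dawson_ang y)"
    unfolding nn_integral_Ioo_eq_Icc dawson_ang_def
    by (rule nn_integral_Icc) (use pi_ge_zero in \<open>auto intro!: continuous_intros mult_nonneg_nonneg sin_ge_zero\<close>)
  finally show ?thesis .
qed

text \<open>The inner integral is \<open>dawson_ang (\<rho> * v)\<close>, and by Dawson's equation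
  the outer integrand has an elementary antiderivative in terms of \<open>erfc_ang\<close> and
  \<open>dawson_ang\<close> which vanishes at infinity.\<close>

lemma edge_E_integral:
  assumes \<rho>: "0 < \<rho>"
  shows "(LBINT v=1..\<infinity>. 1 / v\<^sup>2 * (LBINT \<zeta>=0..1. \<zeta> / sqrt (1 - \<zeta>\<^sup>2) * exp (- (\<rho> * v * \<zeta> / 2)\<^sup>2))) = edge_E \<rho>"
proof -
  have inner: "(LBINT \<zeta>=0..1. \<zeta> / sqrt (1 - \<zeta>\<^sup>2) * exp (- (y * \<zeta> / 2)\<^sup>2)) = dawson_ang y" for y
  proof -
    have "(LBINT \<zeta>=ereal 0..ereal 1. \<zeta> / sqrt (1 - \<zeta>\<^sup>2) * exp (- (y * \<zeta> / 2)\<^sup>2)) = (LINT \<zeta>:{0<..<1}|lborel. \<zeta> / sqrt (1 - \<zeta>\<^sup>2) * exp (- (y * \<zeta> / 2)\<^sup>2))"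
      by (subst interval_integral_Ioo) auto
    also have "\<dots> = enn2real (\<integral>\<^sup>+\<zeta>. ennreal (\<zeta> / sqrt (1 - \<zeta>\<^sup>2) * exp (- (y * \<zeta> / 2)\<^sup>2)) * indicator {0<..<1} \<zeta> \<partial>lborel)"
    proof (rule set_integral_eq_enn2real)
      fix \<zeta> :: real assume z: "\<zeta> \<in> {0<..<1}"
      then have "\<zeta>\<^sup>2 \<le> 1\<^sup>2" by (intro power_mono) auto
      then show "0 \<le> \<zeta> / sqrt (1 - \<zeta>\<^sup>2) * exp (- (y * \<zeta> / 2)\<^sup>2)" using z by simp
    qed auto
    also have "\<dots> = dawson_ang y" unfolding nn_integral_dawson using dawson_ang_nonneg by simp
    finally show ?thesis by (simp add: zero_ereal_def one_ereal_def)
  qed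
  \<comment> \<open>This is \<open>- edge_E (\<rho> * v) / v\<close>, so minus its value at v = 1 is
    the claimed result.\<close>
  define F where "F v = (sqrt pi * \<rho> * erfc_ang (\<rho> * v) - (1 + dawson_ang (\<rho> * v)) / v) / 2" for v
  have F: "(F has_real_derivative 1 / v\<^sup>2 * dawson_ang (\<rho> * v)) (at v)" if v: "1 \<le> v" for v
  proof -
    define P where "P = sqrt pi"
    have P: "P > 0" by (simp add: P_def)
    define y where "y = \<rho> * v"
    have y: "0 \<le> y" using v \<rho> by (simp add: y_def)
    define H H' where "H = dawson_ang y" and "H' = dawson_ang_d y"
    have ode: "y * H' = 1 - H - y * y * H / 2" using dawson_ang_ode[of y] by (simp add: H_def H'_def power2_eq_square)
    have lin: "((\<lambda>v. \<rho> * v) has_real_derivative \<rho>) (at v)" using DERIV_cmult[OF DERIV_ident, of \<rho>] by simp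
    have d1: "((\<lambda>v. erfc_ang (\<rho> * v)) has_real_derivative - H / (2 * P) * \<rho>) (at v)"
      using DERIV_chain2[OF DERIV_erfc_ang[OF y[unfolded y_def]] lin] by (simp add: H_def P_def y_def)
    have d2: "((\<lambda>v. dawson_ang (\<rho> * v)) has_real_derivative H' * \<rho>) (at v)"
      using DERIV_chain2[OF DERIV_dawson_ang[OF y[unfolded y_def]] lin] by (simp add: H'_def y_def)
    have v0: "v \<noteq> 0" using v by simp
    have "(F has_real_derivative (P * \<rho> * (- H / (2 * P) * \<rho>) - ((0 + H' * \<rho>) * v - (1 + H) * 1) / (v * v)) / 2) (at v)"
      unfolding F_def[abs_def] P_def[symmetric]
      using DERIV_cdivide[OF DERIV_diff[OF DERIV_cmult[OF d1, of "P * \<rho>"] DERIV_divide[OF DERIV_add[OF DERIV_const[of 1] d2] DERIV_ident v0]], of 2]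
      by (simp add: H_def y_def)
    also have "(P * \<rho> * (- H / (2 * P) * \<rho>) - ((0 + H' * \<rho>) * v - (1 + H) * 1) / (v * v)) / 2 = 1 / v\<^sup>2 * dawson_ang (\<rho> * v)"
    proof -
      have a: "P * \<rho> * (- H / (2 * P) * \<rho>) = - (y * y * H / 2) / (v * v)" using P v0 by (simp add: y_def)
      have b: "(0 + H' * \<rho>) * v - (1 + H) * 1 = y * H' - (1 + H)" by (simp add: y_def)
      have "(P * \<rho> * (- H / (2 * P) * \<rho>) - ((0 + H' * \<rho>) * v - (1 + H) * 1) / (v * v)) / 2 = (- (y * y * H / 2) - (y * H' - (1 + H))) / (v * v) / 2"
        unfolding a b by (simp only: diff_divide_distrib)
      also have "- (y * y * H / 2) - (y * H' - (1 + H)) = 2 * H" unfolding ode by simp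
      finally show ?thesis by (simp add: H_def y_def power2_eq_square)
    qed
    finally show ?thesis .
  qed
  have F1: "0 - F 1 = edge_E \<rho>" by (simp add: F_def edge_E_def field_simps)
  have lim: "(F \<longlongrightarrow> 0) at_top"
  proof -
    have "filterlim (\<lambda>v. \<rho> * v) at_top at_top" using \<rho> by real_asymp
    from filterlim_compose[OF erfc_ang_at_top this] have 1: "((\<lambda>v. erfc_ang (\<rho> * v)) \<longlongrightarrow> 0) at_top" .
    have 2: "((\<lambda>v. (1 + dawson_ang (\<rho> * v)) / v) \<longlongrightarrow> 0) at_top"
    proof (rule tendsto_sandwich)
      show "\<forall>\<^sub>F v in at_top. 0 \<le> (1 + dawson_ang (\<rho> * v)) / v"
        using eventually_gt_at_top[of 0] by eventually_elim (use dawson_ang_nonneg in \<open>auto intro!: divide_nonneg_pos add_nonneg_nonneg\<close>)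
      show "\<forall>\<^sub>F v in at_top. (1 + dawson_ang (\<rho> * v)) / v \<le> (1 + pi / 2) / v"
        using eventually_gt_at_top[of 0] by eventually_elim (use dawson_ang_le in \<open>auto intro!: divide_right_mono\<close>)
      show "((\<lambda>v::real. (1 + pi / 2) / v) \<longlongrightarrow> 0) at_top" by real_asymp
    qed simp
    have "(F \<longlongrightarrow> (sqrt pi * \<rho> * 0 - 0) / 2) at_top" unfolding F_def by (intro tendsto_intros 1 2) auto
    then show ?thesis by simp
  qed
  have "(\<integral>\<^sup>+v. ennreal (1 / v\<^sup>2 * dawson_ang (\<rho> * v)) * indicator {1..} v \<partial>lborel) = ennreal (0 - F 1)"
    by (rule nn_integral_FTC_atLeast) (use F lim dawson_ang_nonneg in auto)
  also have "(\<integral>\<^sup>+v. ennreal (1 / v\<^sup>2 * dawson_ang (\<rho> * v)) * indicator {1..} v \<partial>lborel) = (\<integral>\<^sup>+v. ennreal (1 / v\<^sup>2 * dawson_ang (\<rho> * v)) * indicator {1<..} v \<partial>lborel)"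
  proof (rule nn_integral_cong_AE)
    show "AE v in lborel. ennreal (1 / v\<^sup>2 * dawson_ang (\<rho> * v)) * indicator {1..} v = ennreal (1 / v\<^sup>2 * dawson_ang (\<rho> * v)) * indicator {1<..} v"
      using AE_lborel_singleton[of "1::real"] by eventually_elim (auto split: split_indicator)
  qed
  finally have I: "(\<integral>\<^sup>+v. ennreal (1 / v\<^sup>2 * dawson_ang (\<rho> * v)) * indicator {1<..} v \<partial>lborel) = ennreal (edge_E \<rho>)"
    unfolding F1 .
  have pos: "0 \<le> edge_E \<rho>"
  proof (rule tendsto_lowerbound[of "\<lambda>v. F v - F 1" _ at_top])
    show "((\<lambda>v. F v - F 1) \<longlongrightarrow> edge_E \<rho>) at_top"
      using tendsto_diff[OF lim tendsto_const[of "F 1"]] unfolding F1 .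
    show "\<forall>\<^sub>F v in at_top. 0 \<le> F v - F 1"
      using eventually_ge_at_top[of 1]
    proof eventually_elim
      case (elim v)
      have "F 1 \<le> F v"
        by (rule DERIV_nonneg_imp_nondecreasing[OF elim]) (use F dawson_ang_nonneg in \<open>fastforce intro!: mult_nonneg_nonneg\<close>)
      then show ?case by simp
    qed
  qed simp
  have "(LBINT v=ereal 1..\<infinity>. 1 / v\<^sup>2 * dawson_ang (\<rho> * v)) = (LINT v:{1<..}|lborel. 1 / v\<^sup>2 * dawson_ang (\<rho> * v))"
    by (rule interval_integral_to_infinity_eq)
  also have "\<dots> = edge_E \<rho>"
    by (subst set_integral_eq_enn2real) (use dawson_ang_nonneg I pos in auto)
  finally show ?thesis unfolding inner by (simp add: one_ereal_def)
qed

subsection \<open>Integration over the sector\<close>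

text \<open>Signed counterpart of the iterated nonnegative integrals. The decomposition of the
  sector kernel has negative coefficients, so each part enters by
  \<open>has_strip_integralI\<close>, is combined linearly, and the nonnegative total leaves by
  \<open>nn_integral_of_dbl\<close>.\<close>

definition has_strip_integral :: "real set \<Rightarrow> (real \<Rightarrow> real \<Rightarrow> real) \<Rightarrow> real \<Rightarrow> bool" where
  "has_strip_integral S f x \<longleftrightarrow> has_bochner_integral (lborel \<Otimes>\<^sub>M lborel) (\<lambda>z. f (fst z) (snd z) * indicator (S \<times> {0<..}) z) x"

lemma nn_integral_dbl:
  assumes [measurable]: "(\<lambda>z. f (fst z) (snd z)) \<in> borel_measurable (borel :: (real \<times> real) measure)" "S \<in> sets borel"
  shows "(\<integral>\<^sup>+z. ennreal (f (fst z) (snd z) * indicator (S \<times> {0<..}) z) \<partial>(lborel \<Otimes>\<^sub>M lborel))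
    = (\<integral>\<^sup>+r. (\<integral>\<^sup>+s. ennreal (f r s) * indicator {0<..} s \<partial>lborel) * indicator S r \<partial>lborel)"
proof -
  have [measurable]: "(\<lambda>z. f (fst z) (snd z)) \<in> borel_measurable (borel \<Otimes>\<^sub>M borel)" using assms(1) by (simp only: borel_prod)
  have "(\<integral>\<^sup>+z. ennreal (f (fst z) (snd z) * indicator (S \<times> {0<..}) z) \<partial>(lborel \<Otimes>\<^sub>M lborel))
    = (\<integral>\<^sup>+r. (\<integral>\<^sup>+s. ennreal (f (fst (r, s)) (snd (r, s)) * indicator (S \<times> {0<..}) (r, s)) \<partial>lborel) \<partial>lborel)"
    by (rule lborel.nn_integral_fst[symmetric]) measurable
  also have "\<dots> = (\<integral>\<^sup>+r. (\<integral>\<^sup>+s. ennreal (f r s) * indicator {0<..} s \<partial>lborel) * indicator S r \<partial>lborel)"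
    by (intro nn_integral_cong) (auto intro!: nn_integral_cong split: split_indicator)
  finally show ?thesis .
qed

lemma has_strip_integralI:
  assumes m: "(\<lambda>z. f (fst z) (snd z)) \<in> borel_measurable (borel :: (real \<times> real) measure)" "S \<in> sets borel"
    and nonneg: "\<And>r s. r \<in> S \<Longrightarrow> 0 < s \<Longrightarrow> 0 \<le> f r s"
    and "(\<integral>\<^sup>+r. (\<integral>\<^sup>+s. ennreal (f r s) * indicator {0<..} s \<partial>lborel) * indicator S r \<partial>lborel) = ennreal x" "0 \<le> x"
  shows "has_strip_integral S f x"
  unfolding has_strip_integral_def
proof (rule has_bochner_integral_nn_integral)
  note [measurable] = m(2)
  have [measurable]: "(\<lambda>z. f (fst z) (snd z)) \<in> borel_measurable (borel \<Otimes>\<^sub>M borel)" using m(1) by (simp only: borel_prod)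
  show "(\<lambda>z. f (fst z) (snd z) * indicator (S \<times> {0<..}) z) \<in> borel_measurable (lborel \<Otimes>\<^sub>M lborel)" by measurable
  show "AE z in lborel \<Otimes>\<^sub>M lborel. 0 \<le> f (fst z) (snd z) * indicator (S \<times> {0<..}) z"
    using nonneg by (intro AE_I2) (auto split: split_indicator)
qed (use assms nn_integral_dbl[OF m] in auto)

lemma nn_integral_of_dbl:
  assumes m: "(\<lambda>z. f (fst z) (snd z)) \<in> borel_measurable (borel :: (real \<times> real) measure)" "S \<in> sets borel"
    and nonneg: "\<And>r s. r \<in> S \<Longrightarrow> 0 < s \<Longrightarrow> 0 \<le> f r s" and d: "has_strip_integral S f x"
  shows "(\<integral>\<^sup>+r. (\<integral>\<^sup>+s. ennreal (f r s) * indicator {0<..} s \<partial>lborel) * indicator S r \<partial>lborel) = ennreal x" "0 \<le> x"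
proof -
  let ?g = "\<lambda>z. f (fst z) (snd z) * indicator (S \<times> {0<..}) z"
  have ae: "0 \<le> ?g z" for z using nonneg by (auto split: split_indicator)
  have i: "integrable (lborel \<Otimes>\<^sub>M lborel) ?g" "integral\<^sup>L (lborel \<Otimes>\<^sub>M lborel) ?g = x"
    using d by (auto simp: has_strip_integral_def has_bochner_integral_iff)
  have "(\<integral>\<^sup>+z. ennreal (?g z) \<partial>(lborel \<Otimes>\<^sub>M lborel)) = ennreal x"
    unfolding i(2)[symmetric] by (rule nn_integral_eq_integral[OF i(1)]) (use ae in simp)
  then show "(\<integral>\<^sup>+r. (\<integral>\<^sup>+s. ennreal (f r s) * indicator {0<..} s \<partial>lborel) * indicator S r \<partial>lborel) = ennreal x"
    unfolding nn_integral_dbl[OF m] .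
  show "0 \<le> x" unfolding i(2)[symmetric] by (rule integral_nonneg_AE) (use ae in simp)
qed

lemma has_strip_integral_cmult: "has_strip_integral S f x \<Longrightarrow> has_strip_integral S (\<lambda>r s. c * f r s) (c * x)"
  unfolding has_strip_integral_def using has_bochner_integral_mult_right[of c] by (fastforce simp: mult.assoc)

lemma has_strip_integral_add: "has_strip_integral S f x \<Longrightarrow> has_strip_integral S g y \<Longrightarrow> has_strip_integral S (\<lambda>r s. f r s + g r s) (x + y)"
  unfolding has_strip_integral_def distrib_right by (rule has_bochner_integral_add)

lemma has_strip_integral_diff: "has_strip_integral S f x \<Longrightarrow> has_strip_integral S g y \<Longrightarrow> has_strip_integral S (\<lambda>r s. f r s - g r s) (x - y)"
  unfolding has_strip_integral_def left_diff_distrib by (rule has_bochner_integral_diff)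

lemma borel_measurable_param_integral:
  fixes f :: "real \<Rightarrow> real \<Rightarrow> real \<Rightarrow> real"
  assumes "continuous_on UNIV (\<lambda>(z, \<gamma>). f (fst z) (snd z) \<gamma>)"
  shows "(\<lambda>z. integral {a..b} (f (fst z) (snd z))) \<in> borel_measurable (borel :: (real \<times> real) measure)"
proof -
  have "continuous_on UNIV (\<lambda>z. integral (cbox a b) (f (fst z) (snd z)))"
    by (rule integral_continuous_on_param) (rule continuous_on_subset[OF assms], simp)
  then show ?thesis by (intro borel_measurable_continuous_onI) (simp add: cbox_interval)
qed

lemma measurable_weight_int: "(\<lambda>z. weight_int (kern (fst z) (snd z)) \<beta>) \<in> borel_measurable (borel :: (real \<times> real) measure)"
  unfolding weight_int_def between_def kern_def
  by (rule borel_measurable_param_integral) (auto simp: case_prod_beta intro!: continuous_intros)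

lemma measurable_kern0_int: "(\<lambda>z. integral {0..pi} (\<lambda>\<gamma>. kern0 (fst z) (snd z) \<gamma>)) \<in> borel_measurable (borel :: (real \<times> real) measure)"
  unfolding kern0_def
  by (rule borel_measurable_param_integral) (auto simp: case_prod_beta intro!: continuous_intros)

lemma measurable_kern0_int_weighted: "(\<lambda>z. integral {0..pi} (\<lambda>\<gamma>. (pi - \<gamma>) * kern0 (fst z) (snd z) \<gamma>)) \<in> borel_measurable (borel :: (real \<times> real) measure)"
  unfolding kern0_def
  by (rule borel_measurable_param_integral) (auto simp: case_prod_beta intro!: continuous_intros)

text \<open>The Gaussian rate at which \<open>weight_int (kern r s) \<beta>\<close> decays; it is where \<open>m\<close> comes from.\<close>

definition decay :: "real \<Rightarrow> real" where
  "decay \<beta> = 1 - (max 0 (cos (\<beta> / 2)))\<^sup>2"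

lemma decay_pos:
  assumes "0 < \<beta>" "\<beta> < 4 * pi" shows "0 < decay \<beta>"
proof -
  have "(max 0 (cos (\<beta> / 2)))\<^sup>2 < 1\<^sup>2" using cos_half_less_1[OF assms] by (intro power_strict_mono) auto
  then show ?thesis by (simp add: decay_def)
qed

text \<open>The cosine of half the angle falls up to 2 pi and rises after it, so on a range with one
  end at 2 pi it is largest at the other end.\<close>

lemma cos_half_between:
  assumes b: "0 < \<beta>" "\<beta> < 4 * pi" and g: "\<gamma> \<in> between \<beta> (2 * pi)"
  shows "cos (\<gamma> / 2) \<le> cos (\<beta> / 2)"
proof (cases "\<beta> \<le> 2 * pi")
  case True
  then show ?thesis using g b by (intro cos_monotone_0_pi_le) (auto simp: between_def)
next
  case False
  have "cos (2 * pi - \<gamma> / 2) \<le> cos (2 * pi - \<beta> / 2)"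
    using False g b by (intro cos_monotone_0_pi_le) (auto simp: between_def)
  then show ?thesis by (simp add: cos_diff)
qed

text \<open>Replace gamma by the end of its range nearest to the peak and use
  \<open>sommerfeld_le_exp\<close>. The cosine has to be truncated at 0 first, because squaring a
  negative cosine would lose the decay.\<close>

lemma kern_le:
  assumes b: "0 < \<beta>" "\<beta> < 4 * pi" and g: "\<gamma> \<in> between \<beta> (2 * pi)" and rs: "0 \<le> r" "0 \<le> s"
  shows "kern r s \<gamma> \<le> r * s / (4 * pi) * exp (- decay \<beta> * (r\<^sup>2 + s\<^sup>2) / 4)"
proof -
  define c where "c = max 0 (cos (\<beta> / 2))"
  have c: "0 \<le> c" "c \<le> 1" by (auto simp: c_def)
  have c2: "0 \<le> c\<^sup>2" "c\<^sup>2 \<le> 1" using c power_mono[of c 1 2] by auto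
  have "sommerfeld (sqrt (r * s) * cos (\<gamma> / 2)) \<le> sommerfeld (sqrt (r * s) * c)"
    using cos_half_between[OF b g] rs by (intro sommerfeld_mono mult_left_mono) (auto simp: c_def)
  also have "\<dots> \<le> exp ((sqrt (r * s) * c)\<^sup>2)" by (rule sommerfeld_le_exp)
  also have "(sqrt (r * s) * c)\<^sup>2 = r * s * c\<^sup>2" using rs by (simp add: power_mult_distrib)
  finally have "kern r s \<gamma> \<le> r * s / (4 * pi) * exp (- (r + s)\<^sup>2 / 4) * exp (r * s * c\<^sup>2)"
    unfolding kern_def using rs by (intro mult_left_mono) auto
  also have "\<dots> = r * s / (4 * pi) * exp (- (r + s)\<^sup>2 / 4 + r * s * c\<^sup>2)" unfolding exp_add by simp
  also have "\<dots> \<le> r * s / (4 * pi) * exp (- decay \<beta> * (r\<^sup>2 + s\<^sup>2) / 4)"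
  proof (intro mult_left_mono)
    have "- decay \<beta> * (r\<^sup>2 + s\<^sup>2) / 4 - (- (r + s)\<^sup>2 / 4 + r * s * c\<^sup>2) = c\<^sup>2 * (r - s)\<^sup>2 / 4 + (1 - c\<^sup>2) * (r * s) / 2"
      unfolding decay_def c_def[symmetric] by (simp add: power2_eq_square field_simps)
    moreover have "0 \<le> c\<^sup>2 * (r - s)\<^sup>2 / 4 + (1 - c\<^sup>2) * (r * s) / 2" using c2 rs by simp
    ultimately show "exp (- (r + s)\<^sup>2 / 4 + r * s * c\<^sup>2) \<le> exp (- decay \<beta> * (r\<^sup>2 + s\<^sup>2) / 4)" by simp
  qed (use rs in simp)
  finally show ?thesis .
qed

lemma weight_int_kern_nonneg: "0 \<le> r \<Longrightarrow> 0 \<le> s \<Longrightarrow> 0 \<le> weight_int (kern r s) \<beta>"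
  unfolding weight_int_def between_def
  by (intro Henstock_Kurzweil_Integration.integral_nonneg integrable_continuous_interval continuous_intros continuous_on_kern mult_nonneg_nonneg kern_nonneg) auto

text \<open>Weight and length of the range are at most 2 pi each, which with the 1 / (4 pi) of the
  kernel gives pi. The bound is a product of a function of r and a function of s, so the tail splits
  into one-dimensional integrals.\<close>

lemma weight_int_kern_le:
  assumes b: "0 < \<beta>" "\<beta> < 4 * pi" and rs: "0 \<le> r" "0 \<le> s"
  shows "weight_int (kern r s) \<beta> \<le> pi * (r * exp (- decay \<beta> * r\<^sup>2 / 4)) * (s * exp (- decay \<beta> * s\<^sup>2 / 4))"
proof -
  define B where "B = r * s / (4 * pi) * exp (- decay \<beta> * (r\<^sup>2 + s\<^sup>2) / 4)"
  have B: "0 \<le> B" using rs by (simp add: B_def)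
  have "weight_int (kern r s) \<beta> \<le> integral (between \<beta> (2 * pi)) (\<lambda>_. 2 * pi * B)"
    unfolding weight_int_def
  proof (rule integral_le)
    show "(\<lambda>\<gamma>. \<bar>\<beta> - \<gamma>\<bar> * kern r s \<gamma>) integrable_on between \<beta> (2 * pi)"
      unfolding between_def by (intro integrable_continuous_interval continuous_intros continuous_on_kern)
    fix \<gamma> assume g: "\<gamma> \<in> between \<beta> (2 * pi)"
    show "\<bar>\<beta> - \<gamma>\<bar> * kern r s \<gamma> \<le> 2 * pi * B"
    proof (rule mult_mono)
      show "\<bar>\<beta> - \<gamma>\<bar> \<le> 2 * pi" using g b by (auto simp: between_def)
      show "kern r s \<gamma> \<le> B" unfolding B_def by (rule kern_le[OF b g rs])
    qed (use kern_nonneg[OF rs] in auto)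
  qed (unfold between_def, rule integrable_const_ivl)
  also have "\<dots> = (max \<beta> (2 * pi) - min \<beta> (2 * pi)) * (2 * pi * B)" by (simp add: between_def)
  also have "\<dots> \<le> 2 * pi * (2 * pi * B)" using b B by (intro mult_right_mono) auto
  also have "\<dots> = pi * (r * exp (- decay \<beta> * r\<^sup>2 / 4)) * (s * exp (- decay \<beta> * s\<^sup>2 / 4))"
  proof -
    have "- decay \<beta> * (r\<^sup>2 + s\<^sup>2) / 4 = - decay \<beta> * r\<^sup>2 / 4 + - decay \<beta> * s\<^sup>2 / 4" by (simp add: field_simps)
    then show ?thesis unfolding B_def by (simp only: exp_add) simp
  qed
  finally show ?thesis .
qed

lemma nn_integral_gauss_tail:
  assumes q: "0 < q" and a: "0 \<le> a"
  shows "(\<integral>\<^sup>+x. ennreal (x * exp (- q * x\<^sup>2 / 4)) * indicator {a<..} x \<partial>lborel) = ennreal (2 / q * exp (- q * a\<^sup>2 / 4))"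
proof -
  define F where "F x = - 2 / q * exp (- q * x\<^sup>2 / 4)" for x
  have "(\<integral>\<^sup>+x. ennreal (x * exp (- q * x\<^sup>2 / 4)) * indicator {a..} x \<partial>lborel) = ennreal (0 - F a)"
  proof (rule nn_integral_FTC_atLeast)
    show "(F has_real_derivative x * exp (- q * x\<^sup>2 / 4)) (at x)" for x
      unfolding F_def by (rule derivative_eq_intros refl | use q in simp)+
    show "(F \<longlongrightarrow> 0) at_top" unfolding F_def using q by real_asymp
  qed (use a in auto)
  also have "(\<integral>\<^sup>+x. ennreal (x * exp (- q * x\<^sup>2 / 4)) * indicator {a..} x \<partial>lborel) = (\<integral>\<^sup>+x. ennreal (x * exp (- q * x\<^sup>2 / 4)) * indicator {a<..} x \<partial>lborel)"
  proof (rule nn_integral_cong_AE)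
    show "AE x in lborel. ennreal (x * exp (- q * x\<^sup>2 / 4)) * indicator {a..} x = ennreal (x * exp (- q * x\<^sup>2 / 4)) * indicator {a<..} x"
      using AE_lborel_singleton[of a] by eventually_elim (auto split: split_indicator)
  qed
  finally show ?thesis by (simp add: F_def)
qed

text \<open>The integral over all radii is known, and x is the part with r > rho. It is bounded by
  pi times two Gaussian integrals, each contributing a factor 2 / q with q =
  \<open>decay \<beta>\<close>.\<close>

lemma has_strip_integral_weight_int:
  assumes b: "0 < \<beta>" "\<beta> < 4 * pi" and \<rho>: "0 < \<rho>"
  shows "\<exists>x. 0 \<le> x \<and> x \<le> 4 * pi / (decay \<beta>)\<^sup>2 * exp (- decay \<beta> * \<rho>\<^sup>2 / 4) \<and>
    has_strip_integral {0<..\<rho>} (\<lambda>r s. weight_int (kern r s) \<beta>) (edge_fun \<beta> - edge_fun (2 * pi) - x)"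
proof -
  define q where "q = decay \<beta>"
  have q: "0 < q" unfolding q_def by (rule decay_pos[OF b])
  let ?w = "\<lambda>r s. weight_int (kern r s) \<beta>"
  let ?I = "\<lambda>S. (\<integral>\<^sup>+r. (\<integral>\<^sup>+s. ennreal (?w r s) * indicator {0<..} s \<partial>lborel) * indicator S r \<partial>lborel)"
  define T where "T = 4 * pi / q\<^sup>2 * exp (- q * \<rho>\<^sup>2 / 4)"
  have le: "?I {\<rho><..} \<le> ennreal T"
  proof -
    have "?I {\<rho><..} \<le> (\<integral>\<^sup>+r. (\<integral>\<^sup>+s. ennreal (pi * (r * exp (- q * r\<^sup>2 / 4))) * (ennreal (s * exp (- q * s\<^sup>2 / 4)) * indicator {0<..} s) \<partial>lborel) * indicator {\<rho><..} r \<partial>lborel)"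
    proof (intro nn_integral_mono)
      fix r :: real
      show "(\<integral>\<^sup>+s. ennreal (?w r s) * indicator {0<..} s \<partial>lborel) * indicator {\<rho><..} r \<le> (\<integral>\<^sup>+s. ennreal (pi * (r * exp (- q * r\<^sup>2 / 4))) * (ennreal (s * exp (- q * s\<^sup>2 / 4)) * indicator {0<..} s) \<partial>lborel) * indicator {\<rho><..} r"
      proof (cases "r > \<rho>")
        case True
        have "(\<integral>\<^sup>+s. ennreal (?w r s) * indicator {0<..} s \<partial>lborel) \<le> (\<integral>\<^sup>+s. ennreal (pi * (r * exp (- q * r\<^sup>2 / 4))) * (ennreal (s * exp (- q * s\<^sup>2 / 4)) * indicator {0<..} s) \<partial>lborel)"
        proof (intro nn_integral_mono)
          fix s :: real
          show "ennreal (?w r s) * indicator {0<..} s \<le> ennreal (pi * (r * exp (- q * r\<^sup>2 / 4))) * (ennreal (s * exp (- q * s\<^sup>2 / 4)) * indicator {0<..} s)"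
          proof (cases "s > 0")
            case s: True
            have "ennreal (?w r s) \<le> ennreal (pi * (r * exp (- q * r\<^sup>2 / 4)) * (s * exp (- q * s\<^sup>2 / 4)))"
              unfolding q_def using True \<rho> s by (intro ennreal_leI weight_int_kern_le[OF b]) auto
            also have "\<dots> = ennreal (pi * (r * exp (- q * r\<^sup>2 / 4))) * ennreal (s * exp (- q * s\<^sup>2 / 4))"
              by (rule ennreal_mult'') (use s in simp)
            finally show ?thesis using s by simp
          qed simp
        qed
        then show ?thesis using True by simp
      qed simp
    qed
    also have "\<dots> = (\<integral>\<^sup>+r. ennreal (pi * (2 / q)) * (ennreal (r * exp (- q * r\<^sup>2 / 4)) * indicator {\<rho><..} r) \<partial>lborel)"
    proof (intro nn_integral_cong)
      fix r :: real
      have "(\<integral>\<^sup>+s. ennreal (pi * (r * exp (- q * r\<^sup>2 / 4))) * (ennreal (s * exp (- q * s\<^sup>2 / 4)) * indicator {0<..} s) \<partial>lborel) = ennreal (pi * (r * exp (- q * r\<^sup>2 / 4))) * ennreal (2 / q * exp (- q * 0\<^sup>2 / 4))"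
        unfolding nn_integral_gauss_tail[OF q order_refl, symmetric] by (rule nn_integral_cmult) measurable
      also have "\<dots> = ennreal (pi * (r * exp (- q * r\<^sup>2 / 4)) * (2 / q * exp (- q * 0\<^sup>2 / 4)))"
        by (rule ennreal_mult''[symmetric]) (use q in simp)
      also have "pi * (r * exp (- q * r\<^sup>2 / 4)) * (2 / q * exp (- q * 0\<^sup>2 / 4)) = (pi * (2 / q)) * (r * exp (- q * r\<^sup>2 / 4))" by simp
      also have "ennreal ((pi * (2 / q)) * (r * exp (- q * r\<^sup>2 / 4))) = ennreal (pi * (2 / q)) * ennreal (r * exp (- q * r\<^sup>2 / 4))"
        by (rule ennreal_mult') (use q in simp)
      finally show "(\<integral>\<^sup>+s. ennreal (pi * (r * exp (- q * r\<^sup>2 / 4))) * (ennreal (s * exp (- q * s\<^sup>2 / 4)) * indicator {0<..} s) \<partial>lborel) * indicator {\<rho><..} r = ennreal (pi * (2 / q)) * (ennreal (r * exp (- q * r\<^sup>2 / 4)) * indicator {\<rho><..} r)"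
        by (simp only: mult.assoc)
    qed
    also have "\<dots> = ennreal (pi * (2 / q)) * ennreal (2 / q * exp (- q * \<rho>\<^sup>2 / 4))"
      unfolding nn_integral_gauss_tail[OF q less_imp_le[OF \<rho>], symmetric] by (rule nn_integral_cmult) measurable
    also have "\<dots> = ennreal (pi * (2 / q) * (2 / q * exp (- q * \<rho>\<^sup>2 / 4)))"
      by (rule ennreal_mult''[symmetric]) (use q in simp)
    also have "pi * (2 / q) * (2 / q * exp (- q * \<rho>\<^sup>2 / 4)) = T" by (simp add: T_def power2_eq_square)
    finally show ?thesis .
  qed
  have T0: "0 \<le> T" by (simp add: T_def)
  have "?I {\<rho><..} < top" using le ennreal_less_top le_less_trans by blast
  then obtain x where x: "0 \<le> x" "?I {\<rho><..} = ennreal x" by (cases "?I {\<rho><..}") auto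
  have full: "?I {0<..} = ennreal (edge_fun \<beta> - edge_fun (2 * pi))" by (rule nn_integral_weight_kern[OF b])
  have d1: "has_strip_integral {\<rho><..} ?w x"
    by (rule has_strip_integralI[OF measurable_weight_int]) (use x \<rho> in \<open>auto intro!: weight_int_kern_nonneg\<close>)
  \<comment> \<open>The total is nonnegative because its theta-integral has a nonnegative
    integrand.\<close>
  have e0: "0 \<le> edge_fun \<beta> - edge_fun (2 * pi)"
  proof -
    have h: "has_pos_integral (theta_fun (2 * pi - \<beta>)) (8 * (edge_fun \<beta> - edge_fun (2 * pi)))" by (rule theta_integral[OF b])
    have "0 \<le> theta_fun (2 * pi - \<beta>) \<theta>" for \<theta>
      using cosh_real_ge_1[of "(2 * pi - \<beta>) * \<theta>"] cosh_real_pos[of "pi * \<theta>"] unfolding theta_fun_def by simp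
    then have "0 \<le> 8 * (edge_fun \<beta> - edge_fun (2 * pi))"
      unfolding has_bochner_integral_integral_eq[OF h[unfolded has_pos_integral_def], symmetric]
      by (intro integral_nonneg_AE AE_I2 mult_nonneg_nonneg) auto
    then show ?thesis by simp
  qed
  have d2: "has_strip_integral {0<..} ?w (edge_fun \<beta> - edge_fun (2 * pi))"
    by (rule has_strip_integralI[OF measurable_weight_int]) (use full e0 in \<open>auto intro!: weight_int_kern_nonneg\<close>)
  have "has_bochner_integral (lborel \<Otimes>\<^sub>M lborel) (\<lambda>z. ?w (fst z) (snd z) * indicator ({0<..} \<times> {0<..}) z - ?w (fst z) (snd z) * indicator ({\<rho><..} \<times> {0<..}) z)
      (edge_fun \<beta> - edge_fun (2 * pi) - x)"
    using d1 d2 unfolding has_strip_integral_def by (intro has_bochner_integral_diff)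
  also have "(\<lambda>z. ?w (fst z) (snd z) * indicator ({0<..} \<times> {0<..}) z - ?w (fst z) (snd z) * indicator ({\<rho><..} \<times> {0<..}) z) = (\<lambda>z. ?w (fst z) (snd z) * indicator ({0<..\<rho>} \<times> {0<..}) z)"
    using \<rho> by (auto simp: fun_eq_iff split: split_indicator)
  finally have "has_strip_integral {0<..\<rho>} ?w (edge_fun \<beta> - edge_fun (2 * pi) - x)" unfolding has_strip_integral_def .
  moreover have "x \<le> T" using le T0 unfolding x(2) by simp
  ultimately show ?thesis using x(1) unfolding T_def q_def by blast
qed

definition sector_kern :: "real \<Rightarrow> real \<Rightarrow> real \<Rightarrow> real" where
  "sector_kern \<alpha> r s = integral {0..\<alpha>} (\<lambda>p. integral {0..\<alpha>} (\<lambda>q. kern r s (p - q) - kern r s (p + q)))"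

text \<open>cos ((p - q) / 2) - cos ((p + q) / 2) = 2 sin (p / 2) sin (q / 2) is nonnegative for
  angles up to 2 pi, and \<open>sommerfeld\<close> is increasing.\<close>

lemma kern_diff_nonneg:
  assumes "0 \<le> r" "0 \<le> s" "0 \<le> p" "p \<le> 2 * pi" "0 \<le> q" "q \<le> 2 * pi"
  shows "0 \<le> kern r s (p - q) - kern r s (p + q)"
proof -
  have "0 \<le> sin (p / 2) * sin (q / 2)" using assms by (intro mult_nonneg_nonneg sin_ge_zero) auto
  then have "cos ((p + q) / 2) \<le> cos ((p - q) / 2)" by (simp add: add_divide_distrib diff_divide_distrib cos_add cos_diff)
  then have "sommerfeld (sqrt (r * s) * cos ((p + q) / 2)) \<le> sommerfeld (sqrt (r * s) * cos ((p - q) / 2))"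
    using assms by (intro sommerfeld_mono mult_left_mono) auto
  then have "kern r s (p + q) \<le> kern r s (p - q)" unfolding kern_def using assms by (intro mult_left_mono) auto
  then show ?thesis by simp
qed

lemma sector_kern_nonneg:
  assumes "0 \<le> r" "0 \<le> s" "\<alpha> \<le> 2 * pi" shows "0 \<le> sector_kern \<alpha> r s"
proof -
  have nn: "0 \<le> integral S f" if "\<And>x. x \<in> S \<Longrightarrow> 0 \<le> f x" for S and f :: "real \<Rightarrow> real"
    by (cases "f integrable_on S") (use that in \<open>auto intro: Henstock_Kurzweil_Integration.integral_nonneg simp: not_integrable_integral\<close>)
  show ?thesis unfolding sector_kern_def by (intro nn kern_diff_nonneg) (use assms in auto)
qed

text \<open>Reflection negates cos (gamma / 2), and \<open>sommerfeld_add_minus\<close> leaves a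
  pure exponential, whose exponent the half-angle formula turns into the law of cosines.\<close>

lemma kern_add_reflected:
  assumes "0 \<le> r" "0 \<le> s" shows "kern r s \<gamma> + kern r s (2 * pi - \<gamma>) = kern0 r s \<gamma>"
proof -
  define x where "x = sqrt (r * s) * cos (\<gamma> / 2)"
  have "(2 * pi - \<gamma>) / 2 = pi - \<gamma> / 2" by simp
  then have "cos ((2 * pi - \<gamma>) / 2) = - cos (\<gamma> / 2)" by (simp only: cos_diff) simp
  then have "kern r s \<gamma> + kern r s (2 * pi - \<gamma>) = r * s / (4 * pi) * exp (- (r + s)\<^sup>2 / 4) * (sommerfeld x + sommerfeld (- x))"
    unfolding kern_def x_def by (simp add: distrib_left)
  also have "\<dots> = r * s / (4 * pi) * exp (- (r + s)\<^sup>2 / 4 + x\<^sup>2)" unfolding sommerfeld_add_minus exp_add by simp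
  also have "- (r + s)\<^sup>2 / 4 + x\<^sup>2 = - (r\<^sup>2 + s\<^sup>2 - 2 * r * s * cos \<gamma>) / 4"
  proof -
    have "x\<^sup>2 = r * s * (cos (\<gamma> / 2))\<^sup>2" using assms by (simp add: x_def power_mult_distrib)
    also have "(cos (\<gamma> / 2))\<^sup>2 = (1 + cos \<gamma>) / 2" using cos_double_cos[of "\<gamma> / 2"] by simp
    finally show ?thesis by (simp add: power2_eq_square field_simps)
  qed
  finally show ?thesis by (simp add: kern0_def)
qed

lemma sector_kern_eq:
  assumes "0 \<le> r" "0 \<le> s" "0 \<le> \<alpha>"
  shows "sector_kern \<alpha> r s = (2 * \<alpha> - 3 * pi) * integral {0..pi} (kern0 r s) + 3 * integral {0..pi} (\<lambda>\<gamma>. (pi - \<gamma>) * kern0 r s \<gamma>)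
     - 6 * weight_int (kern r s) pi + 4 * weight_int (kern r s) \<alpha> - weight_int (kern r s) (2 * \<alpha>)"
  unfolding sector_kern_def
proof (rule angular_decomposition)
  show "continuous_on UNIV (kern r s)" by (rule continuous_on_kern)
  show "kern r s (- x) = kern r s x" for x by (simp add: kern_def)
  show "kern r s x + kern r s (2 * pi - x) = kern0 r s x" for x by (rule kern_add_reflected[OF assms(1,2)])
qed (rule assms(3))

text \<open>The half-plane terms combine to the area term, as (2 alpha - 3 pi) / 4 + 3 pi / 4 =
  alpha / 2, and to three times the boundary layer. The rate m is the slowest of the three decay
  rates, and C adds the tail constants with weights 6, 4 and 1, independently of rho.\<close>

lemma sector_mass:
  assumes a: "0 < \<alpha>" "\<alpha> < 2 * pi"
  shows "\<exists>m>0. \<exists>C. \<forall>\<rho>>0. \<exists>J\<ge>0.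
    (\<integral>\<^sup>+r. (\<integral>\<^sup>+s. ennreal (sector_kern \<alpha> r s) * indicator {0<..} s \<partial>lborel) * indicator {0<..\<rho>} r \<partial>lborel) = ennreal J \<and>
    \<bar>J - (\<alpha> * \<rho>\<^sup>2 / 2 - 3 * \<rho> / sqrt pi * (1 - edge_E \<rho>) + a_coeff \<alpha>)\<bar> \<le> C * exp (- (m * \<rho>\<^sup>2 / 4))"
proof -
  define m where "m = min (decay pi) (min (decay \<alpha>) (decay (2 * \<alpha>)))"
  have rng: "0 < \<alpha>" "\<alpha> < 4 * pi" "0 < 2 * \<alpha>" "2 * \<alpha> < 4 * pi" "0 < pi" "pi < 4 * pi" using a pi_gt_zero by auto
  have m: "0 < m" "m \<le> decay pi" "m \<le> decay \<alpha>" "m \<le> decay (2 * \<alpha>)"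
    using decay_pos[OF rng(1,2)] decay_pos[OF rng(3,4)] decay_pos[OF rng(5,6)] by (auto simp: m_def)
  define c where "c \<beta> = 4 * pi / (decay \<beta>)\<^sup>2" for \<beta>
  define C where "C = 6 * c pi + 4 * c \<alpha> + c (2 * \<alpha>)"
  show ?thesis
  proof (rule exI[of _ m], intro conjI m(1), rule exI[of _ C], intro allI impI)
    fix \<rho> :: real assume \<rho>: "0 < \<rho>"
    define e where "e = exp (- (m * \<rho>\<^sup>2 / 4))"
    have ex: "\<exists>x. 0 \<le> x \<and> x \<le> c \<beta> * e \<and> has_strip_integral {0<..\<rho>} (\<lambda>r s. weight_int (kern r s) \<beta>) (edge_fun \<beta> - edge_fun (2 * pi) - x)"
      if b: "0 < \<beta>" "\<beta> < 4 * pi" and mb: "m \<le> decay \<beta>" for \<beta>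
    proof -
      obtain x where x: "0 \<le> x" "x \<le> c \<beta> * exp (- decay \<beta> * \<rho>\<^sup>2 / 4)" "has_strip_integral {0<..\<rho>} (\<lambda>r s. weight_int (kern r s) \<beta>) (edge_fun \<beta> - edge_fun (2 * pi) - x)"
        using has_strip_integral_weight_int[OF b \<rho>] unfolding c_def by blast
      have "m * \<rho>\<^sup>2 \<le> decay \<beta> * \<rho>\<^sup>2" using mb by (intro mult_right_mono) auto
      then have "exp (- decay \<beta> * \<rho>\<^sup>2 / 4) \<le> e" by (simp add: e_def)
      then have "c \<beta> * exp (- decay \<beta> * \<rho>\<^sup>2 / 4) \<le> c \<beta> * e" by (intro mult_left_mono) (simp_all add: c_def)
      then show ?thesis using x order_trans by blast
    qed
    obtain x where x: "0 \<le> x" "x \<le> c pi * e" "has_strip_integral {0<..\<rho>} (\<lambda>r s. weight_int (kern r s) pi) (edge_fun pi - edge_fun (2 * pi) - x)"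
      using ex[OF rng(5,6) m(2)] by blast
    obtain y where y: "0 \<le> y" "y \<le> c \<alpha> * e" "has_strip_integral {0<..\<rho>} (\<lambda>r s. weight_int (kern r s) \<alpha>) (edge_fun \<alpha> - edge_fun (2 * pi) - y)"
      using ex[OF rng(1,2) m(3)] by blast
    obtain z where z: "0 \<le> z" "z \<le> c (2 * \<alpha>) * e" "has_strip_integral {0<..\<rho>} (\<lambda>r s. weight_int (kern r s) (2 * \<alpha>)) (edge_fun (2 * \<alpha>) - edge_fun (2 * pi) - z)"
      using ex[OF rng(3,4) m(4)] by blast
    have k0: "has_strip_integral {0<..\<rho>} (\<lambda>r s. integral {0..pi} (kern0 r s)) (\<rho>\<^sup>2 / 4)"
    proof (rule has_strip_integralI[OF measurable_kern0_int])
      show "0 \<le> integral {0..pi} (kern0 r s)" if "r \<in> {0<..\<rho>}" "0 < s" for r s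
        by (rule Henstock_Kurzweil_Integration.integral_nonneg) (use that in \<open>auto intro!: integrable_continuous_interval continuous_intros simp: kern0_def\<close>)
    qed (use nn_integral_kern0_total[OF \<rho>] in auto)
    define U where "U = pi * \<rho>\<^sup>2 / 4 - \<rho> / sqrt pi * (1 - edge_E \<rho>)"
    have k1: "has_strip_integral {0<..\<rho>} (\<lambda>r s. integral {0..pi} (\<lambda>\<gamma>. (pi - \<gamma>) * kern0 r s \<gamma>)) U"
    proof (rule has_strip_integralI[OF measurable_kern0_int_weighted])
      show "0 \<le> integral {0..pi} (\<lambda>\<gamma>. (pi - \<gamma>) * kern0 r s \<gamma>)" if "r \<in> {0<..\<rho>}" "0 < s" for r s
        by (rule Henstock_Kurzweil_Integration.integral_nonneg) (use that in \<open>auto intro!: integrable_continuous_interval continuous_intros mult_nonneg_nonneg kern0_nonneg simp: kern0_def[abs_def]\<close>)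
      show "0 \<le> U" unfolding U_def by (rule kern0_weighted_nonneg[OF \<rho>])
    qed (use nn_integral_kern0_weighted[OF \<rho>] in \<open>auto simp: U_def\<close>)
    define g where "g r s = (2 * \<alpha> - 3 * pi) * integral {0..pi} (kern0 r s) + 3 * integral {0..pi} (\<lambda>\<gamma>. (pi - \<gamma>) * kern0 r s \<gamma>)
     - 6 * weight_int (kern r s) pi + 4 * weight_int (kern r s) \<alpha> - weight_int (kern r s) (2 * \<alpha>)" for r s
    define J where "J = (2 * \<alpha> - 3 * pi) * (\<rho>\<^sup>2 / 4) + 3 * U - 6 * (edge_fun pi - edge_fun (2 * pi) - x)
      + 4 * (edge_fun \<alpha> - edge_fun (2 * pi) - y) - (edge_fun (2 * \<alpha>) - edge_fun (2 * pi) - z)"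
    have gJ: "has_strip_integral {0<..\<rho>} g J"
      unfolding g_def[abs_def] J_def by (intro has_strip_integral_diff has_strip_integral_add has_strip_integral_cmult k0 k1 x(3) y(3) z(3))
    have gs: "sector_kern \<alpha> r s = g r s" if "0 < r" "0 < s" for r s
      unfolding g_def by (rule sector_kern_eq) (use that a in auto)
    have g_measurable: "(\<lambda>z. g (fst z) (snd z)) \<in> borel_measurable borel"
      unfolding g_def by (intro borel_measurable_add borel_measurable_diff borel_measurable_times borel_measurable_const measurable_weight_int measurable_kern0_int measurable_kern0_int_weighted)
    have gn: "0 \<le> g r s" if "r \<in> {0<..\<rho>}" "0 < s" for r s
      using sector_kern_nonneg[of r s \<alpha>] gs[of r s] that a by auto
    note J = nn_integral_of_dbl[OF g_measurable _ gn gJ]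
    show "\<exists>J\<ge>0. (\<integral>\<^sup>+r. (\<integral>\<^sup>+s. ennreal (sector_kern \<alpha> r s) * indicator {0<..} s \<partial>lborel) * indicator {0<..\<rho>} r \<partial>lborel) = ennreal J \<and>
      \<bar>J - (\<alpha> * \<rho>\<^sup>2 / 2 - 3 * \<rho> / sqrt pi * (1 - edge_E \<rho>) + a_coeff \<alpha>)\<bar> \<le> C * exp (- (m * \<rho>\<^sup>2 / 4))"
    proof (intro exI[of _ J] conjI)
      show "0 \<le> J" by (rule J(2)) auto
      have "(\<integral>\<^sup>+r. (\<integral>\<^sup>+s. ennreal (sector_kern \<alpha> r s) * indicator {0<..} s \<partial>lborel) * indicator {0<..\<rho>} r \<partial>lborel)
        = (\<integral>\<^sup>+r. (\<integral>\<^sup>+s. ennreal (g r s) * indicator {0<..} s \<partial>lborel) * indicator {0<..\<rho>} r \<partial>lborel)"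
        by (intro nn_integral_cong) (auto intro!: nn_integral_cong simp: gs split: split_indicator)
      then show "(\<integral>\<^sup>+r. (\<integral>\<^sup>+s. ennreal (sector_kern \<alpha> r s) * indicator {0<..} s \<partial>lborel) * indicator {0<..\<rho>} r \<partial>lborel) = ennreal J"
        using J(1) by simp
      \<comment> \<open>The constants add up to \<open>a_coeff \<alpha>\<close>, so the error
        consists of the tails x, y, z cut off in the directions pi, alpha and 2 alpha.\<close>
      have "J - (\<alpha> * \<rho>\<^sup>2 / 2 - 3 * \<rho> / sqrt pi * (1 - edge_E \<rho>) + a_coeff \<alpha>) = 6 * x - 4 * y + z"
      proof -
        define X where "X = \<rho> / sqrt pi * (1 - edge_E \<rho>)"
        have "3 * \<rho> / sqrt pi * (1 - edge_E \<rho>) = 3 * X" by (simp add: X_def)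
        moreover have "6 * (edge_fun pi - edge_fun (2 * pi) - x) = 6 / 8 - 6 * x" unfolding edge_fun_pi by simp
        moreover have "(2 * \<alpha> - 3 * pi) * (\<rho>\<^sup>2 / 4) + 3 * U = \<alpha> * \<rho>\<^sup>2 / 2 - 3 * X"
        proof -
          have "U = pi * \<rho>\<^sup>2 / 4 - X" by (simp only: U_def X_def)
          then show ?thesis by (simp add: field_simps)
        qed
        ultimately show ?thesis unfolding J_def a_coeff_eq[OF a] by simp
      qed
      moreover have "\<bar>6 * x - 4 * y + z\<bar> \<le> 6 * x + 4 * y + z" using x y z by linarith
      moreover have "6 * x + 4 * y + z \<le> C * e" using x(2) y(2) z(2) unfolding C_def by (simp add: algebra_simps)
      ultimately show "\<bar>J - (\<alpha> * \<rho>\<^sup>2 / 2 - 3 * \<rho> / sqrt pi * (1 - edge_E \<rho>) + a_coeff \<alpha>)\<bar> \<le> C * exp (- (m * \<rho>\<^sup>2 / 4))"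
        unfolding e_def by simp
    qed
  qed
qed

subsection \<open>The heat content of the wedge\<close>

lemma norm_polar: "0 \<le> r \<Longrightarrow> norm (polar r \<phi>) = r"
proof -
  assume r: "0 \<le> r"
  have "(norm (polar r \<phi>))\<^sup>2 = r\<^sup>2 * ((cos \<phi>)\<^sup>2 + (sin \<phi>)\<^sup>2)"
    unfolding norm_prod_sq polar_def by (simp only: fst_conv snd_conv power_mult_distrib distrib_left)
  then show ?thesis using r by (simp add: power2_eq_iff_nonneg)
qed

lemma root_polar:
  assumes r: "0 < r" and p: "0 < \<phi>" "\<phi> < 2 * pi"
  shows "root_im (polar r \<phi>) = sqrt r * sin (\<phi> / 2)" "root_re (polar r \<phi>) = sqrt r * cos (\<phi> / 2)"
proof -
  have s: "sin (\<phi> / 2) > 0" using p by (intro sin_gt_zero) auto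
  have "(r - r * cos \<phi>) / 2 = r * (sin (\<phi> / 2))\<^sup>2"
  proof -
    have c: "cos \<phi> = 1 - 2 * (sin (\<phi> / 2))\<^sup>2" using cos_double_sin[of "\<phi> / 2"] by simp
    show ?thesis unfolding c by (simp add: algebra_simps)
  qed
  then show im: "root_im (polar r \<phi>) = sqrt r * sin (\<phi> / 2)"
    unfolding root_im_def norm_polar[OF less_imp_le[OF r]] using s by (simp add: polar_def real_sqrt_mult)
  have "sin \<phi> = 2 * sin (\<phi> / 2) * cos (\<phi> / 2)" using sin_double[of "\<phi> / 2"] by simp
  moreover have "r = sqrt r * sqrt r" using r by simp
  moreover have "x * x * (2 * S * C) / (2 * (x * S)) = x * C" if "x \<noteq> 0" "S \<noteq> 0" for x S C :: real
    using that by (simp add: field_simps)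
  ultimately have "r * sin \<phi> / (2 * (sqrt r * sin (\<phi> / 2))) = sqrt r * cos (\<phi> / 2)"
    using s r by (metis less_numeral_extra(3) real_sqrt_gt_0_iff)
  then show "root_re (polar r \<phi>) = sqrt r * cos (\<phi> / 2)" unfolding root_re_def im by (simp add: polar_def)
qed

lemma polar_in_slit_plane: "0 < r \<Longrightarrow> 0 < \<phi> \<Longrightarrow> \<phi> < 2 * pi \<Longrightarrow> polar r \<phi> \<in> slit_plane"
  unfolding slit_plane_iff root_polar(1) by (intro mult_pos_pos sin_gt_zero) auto

text \<open>The square root lies in the open upper half-plane and has an angle t strictly between 0
  and pi; doubling t gives the polar angle.\<close>

lemma slit_plane_polar:
  assumes x: "x \<in> slit_plane"
  obtains r \<phi> where "0 < r" "0 < \<phi>" "\<phi> < 2 * pi" "x = polar r \<phi>"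
proof -
  define n where "n = norm x"
  have n: "0 < n" unfolding n_def by (rule norm_pos_slit[OF x])
  have nr: "n = (root_re x)\<^sup>2 + (root_im x)\<^sup>2" unfolding n_def by (rule norm_eq_root[OF x])
  have "(root_re x / sqrt n)\<^sup>2 + (root_im x / sqrt n)\<^sup>2 = ((root_re x)\<^sup>2 + (root_im x)\<^sup>2) / n"
    using n by (simp add: power_divide add_divide_distrib)
  also have "\<dots> = 1" unfolding nr[symmetric] using n by simp
  finally obtain t where t: "0 \<le> t" "t \<le> pi" "root_re x / sqrt n = cos t" "root_im x / sqrt n = sin t"
    using sincos_total_pi[of "root_im x / sqrt n" "root_re x / sqrt n"] n by (metis divide_nonneg_nonneg real_sqrt_ge_zero less_imp_le root_im_nonneg)
  have rt: "root_re x = sqrt n * cos t" "root_im x = sqrt n * sin t" using t n by (simp_all add: field_simps)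
  have st: "sin t \<noteq> 0" using root_im_pos[OF x] rt n by auto
  then have "t \<noteq> 0" "t \<noteq> pi" by auto
  moreover have "fst x = n * cos (2 * t)"
    unfolding fst_eq_root[OF x] rt cos_double using n by (simp add: power_mult_distrib right_diff_distrib)
  moreover have "snd x = n * sin (2 * t)"
    unfolding root_re_im[OF x, symmetric] rt sin_double using n by simp
  ultimately show ?thesis using that[of n "2 * t"] n t(1,2) by (auto simp: polar_def prod_eq_iff)
qed

text \<open>Makes the wedge measurable: on the slit plane phi < alpha is a condition on
  \<open>root_re\<close>, because the cosine of the half-angle is strictly decreasing for phi
  between 0 and 2 pi.\<close>

lemma wedge_eq:
  assumes a: "0 < \<alpha>" "\<alpha> < 2 * pi"
  shows "wedge \<alpha> = {x \<in> slit_plane. sqrt (norm x) * cos (\<alpha> / 2) < root_re x}"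
proof -
  have iff: "cos (\<alpha> / 2) < cos (\<phi> / 2) \<longleftrightarrow> \<phi> < \<alpha>" if "0 < \<phi>" "\<phi> < 2 * pi" for \<phi>
    using cos_monotone_0_pi[of "\<phi> / 2" "\<alpha> / 2"] cos_monotone_0_pi_le[of "\<alpha> / 2" "\<phi> / 2"] that a
    by (cases "\<phi> < \<alpha>") auto
  have "x \<in> wedge \<alpha> \<longleftrightarrow> sqrt (norm x) * cos (\<alpha> / 2) < root_re x" if "x \<in> slit_plane" for x
    using that
  proof (rule slit_plane_polar)
    fix r \<phi> assume r: "0 < r" "0 < \<phi>" "\<phi> < 2 * pi" "x = polar r \<phi>"
    have "x \<in> wedge \<alpha> \<longleftrightarrow> \<phi> < \<alpha>" unfolding r(4) by (rule polar_wedge_iff) (use r a in auto)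
    then show ?thesis unfolding r(4) norm_polar[OF less_imp_le[OF r(1)]] root_polar(2)[OF r(1,2,3)]
      using iff[OF r(2,3)] r(1) by simp
  qed
  moreover have "wedge \<alpha> \<subseteq> slit_plane"
    using polar_in_slit_plane a unfolding wedge_def by fastforce
  ultimately show ?thesis by blast
qed

lemma sets_wedge [measurable]:
  assumes "0 < \<alpha>" "\<alpha> < 2 * pi" shows "wedge \<alpha> \<in> sets borel"
proof -
  have "slit_plane \<in> sets borel" by measurable
  then have "{x \<in> space borel. x \<in> slit_plane \<and> sqrt (norm x) * cos (\<alpha> / 2) < root_re x} \<in> sets borel" by measurable
  then show ?thesis by (simp add: wedge_eq[OF assms])
qed

lemma measurable_slit_kernel2:
  "(\<lambda>z. slit_kernel (fst z) (snd z) t) \<in> borel_measurable (borel \<Otimes>\<^sub>M borel)"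
  unfolding slit_kernel_eq hk_pre_def hk_arg_def by measurable

lemma measurable_slit_kernel_snd: "(\<lambda>y. slit_kernel x y t) \<in> borel_measurable borel"
  unfolding slit_kernel_eq hk_pre_def hk_arg_def by measurable

lemma measurable_u_wedge:
  assumes a: "0 < \<alpha>" "\<alpha> < 2 * pi"
  shows "(\<lambda>x. u_wedge \<alpha> x t) \<in> borel_measurable borel"
proof -
  note [measurable] = sets_wedge[OF a] measurable_slit_kernel2
  have [measurable]: "slit_plane \<in> sets borel" by measurable
  show ?thesis
    unfolding u_wedge_def dirichlet_heat_kernel_slit set_lebesgue_integral_def slit_heat_kernel_def
    by (rule lborel.borel_measurable_lebesgue_integral) (unfold case_prod_beta, measurable)
qed

lemma interval_integral_0_eq_Ioo: "0 \<le> b \<Longrightarrow> (LBINT x=0..ereal b. f x) = (LINT x:{0<..<b}|lborel. f x)"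
  by (subst interval_integral_Ioo) auto

definition kern_diff :: "real \<Rightarrow> real \<Rightarrow> real \<Rightarrow> real \<Rightarrow> real" where
  "kern_diff r s \<phi> \<psi> = kern r s (\<phi> - \<psi>) - kern r s (\<phi> + \<psi>)"

text \<open>Scaling to time 1: the Jacobians r and s absorb the prefactor 1 / t, and the exponent
  and the \<open>sommerfeld\<close> argument depend only on r / sqrt t and s / sqrt t.\<close>

lemma slit_kernel_polar:
  assumes t: "0 < t" and r: "0 < r" "0 < \<phi>" "\<phi> < 2 * pi" and s: "0 < s" "0 < \<psi>" "\<psi> < 2 * pi"
  shows "r * (slit_kernel (polar r \<phi>) (polar s \<psi>) t * s) = kern_diff (r / sqrt t) (s / sqrt t) \<phi> \<psi>"
proof -
  have arg: "hk_arg (root_re (polar s \<psi>)) (root_im (polar s \<psi>)) (polar r \<phi>) = sqrt (r * s) * cos ((\<phi> - \<psi>) / 2)"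
    "hk_arg (root_re (polar s \<psi>)) (- root_im (polar s \<psi>)) (polar r \<phi>) = sqrt (r * s) * cos ((\<phi> + \<psi>) / 2)"
    unfolding hk_arg_def root_polar[OF r] root_polar[OF s]
    by (simp_all add: real_sqrt_mult cos_diff cos_add diff_divide_distrib add_divide_distrib algebra_simps)
  have pre: "hk_pre (root_re (polar s \<psi>)) (root_im (polar s \<psi>)) (polar r \<phi>) t = exp (- (r + s)\<^sup>2 / (4 * t)) / (4 * pi * t)"
    unfolding hk_pre_eq[OF polar_in_slit_plane[OF s]] using r s by (simp add: norm_polar)
  have k: "kern (r / sqrt t) (s / sqrt t) \<gamma> = r * s * (exp (- (r + s)\<^sup>2 / (4 * t)) / (4 * pi * t)) * sommerfeld (sqrt (r * s) * cos (\<gamma> / 2) / sqrt t)" for \<gamma>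
  proof -
    have 1: "r / sqrt t * (s / sqrt t) = r * s / t" using t by simp
    have 2: "r / sqrt t + s / sqrt t = (r + s) / sqrt t" by (simp add: add_divide_distrib)
    have 3: "- ((r + s) / sqrt t)\<^sup>2 / 4 = - (r + s)\<^sup>2 / (4 * t)" using t by (simp add: power_divide)
    have 4: "sqrt (r * s / t) * cos (\<gamma> / 2) = sqrt (r * s) * cos (\<gamma> / 2) / sqrt t" by (simp add: real_sqrt_divide)
    show ?thesis unfolding kern_def 1 2 3 4 by (simp add: mult.commute)
  qed
  show ?thesis unfolding slit_kernel_eq arg pre kern_diff_def k by (simp add: algebra_simps)
qed

text \<open>Extended-valued twin of \<open>sector_kern\<close>. The angles can be moved past the
  radius by Fubini for nonnegative functions, and \<open>wedge_nn_eq\<close> returns to the real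
  integral.\<close>

definition wedge_nn :: "real \<Rightarrow> real \<Rightarrow> real \<Rightarrow> ennreal" where
  "wedge_nn \<alpha> r s = (\<integral>\<^sup>+\<phi>. (\<integral>\<^sup>+\<psi>. ennreal (kern_diff r s \<phi> \<psi>) * indicator {0<..<\<alpha>} \<psi> \<partial>lborel) * indicator {0<..<\<alpha>} \<phi> \<partial>lborel)"

lemma borel_measurable_wedge_nn [measurable (raw)]:
  assumes [measurable]: "f \<in> borel_measurable M" "g \<in> borel_measurable M"
  shows "(\<lambda>x. wedge_nn \<alpha> (f x) (g x)) \<in> borel_measurable M"
  unfolding wedge_nn_def kern_diff_def by measurable

lemma wedge_nn_eq:
  assumes rs: "0 \<le> r" "0 \<le> s" and a: "0 < \<alpha>" "\<alpha> < 2 * pi"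
  shows "wedge_nn \<alpha> r s = ennreal (sector_kern \<alpha> r s)"
proof -
  have c: "continuous_on A (\<lambda>\<psi>. kern_diff r s \<phi> \<psi>)" for A \<phi>
    unfolding kern_diff_def kern_def by (intro continuous_intros) auto
  have nn: "0 \<le> kern_diff r s \<phi> \<psi>" if "\<phi> \<in> {0..\<alpha>}" "\<psi> \<in> {0..\<alpha>}" for \<phi> \<psi>
    unfolding kern_diff_def by (rule kern_diff_nonneg) (use rs a that in auto)
  have "wedge_nn \<alpha> r s = (\<integral>\<^sup>+\<phi>. ennreal (integral {0..\<alpha>} (kern_diff r s \<phi>)) * indicator {0..\<alpha>} \<phi> \<partial>lborel)"
    unfolding wedge_nn_def nn_integral_Ioo_eq_Icc
  proof (intro nn_integral_cong)
    fix \<phi> :: real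
    show "(\<integral>\<^sup>+\<psi>. ennreal (kern_diff r s \<phi> \<psi>) * indicator {0..\<alpha>} \<psi> \<partial>lborel) * indicator {0..\<alpha>} \<phi> = ennreal (integral {0..\<alpha>} (kern_diff r s \<phi>)) * indicator {0..\<alpha>} \<phi>"
      by (cases "\<phi> \<in> {0..\<alpha>}") (auto intro!: nn_integral_Icc c nn)
  qed
  also have "\<dots> = ennreal (integral {0..\<alpha>} (\<lambda>\<phi>. integral {0..\<alpha>} (kern_diff r s \<phi>)))"
  proof (rule nn_integral_Icc)
    have "continuous_on {0..\<alpha>} (\<lambda>\<phi>. integral (cbox 0 \<alpha>) (kern_diff r s \<phi>))"
      by (rule integral_continuous_on_param) (auto simp: kern_diff_def kern_def case_prod_beta intro!: continuous_intros)
    then show "continuous_on {0..\<alpha>} (\<lambda>\<phi>. integral {0..\<alpha>} (kern_diff r s \<phi>))" by (simp add: cbox_interval)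
    show "0 \<le> integral {0..\<alpha>} (kern_diff r s \<phi>)" if "\<phi> \<in> {0..\<alpha>}" for \<phi>
      by (rule Henstock_Kurzweil_Integration.integral_nonneg) (use nn that in \<open>auto intro!: integrable_continuous_interval c\<close>)
  qed
  finally show ?thesis by (simp add: sector_kern_def kern_diff_def[abs_def])
qed

lemma borel_measurable_polar [measurable (raw)]:
  assumes [measurable]: "f \<in> borel_measurable M" "g \<in> borel_measurable M"
  shows "(\<lambda>z. polar (f z) (g z)) \<in> borel_measurable M"
  unfolding polar_def by measurable

text \<open>Domination by the Gaussian, which has mass 1, keeps the extended integral finite, so
  that the real-valued \<open>u_wedge\<close> can be exchanged for it without loss.\<close>

lemma u_wedge_polar:
  assumes a: "0 < \<alpha>" "\<alpha> < 2 * pi" and t: "0 < t" and r: "0 < r" and p: "0 < \<phi>" "\<phi> < \<alpha>"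
  shows "0 \<le> u_wedge \<alpha> (polar r \<phi>) t" "u_wedge \<alpha> (polar r \<phi>) t \<le> 1"
    "ennreal r * ennreal (u_wedge \<alpha> (polar r \<phi>) t) = (\<integral>\<^sup>+\<psi>. (\<integral>\<^sup>+s. ennreal (kern_diff (r / sqrt t) (s / sqrt t) \<phi> \<psi>) * indicator {0<..} s \<partial>lborel) * indicator {0<..<\<alpha>} \<psi> \<partial>lborel)"
proof -
  note [measurable] = sets_wedge[OF a] measurable_slit_kernel_snd
  define x where "x = polar r \<phi>"
  define u where "u = u_wedge \<alpha> x t"
  have x: "x \<in> slit_plane" unfolding x_def by (rule polar_in_slit_plane) (use r p a in auto)
  have ws: "y \<in> slit_plane" if "y \<in> wedge \<alpha>" for y using that wedge_eq[OF a] by auto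
  have u_eq: "u = (\<integral>y. slit_kernel x y t * indicator (wedge \<alpha>) y \<partial>lborel)"
    unfolding u_def u_wedge_def dirichlet_heat_kernel_slit set_lebesgue_integral_def
    by (intro Bochner_Integration.integral_cong) (use x ws t in \<open>auto simp: slit_heat_kernel_def split: split_indicator\<close>)
  have nn: "0 \<le> slit_kernel x y t * indicator (wedge \<alpha>) y" for y
    using slit_kernel_nonneg[OF t, of x y] by simp
  define X where "X = (\<integral>\<^sup>+y. ennreal (slit_kernel x y t) * indicator (wedge \<alpha>) y \<partial>lborel)"
  have X: "X = (\<integral>\<^sup>+y. ennreal (slit_kernel x y t * indicator (wedge \<alpha>) y) \<partial>lborel)"
    unfolding X_def by (intro nn_integral_cong) (auto split: split_indicator)
  have u2: "u = enn2real X"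
    unfolding u_eq X by (rule integral_eq_nn_integral) (use nn in auto)
  have "X \<le> (\<integral>\<^sup>+y. ennreal (gauss_kernel x y t) \<partial>lborel)"
    unfolding X using slit_kernel_le_gauss_kernel[OF x ws t] gauss_kernel_nonneg[OF t]
    by (intro nn_integral_mono ennreal_leI) (auto split: split_indicator)
  also have "\<dots> = 1" using nn_integral_gauss_kernel[OF t, of 1 0 x] by simp
  finally have X1: "X \<le> 1" .
  have uX: "ennreal u = X" unfolding u2 by (rule ennreal_enn2real) (use X1 in \<open>auto intro: le_less_trans\<close>)
  show "0 \<le> u_wedge \<alpha> (polar r \<phi>) t" unfolding x_def[symmetric] u_def[symmetric] u2 by simp
  show "u_wedge \<alpha> (polar r \<phi>) t \<le> 1"
    unfolding x_def[symmetric] u_def[symmetric] using X1 unfolding uX[symmetric] by simp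
  have "X = (\<integral>\<^sup>+\<psi>. (\<integral>\<^sup>+s. ennreal (slit_kernel x (polar s \<psi>) t) * ennreal s * indicator {0<..} s \<partial>lborel) * indicator {0<..<\<alpha>} \<psi> \<partial>lborel)"
    unfolding X_def by (rule nn_integral_wedge_polar) (use a in auto)
  then have "ennreal r * X = (\<integral>\<^sup>+\<psi>. ennreal r * ((\<integral>\<^sup>+s. ennreal (slit_kernel x (polar s \<psi>) t) * ennreal s * indicator {0<..} s \<partial>lborel) * indicator {0<..<\<alpha>} \<psi>) \<partial>lborel)"
    by (simp only:) (rule nn_integral_cmult[symmetric], measurable)
  also have "\<dots> = (\<integral>\<^sup>+\<psi>. (\<integral>\<^sup>+s. ennreal (kern_diff (r / sqrt t) (s / sqrt t) \<phi> \<psi>) * indicator {0<..} s \<partial>lborel) * indicator {0<..<\<alpha>} \<psi> \<partial>lborel)"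
  proof (intro nn_integral_cong)
    fix \<psi> :: real
    show "ennreal r * ((\<integral>\<^sup>+s. ennreal (slit_kernel x (polar s \<psi>) t) * ennreal s * indicator {0<..} s \<partial>lborel) * indicator {0<..<\<alpha>} \<psi>)
       = (\<integral>\<^sup>+s. ennreal (kern_diff (r / sqrt t) (s / sqrt t) \<phi> \<psi>) * indicator {0<..} s \<partial>lborel) * indicator {0<..<\<alpha>} \<psi>"
    proof (cases "\<psi> \<in> {0<..<\<alpha>}")
      case True
      have "ennreal r * (ennreal (slit_kernel x (polar s \<psi>) t) * ennreal s * indicator {0<..} s) = ennreal (kern_diff (r / sqrt t) (s / sqrt t) \<phi> \<psi>) * indicator {0<..} s" for s
      proof (cases "s > 0")
        case s: True
        have "ennreal r * (ennreal (slit_kernel x (polar s \<psi>) t) * ennreal s) = ennreal (r * (slit_kernel x (polar s \<psi>) t * s))"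
          using r s slit_kernel_nonneg[OF t] by (simp add: ennreal_mult')
        also have "r * (slit_kernel x (polar s \<psi>) t * s) = kern_diff (r / sqrt t) (s / sqrt t) \<phi> \<psi>"
          unfolding x_def by (rule slit_kernel_polar) (use t r p a s True in auto)
        finally show ?thesis using s by simp
      qed simp
      then show ?thesis using True by (simp add: nn_integral_cmult[symmetric])
    qed simp
  qed
  finally show "ennreal r * ennreal (u_wedge \<alpha> (polar r \<phi>) t) = (\<integral>\<^sup>+\<psi>. (\<integral>\<^sup>+s. ennreal (kern_diff (r / sqrt t) (s / sqrt t) \<phi> \<psi>) * indicator {0<..} s \<partial>lborel) * indicator {0<..<\<alpha>} \<psi> \<partial>lborel)"
    unfolding x_def[symmetric] u_def[symmetric] uX .
qed

lemma angular_integral_u_wedge: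
  assumes a: "0 < \<alpha>" "\<alpha> < 2 * pi" and t: "0 < t" and r: "0 < r"
  shows "0 \<le> (LBINT \<phi>=0..\<alpha>. u_wedge \<alpha> (polar r \<phi>) t)"
    "ennreal (r * (LBINT \<phi>=0..\<alpha>. u_wedge \<alpha> (polar r \<phi>) t)) = (\<integral>\<^sup>+s. wedge_nn \<alpha> (r / sqrt t) (s / sqrt t) * indicator {0<..} s \<partial>lborel)"
proof -
  note [measurable] = measurable_u_wedge[OF a]
  define Y where "Y = (\<integral>\<^sup>+\<phi>. ennreal (u_wedge \<alpha> (polar r \<phi>) t) * indicator {0<..<\<alpha>} \<phi> \<partial>lborel)"
  have "(LBINT \<phi>=0..\<alpha>. u_wedge \<alpha> (polar r \<phi>) t) = (LINT \<phi>:{0<..<\<alpha>}|lborel. u_wedge \<alpha> (polar r \<phi>) t)"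
    by (rule interval_integral_0_eq_Ioo) (use a in simp)
  also have "\<dots> = enn2real Y"
    unfolding Y_def by (rule set_integral_eq_enn2real) (use u_wedge_polar(1)[OF a t r] in auto)
  finally have L: "(LBINT \<phi>=0..\<alpha>. u_wedge \<alpha> (polar r \<phi>) t) = enn2real Y" .
  show "0 \<le> (LBINT \<phi>=0..\<alpha>. u_wedge \<alpha> (polar r \<phi>) t)" unfolding L by simp
  have "Y \<le> (\<integral>\<^sup>+\<phi>. 1 * indicator {0<..<\<alpha>} \<phi> \<partial>lborel)"
    unfolding Y_def using u_wedge_polar(2)[OF a t r] by (intro nn_integral_mono) (auto split: split_indicator)
  also have "\<dots> = ennreal \<alpha>" using a by simp
  finally have "Y < top" using ennreal_less_top le_less_trans by blast
  then have "ennreal (r * (LBINT \<phi>=0..\<alpha>. u_wedge \<alpha> (polar r \<phi>) t)) = ennreal r * Y"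
    unfolding L using r by (simp add: ennreal_mult' ennreal_enn2real)
  also have "\<dots> = (\<integral>\<^sup>+\<phi>. ennreal r * (ennreal (u_wedge \<alpha> (polar r \<phi>) t) * indicator {0<..<\<alpha>} \<phi>) \<partial>lborel)"
    unfolding Y_def by (rule nn_integral_cmult[symmetric]) measurable
  also have "\<dots> = (\<integral>\<^sup>+\<phi>. (\<integral>\<^sup>+\<psi>. (\<integral>\<^sup>+s. ennreal (kern_diff (r / sqrt t) (s / sqrt t) \<phi> \<psi>) * indicator {0<..} s \<partial>lborel) * indicator {0<..<\<alpha>} \<psi> \<partial>lborel) * indicator {0<..<\<alpha>} \<phi> \<partial>lborel)"
    using u_wedge_polar(3)[OF a t r] by (intro nn_integral_cong) (auto split: split_indicator)
  also have "\<dots> = (\<integral>\<^sup>+\<phi>. (\<integral>\<^sup>+s. (\<integral>\<^sup>+\<psi>. ennreal (kern_diff (r / sqrt t) (s / sqrt t) \<phi> \<psi>) * indicator {0<..} s * indicator {0<..<\<alpha>} \<psi> * indicator {0<..<\<alpha>} \<phi> \<partial>lborel) \<partial>lborel) \<partial>lborel)"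
  proof (intro nn_integral_cong)
    fix \<phi> :: real
    have "(\<integral>\<^sup>+\<psi>. (\<integral>\<^sup>+s. ennreal (kern_diff (r / sqrt t) (s / sqrt t) \<phi> \<psi>) * indicator {0<..} s \<partial>lborel) * indicator {0<..<\<alpha>} \<psi> \<partial>lborel) * indicator {0<..<\<alpha>} \<phi>
      = (\<integral>\<^sup>+\<psi>. (\<integral>\<^sup>+s. ennreal (kern_diff (r / sqrt t) (s / sqrt t) \<phi> \<psi>) * indicator {0<..} s * indicator {0<..<\<alpha>} \<psi> * indicator {0<..<\<alpha>} \<phi> \<partial>lborel) \<partial>lborel)"
      unfolding kern_diff_def by (auto intro!: nn_integral_cong split: split_indicator)
    also have "\<dots> = (\<integral>\<^sup>+s. (\<integral>\<^sup>+\<psi>. ennreal (kern_diff (r / sqrt t) (s / sqrt t) \<phi> \<psi>) * indicator {0<..} s * indicator {0<..<\<alpha>} \<psi> * indicator {0<..<\<alpha>} \<phi> \<partial>lborel) \<partial>lborel)"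
      unfolding kern_diff_def by (rule lborel_pair.Fubini') measurable
    finally show "(\<integral>\<^sup>+\<psi>. (\<integral>\<^sup>+s. ennreal (kern_diff (r / sqrt t) (s / sqrt t) \<phi> \<psi>) * indicator {0<..} s \<partial>lborel) * indicator {0<..<\<alpha>} \<psi> \<partial>lborel) * indicator {0<..<\<alpha>} \<phi>
      = (\<integral>\<^sup>+s. (\<integral>\<^sup>+\<psi>. ennreal (kern_diff (r / sqrt t) (s / sqrt t) \<phi> \<psi>) * indicator {0<..} s * indicator {0<..<\<alpha>} \<psi> * indicator {0<..<\<alpha>} \<phi> \<partial>lborel) \<partial>lborel)" .
  qed
  also have "\<dots> = (\<integral>\<^sup>+s. (\<integral>\<^sup>+\<phi>. (\<integral>\<^sup>+\<psi>. ennreal (kern_diff (r / sqrt t) (s / sqrt t) \<phi> \<psi>) * indicator {0<..} s * indicator {0<..<\<alpha>} \<psi> * indicator {0<..<\<alpha>} \<phi> \<partial>lborel) \<partial>lborel) \<partial>lborel)"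
    unfolding kern_diff_def by (rule lborel_pair.Fubini') measurable
  also have "\<dots> = (\<integral>\<^sup>+s. wedge_nn \<alpha> (r / sqrt t) (s / sqrt t) * indicator {0<..} s \<partial>lborel)"
    unfolding wedge_nn_def by (intro nn_integral_cong) (auto intro!: nn_integral_cong split: split_indicator)
  finally show "ennreal (r * (LBINT \<phi>=0..\<alpha>. u_wedge \<alpha> (polar r \<phi>) t)) = (\<integral>\<^sup>+s. wedge_nn \<alpha> (r / sqrt t) (s / sqrt t) * indicator {0<..} s \<partial>lborel)" .
qed

text \<open>Rescaling the two radii by sqrt t contributes sqrt t each; their product is the factor t
  in front of J.\<close>

lemma sector_integral_u_wedge:
  assumes a: "0 < \<alpha>" "\<alpha> < 2 * pi" and t: "0 < t" and R: "0 < R" and J: "0 \<le> J"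
    "(\<integral>\<^sup>+r. (\<integral>\<^sup>+s. ennreal (sector_kern \<alpha> r s) * indicator {0<..} s \<partial>lborel) * indicator {0<..R / sqrt t} r \<partial>lborel) = ennreal J"
  shows "(LBINT r=0..R. r * (LBINT \<phi>=0..\<alpha>. u_wedge \<alpha> (polar r \<phi>) t)) = t * J"
proof -
  note [measurable] = measurable_u_wedge[OF a]
  have st: "sqrt t > 0" using t by simp
  let ?f = "\<lambda>r. r * (LBINT \<phi>=0..\<alpha>. u_wedge \<alpha> (polar r \<phi>) t)"
  have m: "?f \<in> borel_measurable borel"
  proof -
    have "(LBINT \<phi>=0..\<alpha>. u_wedge \<alpha> (polar r \<phi>) t) = (LINT \<phi>|lborel. indicator {0<..<\<alpha>} \<phi> *\<^sub>R u_wedge \<alpha> (polar r \<phi>) t)" for r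
      by (simp only: interval_integral_0_eq_Ioo[OF less_imp_le[OF a(1)]] set_lebesgue_integral_def)
    then show ?thesis by simp
  qed
  have "(LBINT r=0..R. ?f r) = (LINT r:{0<..<R}|lborel. ?f r)"
    by (rule interval_integral_0_eq_Ioo) (use R in simp)
  also have "\<dots> = enn2real (\<integral>\<^sup>+r. ennreal (?f r) * indicator {0<..<R} r \<partial>lborel)"
    by (rule set_integral_eq_enn2real[OF m]) (use angular_integral_u_wedge(1)[OF a t] in auto)
  also have "(\<integral>\<^sup>+r. ennreal (?f r) * indicator {0<..<R} r \<partial>lborel) = (\<integral>\<^sup>+r. (\<integral>\<^sup>+s. wedge_nn \<alpha> (r / sqrt t) (s / sqrt t) * indicator {0<..} s \<partial>lborel) * indicator {0<..<R} r \<partial>lborel)"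
    using angular_integral_u_wedge(2)[OF a t] by (intro nn_integral_cong) (auto split: split_indicator)
  also have "\<dots> = ennreal \<bar>sqrt t\<bar> * (\<integral>\<^sup>+r. (\<integral>\<^sup>+s. wedge_nn \<alpha> ((0 + sqrt t * r) / sqrt t) (s / sqrt t) * indicator {0<..} s \<partial>lborel) * indicator {0<..<R} (0 + sqrt t * r) \<partial>lborel)"
    by (rule nn_integral_real_affine) (use st in auto)
  also have "(\<integral>\<^sup>+r. (\<integral>\<^sup>+s. wedge_nn \<alpha> ((0 + sqrt t * r) / sqrt t) (s / sqrt t) * indicator {0<..} s \<partial>lborel) * indicator {0<..<R} (0 + sqrt t * r) \<partial>lborel)
     = (\<integral>\<^sup>+r. ennreal (sqrt t) * ((\<integral>\<^sup>+s. wedge_nn \<alpha> r s * indicator {0<..} s \<partial>lborel) * indicator {0<..<R / sqrt t} r) \<partial>lborel)"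
  proof (intro nn_integral_cong)
    fix r :: real
    have "(\<integral>\<^sup>+s. wedge_nn \<alpha> r (s / sqrt t) * indicator {0<..} s \<partial>lborel) = ennreal \<bar>sqrt t\<bar> * (\<integral>\<^sup>+s. wedge_nn \<alpha> r ((0 + sqrt t * s) / sqrt t) * indicator {0<..} (0 + sqrt t * s) \<partial>lborel)"
      by (rule nn_integral_real_affine) (use st in auto)
    also have "(\<integral>\<^sup>+s. wedge_nn \<alpha> r ((0 + sqrt t * s) / sqrt t) * indicator {0<..} (0 + sqrt t * s) \<partial>lborel) = (\<integral>\<^sup>+s. wedge_nn \<alpha> r s * indicator {0<..} s \<partial>lborel)"
      using t by (intro nn_integral_cong) (auto simp: zero_less_mult_iff split: split_indicator)
    finally have "(\<integral>\<^sup>+s. wedge_nn \<alpha> r (s / sqrt t) * indicator {0<..} s \<partial>lborel) = ennreal (sqrt t) * (\<integral>\<^sup>+s. wedge_nn \<alpha> r s * indicator {0<..} s \<partial>lborel)"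
      using st by simp
    moreover have "(0 + sqrt t * r) / sqrt t = r" using st by simp
    moreover have "indicator {0<..<R} (0 + sqrt t * r) = (indicator {0<..<R / sqrt t} r :: ennreal)"
      using t by (auto simp: zero_less_mult_iff pos_less_divide_eq mult.commute split: split_indicator)
    ultimately show "(\<integral>\<^sup>+s. wedge_nn \<alpha> ((0 + sqrt t * r) / sqrt t) (s / sqrt t) * indicator {0<..} s \<partial>lborel) * indicator {0<..<R} (0 + sqrt t * r)
      = ennreal (sqrt t) * ((\<integral>\<^sup>+s. wedge_nn \<alpha> r s * indicator {0<..} s \<partial>lborel) * indicator {0<..<R / sqrt t} r)"
      by (simp only: mult.assoc)
  qed
  also have "\<dots> = ennreal (sqrt t) * (\<integral>\<^sup>+r. (\<integral>\<^sup>+s. wedge_nn \<alpha> r s * indicator {0<..} s \<partial>lborel) * indicator {0<..<R / sqrt t} r \<partial>lborel)"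
    by (rule nn_integral_cmult) measurable
  also have "(\<integral>\<^sup>+r. (\<integral>\<^sup>+s. wedge_nn \<alpha> r s * indicator {0<..} s \<partial>lborel) * indicator {0<..<R / sqrt t} r \<partial>lborel) = ennreal J"
    unfolding J(2)[symmetric]
  proof (rule nn_integral_cong_AE)
    have eq: "(\<integral>\<^sup>+s. wedge_nn \<alpha> r s * indicator {0<..} s \<partial>lborel) = (\<integral>\<^sup>+s. ennreal (sector_kern \<alpha> r s) * indicator {0<..} s \<partial>lborel)" if "0 < r" for r
      using wedge_nn_eq[OF _ _ a, of r] that by (intro nn_integral_cong) (auto split: split_indicator)
    show "AE r in lborel. (\<integral>\<^sup>+s. wedge_nn \<alpha> r s * indicator {0<..} s \<partial>lborel) * indicator {0<..<R / sqrt t} r = (\<integral>\<^sup>+s. ennreal (sector_kern \<alpha> r s) * indicator {0<..} s \<partial>lborel) * indicator {0<..R / sqrt t} r"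
      using AE_lborel_singleton[of "R / sqrt t"] by eventually_elim (auto simp: eq split: split_indicator)
  qed
  also have "ennreal \<bar>sqrt t\<bar> * (ennreal (sqrt t) * ennreal J) = ennreal (t * J)"
  proof -
    have "ennreal \<bar>sqrt t\<bar> * (ennreal (sqrt t) * ennreal J) = ennreal (sqrt t * (sqrt t * J))"
      using t J(1) by (simp add: ennreal_mult')
    also have "sqrt t * (sqrt t * J) = t * J" using t by (simp only: mult.assoc[symmetric]) simp
    finally show ?thesis .
  qed
  finally show ?thesis using t J(1) by simp
qed

theorem theorem2:
  fixes \<alpha> :: real
  assumes "0 < \<alpha>" and "\<alpha> < 2 * pi"
  shows "\<exists>m>0. \<forall>R>0.
    (\<lambda>t. (LBINT r=0..R. r * (LBINT \<phi>=0..\<alpha>. u_wedge \<alpha> (polar r \<phi>) t))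
       - (1 / 2 * \<alpha> * R\<^sup>2
          - 3 / sqrt pi * R * sqrt t
          + a_coeff \<alpha> * t
          + 3 * R * sqrt t / sqrt pi *
              (LBINT v=1..\<infinity>. 1 / v\<^sup>2 *
                 (LBINT \<zeta>=0..1. \<zeta> / sqrt (1 - \<zeta>\<^sup>2) * exp (- (R\<^sup>2 * \<zeta>\<^sup>2 * v\<^sup>2 / (4 * t)))))))
    \<in> O[at_right 0](\<lambda>t. exp (- (m * R\<^sup>2 / (4 * t))))"
  using sector_mass[OF assms]
proof (elim exE conjE)
  fix m C :: real
  assume m: "0 < m" and mass: "\<forall>\<rho>>0. \<exists>J\<ge>0.
    (\<integral>\<^sup>+r. (\<integral>\<^sup>+s. ennreal (sector_kern \<alpha> r s) * indicator {0<..} s \<partial>lborel) * indicator {0<..\<rho>} r \<partial>lborel) = ennreal J \<and>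
    \<bar>J - (\<alpha> * \<rho>\<^sup>2 / 2 - 3 * \<rho> / sqrt pi * (1 - edge_E \<rho>) + a_coeff \<alpha>)\<bar> \<le> C * exp (- (m * \<rho>\<^sup>2 / 4))"
  show ?thesis
  \<comment> \<open>For t < 1 the factor t from the scaling is bounded by 1, and
    \<open>\<bar>C\<bar>\<close> serves because the sign of C is not recorded. The same constant
    works for every R.\<close>
  proof (intro exI[of _ m] conjI m allI impI bigoI[where c = "\<bar>C\<bar>"] eventually_at_rightI[of 0 1])
    fix R t :: real assume R: "0 < R" and "t \<in> {0<..<1}"
    then have t: "0 < t" "t < 1" by auto
    define \<rho> where "\<rho> = R / sqrt t"
    have \<rho>: "0 < \<rho>" "t * \<rho>\<^sup>2 = R\<^sup>2" using R t
      by (auto simp: \<rho>_def power_divide)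
    have "t * \<rho> = R * (t / sqrt t)" by (simp add: \<rho>_def)
    also have "t / sqrt t = sqrt t" using t by (simp add: real_div_sqrt)
    finally have \<rho>3: "t * \<rho> = R * sqrt t" .
    obtain J where J: "0 \<le> J" "(\<integral>\<^sup>+r. (\<integral>\<^sup>+s. ennreal (sector_kern \<alpha> r s) * indicator {0<..} s \<partial>lborel) * indicator {0<..\<rho>} r \<partial>lborel) = ennreal J"
      and Jb: "\<bar>J - (\<alpha> * \<rho>\<^sup>2 / 2 - 3 * \<rho> / sqrt pi * (1 - edge_E \<rho>) + a_coeff \<alpha>)\<bar> \<le> C * exp (- (m * \<rho>\<^sup>2 / 4))"
      using mass[rule_format, OF \<rho>(1)] by blast
    have I: "(LBINT r=0..R. r * (LBINT \<phi>=0..\<alpha>. u_wedge \<alpha> (polar r \<phi>) t)) = t * J"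
      by (rule sector_integral_u_wedge[OF assms t(1) R J[unfolded \<rho>_def]])
    have "R\<^sup>2 * \<zeta>\<^sup>2 * v\<^sup>2 / (4 * t) = (\<rho> * v * \<zeta> / 2)\<^sup>2" for v \<zeta>
      using t by (simp add: \<rho>_def power_divide power_mult_distrib mult.commute mult.left_commute)
    then have E: "(LBINT v=1..\<infinity>. 1 / v\<^sup>2 * (LBINT \<zeta>=0..1. \<zeta> / sqrt (1 - \<zeta>\<^sup>2) * exp (- (R\<^sup>2 * \<zeta>\<^sup>2 * v\<^sup>2 / (4 * t))))) = edge_E \<rho>"
      using edge_E_integral[OF \<rho>(1)] by (simp only:)
    have "1 / 2 * \<alpha> * R\<^sup>2 - 3 / sqrt pi * R * sqrt t + a_coeff \<alpha> * t + 3 * R * sqrt t / sqrt pi * edge_E \<rho>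
      = \<alpha> * (t * \<rho>\<^sup>2) / 2 - 3 * (t * \<rho>) / sqrt pi * (1 - edge_E \<rho>) + a_coeff \<alpha> * t"
      unfolding \<rho>(2) \<rho>3 by (simp add: right_diff_distrib)
    also have "\<dots> = t * (\<alpha> * \<rho>\<^sup>2 / 2 - 3 * \<rho> / sqrt pi * (1 - edge_E \<rho>) + a_coeff \<alpha>)"
      by (simp add: algebra_simps)
    finally have eq: "t * J - (1 / 2 * \<alpha> * R\<^sup>2 - 3 / sqrt pi * R * sqrt t + a_coeff \<alpha> * t + 3 * R * sqrt t / sqrt pi * edge_E \<rho>)
      = t * (J - (\<alpha> * \<rho>\<^sup>2 / 2 - 3 * \<rho> / sqrt pi * (1 - edge_E \<rho>) + a_coeff \<alpha>))"
      by (simp only: right_diff_distrib)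
    have ex: "m * \<rho>\<^sup>2 / 4 = m * R\<^sup>2 / (4 * t)" using t by (simp add: \<rho>_def power_divide)
    have "\<bar>t * (J - (\<alpha> * \<rho>\<^sup>2 / 2 - 3 * \<rho> / sqrt pi * (1 - edge_E \<rho>) + a_coeff \<alpha>))\<bar> \<le> 1 * (C * exp (- (m * \<rho>\<^sup>2 / 4)))"
      unfolding abs_mult by (rule mult_mono) (use t Jb in auto)
    also have "\<dots> \<le> \<bar>C\<bar> * exp (- (m * R\<^sup>2 / (4 * t)))" unfolding ex by (simp add: mult_right_mono)
    finally show "norm ((LBINT r=0..R. r * (LBINT \<phi>=0..\<alpha>. u_wedge \<alpha> (polar r \<phi>) t))
       - (1 / 2 * \<alpha> * R\<^sup>2 - 3 / sqrt pi * R * sqrt t + a_coeff \<alpha> * t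
          + 3 * R * sqrt t / sqrt pi *
              (LBINT v=1..\<infinity>. 1 / v\<^sup>2 * (LBINT \<zeta>=0..1. \<zeta> / sqrt (1 - \<zeta>\<^sup>2) * exp (- (R\<^sup>2 * \<zeta>\<^sup>2 * v\<^sup>2 / (4 * t))))))) 
      \<le> \<bar>C\<bar> * norm (exp (- (m * R\<^sup>2 / (4 * t))))"
      unfolding I E eq by simp
  qed simp
qed

end
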